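(* Let $V$ be a spectrally negative Lévy process which is not the opposite of a subordinator, with Laplace exponent $\Psi_V$, let $\kappa$ be as defined in the context, let $V^{\uparrow}$ be $V$ conditioned to stay positive (starting from $0$), and let $I(V^{\uparrow}) := \int_0^{+\infty} e^{-V^{\uparrow}(t)}\,dt$. Let $\varphi_V(x) := \inf\{\lambda\geq 0 : \Psi_V(\lambda+\kappa)/\lambda > x\}$. Assume that $V$ has unbounded variation and does not oscillate. Then there are positive constants $K_1$ and $K_2$ such that for any $\delta>1$ and all $x>0$ small enough (depending on $\delta$), $$K_1(\delta-1)\sqrt{\varphi_V'\left(\frac{\delta}{x}\right)}\exp\left(-\int_{\Psi_V'(\kappa)}^{\delta/x}\frac{\varphi_V(r)}{r}\,dr\right) \leq \mathbb{P}\left(I(V^{\uparrow})\leq x\right) \leq \frac{K_2}{(\delta-1)x}\sqrt{\varphi_V'\left(\frac{1}{\delta x}\right)}\exp\left(-\int_{\Psi_V'(\kappa)}^{1/(\delta x)}\frac{\varphi_V(r)}{r}\,dr\right).$$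
   Context: In the definition of $\varphi_V$, the ratio $\Psi_V(\lambda+\kappa)/\lambda$ at $\lambda=0$ is understood as its limit $\Psi_V'(\kappa)$ (right derivative at $0$ if $\kappa=0$). "$V$ does not oscillate" means that $V$ drifts to $+\infty$ or to $-\infty$, i.e. $V(t)\to+\infty$ a.s. or $V(t)\to-\infty$ a.s. A spectrally negative Lévy process is a real-valued càdlàg Lévy process $V$ with $V(0)=0$ and no positive jumps. Its Laplace exponent $\Psi_V$ is given by $\mathbb{E}[e^{\lambda V(t)}] = e^{t\Psi_V(\lambda)}$ for $t,\lambda \geq 0$. If $V$ drifts to $-\infty$, $\kappa := \inf\{\lambda>0 : \Psi_V(\lambda)=0\}$; otherwise $\kappa := 0$. Write $V_x := x+V$. Scale function: $W:[0,+\infty[\to[0,+\infty[$ is the continuous increasing function with $\int_0^{+\infty} e^{-\lambda x}W(x)\,dx = 1/\Psi_V(\lambda)$ for all $\lambda>\kappa$. $V$ conditioned to stay positive: for $x>0$, $V^{\uparrow}_x$ is the Markov process started from $x$, with values in $]0,+\infty[$ and infinite lifetime, whose transition semigroup is $p^{\uparrow}_t(x,dy) := \frac{W(y)}{W(x)}\,\mathbb{P}\left(V_x(t)\in dy,\ \inf_{[0,t]}V_x>0\right)$. $V^{\uparrow}=V^{\uparrow}_0$ is the process started from $0$ obtained as the limit in distribution of $V^{\uparrow}_x$ as $x\to 0+$; it is a Feller process whose transition laws restricted to $]0,+\infty[$ are given by $p^{\uparrow}_t$. *)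

theory Defs
  imports "HOL-Probability.Probability"
begin

definition cadlag :: "(real \<Rightarrow> real) \<Rightarrow> bool" where
  "cadlag f \<longleftrightarrow>
     (\<forall>t\<ge>0. continuous (at_right t) f) \<and> (\<forall>t>0. \<exists>l. (f \<longlongrightarrow> l) (at_left t))"

text \<open>Time is the half-line of nonnegative reals; values at negative times are irrelevant.\<close>

locale levy_process = prob_space M
  for M :: "'a measure" and V :: "real \<Rightarrow> 'a \<Rightarrow> real" +
  assumes random_variable_V: "\<And>t. 0 \<le> t \<Longrightarrow> V t \<in> borel_measurable M"
    and cadlag_paths: "\<And>\<omega>. \<omega> \<in> space M \<Longrightarrow> cadlag (\<lambda>t. V t \<omega>)"
    and start_zero: "AE \<omega> in M. V 0 \<omega> = 0"
    and indep_increments: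
      "\<And>(n::nat) t. 0 \<le> t 0 \<Longrightarrow> mono t \<Longrightarrow>
         indep_vars (\<lambda>_. borel) (\<lambda>i \<omega>. V (t (Suc i)) \<omega> - V (t i) \<omega>) {..<n}"
    and stationary_increments:
      "\<And>s t. 0 \<le> s \<Longrightarrow> 0 \<le> t \<Longrightarrow>
         distr M borel (\<lambda>\<omega>. V (s + t) \<omega> - V s \<omega>) = distr M borel (V t)"

locale spectrally_negative_levy_process = levy_process +
  assumes no_positive_jumps: "AE \<omega> in M. \<forall>t>0. V t \<omega> \<le> Lim (at_left t) (\<lambda>s. V s \<omega>)"

definition subordinator :: "'a measure \<Rightarrow> (real \<Rightarrow> 'a \<Rightarrow> real) \<Rightarrow> bool" where
  "subordinator M X \<longleftrightarrow> levy_process M X \<and> (AE \<omega> in M. mono_on {0..} (\<lambda>t. X t \<omega>))"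

definition bounded_variation_on :: "(real \<Rightarrow> real) \<Rightarrow> real \<Rightarrow> real \<Rightarrow> bool" where
  "bounded_variation_on f a b \<longleftrightarrow>
     (\<exists>C. \<forall>(n::nat) p. mono_on {..n} p \<and> p ` {..n} \<subseteq> {a..b}
            \<longrightarrow> (\<Sum>i<n. \<bar>f (p (Suc i)) - f (p i)\<bar>) \<le> C)"

definition unbounded_variation :: "'a measure \<Rightarrow> (real \<Rightarrow> 'a \<Rightarrow> real) \<Rightarrow> bool" where
  "unbounded_variation M V \<longleftrightarrow>
     \<not> (AE \<omega> in M. \<forall>t\<ge>0. bounded_variation_on (\<lambda>s. V s \<omega>) 0 t)"

definition drifts_to_plus_infinity :: "'a measure \<Rightarrow> (real \<Rightarrow> 'a \<Rightarrow> real) \<Rightarrow> bool" where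
  "drifts_to_plus_infinity M V \<longleftrightarrow> (AE \<omega> in M. filterlim (\<lambda>t. V t \<omega>) at_top at_top)"

definition drifts_to_minus_infinity :: "'a measure \<Rightarrow> (real \<Rightarrow> 'a \<Rightarrow> real) \<Rightarrow> bool" where
  "drifts_to_minus_infinity M V \<longleftrightarrow> (AE \<omega> in M. filterlim (\<lambda>t. V t \<omega>) at_bot at_top)"

text \<open>Integrability of \<open>exp (l * V t)\<close> is implied: the Bochner integral of a function that is
  not integrable is 0, and the right-hand side is positive.\<close>

definition laplace_exponent ::
    "'a measure \<Rightarrow> (real \<Rightarrow> 'a \<Rightarrow> real) \<Rightarrow> (real \<Rightarrow> real) \<Rightarrow> bool" where
  "laplace_exponent M V \<Psi> \<longleftrightarrow>
     (\<forall>t\<ge>0. \<forall>l\<ge>0. (\<integral>\<omega>. exp (l * V t \<omega>) \<partial>M) = exp (t * \<Psi> l))"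

definition kappa :: "'a measure \<Rightarrow> (real \<Rightarrow> 'a \<Rightarrow> real) \<Rightarrow> (real \<Rightarrow> real) \<Rightarrow> real" where
  "kappa M V \<Psi> = (if drifts_to_minus_infinity M V then Inf {l. 0 < l \<and> \<Psi> l = 0} else 0)"

text \<open>\<open>\<Psi>\<close> is only meaningful on the nonnegative reals, so the derivative is taken within that
  half-line: it is the right derivative at 0 and the ordinary derivative elsewhere.\<close>

definition deriv_nonneg :: "(real \<Rightarrow> real) \<Rightarrow> real \<Rightarrow> real" where
  "deriv_nonneg \<Psi> k = vector_derivative \<Psi> (at k within {0..})"

definition phi :: "(real \<Rightarrow> real) \<Rightarrow> real \<Rightarrow> real \<Rightarrow> real" where
  "phi \<Psi> k x =
     Inf {l. 0 \<le> l \<and> x < (if l = 0 then deriv_nonneg \<Psi> k else \<Psi> (l + k) / l)}"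

definition scale_function :: "(real \<Rightarrow> real) \<Rightarrow> real \<Rightarrow> (real \<Rightarrow> real) \<Rightarrow> bool" where
  "scale_function \<Psi> k W \<longleftrightarrow>
     continuous_on {0..} W \<and> mono_on {0..} W \<and> (\<forall>x\<ge>0. 0 \<le> W x) \<and>
     (\<forall>l>k. ((\<lambda>x. exp (- l * x) * W x) has_integral 1 / \<Psi> l) {0..})"

text \<open>The measure \<open>(W y / W x) P (x + V t \<in> dy, inf (x + V s) > 0)\<close>, the infimum being over
  \<open>s \<in> [0,t]\<close>. That event forces \<open>y > 0\<close>; the case distinction only hides the values of
  \<open>W\<close> on the negative reals, about which nothing is assumed.\<close>

definition positive_kernel ::
    "'a measure \<Rightarrow> (real \<Rightarrow> 'a \<Rightarrow> real) \<Rightarrow> (real \<Rightarrow> real) \<Rightarrow> real \<Rightarrow> real \<Rightarrow> real measure" where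
  "positive_kernel M V W t x =
     density
       (distr (density M (indicator {\<omega> \<in> space M. 0 < (INF s\<in>{0..t}. x + V s \<omega>)}))
          borel (\<lambda>\<omega>. x + V t \<omega>))
       (\<lambda>y. if 0 < y then ennreal (W y / W x) else 0)"

definition past :: "'b measure \<Rightarrow> (real \<Rightarrow> 'b \<Rightarrow> real) \<Rightarrow> real \<Rightarrow> 'b measure" where
  "past N X s =
     vimage_algebra (space N) (\<lambda>\<omega>. \<lambda>u\<in>{0..s}. X u \<omega>) (PiM {0..s} (\<lambda>_. borel))"

definition markov_process ::
    "(real \<Rightarrow> real \<Rightarrow> real measure) \<Rightarrow> real \<Rightarrow> 'b measure \<Rightarrow> (real \<Rightarrow> 'b \<Rightarrow> real) \<Rightarrow> bool" where
  "markov_process p x N X \<longleftrightarrow>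
     prob_space N \<and> (\<forall>t\<ge>0. X t \<in> borel_measurable N) \<and> (AE \<omega> in N. X 0 \<omega> = x) \<and>
     (\<forall>s\<ge>0. \<forall>t\<ge>0. \<forall>A\<in>sets borel.
        AE \<omega> in N. real_cond_exp N (past N X s) (\<lambda>\<omega>'. indicator A (X (s + t) \<omega>')) \<omega>
                   = measure (p t (X s \<omega>)) A)"

definition conditioned_positive_from ::
    "'a measure \<Rightarrow> (real \<Rightarrow> 'a \<Rightarrow> real) \<Rightarrow> (real \<Rightarrow> real) \<Rightarrow> real
      \<Rightarrow> 'b measure \<Rightarrow> (real \<Rightarrow> 'b \<Rightarrow> real) \<Rightarrow> bool" where
  "conditioned_positive_from M V W x N X \<longleftrightarrow>
     markov_process (positive_kernel M V W) x N X \<and> (\<forall>t\<ge>0. \<forall>\<omega>\<in>space N. 0 < X t \<omega>)"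

text \<open>Convergence in distribution as \<open>x\<close> decreases to 0, for the finite-dimensional marginals.
  Each marginal is a vector indexed by a finite set \<open>J\<close> of times, seen as a function on the reals
  that is constant off \<open>J\<close>; so the test functions below, continuous for the product topology,
  run through all bounded continuous functions of the vector.\<close>

definition fdd_limit_at_zero ::
    "(real \<Rightarrow> 'b measure) \<Rightarrow> (real \<Rightarrow> real \<Rightarrow> 'b \<Rightarrow> real)
      \<Rightarrow> 'c measure \<Rightarrow> (real \<Rightarrow> 'c \<Rightarrow> real) \<Rightarrow> bool" where
  "fdd_limit_at_zero N Y P X \<longleftrightarrow>
     (\<forall>J (f :: (real \<Rightarrow> real) \<Rightarrow> real). finite J \<and> J \<subseteq> {0..} \<and> continuous_on UNIV f \<and> bounded (range f) \<longrightarrow>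
        ((\<lambda>x. \<integral>\<omega>. f (\<lambda>t\<in>J. Y x t \<omega>) \<partial>N x) \<longlongrightarrow> (\<integral>\<omega>. f (\<lambda>t\<in>J. X t \<omega>) \<partial>P)) (at_right 0))"

text \<open>\<open>X\<close>, on \<open>P\<close>, is a cadlag version of the process started from 0 obtained as the limit of the
  processes \<open>Y x\<close>, on \<open>N x\<close>, started from \<open>x > 0\<close>. Cadlag paths and finite-dimensional marginals
  determine the law of \<open>X\<close>.\<close>

definition conditioned_positive_from_zero ::
    "'a measure \<Rightarrow> (real \<Rightarrow> 'a \<Rightarrow> real) \<Rightarrow> (real \<Rightarrow> real)
      \<Rightarrow> (real \<Rightarrow> 'b measure) \<Rightarrow> (real \<Rightarrow> real \<Rightarrow> 'b \<Rightarrow> real)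
      \<Rightarrow> 'c measure \<Rightarrow> (real \<Rightarrow> 'c \<Rightarrow> real) \<Rightarrow> bool" where
  "conditioned_positive_from_zero M V W N Y P X \<longleftrightarrow>
     (\<forall>x>0. conditioned_positive_from M V W x (N x) (Y x)) \<and>
     prob_space P \<and> (\<forall>t\<ge>0. X t \<in> borel_measurable P) \<and>
     (\<forall>\<omega>\<in>space P. cadlag (\<lambda>t. X t \<omega>)) \<and> (AE \<omega> in P. X 0 \<omega> = 0) \<and>
     fdd_limit_at_zero N Y P X"

definition exponential_functional :: "(real \<Rightarrow> 'c \<Rightarrow> real) \<Rightarrow> 'c \<Rightarrow> ennreal" where
  "exponential_functional X \<omega> = (\<integral>\<^sup>+t\<in>{0..}. ennreal (exp (- X t \<omega>)) \<partial>lborel)"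

end

theory Submission
  imports Defs "HOL-Complex_Analysis.Complex_Analysis" "HOL-Real_Asymp.Real_Asymp"
begin


text \<open>Write \<open>S l = \<Psi> (\<kappa> + l)\<close> and \<open>g l = S l / l\<close>, so that \<open>\<phi>\<close> inverts \<open>g\<close>. The exponential functional has
  Laplace transform \<open>1 / J q\<close> with \<open>J q = (\<Sum>n. q ^ n / (\<Prod>i=1..n. S i))\<close>: iterated convolutions of \<open>W\<close> with
  \<open>exp (- x)\<close> give a function \<open>K\<close>, equal to 1 at 0 and tending to \<open>J q\<close> at infinity, for which
  \<open>exp (- (q * \<integral>exp (- X))) * K (X t)\<close> has constant expectation. Since \<open>(\<Sum>k\<le>n. ln (b / g k))\<close> is a Riemann-type
  sum for the integral of \<open>\<phi> r / r\<close> up to \<open>b\<close>, the upper bound is Chernoff's with \<open>q = n / x\<close> and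
  \<open>n = \<lfloor>\<phi> (1 / (\<delta> * x))\<rfloor>\<close>, and the lower bound comes from tilting by \<open>exp (- (q * Z))\<close>. Moving \<open>x\<close> by the factor
  \<open>\<delta>\<close> absorbs all polynomial factors and \<open>\<phi>'\<close>.\<close>

section \<open>Two-sided Laplace transforms\<close>

text \<open>Of the scale function only monotonicity, continuity, sign and transform are given;
  everything else about \<open>W\<close> has to be derived. Its invariance for the process killed
  below zero is read off the Markov property of \<open>Y x\<close>, whose kernels must have mass
  one. The hypothesis on oscillation is used as a positive slope of \<open>\<Psi>\<close> at
  \<open>\<kappa>\<close>, which keeps \<open>g\<close> away from 0: under drift to minus infinity
  \<open>\<Psi>\<close> is negative somewhere before \<open>\<kappa>\<close>, under drift to plus
  infinity \<open>W\<close> is bounded. Unbounded variation is used as superlinear growth of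
  \<open>\<Psi>\<close>, so that \<open>g\<close> takes every value above its limit at 0. Of
  \<open>X\<close> only the path regularity and the marginals, as limits of those of
  \<open>Y x\<close>, are given; so the martingale is built from products over finitely many times,
  with test functions bounded and continuous on the whole line. Identities found by inverting
  transforms hold for almost every starting point only; left-continuity of survival in that point
  removes the exception. In the analytic part \<open>S\<close> is convex, differentiable and of
  subexponential growth, and tangents replace second derivatives.\<close>

lemma powser_coeffs_zero:
  fixes a :: "nat \<Rightarrow> real"
  assumes "0 < r" and "\<And>x. \<bar>x\<bar> < r \<Longrightarrow> (\<lambda>n. a n * x ^ n) sums 0"
  shows "a m = 0"
proof (rule ccontr)
  assume m: "a m \<noteq> 0"
  show False
  proof (cases "m = 0")
    case True
    have "(\<lambda>n. a n * 0 ^ n) sums 0" using assms(2)[of 0] assms(1) by simp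
    then show False using m True by (simp add: powser_sums_zero_iff del: power_0_left)
  next
    case False
    show False
    \<comment> \<open>A nonzero coefficient of positive order would make 0 an isolated zero of the
      sum, which is the zero function.\<close>
    proof (rule powser_0_nonzero[of r 0 a "\<lambda>_. 0" m])
      fix s :: real
      assume s: "0 < s" and "\<And>z::real. z \<in> cball 0 s - {0} \<Longrightarrow> (0::real) \<noteq> 0"
      from this(2)[of s] s show False by simp
    qed (use assms m False in auto)
  qed
qed

lemma sum_exp_le:
  fixes y :: real
  assumes "0 \<le> y"
  shows "(\<Sum>i<n. y ^ i / fact i) \<le> exp y"
proof -
  have "(\<lambda>i. y ^ i / fact i) sums exp y"
    using exp_converges[of y] by (simp add: divide_inverse mult.commute scaleR_conv_of_real)
  then show ?thesis
    using sum_le_suminf[of "\<lambda>i. y ^ i / fact i" "{..<n}"] assms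
    by (auto simp: sums_iff)
qed

text \<open>This supplies the dominating function for expanding a two-sided transform: the weight
  \<open>exp (w * \<bar>x\<bar>)\<close> only costs a shift of the exponent by \<open>w\<close> in
  each direction.\<close>

lemma exp_abs_le:
  fixes w a x :: real
  assumes "0 \<le> w"
  shows "exp (w * \<bar>x\<bar>) * exp (- (a * x)) \<le> exp (- ((a - w) * x)) + exp (- ((a + w) * x))"
proof -
  have "exp (w * \<bar>x\<bar>) * exp (- (a * x)) = exp (w * \<bar>x\<bar> - a * x)"
    by (simp add: exp_add[symmetric])
  also have "\<dots> \<le> exp (- ((a - w) * x)) + exp (- ((a + w) * x))"
    by (cases "0 \<le> x") (auto simp: algebra_simps intro: add_increasing add_increasing2)
  finally show ?thesis .
qed

text \<open>Expansion of the transform about the real point \<open>a\<close>. The partial sums of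
  the exponential series are dominated by \<open>exp (norm w * \<bar>x\<bar>)\<close>, and
  \<open>exp_abs_le\<close> then needs the exponents \<open>a - norm w\<close> and
  \<open>a + norm w\<close> only, both above \<open>c\<close>. So the disc has radius
  \<open>a - c\<close>, the full distance to the edge of the half-plane.\<close>

lemma laplace_powser:
  fixes w :: complex
  assumes [measurable_cong]: "sets M = sets borel"
    and int: "\<And>l. c < l \<Longrightarrow> integrable M (\<lambda>x::real. exp (- (l * x)))"
    and w: "norm w < a - c"
  shows "(\<lambda>n. of_real (\<integral>x. x ^ n * exp (- (a * x)) \<partial>M) * ((- w) ^ n / fact n))
           sums (\<integral>x. exp (- (of_real a + w) * of_real x) \<partial>M)" (is ?sums)
    and "integrable M (\<lambda>x. x ^ n * exp (- (a * x)))"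
proof -
  define f where "f n x = of_real (x ^ n * exp (- (a * x))) * ((- w) ^ n / fact n)" for n and x :: real
  define D where "D v x = exp (- ((a - v) * x)) + exp (- ((a + v) * x))" for v x
  have nf: "norm (f n x) = (norm w * \<bar>x\<bar>) ^ n / fact n * exp (- (a * x))" for n x
    by (simp add: f_def norm_mult norm_divide norm_power power_mult_distrib)
  have D: "integrable M (D v)" if "\<bar>v\<bar> < a - c" for v
    unfolding D_def using that by (intro Bochner_Integration.integrable_add int) auto
  have sumf: "norm (\<Sum>i<n. f i x) \<le> D (norm w) x" for n x
  proof -
    have "norm (\<Sum>i<n. f i x) \<le> (\<Sum>i<n. (norm w * \<bar>x\<bar>) ^ i / fact i) * exp (- (a * x))"
      by (rule order_trans[OF norm_sum]) (simp add: nf sum_distrib_right)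
    also have "\<dots> \<le> exp (norm w * \<bar>x\<bar>) * exp (- (a * x))"
      by (intro mult_right_mono sum_exp_le) auto
    also have "\<dots> \<le> D (norm w) x"
      unfolding D_def by (rule exp_abs_le) simp
    finally show ?thesis .
  qed
  show mom: "integrable M (\<lambda>x. x ^ n * exp (- (a * x)))" for n
  proof -
    \<comment> \<open>Any \<open>v\<close> strictly between 0 and \<open>a - c\<close> would do: a
      power of \<open>x\<close> is absorbed by \<open>exp (v * \<bar>x\<bar>)\<close>.\<close>
    define v where "v = (a - c) / 2"
    have "0 < a - c" using w norm_ge_zero[of w] by linarith
    then have v: "0 < v" "v < a - c" unfolding v_def by simp_all
    have "norm (x ^ n * exp (- (a * x))) \<le> norm (fact n / v ^ n * D v x)" for x :: real
    proof -
      have "(v * \<bar>x\<bar>) ^ n / fact n \<le> (\<Sum>i<Suc n. (v * \<bar>x\<bar>) ^ i / fact i)"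
        using v by (simp add: sum_nonneg)
      also have "\<dots> \<le> exp (v * \<bar>x\<bar>)" using v by (intro sum_exp_le) auto
      finally have "(v * \<bar>x\<bar>) ^ n / fact n * exp (- (a * x)) \<le> exp (v * \<bar>x\<bar>) * exp (- (a * x))"
        by (rule mult_right_mono) simp
      also have "\<dots> \<le> D v x" unfolding D_def using v by (intro exp_abs_le) simp
      finally have "\<bar>x\<bar> ^ n * exp (- (a * x)) * (v ^ n / fact n) \<le> D v x"
        by (simp add: power_mult_distrib mult_ac)
      then have "\<bar>x\<bar> ^ n * exp (- (a * x)) \<le> D v x * (fact n / v ^ n)"
        using v by (simp add: field_simps)
      moreover have "0 \<le> D v x" unfolding D_def by (simp add: add_nonneg_nonneg)
      ultimately show ?thesis using v
        by (simp add: abs_mult power_abs mult_ac)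
    qed
    then show ?thesis
      by (intro Bochner_Integration.integrable_bound[OF integrable_mult_right[OF D[of v], of "fact n / v ^ n"]])
        (use v in \<open>auto simp: D_def\<close>)
  qed
  have intf: "integrable M (f n)" for n
    unfolding f_def using integrable_of_real[OF mom[of n], where 'a=complex]
    by (intro integrable_mult_left) auto
  have "(\<lambda>n. \<integral>x. (\<Sum>i<n. f i x) \<partial>M) \<longlonglongrightarrow> (\<integral>x. exp (- (of_real a + w) * of_real x) \<partial>M)"
  proof (rule integral_dominated_convergence[where w="D (norm w)"])
    show "AE x in M. (\<lambda>n. \<Sum>i<n. f i x) \<longlonglongrightarrow> exp (- (of_real a + w) * of_real x)"
    proof (rule AE_I2)
      fix x :: real
      have "(\<lambda>n. (- w * of_real x) ^ n / fact n) sums exp (- w * of_real x)"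
        using exp_converges[of "- w * of_real x"]
        by (simp add: divide_inverse mult.commute scaleR_conv_of_real)
      then have "(\<lambda>n. of_real (exp (- (a * x))) * ((- w * of_real x) ^ n / fact n)) sums
          (of_real (exp (- (a * x))) * exp (- w * of_real x))"
        by (rule sums_mult)
      moreover have "of_real (exp (- (a * x))) * ((- w * of_real x) ^ n / fact n) = f n x" for n
        unfolding f_def power_mult_distrib by simp
      moreover have "of_real (exp (- (a * x))) * exp (- w * of_real x) = exp (- (of_real a + w) * of_real x)"
        by (simp add: exp_of_real[symmetric] exp_add[symmetric] algebra_simps)
      ultimately show "(\<lambda>n. \<Sum>i<n. f i x) \<longlonglongrightarrow> exp (- (of_real a + w) * of_real x)"
        by (simp add: sums_def)
    qed
    show "integrable M (D (norm w))" using w by (intro D) simp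
  qed (use sumf intf in \<open>auto simp: f_def\<close>)
  moreover have "(\<integral>x. (\<Sum>i<n. f i x) \<partial>M) =
      (\<Sum>i<n. of_real (\<integral>x. x ^ i * exp (- (a * x)) \<partial>M) * ((- w) ^ i / fact i))" for n
    by (subst Bochner_Integration.integral_sum[OF intf])
      (simp only: f_def[abs_def] integral_mult_left_zero integral_complex_of_real)
  ultimately show ?sums by (simp add: sums_def)
qed

lemma laplace_powser_real:
  fixes t :: real
  assumes K: "sets K = sets borel" "\<And>l. c < l \<Longrightarrow> integrable K (\<lambda>x::real. exp (- (l * x)))"
    and t: "\<bar>t\<bar> < a - c"
  shows "(\<lambda>n. (\<integral>x. x ^ n * exp (- (a * x)) \<partial>K) * ((- t) ^ n / fact n)) sums (\<integral>x. exp (- ((a + t) * x)) \<partial>K)"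
proof -
  define mm where "mm n = (\<integral>x. x ^ n * exp (- (a * x)) \<partial>K)" for n
    have "(\<lambda>n. complex_of_real (mm n) * ((- complex_of_real t) ^ n / fact n)) sums
        (\<integral>x. exp (- (complex_of_real a + complex_of_real t) * complex_of_real x) \<partial>K)"
      unfolding mm_def by (rule laplace_powser(1)[OF K]) (use t in auto)
    moreover have "exp (- (complex_of_real a + complex_of_real t) * complex_of_real x) =
        complex_of_real (exp (- ((a + t) * x)))" for x
      by (simp add: exp_of_real[symmetric] algebra_simps)
    moreover have "complex_of_real (mm n) * ((- complex_of_real t) ^ n / fact n) =
        complex_of_real (mm n * ((- t) ^ n / fact n))" for n
      by simp
    ultimately have "(\<lambda>n. complex_of_real (mm n * ((- t) ^ n / fact n))) sums
        complex_of_real (\<integral>x. exp (- ((a + t) * x)) \<partial>K)"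
      by (simp only: integral_complex_of_real)
    then show ?thesis by (simp only: sums_of_real_iff mm_def)
qed

text \<open>Up to explicit factors these moments are the Taylor coefficients at \<open>a\<close> of
  the transform on the real line. Agreement at real arguments therefore fixes them, and with them
  the complex transform on a disc about \<open>a\<close>.\<close>

lemma laplace_moments_eq:
  assumes M: "sets M = sets borel" "\<And>l. c < l \<Longrightarrow> integrable M (\<lambda>x::real. exp (- (l * x)))"
    and N: "sets N = sets borel" "\<And>l. c < l \<Longrightarrow> integrable N (\<lambda>x::real. exp (- (l * x)))"
    and eq: "\<And>l. c < l \<Longrightarrow> (\<integral>x. exp (- (l * x)) \<partial>M) = (\<integral>x. exp (- (l * x)) \<partial>N)"
    and a: "c < a"
  shows "(\<integral>x. x ^ n * exp (- (a * x)) \<partial>M) = (\<integral>x. x ^ n * exp (- (a * x)) \<partial>N)"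
proof -
  define mm where "mm K n = (\<integral>x. x ^ n * exp (- (a * x)) \<partial>K)" for K :: "real measure" and n
  have *: "(\<lambda>n. mm K n * ((- t) ^ n / fact n)) sums (\<integral>x. exp (- ((a + t) * x)) \<partial>K)"
    if K: "sets K = sets borel" "\<And>l. c < l \<Longrightarrow> integrable K (\<lambda>x::real. exp (- (l * x)))"
      and t: "\<bar>t\<bar> < a - c" for K and t :: real
    unfolding mm_def by (rule laplace_powser_real[OF K t])
  have "(mm M n - mm N n) * ((- 1) ^ n / fact n) = 0"
  proof (rule powser_coeffs_zero)
    fix t :: real
    assume t: "\<bar>t\<bar> < a - c"
    have "(\<lambda>n. mm M n * ((- t) ^ n / fact n) - mm N n * ((- t) ^ n / fact n)) sums
        ((\<integral>x. exp (- ((a + t) * x)) \<partial>M) - (\<integral>x. exp (- ((a + t) * x)) \<partial>N))"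
      by (intro sums_diff * M N t)
    moreover have "(\<integral>x. exp (- ((a + t) * x)) \<partial>M) = (\<integral>x. exp (- ((a + t) * x)) \<partial>N)"
      using t by (intro eq) auto
    moreover have "mm M n * ((- t) ^ n / fact n) - mm N n * ((- t) ^ n / fact n) =
        (mm M n - mm N n) * ((- 1) ^ n / fact n) * t ^ n" for n
      by (simp add: power_minus[of t] field_simps)
    ultimately show "(\<lambda>n. (mm M n - mm N n) * ((- 1) ^ n / fact n) * t ^ n) sums 0"
      by simp
  qed (use a in simp)
  then show ?thesis by (simp add: mm_def)
qed

lemma laplace_complex_eq:
  assumes M: "sets M = sets borel" "\<And>l. c < l \<Longrightarrow> integrable M (\<lambda>x::real. exp (- (l * x)))"
    and N: "sets N = sets borel" "\<And>l. c < l \<Longrightarrow> integrable N (\<lambda>x::real. exp (- (l * x)))"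
    and eq: "\<And>l. c < l \<Longrightarrow> (\<integral>x. exp (- (l * x)) \<partial>M) = (\<integral>x. exp (- (l * x)) \<partial>N)"
    and z: "c < Re z"
  shows "(\<integral>x. exp (- z * of_real x) \<partial>M) = (\<integral>x. exp (- z * of_real x) \<partial>N)"
proof -
  define b \<theta> where "b = Re z" and "\<theta> = Im z"
  \<comment> \<open>The centre \<open>a = b + s\<close> moves to the right until its disc of radius
    \<open>a - c\<close> contains \<open>z\<close>. This needs
    \<open>\<theta>\<^sup>2 < 2 * s * (b - c) + (b - c)\<^sup>2\<close>, and the chosen
    \<open>s\<close> already makes \<open>s * (b - c)\<close> larger than
    \<open>\<theta>\<^sup>2\<close>.\<close>
  define s where "s = \<theta>\<^sup>2 / (b - c) + 1"
  have bc: "0 < b - c" using z by (simp add: b_def)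
  then have s: "0 < s" "s * (b - c) = \<theta>\<^sup>2 + (b - c)"
    by (auto simp: s_def distrib_right intro: add_nonneg_pos)
  define a where "a = b + s"
  have "cmod (z - of_real a) = sqrt (s\<^sup>2 + \<theta>\<^sup>2)"
    by (simp add: cmod_def a_def b_def \<theta>_def)
  also have "\<dots> < a - c"
  proof (rule real_less_lsqrt)
    have "(a - c)\<^sup>2 = s\<^sup>2 + 2 * (s * (b - c)) + (b - c)\<^sup>2"
      by (simp add: a_def power2_eq_square algebra_simps)
    then show "s\<^sup>2 + \<theta>\<^sup>2 < (a - c)\<^sup>2" unfolding s(2) using bc
      by (smt (verit) zero_le_power2)
  qed (use s bc in \<open>auto simp: a_def\<close>)
  finally have w: "cmod (z - of_real a) < a - c" .
  have ca: "c < a" using s bc by (simp add: a_def)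
  have "(\<integral>x. exp (- (of_real a + (z - of_real a)) * of_real x) \<partial>M) =
        (\<integral>x. exp (- (of_real a + (z - of_real a)) * of_real x) \<partial>N)"
    using laplace_powser(1)[OF M w] laplace_powser(1)[OF N w] laplace_moments_eq[OF M N eq ca]
    by (auto dest: sums_unique2)
  then show ?thesis by simp
qed

lemma density_pos_cancel:
  fixes f :: "'a \<Rightarrow> real"
  assumes sets: "sets N = sets M" and f: "f \<in> borel_measurable M" "\<And>x. 0 < f x"
    and eq: "density M f = density N f"
  shows "M = N"
proof -
  have *: "density (density K f) (\<lambda>x. ennreal (1 / f x)) = K" if "sets K = sets M" for K
  proof -
    have fK: "f \<in> borel_measurable K" using f(1) that by (simp cong: measurable_cong_sets)
    have "ennreal (f x) * ennreal (1 / f x) = 1" for x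
      using f(2)[of x] by (simp add: ennreal_mult[symmetric] less_imp_le)
    then have "density (density K f) (\<lambda>x. ennreal (1 / f x)) = density K (\<lambda>_. 1)"
      using fK by (subst density_density_eq) auto
    then show ?thesis by (simp add: density_1)
  qed
  have "M = density (density M f) (\<lambda>x. ennreal (1 / f x))" by (rule *[OF refl, symmetric])
  also have "\<dots> = N" unfolding eq by (rule *[OF sets])
  finally show ?thesis .
qed

text \<open>Divided by the common value at \<open>b\<close>, the weight
  \<open>exp (- (b * x))\<close> turns both measures into probability measures whose characteristic
  functions are the transforms on the vertical line through \<open>b\<close>, and Levy's uniqueness
  theorem applies. If the common value is 0, both measures vanish.\<close>

lemma laplace_unique:
  assumes M: "sets M = sets borel" "\<And>l. c < l \<Longrightarrow> integrable M (\<lambda>x::real. exp (- (l * x)))"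
    and N: "sets N = sets borel" "\<And>l. c < l \<Longrightarrow> integrable N (\<lambda>x::real. exp (- (l * x)))"
    and eq: "\<And>l. c < l \<Longrightarrow> (\<integral>x. exp (- (l * x)) \<partial>M) = (\<integral>x. exp (- (l * x)) \<partial>N)"
  shows "M = N"
proof -
  define b where "b = c + 1"
  define Z where "Z = (\<integral>x. exp (- (b * x)) \<partial>M)"
  have ZN: "Z = (\<integral>x. exp (- (b * x)) \<partial>N)" unfolding Z_def by (rule eq) (simp add: b_def)
  have null: "emeasure K A = 0" if "sets K = sets borel" "integrable K (\<lambda>x::real. exp (- (b * x)))"
    "(\<integral>x. exp (- (b * x)) \<partial>K) = 0" for K A
  proof -
    have "AE x in K. exp (- (b * x)) = 0"
      using that by (subst integral_nonneg_eq_0_iff_AE[symmetric]) auto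
    then have "AE x in K. False" by simp
    then have "emeasure K (space K) = 0" by (simp add: AE_iff_measurable[of "space K"])
    then show ?thesis
      using emeasure_space[of K A] by simp
  qed
  show ?thesis
  proof (cases "Z = 0")
    case True
    then show ?thesis
      using null[OF M(1) M(2)] null[OF N(1) N(2)] ZN M(1) N(1)
      by (intro measure_eqI) (simp_all add: b_def Z_def)
  next
    case False
    have "0 \<le> Z" unfolding Z_def by simp
    with False have Z: "0 < Z" by simp
    define D where "D K = density K (\<lambda>x. ennreal (exp (- (b * x)) / Z))" for K :: "real measure"
    have rd: "real_distribution (D K)" and ch: "char (D K) t = (\<integral>x. exp (- Complex b (- t) * of_real x) \<partial>K) / Z"
      if K: "sets K = sets borel" "integrable K (\<lambda>x::real. exp (- (b * x)))"
        "(\<integral>x. exp (- (b * x)) \<partial>K) = Z" for K t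
    proof -
      have [measurable]: "(\<lambda>x. exp (- (b * x)) / Z) \<in> borel_measurable K"
        using K(1) by (simp cong: measurable_cong_sets)
      have "emeasure (D K) (space (D K)) = (\<integral>\<^sup>+x. ennreal (exp (- (b * x)) / Z) \<partial>K)"
        by (simp add: D_def emeasure_density cong: nn_integral_cong)
      also have "\<dots> = ennreal (\<integral>x. exp (- (b * x)) / Z \<partial>K)"
        using K Z by (intro nn_integral_eq_integral) auto
      also have "\<dots> = 1" using K(3) Z by simp
      finally have "prob_space (D K)" by (rule prob_spaceI)
      moreover have "sets (D K) = sets borel" "space (D K) = UNIV"
        using K(1) sets_eq_imp_space_eq[OF K(1)] by (auto simp: D_def)
      ultimately show "real_distribution (D K)"
        by (simp add: real_distribution_def real_distribution_axioms_def)
      have "char (D K) t = (\<integral>x. (exp (- (b * x)) / Z) *\<^sub>R iexp (t * x) \<partial>K)"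
        unfolding char_def D_def using K(1) Z
        by (subst integral_density) (auto cong: measurable_cong_sets)
      also have "\<dots> = (\<integral>x. exp (- Complex b (- t) * of_real x) / Z \<partial>K)"
      proof (rule Bochner_Integration.integral_cong[OF refl])
        fix x
        have "exp (- Complex b (- t) * of_real x) = exp (of_real (- b * x)) * iexp (t * x)"
          by (subst exp_add[symmetric], rule arg_cong[where f=exp]) (simp add: complex_eq_iff)
        then show "(exp (- (b * x)) / Z) *\<^sub>R iexp (t * x) = exp (- Complex b (- t) * of_real x) / Z"
          by (simp add: scaleR_conv_of_real exp_of_real[symmetric])
      qed
      finally show "char (D K) t = (\<integral>x. exp (- Complex b (- t) * of_real x) \<partial>K) / Z" by simp
    qed
    have cb: "c < b" by (simp add: b_def)
    have "D M = D N"
    proof (rule Levy_uniqueness)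
      show "real_distribution (D M)" "real_distribution (D N)"
        using rd[OF M(1) M(2)[OF cb]] rd[OF N(1) N(2)[OF cb]] ZN by (simp_all add: Z_def)
      show "char (D M) = char (D N)"
      proof
        fix t
        have "(\<integral>x. exp (- Complex b (- t) * of_real x) \<partial>M) = (\<integral>x. exp (- Complex b (- t) * of_real x) \<partial>N)"
          using cb by (intro laplace_complex_eq[OF M N eq]) auto
        then show "char (D M) t = char (D N) t"
          unfolding ch[OF M(1) M(2)[OF cb] Z_def[symmetric]] ch[OF N(1) N(2)[OF cb] ZN[symmetric]] by (rule arg_cong)
      qed
    qed
    then show ?thesis
      unfolding D_def using M(1) N(1) Z
      by (intro density_pos_cancel[of N M "\<lambda>x. exp (- (b * x)) / Z"]) (simp_all cong: measurable_cong_sets)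
  qed
qed

text \<open>Functions are recovered almost everywhere only. The identities derived from it carry
  this exception in the starting point until one-sided continuity removes it.\<close>

lemma laplace_unique_AE:
  fixes f g :: "real \<Rightarrow> ennreal"
  assumes [measurable]: "f \<in> borel_measurable borel" "g \<in> borel_measurable borel"
    and eq: "\<And>l. c < l \<Longrightarrow> (\<integral>\<^sup>+x. ennreal (exp (- (l * x))) * f x \<partial>lborel) = (\<integral>\<^sup>+x. ennreal (exp (- (l * x))) * g x \<partial>lborel)"
    and fin: "\<And>l. c < l \<Longrightarrow> (\<integral>\<^sup>+x. ennreal (exp (- (l * x))) * f x \<partial>lborel) < \<infinity>"
  shows "AE x in lborel. f x = g x"
proof -
  have nn: "(\<integral>\<^sup>+x. ennreal (exp (- (l * x))) \<partial>density lborel h) = (\<integral>\<^sup>+x. ennreal (exp (- (l * x))) * h x \<partial>lborel)"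
    if "h \<in> borel_measurable borel" for h l
    using that by (subst nn_integral_density) (auto simp: mult.commute)
  have int: "integrable (density lborel h) (\<lambda>x. exp (- (l * x)))"
    if "h \<in> borel_measurable borel" "(\<integral>\<^sup>+x. ennreal (exp (- (l * x))) * h x \<partial>lborel) < \<infinity>" for h l
    using that nn[OF that(1), of l] by (intro integrableI_bounded) auto
  have "density lborel f = density lborel g"
  proof (rule laplace_unique)
    fix l assume "c < l"
    show "integrable (density lborel f) (\<lambda>x. exp (- (l * x)))" "integrable (density lborel g) (\<lambda>x. exp (- (l * x)))"
      using int[of f l] int[of g l] eq[OF \<open>c < l\<close>] fin[OF \<open>c < l\<close>] by simp_all
    show "(\<integral>x. exp (- (l * x)) \<partial>density lborel f) = (\<integral>x. exp (- (l * x)) \<partial>density lborel g)"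
      using eq[OF \<open>c < l\<close>] by (simp add: integral_eq_nn_integral nn)
  qed auto
  then show ?thesis by (subst (asm) sigma_finite_measure.density_unique_iff[OF sigma_finite_lborel]) auto
qed

section \<open>Cadlag paths\<close>

lemma cadlag_right_event:
  assumes "cadlag f" "0 \<le> s" "0 < e"
  obtains b where "s < b" "\<And>y. s \<le> y \<Longrightarrow> y < b \<Longrightarrow> \<bar>f y - f s\<bar> < e"
proof -
  have "(f \<longlongrightarrow> f s) (at_right s)" using assms by (simp add: cadlag_def continuous_within)
  then have "\<forall>\<^sub>F y in at_right s. dist (f y) (f s) < e" using assms(3) by (rule tendstoD)
  then obtain b where "s < b" "\<forall>y>s. y < b \<longrightarrow> dist (f y) (f s) < e"
    by (auto simp: eventually_at_right_field)
  with assms(3) show thesis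
    by (intro that[of b]) (auto simp: dist_real_def le_less)
qed

text \<open>Right-continuity at \<open>s\<close> and the left limit at \<open>s\<close> bound the
  path near \<open>s\<close>; compactness of the interval does the rest.\<close>

lemma cadlag_bounded:
  assumes f: "cadlag f"
  shows "\<exists>B. \<forall>s\<in>{0..t}. \<bar>f s\<bar> \<le> B"
proof -
  have "\<exists>U B. open U \<and> s \<in> U \<and> (\<forall>y\<in>U \<inter> {0..}. \<bar>f y\<bar> \<le> B)" if s: "0 \<le> s" for s
  proof -
    obtain b where b: "s < b" "\<And>y. s \<le> y \<Longrightarrow> y < b \<Longrightarrow> \<bar>f y - f s\<bar> < 1"
      using cadlag_right_event[OF f s, of 1] by auto
    have "\<exists>a l. a < s \<and> (\<forall>y\<ge>0. a < y \<and> y < s \<longrightarrow> \<bar>f y - l\<bar> < 1)"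
    proof (cases "s = 0")
      case True
      then show ?thesis by (intro exI[of _ "-1"]) auto
    next
      case False
      with s have "0 < s" by simp
      then obtain l where "(f \<longlongrightarrow> l) (at_left s)" using f unfolding cadlag_def by metis
      then have "\<forall>\<^sub>F y in at_left s. dist (f y) l < 1" by (rule tendstoD) simp
      then show ?thesis by (force simp: eventually_at_left_field dist_real_def)
    qed
    then obtain a l where a: "a < s" "\<And>y. 0 \<le> y \<Longrightarrow> a < y \<Longrightarrow> y < s \<Longrightarrow> \<bar>f y - l\<bar> < 1" by blast
    show ?thesis
    proof (intro exI conjI ballI)
      fix y assume "y \<in> {a<..<b} \<inter> {0..}"
      then show "\<bar>f y\<bar> \<le> \<bar>f s\<bar> + \<bar>l\<bar> + 1"
        using a(2)[of y] b(2)[of y] by (cases "y < s") auto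
    qed (use a b in auto)
  qed
  then obtain U B where UB: "\<And>s. 0 \<le> s \<Longrightarrow> open (U s) \<and> s \<in> U s \<and> (\<forall>y\<in>U s \<inter> {0..}. \<bar>f y\<bar> \<le> B s)"
    by metis
  have "compact {0..t}" by simp
  moreover have "\<And>T. T \<in> {0..t} \<Longrightarrow> open (U T)" "{0..t} \<subseteq> (\<Union>s\<in>{0..t}. U s)" using UB by auto
  ultimately obtain C where C: "C \<subseteq> {0..t}" "finite C" "{0..t} \<subseteq> (\<Union>s\<in>C. U s)"
    by (rule compactE_image)
  show ?thesis
  proof (intro exI ballI)
    fix y assume y: "y \<in> {0..t}"
    then obtain s where "s \<in> C" "y \<in> U s" using C by auto
    moreover have "\<bar>f y\<bar> \<le> B s" using UB[of s] C y calculation by auto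
    moreover have "B s \<le> (\<Sum>s\<in>C. \<bar>B s\<bar>)"
      using calculation C member_le_sum[of s C "\<lambda>s. \<bar>B s\<bar>"] by auto
    ultimately show "\<bar>f y\<bar> \<le> (\<Sum>s\<in>C. \<bar>B s\<bar>)" by linarith
  qed
qed

definition runinf :: "(real \<Rightarrow> real) \<Rightarrow> real \<Rightarrow> real" where
  "runinf f t = (INF s\<in>{0..t}. f s)"

lemma cadlag_bdd_below:
  assumes "cadlag f"
  shows "bdd_below (f ` {0..t})"
proof -
  obtain B where "\<forall>s\<in>{0..t}. \<bar>f s\<bar> \<le> B" using cadlag_bounded[OF assms] by blast
  then show ?thesis by (intro bdd_belowI2[of _ "-B"]) (auto simp: abs_le_iff minus_le_iff)
qed

lemma runinf_le: "cadlag f \<Longrightarrow> 0 \<le> s \<Longrightarrow> s \<le> t \<Longrightarrow> runinf f t \<le> f s"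
  unfolding runinf_def by (intro cINF_lower cadlag_bdd_below) auto

lemma runinf_lessD: "cadlag f \<Longrightarrow> 0 \<le> t \<Longrightarrow> runinf f t < y \<Longrightarrow> \<exists>s\<in>{0..t}. f s < y"
  unfolding runinf_def by (subst (asm) cINF_less_iff[OF _ cadlag_bdd_below]) auto

lemma runinf_add:
  assumes "cadlag f" "0 \<le> t"
  shows "(INF s\<in>{0..t}. x + f s) = x + runinf f t"
  unfolding runinf_def using assms cadlag_bdd_below by (intro Inf_add_eq) auto

text \<open>Writing times in the interval as \<open>t * u\<close> keeps the index set countable and
  independent of \<open>t\<close>, which yields joint measurability in time and path. The end point
  \<open>s = t\<close> is separate, since nothing to its right lies in the interval; it is reached
  because \<open>u = 1\<close> is rational.\<close>

lemma runinf_rational: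
  assumes f: "cadlag f" and t: "0 \<le> t"
  shows "runinf f t = (INF u\<in>\<rat> \<inter> {0..1}. f (t * u))"
proof (rule antisym)
  have ne: "\<rat> \<inter> {0..1::real} \<noteq> {}" using Rats_0 by (auto intro!: exI[of _ 0])
  have mem: "t * u \<in> {0..t}" if "u \<in> \<rat> \<inter> {0..1}" for u
    using that t by (auto intro: mult_left_le)
  show "runinf f t \<le> (INF u\<in>\<rat> \<inter> {0..1}. f (t * u))"
    using mem by (intro cINF_greatest ne runinf_le[OF f]) auto
  have bdd: "bdd_below ((\<lambda>u. f (t * u)) ` (\<rat> \<inter> {0..1}))"
    using mem by (intro bdd_below_mono[OF cadlag_bdd_below[OF f, of t]]) auto
  show "(INF u\<in>\<rat> \<inter> {0..1}. f (t * u)) \<le> runinf f t"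
    unfolding runinf_def
  proof (rule cINF_greatest)
    fix s assume s: "s \<in> {0..t}"
    show "(INF u\<in>\<rat> \<inter> {0..1}. f (t * u)) \<le> f s"
    proof (cases "s = t")
      case True
      have "(INF u\<in>\<rat> \<inter> {0..1}. f (t * u)) \<le> f (t * 1)"
        by (intro cINF_lower[OF bdd]) simp
      then show ?thesis using True by simp
    next
      case False
      with s have st: "0 \<le> s" "s < t" by auto
      show ?thesis
      proof (rule field_le_epsilon)
        fix e :: real assume "0 < e"
        obtain b where b: "s < b" "\<And>y. s \<le> y \<Longrightarrow> y < b \<Longrightarrow> \<bar>f y - f s\<bar> < e"
          using cadlag_right_event[OF f st(1) \<open>0 < e\<close>] by metis
        have t0: "0 < t" using st by simp
        have "s / t < min (b / t) 1" using st b by (simp add: divide_strict_right_mono)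
        then obtain u where u: "u \<in> \<rat>" "s / t < u" "u < min (b / t) 1"
          by (rule Rats_dense_in_real[THEN bexE]) auto
        then have "s < t * u" "t * u < b" "t * u < t" using st t0 by (auto simp: field_simps)
        moreover have "0 \<le> u" using u(2) st by (smt (verit) divide_nonneg_nonneg)
        moreover have "u \<le> 1" using \<open>t * u < t\<close> st mult_less_cancel_left_pos[of t u 1] by simp
        ultimately have "(INF u\<in>\<rat> \<inter> {0..1}. f (t * u)) \<le> f (t * u)" "f (t * u) < f s + e"
          using b(2)[of "t * u"] u by (auto intro!: cINF_lower[OF bdd])
        then show "(INF u\<in>\<rat> \<inter> {0..1}. f (t * u)) \<le> f s + e" by simp
      qed
    qed
  qed (use t in auto)
qed

text \<open>The path is sampled at the grid point strictly to the right of \<open>t\<close>, so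
  right-continuity gives convergence of these countably valued approximations. Negative times are
  sent to 0 so that time ranges over all reals; the rules declared \<open>measurable (raw)\<close>
  below use the same device and so carry no sign premise.\<close>

lemma right_continuous_jointly_measurable:
  fixes X :: "real \<Rightarrow> 'a \<Rightarrow> real"
  assumes X[measurable]: "\<And>t. 0 \<le> t \<Longrightarrow> X t \<in> borel_measurable M"
    and cad: "\<And>\<omega>. \<omega> \<in> space M \<Longrightarrow> cadlag (\<lambda>t. X t \<omega>)"
  shows "(\<lambda>(t, \<omega>). X (max 0 t) \<omega>) \<in> borel_measurable (borel \<Otimes>\<^sub>M M)"
proof -
  define g where "g n t = nat \<lfloor>max 0 t * real (Suc n)\<rfloor>" for n :: nat and t :: real
  have g: "real (g n t) \<le> max 0 t * real (Suc n)" "max 0 t * real (Suc n) < real (g n t) + 1" for n t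
  proof -
    have *: "real (nat \<lfloor>y\<rfloor>) \<le> y \<and> y < real (nat \<lfloor>y\<rfloor>) + 1" if "0 \<le> y" for y :: real
      using that by simp
    have "0 \<le> max 0 t * real (Suc n)" by simp
    from *[OF this] show "real (g n t) \<le> max 0 t * real (Suc n)" "max 0 t * real (Suc n) < real (g n t) + 1"
      unfolding g_def by blast+
  qed
  show ?thesis
  proof (rule borel_measurable_LIMSEQ_real)
    fix n
    show "(\<lambda>p. X ((real (g n (fst p)) + 1) / real (Suc n)) (snd p)) \<in> borel_measurable (borel \<Otimes>\<^sub>M M)"
    proof (rule measurable_compose_countable[where f="\<lambda>i p. X ((real i + 1) / real (Suc n)) (snd p)"])
      show "(\<lambda>p. X ((real i + 1) / real (Suc n)) (snd p)) \<in> borel_measurable (borel \<Otimes>\<^sub>M M)" for i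
        by (rule measurable_compose[OF measurable_snd X]) simp
      show "(\<lambda>p. g n (fst p)) \<in> borel \<Otimes>\<^sub>M M \<rightarrow>\<^sub>M count_space UNIV"
        unfolding g_def by measurable
    qed
  next
    fix p :: "real \<times> 'a" assume p: "p \<in> space (borel \<Otimes>\<^sub>M M)"
    obtain t \<omega> where t: "p = (t, \<omega>)" by force
    with p have \<omega>: "\<omega> \<in> space M" by (simp add: space_pair_measure)
    define s where "s = max 0 t"
    have s: "0 \<le> s" by (simp add: s_def)
    define r where "r n = (real (g n t) + 1) / real (Suc n)" for n
    have r: "s < r n" "r n \<le> s + 1 / real (Suc n)" for n
    proof -
      show "s < r n"
        unfolding r_def s_def using g(2)[of t n] by (subst pos_less_divide_eq) auto
      have "real (g n t) / real (Suc n) \<le> s"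
        unfolding s_def using g(1)[of n t] by (subst pos_divide_le_eq) auto
      then show "r n \<le> s + 1 / real (Suc n)" by (simp add: r_def add_divide_distrib)
    qed
    have "(\<lambda>n. s + 1 / real (Suc n)) \<longlonglongrightarrow> s + 0"
      by (intro tendsto_add tendsto_const LIMSEQ_Suc[OF lim_1_over_n])
    then have rl: "r \<longlonglongrightarrow> s"
      by (intro tendsto_sandwich[of "\<lambda>_. s" r sequentially "\<lambda>n. s + 1 / real (Suc n)"])
        (use r in \<open>auto intro!: always_eventually less_imp_le\<close>)
    have "filterlim r (at_right s) sequentially"
      using rl r by (auto simp: filterlim_at intro!: always_eventually)
    moreover have "((\<lambda>t. X t \<omega>) \<longlongrightarrow> X s \<omega>) (at_right s)"
      using cad[OF \<omega>] s by (simp add: cadlag_def continuous_within)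
    ultimately have "(\<lambda>n. X (r n) \<omega>) \<longlonglongrightarrow> X s \<omega>" by (rule filterlim_compose[rotated])
    then show "(\<lambda>n. X ((real (g n (fst p)) + 1) / real (Suc n)) (snd p)) \<longlonglongrightarrow> (case p of (t, \<omega>) \<Rightarrow> X (max 0 t) \<omega>)"
      by (simp add: t r_def s_def)
  qed
qed

lemma runinf_jointly_measurable:
  fixes X :: "real \<Rightarrow> 'a \<Rightarrow> real"
  assumes X: "\<And>t. 0 \<le> t \<Longrightarrow> X t \<in> borel_measurable M"
    and cad: "\<And>\<omega>. \<omega> \<in> space M \<Longrightarrow> cadlag (\<lambda>t. X t \<omega>)"
  shows "(\<lambda>(t, \<omega>). runinf (\<lambda>s. X s \<omega>) (max 0 t)) \<in> borel_measurable (borel \<Otimes>\<^sub>M M)"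
proof -
  note [measurable] = right_continuous_jointly_measurable[OF X cad]
  have "(\<lambda>p :: real \<times> 'a. (INF u\<in>\<rat> \<inter> {0..1}. X (max 0 (max 0 (fst p) * u)) (snd p))) \<in> borel_measurable (borel \<Otimes>\<^sub>M M)"
  proof (rule borel_measurable_cINF_real)
    show "countable (\<rat> \<inter> {0..1::real})" using countable_rat by auto
    fix u :: real
    have "(\<lambda>p :: real \<times> 'a. (max 0 (fst p) * u, snd p)) \<in> borel \<Otimes>\<^sub>M M \<rightarrow>\<^sub>M borel \<Otimes>\<^sub>M M" by measurable
    from measurable_compose[OF this right_continuous_jointly_measurable[OF X cad]]
    show "(\<lambda>p :: real \<times> 'a. X (max 0 (max 0 (fst p) * u)) (snd p)) \<in> borel_measurable (borel \<Otimes>\<^sub>M M)" by simp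
  qed
  then show ?thesis
  proof (rule measurable_cong[THEN iffD1, rotated])
    fix p :: "real \<times> 'a" assume "p \<in> space (borel \<Otimes>\<^sub>M M)"
    then have "cadlag (\<lambda>s. X s (snd p))" using cad by (auto simp: space_pair_measure)
    from runinf_rational[OF this, of "max 0 (fst p)"]
    show "(INF u\<in>\<rat> \<inter> {0..1}. X (max 0 (max 0 (fst p) * u)) (snd p)) =
        (case p of (t, \<omega>) \<Rightarrow> runinf (\<lambda>s. X s \<omega>) (max 0 t))"
      by (auto simp: case_prod_beta intro!: INF_cong arg_cong2[where f=X] mult_nonneg_nonneg)
  qed
qed

section \<open>Levy processes with a Laplace exponent\<close>

lemma (in prob_space) nn_integral_indep:
  assumes ind: "indep_var N1 D N2 E" and H[measurable]: "H \<in> borel_measurable (N1 \<Otimes>\<^sub>M N2)"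
  shows "(\<integral>\<^sup>+\<omega>. H (D \<omega>, E \<omega>) \<partial>M) = (\<integral>\<^sup>+\<omega>. \<integral>\<^sup>+\<omega>'. H (D \<omega>, E \<omega>') \<partial>M \<partial>M)"
proof -
  have D[measurable]: "D \<in> M \<rightarrow>\<^sub>M N1" and E[measurable]: "E \<in> M \<rightarrow>\<^sub>M N2"
    using indep_var_rv1[OF ind] indep_var_rv2[OF ind] by simp_all
  interpret E: prob_space "distr M N2 E" by (rule prob_space_distr) simp
  have "(\<integral>\<^sup>+\<omega>. H (D \<omega>, E \<omega>) \<partial>M) = (\<integral>\<^sup>+p. H p \<partial>distr M (N1 \<Otimes>\<^sub>M N2) (\<lambda>\<omega>. (D \<omega>, E \<omega>)))"
    by (subst nn_integral_distr) auto
  also have "\<dots> = (\<integral>\<^sup>+p. H p \<partial>(distr M N1 D \<Otimes>\<^sub>M distr M N2 E))"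
    using ind by (simp add: indep_var_distribution_eq)
  also have "\<dots> = (\<integral>\<^sup>+d. \<integral>\<^sup>+e. H (d, e) \<partial>distr M N2 E \<partial>distr M N1 D)"
    by (rule E.nn_integral_fst[symmetric]) (simp cong: measurable_cong_sets)
  also have "\<dots> = (\<integral>\<^sup>+d. \<integral>\<^sup>+\<omega>'. H (d, E \<omega>') \<partial>M \<partial>distr M N1 D)"
    by (intro nn_integral_cong nn_integral_distr) auto
  also have "\<dots> = (\<integral>\<^sup>+\<omega>. \<integral>\<^sup>+\<omega>'. H (D \<omega>, E \<omega>') \<partial>M \<partial>M)"
    by (subst nn_integral_distr) auto
  finally show ?thesis .
qed

context levy_process
begin

lemma V_raw [measurable (raw)]:
  assumes "f \<in> borel_measurable K" "g \<in> K \<rightarrow>\<^sub>M M"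
  shows "(\<lambda>x. V (max 0 (f x)) (g x)) \<in> borel_measurable K"
proof -
  have "(\<lambda>x. (f x, g x)) \<in> K \<rightarrow>\<^sub>M borel \<Otimes>\<^sub>M M" using assms by measurable
  from measurable_compose[OF this right_continuous_jointly_measurable[OF random_variable_V cadlag_paths]]
  show ?thesis by simp
qed

lemma runinf_raw [measurable (raw)]:
  assumes "f \<in> borel_measurable K" "g \<in> K \<rightarrow>\<^sub>M M"
  shows "(\<lambda>x. runinf (\<lambda>s. V s (g x)) (max 0 (f x))) \<in> borel_measurable K"
proof -
  have "(\<lambda>x. (f x, g x)) \<in> K \<rightarrow>\<^sub>M borel \<Otimes>\<^sub>M M" using assms by measurable
  from measurable_compose[OF this runinf_jointly_measurable[OF random_variable_V cadlag_paths]]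
  show ?thesis by simp
qed

lemma increment_nn_integral:
  assumes "0 \<le> s" "0 \<le> t" and [measurable]: "F \<in> borel_measurable borel"
  shows "(\<integral>\<^sup>+\<omega>. F (V (s + t) \<omega> - V s \<omega>) \<partial>M) = (\<integral>\<^sup>+\<omega>. F (V t \<omega>) \<partial>M)"
proof -
  have [measurable]: "V (s + t) \<in> borel_measurable M" "V s \<in> borel_measurable M" "V t \<in> borel_measurable M"
    using assms by (auto intro!: random_variable_V)
  have "(\<integral>\<^sup>+\<omega>. F (V (s + t) \<omega> - V s \<omega>) \<partial>M) = (\<integral>\<^sup>+x. F x \<partial>distr M borel (\<lambda>\<omega>. V (s + t) \<omega> - V s \<omega>))"
    by (subst nn_integral_distr) auto
  also have "\<dots> = (\<integral>\<^sup>+\<omega>. F (V t \<omega>) \<partial>M)"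
    unfolding stationary_increments[OF assms(1,2)] by (subst nn_integral_distr) auto
  finally show ?thesis .
qed

text \<open>Since \<open>V 0 = 0\<close> almost surely, grid values are partial sums of increments.
  So \<open>A\<close> depends on the first \<open>k\<close> increments, which are independent of the
  increment over the last stretch of length \<open>s\<close>; stationarity then replaces that
  increment by \<open>V s\<close>. Every use of independence of increments goes through this
  lemma.\<close>

lemma markov_grid:
  fixes h s :: real and k :: nat
  assumes h: "0 \<le> h" and s: "0 \<le> s" and B[measurable]: "\<And>j. B j \<in> sets borel"
    and F[measurable]: "F \<in> borel_measurable borel"
  defines "A \<equiv> {\<omega>. \<forall>j\<le>k. V (real j * h) \<omega> \<in> B j}"
  shows "(\<integral>\<^sup>+\<omega>. indicator A \<omega> * F (V (real k * h + s) \<omega>) \<partial>M) =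
         (\<integral>\<^sup>+\<omega>. indicator A \<omega> * (\<integral>\<^sup>+\<omega>'. F (V (real k * h) \<omega> + V s \<omega>') \<partial>M) \<partial>M)"
proof -
  \<comment> \<open>After index \<open>k\<close> the time is frozen at
    \<open>real k * h + s\<close>, so the increment with index \<open>k\<close> is the one of length
    \<open>s\<close>.\<close>
  define tt where "tt i = (if i \<le> k then real i * h else real k * h + s)" for i
  have tt0: "0 \<le> tt i" for i using h s by (simp add: tt_def)
  have "mono tt" unfolding mono_iff_le_Suc
    using h s by (auto simp: tt_def distrib_right intro!: add_increasing2 mult_right_mono)
  then have iv: "indep_vars (\<lambda>_. borel) (\<lambda>i \<omega>. V (tt (Suc i)) \<omega> - V (tt i) \<omega>) {..<Suc k}"
    by (intro indep_increments tt0)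
  define D where "D = (\<lambda>\<omega>. \<lambda>i\<in>{..<k}. V (tt (Suc i)) \<omega> - V (tt i) \<omega>)"
  define E where "E = (\<lambda>\<omega>. V (real k * h + s) \<omega> - V (real k * h) \<omega>)"
  define E' where "E' = (\<lambda>\<omega>. \<lambda>i\<in>{k}. V (tt (Suc i)) \<omega> - V (tt i) \<omega>)"
  have E': "E' \<omega> k = E \<omega>" for \<omega> by (simp add: E'_def E_def tt_def)
  have DE: "indep_var (PiM {..<k} (\<lambda>_. borel)) D (PiM {k} (\<lambda>_. borel)) E'"
    unfolding D_def E'_def by (rule indep_var_restrict[OF iv]) auto
  define H where "H p = (if \<forall>j\<in>{..k}. (\<Sum>i<j. fst p i) \<in> B j then F ((\<Sum>i<k. fst p i) + snd p k) else 0)"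
    for p :: "(nat \<Rightarrow> real) \<times> (nat \<Rightarrow> real)"
  have Sm: "(\<lambda>p. \<Sum>i<j. fst p i) \<in> borel_measurable (PiM {..<k} (\<lambda>_. borel :: real measure) \<Otimes>\<^sub>M PiM {k} (\<lambda>_. borel :: real measure))"
    if "j \<le> k" for j
  proof -
    have "(\<lambda>p. fst p i) \<in> borel_measurable (PiM {..<k} (\<lambda>_. borel :: real measure) \<Otimes>\<^sub>M PiM {k} (\<lambda>_. borel :: real measure))"
      if "i < k" for i
      using that by (intro measurable_compose[OF measurable_fst]) auto
    from borel_measurable_sum[of "{..<j}" "\<lambda>i p. fst p i", OF this]
    show ?thesis using that by simp
  qed
  have H[measurable]: "H \<in> borel_measurable (PiM {..<k} (\<lambda>_. borel) \<Otimes>\<^sub>M PiM {k} (\<lambda>_. borel))"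
    unfolding H_def
  proof (intro measurable_If sets.sets_Collect_finite_All')
    show "(\<lambda>p. F ((\<Sum>i<k. fst p i) + snd p k)) \<in>
        borel_measurable (PiM {..<k} (\<lambda>_. borel) \<Otimes>\<^sub>M PiM {k} (\<lambda>_. borel))"
      by (intro measurable_compose[OF _ F] borel_measurable_add Sm measurable_compose[OF measurable_snd]) auto
    show "{p \<in> space (PiM {..<k} (\<lambda>_. borel) \<Otimes>\<^sub>M PiM {k} (\<lambda>_. borel)). (\<Sum>i<j. fst p i) \<in> B j} \<in>
        sets (PiM {..<k} (\<lambda>_. borel) \<Otimes>\<^sub>M PiM {k} (\<lambda>_. borel))" if "j \<in> {..k}" for j
      using measurable_sets_Collect[OF Sm[of j], of "\<lambda>x. x \<in> B j"] that by simp
  qed auto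
  have AE1: "AE \<omega> in M. \<forall>j\<le>k. (\<Sum>i<j. D \<omega> i) = V (real j * h) \<omega>"
    using start_zero
  proof eventually_elim
    fix \<omega> assume 0: "V 0 \<omega> = 0"
    show "\<forall>j\<le>k. (\<Sum>i<j. D \<omega> i) = V (real j * h) \<omega>"
    proof safe
      fix j assume j: "j \<le> k"
      have "(\<Sum>i<j. D \<omega> i) = (\<Sum>i<j. V (real (Suc i) * h) \<omega> - V (real i * h) \<omega>)"
        using j by (intro sum.cong) (auto simp: D_def tt_def)
      also have "\<dots> = V (real j * h) \<omega> - V (real 0 * h) \<omega>" by (rule sum_lessThan_telescope)
      finally show "(\<Sum>i<j. D \<omega> i) = V (real j * h) \<omega>" using 0 by simp
    qed
  qed
  have Heq: "H (D \<omega>, e) = indicator A \<omega> * F (V (real k * h) \<omega> + e k)"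
    if "\<forall>j\<le>k. (\<Sum>i<j. D \<omega> i) = V (real j * h) \<omega>" for \<omega> e
    using that by (auto simp: H_def A_def indicator_def)
  have "(\<integral>\<^sup>+\<omega>. indicator A \<omega> * F (V (real k * h + s) \<omega>) \<partial>M) = (\<integral>\<^sup>+\<omega>. H (D \<omega>, E' \<omega>) \<partial>M)"
    by (intro nn_integral_cong_AE, use AE1 in eventually_elim) (simp add: Heq E' E_def)
  also have "\<dots> = (\<integral>\<^sup>+\<omega>. \<integral>\<^sup>+\<omega>'. H (D \<omega>, E' \<omega>') \<partial>M \<partial>M)"
    by (rule nn_integral_indep[OF DE H])
  also have "\<dots> = (\<integral>\<^sup>+\<omega>. indicator A \<omega> * (\<integral>\<^sup>+\<omega>'. F (V (real k * h) \<omega> + V s \<omega>') \<partial>M) \<partial>M)"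
  proof (intro nn_integral_cong_AE, use AE1 in eventually_elim)
    fix \<omega> assume "\<forall>j\<le>k. (\<Sum>i<j. D \<omega> i) = V (real j * h) \<omega>"
    then have "(\<integral>\<^sup>+\<omega>'. H (D \<omega>, E' \<omega>') \<partial>M) = (\<integral>\<^sup>+\<omega>'. indicator A \<omega> * F (V (real k * h) \<omega> + E \<omega>') \<partial>M)"
      by (simp add: Heq E')
    also have "\<dots> = indicator A \<omega> * (\<integral>\<^sup>+\<omega>'. F (V (real k * h) \<omega> + E \<omega>') \<partial>M)"
      using h s unfolding E_def
      by (intro nn_integral_cmult measurable_compose[OF _ F] borel_measurable_add borel_measurable_diff random_variable_V) auto
    also have "(\<integral>\<^sup>+\<omega>'. F (V (real k * h) \<omega> + E \<omega>') \<partial>M) = (\<integral>\<^sup>+\<omega>'. F (V (real k * h) \<omega> + V s \<omega>') \<partial>M)"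
      unfolding E_def using h s
      by (intro increment_nn_integral[where F="\<lambda>y. F (V (real k * h) \<omega> + y)"]) auto
    finally show "(\<integral>\<^sup>+\<omega>'. H (D \<omega>, E' \<omega>') \<partial>M) = indicator A \<omega> * (\<integral>\<^sup>+\<omega>'. F (V (real k * h) \<omega> + V s \<omega>') \<partial>M)" .
  qed
  finally show ?thesis .
qed

end

locale laplace_levy = levy_process M V for M :: "'a measure" and V +
  fixes \<Psi> :: "real \<Rightarrow> real"
  assumes laplace: "laplace_exponent M V \<Psi>"
begin

lemma exp_integrable:
  assumes "0 \<le> t" "0 \<le> l"
  shows "integrable M (\<lambda>\<omega>. exp (l * V t \<omega>))"
proof (rule ccontr)
  assume "\<not> ?thesis"
  then have "(\<integral>\<omega>. exp (l * V t \<omega>) \<partial>M) = 0" by (rule not_integrable_integral_eq)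
  moreover have "(\<integral>\<omega>. exp (l * V t \<omega>) \<partial>M) = exp (t * \<Psi> l)"
    using laplace assms by (simp add: laplace_exponent_def)
  ultimately show False by simp
qed

lemma exp_integral: "0 \<le> t \<Longrightarrow> 0 \<le> l \<Longrightarrow> (\<integral>\<omega>. exp (l * V t \<omega>) \<partial>M) = exp (t * \<Psi> l)"
  using laplace by (simp add: laplace_exponent_def)

lemma exp_nn_integral:
  "0 \<le> t \<Longrightarrow> 0 \<le> l \<Longrightarrow> (\<integral>\<^sup>+\<omega>. ennreal (exp (l * V t \<omega>)) \<partial>M) = ennreal (exp (t * \<Psi> l))"
  by (simp add: nn_integral_eq_integral exp_integrable exp_integral)

lemma Psi_0: "\<Psi> 0 = 0"
  using exp_integral[of 1 0] by (simp add: prob_space)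

text \<open>Convexity of \<open>exp\<close> is used under the expectation, with the two exponents
  normalised by \<open>\<Psi> a\<close> and \<open>\<Psi> b\<close>: the convex combination then has
  expectation 1, while the smaller side has expectation \<open>exp (\<Psi> l - c)\<close>.\<close>

lemma Psi_convex: "convex_on {0..} \<Psi>"
proof (rule convex_onI)
  fix u a b :: real assume u: "0 < u" "u < 1" and ab: "a \<in> {0..}" "b \<in> {0..}"
  define l where "l = (1 - u) * a + u * b"
  have l: "0 \<le> l" using u ab by (auto simp: l_def intro!: add_nonneg_nonneg)
  define c where "c = (1 - u) * \<Psi> a + u * \<Psi> b"
  have "exp (\<Psi> l - c) = (\<integral>\<omega>. exp (l * V 1 \<omega>) * exp (- c) \<partial>M)"
    using exp_integral[of 1 l] l by (simp add: exp_diff exp_minus divide_inverse)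
  also have "\<dots> \<le> (\<integral>\<omega>. (1 - u) * (exp (a * V 1 \<omega>) * exp (- \<Psi> a)) + u * (exp (b * V 1 \<omega>) * exp (- \<Psi> b)) \<partial>M)"
  proof (rule integral_mono)
    fix \<omega>
    have "exp ((1 - u) * (a * V 1 \<omega> - \<Psi> a) + u * (b * V 1 \<omega> - \<Psi> b)) \<le>
        (1 - u) * exp (a * V 1 \<omega> - \<Psi> a) + u * exp (b * V 1 \<omega> - \<Psi> b)"
      using convex_onD[OF exp_convex, of u "a * V 1 \<omega> - \<Psi> a" "b * V 1 \<omega> - \<Psi> b"] u by simp
    also have "(1 - u) * (a * V 1 \<omega> - \<Psi> a) + u * (b * V 1 \<omega> - \<Psi> b) = l * V 1 \<omega> - c"
      by (simp add: l_def c_def algebra_simps)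
    finally show "exp (l * V 1 \<omega>) * exp (- c) \<le>
        (1 - u) * (exp (a * V 1 \<omega>) * exp (- \<Psi> a)) + u * (exp (b * V 1 \<omega>) * exp (- \<Psi> b))"
      by (simp add: exp_diff exp_minus divide_inverse)
  qed (use l ab in \<open>auto intro!: exp_integrable Bochner_Integration.integrable_add integrable_mult_right integrable_mult_left\<close>)
  also have "\<dots> = (1 - u) * (exp (\<Psi> a) * exp (- \<Psi> a)) + u * (exp (\<Psi> b) * exp (- \<Psi> b))"
    using exp_integral[of 1 a] exp_integral[of 1 b] exp_integrable[of 1 a] exp_integrable[of 1 b] ab by simp
  also have "\<dots> = 1" by (simp add: exp_minus)
  finally have "\<Psi> l \<le> c" by simp
  then show "\<Psi> ((1 - u) *\<^sub>R a + u *\<^sub>R b) \<le> (1 - u) * \<Psi> a + u * \<Psi> b" by (simp add: l_def c_def)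
qed simp

text \<open>The law of \<open>- V 1\<close> has transform \<open>exp (\<Psi> l)\<close>, which is
  the sum of a power series about every \<open>l > 0\<close>; taking the logarithm gives
  \<open>\<Psi>\<close>.\<close>

lemma Psi_differentiable:
  assumes l: "0 < l"
  shows "\<exists>D. (\<Psi> has_real_derivative D) (at l)"
proof -
  define K where "K = distr M borel (\<lambda>\<omega>. - V 1 \<omega>)"
  have V1[measurable]: "V 1 \<in> borel_measurable M" by (rule random_variable_V) simp
  have K: "sets K = sets borel" "integrable K (\<lambda>x. exp (- (a * x)))" "(\<integral>x. exp (- (a * x)) \<partial>K) = exp (\<Psi> a)"
    if "0 \<le> a" for a
    using that exp_integrable[of 1 a] exp_integral[of 1 a]
    by (auto simp: K_def integrable_distr_eq integral_distr)
  define c where "c n = (\<integral>x. x ^ n * exp (- (l * x)) \<partial>K) * ((- 1) ^ n / fact n)" for n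
  have S: "(\<lambda>n. c n * t ^ n) sums exp (\<Psi> (l + t))" if "\<bar>t\<bar> < l" for t
  proof -
    have "(\<lambda>n. (\<integral>x. x ^ n * exp (- (l * x)) \<partial>K) * ((- t) ^ n / fact n)) sums (\<integral>x. exp (- ((l + t) * x)) \<partial>K)"
      using that by (intro laplace_powser_real[where c=0] K) auto
    moreover have "(\<integral>x. x ^ n * exp (- (l * x)) \<partial>K) * ((- t) ^ n / fact n) = c n * t ^ n" for n
      by (simp add: c_def power_minus[of t])
    ultimately show ?thesis using K(3)[of "l + t"] that by simp
  qed
  have "summable (\<lambda>n. c n * (l / 2) ^ n)" using S[of "l / 2"] l by (simp add: sums_iff)
  from termdiffs_strong[OF this, of 0] l
  have "((\<lambda>t. \<Sum>n. c n * t ^ n) has_real_derivative (\<Sum>n. diffs c n * 0 ^ n)) (at 0)" by simp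
  moreover have "\<forall>\<^sub>F t in nhds 0. (\<Sum>n. c n * t ^ n) = exp (\<Psi> (l + t))"
    using eventually_nhds_in_open[of "{- l<..<l}" 0] l
    by (auto elim!: eventually_mono simp: S[THEN sums_unique, symmetric])
  ultimately have "((\<lambda>t. exp (\<Psi> (l + t))) has_real_derivative (\<Sum>n. diffs c n * 0 ^ n)) (at 0)"
    by (subst (asm) DERIV_cong_ev[OF refl _ refl]) auto
  then have "((\<lambda>a. exp (\<Psi> a)) has_real_derivative (\<Sum>n. diffs c n * 0 ^ n)) (at (0 + l))"
    unfolding DERIV_shift by (simp add: add.commute)
  then have "((\<lambda>a. ln (exp (\<Psi> a))) has_real_derivative (1 / exp (\<Psi> l)) * (\<Sum>n. diffs c n * 0 ^ n)) (at l)"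
    by (intro DERIV_chain2[OF DERIV_ln_divide]) auto
  then show ?thesis by auto
qed

lemma chernoff:
  assumes "0 \<le> t" "0 \<le> l"
  shows "measure M {\<omega> \<in> space M. y \<le> V t \<omega>} \<le> exp (t * \<Psi> l - l * y)"
proof -
  have [measurable]: "V t \<in> borel_measurable M" using assms by (intro random_variable_V)
  have "measure M {\<omega> \<in> space M. y \<le> V t \<omega>} = (\<integral>\<omega>. indicator {\<omega> \<in> space M. y \<le> V t \<omega>} \<omega> \<partial>M)"
    by simp
  also have "\<dots> \<le> (\<integral>\<omega>. exp (l * V t \<omega>) * exp (- (l * y)) \<partial>M)"
  proof (rule integral_mono)
    fix \<omega> show "indicator {\<omega> \<in> space M. y \<le> V t \<omega>} \<omega> \<le> exp (l * V t \<omega>) * exp (- (l * y))"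
      using mult_left_mono[of y "V t \<omega>" l] assms(2)
      by (auto simp: indicator_def exp_add[symmetric])
  qed (use assms in \<open>auto intro!: exp_integrable integrable_real_indicator simp: less_top[symmetric]\<close>)
  also have "\<dots> = exp (t * \<Psi> l - l * y)"
    using assms by (simp add: exp_integral exp_diff exp_minus divide_inverse)
  finally show ?thesis .
qed

text \<open>Under the linear bound, Chernoff's inequality at the level \<open>d * t + e\<close>
  gives \<open>exp (t * C - l * e)\<close>, and \<open>l\<close> may tend to infinity.\<close>

lemma tail_zero:
  assumes lin: "\<And>l. 0 \<le> l \<Longrightarrow> \<Psi> l \<le> d * l + C" and t: "0 \<le> t"
  shows "AE \<omega> in M. V t \<omega> \<le> d * t"
proof -
  have [measurable]: "V t \<in> borel_measurable M" using t by (intro random_variable_V)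
  have "AE \<omega> in M. \<not> d * t + 1 / real (Suc n) \<le> V t \<omega>" for n
  proof -
    define e where "e = 1 / real (Suc n)"
    have e: "0 < e" by (simp add: e_def)
    let ?A = "{\<omega> \<in> space M. d * t + e \<le> V t \<omega>}"
    have "measure M ?A \<le> exp (t * C - l * e)" if "0 \<le> l" for l
    proof -
      have "measure M ?A \<le> exp (t * \<Psi> l - l * (d * t + e))" by (rule chernoff[OF t that])
      also have "\<dots> \<le> exp (t * C - l * e)"
        using mult_left_mono[OF lin[OF that] t] by (simp add: algebra_simps)
      finally show ?thesis .
    qed
    moreover have "((\<lambda>l. exp (t * C - l * e)) \<longlongrightarrow> 0) at_top" using e by real_asymp
    ultimately have "measure M ?A \<le> 0"
      by (intro tendsto_lowerbound[of _ 0 at_top]) (auto intro: eventually_at_top_linorderI[of 0])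
    then have "measure M ?A = 0" by (simp add: measure_le_0_iff)
    then show ?thesis unfolding e_def[symmetric]
      by (subst (asm) prob_eq_0) (auto elim: AE_mp)
  qed
  then have "AE \<omega> in M. \<forall>n. \<not> d * t + 1 / real (Suc n) \<le> V t \<omega>" by (simp add: AE_all_countable)
  then show ?thesis
  proof eventually_elim
    fix \<omega> assume *: "\<forall>n. \<not> d * t + 1 / real (Suc n) \<le> V t \<omega>"
    show "V t \<omega> \<le> d * t"
    proof (rule ccontr)
      assume "\<not> V t \<omega> \<le> d * t"
      then obtain n where "inverse (real (Suc n)) < V t \<omega> - d * t"
        using reals_Archimedean[of "V t \<omega> - d * t"] by auto
      then show False using *[THEN spec, of n] by (simp add: inverse_eq_divide)
    qed
  qed
qed

lemma increment_le:
  assumes lin: "\<And>l. 0 \<le> l \<Longrightarrow> \<Psi> l \<le> d * l + C" and st: "0 \<le> s" "s \<le> t"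
  shows "AE \<omega> in M. V t \<omega> - V s \<omega> \<le> d * (t - s)"
proof -
  have [measurable]: "V t \<in> borel_measurable M" "V s \<in> borel_measurable M" "V (t - s) \<in> borel_measurable M"
    using st by (auto intro!: random_variable_V)
  define F where "F x = (indicator {d * (t - s)<..} x :: ennreal)" for x
  have [measurable]: "F \<in> borel_measurable borel" unfolding F_def by measurable
  have "(\<integral>\<^sup>+\<omega>. F (V t \<omega> - V s \<omega>) \<partial>M) = (\<integral>\<^sup>+\<omega>. F (V (t - s) \<omega>) \<partial>M)"
    using increment_nn_integral[of s "t - s" F] st by simp
  also have "\<dots> = 0"
    using tail_zero[OF lin, of "t - s"] st
    by (subst nn_integral_0_iff_AE) (auto simp: F_def indicator_def elim!: eventually_mono)
  finally have "AE \<omega> in M. F (V t \<omega> - V s \<omega>) = 0"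
    by (subst (asm) nn_integral_0_iff_AE) auto
  then show ?thesis by eventually_elim (auto simp: F_def indicator_def split: if_splits)
qed

text \<open>Were \<open>\<Psi>\<close> below a line of slope \<open>d\<close>, almost surely no
  increment would exceed \<open>d\<close> times its duration. Then \<open>d * t - V t\<close> would
  be nondecreasing in \<open>t\<close> and \<open>V\<close> a difference of monotone functions,
  hence of bounded variation.\<close>

lemma Psi_superlinear:
  assumes uv: "unbounded_variation M V"
  shows "\<exists>l\<ge>0. d * l + C < \<Psi> l"
proof (rule ccontr)
  assume "\<not> ?thesis"
  then have lin: "\<Psi> l \<le> d * l + C" if "0 \<le> l" for l using that by (auto simp: not_less)
  \<comment> \<open>Countably many pairs of times come first, on one almost sure event;
    right-continuity then extends the inequality to all times.\<close>
  have "AE \<omega> in M. \<forall>s\<in>\<rat>. \<forall>t\<in>\<rat>. 0 \<le> s \<longrightarrow> s \<le> t \<longrightarrow> V t \<omega> - V s \<omega> \<le> d * (t - s)"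
    by (intro AE_ball_countable'[OF _ countable_rat] AE_impI increment_le[OF lin])
  then have "AE \<omega> in M. \<forall>t\<ge>0. bounded_variation_on (\<lambda>s. V s \<omega>) 0 t"
    using AE_space
  proof eventually_elim
    fix \<omega> assume R: "\<forall>s\<in>\<rat>. \<forall>t\<in>\<rat>. 0 \<le> s \<longrightarrow> s \<le> t \<longrightarrow> V t \<omega> - V s \<omega> \<le> d * (t - s)"
      and \<omega>: "\<omega> \<in> space M"
    define f where "f t = d * t - V t \<omega>" for t
    have tend: "(f \<longlongrightarrow> f s) (at_right s)" if "0 \<le> s" for s
      unfolding f_def using cadlag_paths[OF \<omega>] that
      by (intro tendsto_intros) (simp add: cadlag_def continuous_within)
    have fR: "f s \<le> f t" if "s \<in> \<rat>" "t \<in> \<rat>" "0 \<le> s" "s \<le> t" for s t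
      using R[rule_format, OF that] by (simp add: f_def algebra_simps)
    have f: "f s \<le> f t" if st: "0 \<le> s" "s < t" for s t
    proof (rule ccontr)
      assume "\<not> f s \<le> f t"
      define m where "m = (f s + f t) / 2"
      have m: "m < f s" "f t < m" using \<open>\<not> f s \<le> f t\<close> by (auto simp: m_def)
      have "\<forall>\<^sub>F y in at_right s. m < f y" using tend[of s] st m by (auto dest: order_tendstoD)
      then obtain b where b: "s < b" "\<And>y. s < y \<Longrightarrow> y < b \<Longrightarrow> m < f y" by (auto simp: eventually_at_right_field)
      have "\<forall>\<^sub>F y in at_right t. f y < m" using tend[of t] st m by (auto dest: order_tendstoD)
      then obtain b' where b': "t < b'" "\<And>y. t < y \<Longrightarrow> y < b' \<Longrightarrow> f y < m" by (auto simp: eventually_at_right_field)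
      obtain x where x: "x \<in> \<rat>" "s < x" "x < min b t"
        using Rats_dense_in_real[of s "min b t"] b st by auto
      obtain y where y: "y \<in> \<rat>" "t < y" "y < b'" using Rats_dense_in_real[of t b'] b' by auto
      have "f x \<le> f y" using x y st by (intro fR) auto
      with b(2)[of x] b'(2)[of y] x y show False by simp
    qed
    show "\<forall>t\<ge>0. bounded_variation_on (\<lambda>s. V s \<omega>) 0 t"
      unfolding bounded_variation_on_def
    proof (intro allI impI exI)
      fix t :: real and n :: nat and p :: "nat \<Rightarrow> real"
      assume t: "0 \<le> t" and p: "mono_on {..n} p \<and> p ` {..n} \<subseteq> {0..t}"
      have p0: "0 \<le> p i" "p i \<le> t" if "i \<le> n" for i using p that by auto
      have "(\<Sum>i<n. \<bar>V (p (Suc i)) \<omega> - V (p i) \<omega>\<bar>) \<le>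
          (\<Sum>i<n. (\<bar>d\<bar> * p (Suc i) + f (p (Suc i))) - (\<bar>d\<bar> * p i + f (p i)))"
      proof (rule sum_mono)
        fix i assume i: "i \<in> {..<n}"
        then have pi: "p i \<le> p (Suc i)" using p by (auto simp: mono_on_def)
        then have "f (p i) \<le> f (p (Suc i))"
          using f[of "p i" "p (Suc i)"] p0(1)[of i] i by (cases "p i = p (Suc i)") auto
        moreover have "V (p (Suc i)) \<omega> - V (p i) \<omega> = d * (p (Suc i) - p i) - (f (p (Suc i)) - f (p i))"
          by (simp add: f_def algebra_simps)
        moreover have "\<bar>d * (p (Suc i) - p i)\<bar> \<le> \<bar>d\<bar> * (p (Suc i) - p i)" using pi by (simp add: abs_mult)
        ultimately show "\<bar>V (p (Suc i)) \<omega> - V (p i) \<omega>\<bar> \<le>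
            (\<bar>d\<bar> * p (Suc i) + f (p (Suc i))) - (\<bar>d\<bar> * p i + f (p i))"
          by (simp add: right_diff_distrib)
      qed
      also have "\<dots> = (\<bar>d\<bar> * p n + f (p n)) - (\<bar>d\<bar> * p 0 + f (p 0))"
        by (rule sum_lessThan_telescope)
      also have "\<dots> \<le> \<bar>d\<bar> * t + f t - f 0"
      proof -
        have "\<bar>d\<bar> * p n \<le> \<bar>d\<bar> * t" "0 \<le> \<bar>d\<bar> * p 0" using p0 by (auto intro: mult_left_mono)
        moreover have "f (p n) \<le> f t" using f[of "p n" t] p0[of n] by (cases "p n = t") auto
        moreover have "f 0 \<le> f (p 0)" using f[of 0 "p 0"] p0[of 0] by (cases "p 0 = 0") auto
        ultimately show ?thesis by simp
      qed
      finally show "(\<Sum>i<n. \<bar>V (p (Suc i)) \<omega> - V (p i) \<omega>\<bar>) \<le> \<bar>d\<bar> * t + f t - f 0" .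
    qed
  qed
  with uv show False by (simp add: unbounded_variation_def)
qed

end

section \<open>The resolvent equation for the process killed below zero\<close>

text \<open>The transform is taken over the whole line because the free process, which may become
  negative, acts on it by multiplication, as \<open>LT_PP\<close> shows.\<close>

definition LT :: "(real \<Rightarrow> ennreal) \<Rightarrow> real \<Rightarrow> ennreal" where
  "LT f l = (\<integral>\<^sup>+x. ennreal (exp (- (l * x))) * f x \<partial>lborel)"

definition conv :: "(real \<Rightarrow> ennreal) \<Rightarrow> (real \<Rightarrow> ennreal) \<Rightarrow> real \<Rightarrow> ennreal" where
  "conv a b x = (\<integral>\<^sup>+y. a (x - y) * b y \<partial>lborel)"

lemma conv_measurable [measurable]:
  assumes [measurable]: "a \<in> borel_measurable borel" "b \<in> borel_measurable borel"
  shows "conv a b \<in> borel_measurable borel"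
  unfolding conv_def by measurable

lemma LT_shift:
  assumes [measurable]: "f \<in> borel_measurable borel"
  shows "LT (\<lambda>z. f (z + v)) l = ennreal (exp (l * v)) * LT f l"
proof -
  have "LT f l = (\<integral>\<^sup>+x. ennreal (exp (- (l * (v + 1 * x)))) * f (v + 1 * x) \<partial>lborel)"
    unfolding LT_def using nn_integral_real_affine[of "\<lambda>x. ennreal (exp (- (l * x))) * f x" 1 v] by simp
  also have "ennreal (exp (l * v)) * \<dots> = LT (\<lambda>z. f (z + v)) l"
    unfolding LT_def
  proof (subst nn_integral_cmult[symmetric], measurable, intro nn_integral_cong)
    fix x
    have "exp (l * v) * exp (- (l * (v + x))) = exp (- (l * x))"
      by (subst exp_add[symmetric]) (simp add: distrib_left)
    then show "ennreal (exp (l * v)) * (ennreal (exp (- (l * (v + 1 * x)))) * f (v + 1 * x)) =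
        ennreal (exp (- (l * x))) * f (x + v)"
      by (simp add: ennreal_mult[symmetric] mult.assoc[symmetric] add.commute)
  qed
  finally show ?thesis by simp
qed

lemma LT_add:
  assumes [measurable]: "f \<in> borel_measurable borel" "g \<in> borel_measurable borel"
  shows "LT (\<lambda>z. f z + g z) l = LT f l + LT g l"
  unfolding LT_def by (subst nn_integral_add[symmetric]) (auto simp: distrib_left)

lemma LT_cmult:
  assumes [measurable]: "f \<in> borel_measurable borel"
  shows "LT (\<lambda>z. c * f z) l = c * LT f l"
  unfolding LT_def by (subst nn_integral_cmult[symmetric]) (auto simp: mult_ac)

lemma LT_nn_integral:
  assumes "sigma_finite_measure N" and [measurable]: "(\<lambda>(z, \<omega>). f z \<omega>) \<in> borel_measurable (borel \<Otimes>\<^sub>M N)"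
  shows "LT (\<lambda>z. \<integral>\<^sup>+\<omega>. f z \<omega> \<partial>N) l = (\<integral>\<^sup>+\<omega>. LT (\<lambda>z. f z \<omega>) l \<partial>N)"
proof -
  interpret N: sigma_finite_measure N by fact
  interpret pair_sigma_finite lborel N ..
  have "LT (\<lambda>z. \<integral>\<^sup>+\<omega>. f z \<omega> \<partial>N) l = (\<integral>\<^sup>+z. \<integral>\<^sup>+\<omega>. ennreal (exp (- (l * z))) * f z \<omega> \<partial>N \<partial>lborel)"
    unfolding LT_def by (intro nn_integral_cong nn_integral_cmult[symmetric]) measurable
  also have "\<dots> = (\<integral>\<^sup>+\<omega>. LT (\<lambda>z. f z \<omega>) l \<partial>N)"
    unfolding LT_def by (rule Fubini'[symmetric]) measurable
  finally show ?thesis .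
qed

lemma LT_conv:
  assumes [measurable]: "a \<in> borel_measurable borel" "b \<in> borel_measurable borel"
  shows "LT (conv a b) l = LT a l * LT b l"
proof -
  have "LT (conv a b) l = (\<integral>\<^sup>+y. LT (\<lambda>x. a (x - y) * b y) l \<partial>lborel)"
    unfolding conv_def by (rule LT_nn_integral) (auto intro: sigma_finite_lborel)
  also have "\<dots> = (\<integral>\<^sup>+y. LT a l * (ennreal (exp (- (l * y))) * b y) \<partial>lborel)"
  proof (rule nn_integral_cong)
    fix y
    have "LT (\<lambda>x. b y * a (x + - y)) l = b y * (ennreal (exp (l * - y)) * LT a l)"
      by (subst LT_cmult) (auto simp: LT_shift[of a "- y", simplified])
    then show "LT (\<lambda>x. a (x - y) * b y) l = LT a l * (ennreal (exp (- (l * y))) * b y)"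
      by (simp add: mult_ac)
  qed
  also have "\<dots> = LT a l * LT b l" unfolding LT_def[of b] by (rule nn_integral_cmult) measurable
  finally show ?thesis .
qed

lemma AE_lborel_shift:
  assumes "Measurable.pred borel P" "AE z in lborel. P (z::real)"
  shows "AE x in lborel. P (x + v)"
  using AE_borel_affine[of 1 P v] assms by (simp add: add.commute)

context levy_process
begin

text \<open>\<open>PP\<close> is the transition semigroup of the free process and \<open>KP\<close>
  that of the process killed on leaving the positive half-line. Despite its name,
  \<open>kill\<close> is the indicator of survival; \<open>alive\<close> is its analogue on a grid
  of mesh \<open>h\<close>.\<close>

definition PP :: "real \<Rightarrow> (real \<Rightarrow> ennreal) \<Rightarrow> real \<Rightarrow> ennreal" where
  "PP s f z = (\<integral>\<^sup>+\<omega>. f (z + V (max 0 s) \<omega>) \<partial>M)"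

definition kill :: "real \<Rightarrow> real \<Rightarrow> 'a \<Rightarrow> ennreal" where
  "kill t x \<omega> = (if 0 < x + runinf (\<lambda>r. V r \<omega>) (max 0 t) then 1 else 0)"

definition KP :: "real \<Rightarrow> (real \<Rightarrow> ennreal) \<Rightarrow> real \<Rightarrow> ennreal" where
  "KP t f x = (\<integral>\<^sup>+\<omega>. kill t x \<omega> * f (x + V (max 0 t) \<omega>) \<partial>M)"

definition alive :: "real \<Rightarrow> nat \<Rightarrow> real \<Rightarrow> 'a \<Rightarrow> ennreal" where
  "alive h k x \<omega> = (if \<forall>j. j \<le> k \<longrightarrow> 0 < x + V (max 0 (real j * h)) \<omega> then 1 else 0)"

lemma kill_raw [measurable (raw)]:
  assumes [measurable]: "f \<in> borel_measurable K" "e \<in> borel_measurable K" "g \<in> K \<rightarrow>\<^sub>M M"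
  shows "(\<lambda>y. kill (f y) (e y) (g y)) \<in> borel_measurable K"
  unfolding kill_def by measurable

lemma PP_raw [measurable (raw)]:
  assumes [measurable]: "f \<in> borel_measurable K" "e \<in> borel_measurable K" "u \<in> borel_measurable borel"
  shows "(\<lambda>y. PP (f y) u (e y)) \<in> borel_measurable K"
  unfolding PP_def by measurable

lemma KP_raw [measurable (raw)]:
  assumes [measurable]: "f \<in> borel_measurable K" "e \<in> borel_measurable K" "u \<in> borel_measurable borel"
  shows "(\<lambda>y. KP (f y) u (e y)) \<in> borel_measurable K"
  unfolding KP_def by measurable

lemma alive_raw [measurable (raw)]:
  assumes k: "k \<in> K \<rightarrow>\<^sub>M count_space UNIV" and [measurable]: "e \<in> borel_measurable K" "g \<in> K \<rightarrow>\<^sub>M M"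
  shows "(\<lambda>y. alive h (k y) (e y) (g y)) \<in> borel_measurable K"
proof (rule measurable_compose_countable[OF _ k])
  show "(\<lambda>y. alive h i (e y) (g y)) \<in> borel_measurable K" for i
    unfolding alive_def by measurable
qed

lemma alive_markov:
  assumes h: "0 \<le> h" and s: "0 \<le> s" and F[measurable]: "F \<in> borel_measurable borel"
  shows "(\<integral>\<^sup>+\<omega>. alive h k x \<omega> * F (x + V (real k * h + s) \<omega>) \<partial>M) =
         (\<integral>\<^sup>+\<omega>. alive h k x \<omega> * PP s F (x + V (real k * h) \<omega>) \<partial>M)"
proof -
  have "alive h k x = indicator {\<omega>. \<forall>j\<le>k. V (real j * h) \<omega> \<in> {- x<..}}"
    using h by (auto simp: fun_eq_iff alive_def indicator_def max_def)
  then show ?thesis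
    using markov_grid[OF h s, of "\<lambda>_. {- x<..}" "\<lambda>z. F (x + z)" k] s
    by (simp add: PP_def max_def add.assoc)
qed

lemma kill_0: "AE \<omega> in M. kill 0 x \<omega> = (if 0 < x then 1 else 0) \<and> V 0 \<omega> = 0"
  using start_zero by eventually_elim (simp add: kill_def runinf_def)

text \<open>A path with positive infimum is alive on every grid. If the path is negative at some
  \<open>s'\<close> before \<open>s\<close>, right-continuity keeps it so on an interval, which fine
  grids hit. If it is negative only at \<open>s' = s\<close> there is no such interval, but then
  \<open>g\<close> vanishes at the final value. Infimum exactly 0 is excluded by
  \<open>ne\<close>.\<close>

lemma alive_tendsto:
  fixes g :: "real \<Rightarrow> ennreal"
  assumes \<omega>: "\<omega> \<in> space M" and t: "0 < t" "0 \<le> s" "s \<le> t" and g: "\<And>z. z < 0 \<Longrightarrow> g z = 0"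
    and ne: "x + runinf (\<lambda>r. V r \<omega>) s \<noteq> 0"
  shows "(\<lambda>n. alive (t / 2 ^ n) (nat \<lfloor>s / (t / 2 ^ n)\<rfloor>) x \<omega> * g (x + V s \<omega>))
    \<longlonglongrightarrow> kill s x \<omega> * g (x + V s \<omega>)"
proof -
  have cad: "cadlag (\<lambda>r. V r \<omega>)" using cadlag_paths[OF \<omega>] .
  define h where "h n = t / 2 ^ n" for n :: nat
  have h: "0 < h n" for n using t by (simp add: h_def)
  have hlim: "h \<longlonglongrightarrow> 0" unfolding h_def by real_asymp
  have fl: "j \<le> nat \<lfloor>s / h n\<rfloor> \<longleftrightarrow> real j * h n \<le> s" for j n
    using h[of n] t by (simp add: le_nat_floor le_nat_iff le_floor_iff pos_le_divide_eq)
  show ?thesis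
  proof (cases "0 < x + runinf (\<lambda>r. V r \<omega>) s")
    case True
    have "alive (h n) (nat \<lfloor>s / h n\<rfloor>) x \<omega> = 1" for n
    proof -
      have "0 < x + V (real j * h n) \<omega>" if "real j * h n \<le> s" for j
        using runinf_le[OF cad _ that] h[of n] True by (simp add: less_imp_le)
      then show ?thesis using h[of n] by (auto simp: alive_def fl max_def)
    qed
    then show ?thesis using True t by (simp add: h_def kill_def)
  next
    case False
    then have "runinf (\<lambda>r. V r \<omega>) s < - x" using ne by simp
    from runinf_lessD[OF cad t(2) this] obtain s' where s': "0 \<le> s'" "s' \<le> s" "V s' \<omega> < - x" by auto
    show ?thesis
    proof (cases "s' = s")
      case True
      then have "g (x + V s \<omega>) = 0" using s' by (intro g) simp
      then show ?thesis by simp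
    next
      case F: False
      obtain b where b: "s' < b" "\<And>y. s' \<le> y \<Longrightarrow> y < b \<Longrightarrow> \<bar>V y \<omega> - V s' \<omega>\<bar> < - x - V s' \<omega>"
        using cadlag_right_event[OF cad s'(1), of "- x - V s' \<omega>"] s' by auto
      have "\<forall>\<^sub>F n in sequentially. h n < min b s - s'"
        using order_tendstoD(2)[OF hlim, of "min b s - s'"] b s' F by simp
      then have "\<forall>\<^sub>F n in sequentially. alive (h n) (nat \<lfloor>s / h n\<rfloor>) x \<omega> = 0"
      proof eventually_elim
        fix n assume hn: "h n < min b s - s'"
        define j where "j = nat \<lceil>s' / h n\<rceil>"
        have "s' / h n \<le> real j" "real j < s' / h n + 1"
          unfolding j_def using s' h[of n] by (auto simp: of_nat_nat intro: less_imp_le) linarith+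
        then have j: "s' \<le> real j * h n" "real j * h n < s' + h n"
          using h[of n] by (auto simp: field_simps)
        have "real j * h n < b" using j hn by simp
        from b(2)[OF j(1) this] have "\<not> 0 < x + V (real j * h n) \<omega>" by linarith
        moreover have "j \<le> nat \<lfloor>s / h n\<rfloor>" unfolding fl using j hn by auto
        ultimately show "alive (h n) (nat \<lfloor>s / h n\<rfloor>) x \<omega> = 0"
          using h[of n] by (auto simp: alive_def max_def)
      qed
      then show ?thesis
        using False t by (intro tendsto_eventually) (auto elim!: eventually_mono simp: h_def kill_def max_def)
    qed
  qed
qed

end

context laplace_levy
begin

lemma LT_PP:
  assumes s: "0 \<le> s" and l: "0 \<le> l" and [measurable]: "f \<in> borel_measurable borel"
  shows "LT (PP s f) l = ennreal (exp (s * \<Psi> l)) * LT f l"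
proof -
  have [measurable]: "V s \<in> borel_measurable M" using s by (rule random_variable_V)
  have "LT (PP s f) l = (\<integral>\<^sup>+\<omega>. LT (\<lambda>z. f (z + V (max 0 s) \<omega>)) l \<partial>M)"
    unfolding PP_def by (rule LT_nn_integral) (auto intro: sigma_finite_measure_axioms)
  also have "\<dots> = (\<integral>\<^sup>+\<omega>. ennreal (exp (l * V s \<omega>)) * LT f l \<partial>M)"
    using s by (simp add: LT_shift max_def)
  also have "\<dots> = (\<integral>\<^sup>+\<omega>. ennreal (exp (l * V s \<omega>)) \<partial>M) * LT f l"
    by (rule nn_integral_multc) measurable
  finally show ?thesis using s l by (simp add: exp_nn_integral)
qed

text \<open>The relation of the transforms says that \<open>f\<close> is formally the generator
  applied to \<open>u\<close>, so this is Dynkin's formula for the free process. Both sides have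
  transform \<open>exp (t * \<Psi> l) * LT u l\<close>; positivity of \<open>\<Psi>\<close> keeps
  the computation within nonnegative quantities.\<close>

lemma free_identity:
  assumes [measurable]: "f \<in> borel_measurable borel" "u \<in> borel_measurable borel"
    and c: "0 \<le> c"
    and Psi: "\<And>l. c < l \<Longrightarrow> 0 < \<Psi> l"
    and LT: "\<And>l. c < l \<Longrightarrow> LT f l = ennreal (\<Psi> l) * LT u l"
    and fin: "\<And>l. c < l \<Longrightarrow> LT u l < \<infinity>"
    and t: "0 \<le> t"
  shows "AE z in lborel. PP t u z = u z + (\<integral>\<^sup>+s. PP s f z * indicator {0..t} s \<partial>lborel)"
proof (rule laplace_unique_AE[where c=c])
  fix l assume l: "c < l"
  have l0: "0 \<le> l" using l c by simp
  have "LT (\<lambda>z. u z + (\<integral>\<^sup>+s. PP s f z * indicator {0..t} s \<partial>lborel)) l =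
      LT u l + LT (\<lambda>z. \<integral>\<^sup>+s. PP s f z * indicator {0..t} s \<partial>lborel) l"
    by (rule LT_add) measurable
  also have "LT (\<lambda>z. \<integral>\<^sup>+s. PP s f z * indicator {0..t} s \<partial>lborel) l =
      (\<integral>\<^sup>+s. LT (\<lambda>z. PP s f z * indicator {0..t} s) l \<partial>lborel)"
    by (rule LT_nn_integral) (auto intro: sigma_finite_lborel)
  also have "\<dots> = (\<integral>\<^sup>+s. ennreal (\<Psi> l * exp (s * \<Psi> l)) * indicator {0..t} s * LT u l \<partial>lborel)"
  proof (rule nn_integral_cong)
    fix s
    have "LT (\<lambda>z. indicator {0..t} s * PP s f z) l = indicator {0..t} s * LT (PP s f) l"
      by (rule LT_cmult) measurable
    also have "\<dots> = indicator {0..t} s * (ennreal (exp (s * \<Psi> l)) * (ennreal (\<Psi> l) * LT u l))"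
      using l0 LT[OF l] by (auto simp: LT_PP indicator_def)
    finally show "LT (\<lambda>z. PP s f z * indicator {0..t} s) l =
        ennreal (\<Psi> l * exp (s * \<Psi> l)) * indicator {0..t} s * LT u l"
      using Psi[OF l] by (simp add: ennreal_mult mult_ac)
  qed
  also have "\<dots> = (\<integral>\<^sup>+s. ennreal (\<Psi> l * exp (s * \<Psi> l)) * indicator {0..t} s \<partial>lborel) * LT u l"
    by (rule nn_integral_multc) measurable
  also have "(\<integral>\<^sup>+s. ennreal (\<Psi> l * exp (s * \<Psi> l)) * indicator {0..t} s \<partial>lborel) =
      ennreal (exp (t * \<Psi> l) - exp (0 * \<Psi> l))"
    using t Psi[OF l] by (intro nn_integral_FTC_Icc) (auto intro!: derivative_eq_intros)
  also have "LT u l + ennreal (exp (t * \<Psi> l) - exp (0 * \<Psi> l)) * LT u l =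
      (ennreal 1 + ennreal (exp (t * \<Psi> l) - 1)) * LT u l"
    by (simp add: distrib_right)
  also have "\<dots> = ennreal (exp (t * \<Psi> l)) * LT u l"
    using t Psi[OF l] by (subst ennreal_plus[symmetric]) auto
  also have "\<dots> = LT (PP t u) l" using t l0 by (simp add: LT_PP)
  finally show "(\<integral>\<^sup>+x. ennreal (exp (- (l * x))) * PP t u x \<partial>lborel) =
      (\<integral>\<^sup>+x. ennreal (exp (- (l * x))) * (u x + (\<integral>\<^sup>+s. PP s f x * indicator {0..t} s \<partial>lborel)) \<partial>lborel)"
    by (simp add: LT_def)
  show "(\<integral>\<^sup>+x. ennreal (exp (- (l * x))) * PP t u x \<partial>lborel) < \<infinity>"
    using t l0 fin[OF l] by (simp add: LT_def[symmetric] LT_PP ennreal_mult_less_top)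
qed measurable

end

context levy_process
begin

lemma AE_space_shift:
  assumes P: "Measurable.pred borel P" and AE: "AE z in lborel. P z"
  shows "AE x in lborel. AE \<omega> in M. P (x + V (max 0 t) \<omega>)"
proof -
  interpret pair_sigma_finite lborel M ..
  note P[measurable]
  have "AE \<omega> in M. AE x in lborel. P (x + V (max 0 t) \<omega>)"
    using AE_lborel_shift[OF P AE] by simp
  then show ?thesis by (subst AE_commute) measurable
qed

text \<open>Induction over the grid steps, with the free identity applied from the current position.
  Because \<open>u\<close> vanishes off the positive half-line, survival at the new grid time need
  not be recorded in front of \<open>u\<close>: \<open>alive h (Suc k)\<close> can be replaced there
  by \<open>alive h k\<close>, which is known before the step, and the Markov property
  applies.\<close>

lemma killed_grid:
  assumes [measurable]: "f \<in> borel_measurable borel" "u \<in> borel_measurable borel"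
    and u0: "\<And>z. z \<le> 0 \<Longrightarrow> u z = 0" and h: "0 < h"
    and free: "AE z in lborel. PP h u z = u z + (\<integral>\<^sup>+s. PP s f z * indicator {0..h} s \<partial>lborel)"
  shows "AE x in lborel. (\<integral>\<^sup>+\<omega>. alive h k x \<omega> * u (x + V (real k * h) \<omega>) \<partial>M) =
    u x + (\<integral>\<^sup>+s. (\<integral>\<^sup>+\<omega>. alive h (nat \<lfloor>s / h\<rfloor>) x \<omega> * f (x + V (max 0 s) \<omega>) \<partial>M) *
      indicator {0..<real k * h} s \<partial>lborel)"
proof (induction k)
  case 0
  have "(\<integral>\<^sup>+\<omega>. alive h 0 x \<omega> * u (x + V (real 0 * h) \<omega>) \<partial>M) = u x" for x
  proof -
    have "(\<integral>\<^sup>+\<omega>. alive h 0 x \<omega> * u (x + V (real 0 * h) \<omega>) \<partial>M) = (\<integral>\<^sup>+\<omega>. u x \<partial>M)"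
      by (intro nn_integral_cong_AE, use start_zero in eventually_elim)
        (use u0[of x] in \<open>auto simp: alive_def\<close>)
    then show ?thesis by (simp add: emeasure_space_1)
  qed
  then show ?case by simp
next
  case (Suc k)
  interpret pair_sigma_finite lborel M ..
  define c where "c = real k * h"
  have c: "0 \<le> c" "max 0 c = c" using h by (simp_all add: c_def)
  have cV: "V c \<in> borel_measurable M" using c by (intro random_variable_V)
  note [measurable] = cV
  have Suc_c: "real (Suc k) * h = c + h" by (simp add: c_def distrib_right)
  have "AE x in lborel. AE \<omega> in M. PP h u (x + V (max 0 c) \<omega>) =
      u (x + V (max 0 c) \<omega>) + (\<integral>\<^sup>+s. PP s f (x + V (max 0 c) \<omega>) * indicator {0..h} s \<partial>lborel)"
    by (rule AE_space_shift[OF _ free]) measurable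
  with Suc.IH show ?case
  proof eventually_elim
    fix x
    assume IH: "(\<integral>\<^sup>+\<omega>. alive h k x \<omega> * u (x + V (real k * h) \<omega>) \<partial>M) =
      u x + (\<integral>\<^sup>+s. (\<integral>\<^sup>+\<omega>. alive h (nat \<lfloor>s / h\<rfloor>) x \<omega> * f (x + V (max 0 s) \<omega>) \<partial>M) *
        indicator {0..<real k * h} s \<partial>lborel)"
      and step: "AE \<omega> in M. PP h u (x + V (max 0 c) \<omega>) =
      u (x + V (max 0 c) \<omega>) + (\<integral>\<^sup>+s. PP s f (x + V (max 0 c) \<omega>) * indicator {0..h} s \<partial>lborel)"
    have "(\<integral>\<^sup>+\<omega>. alive h (Suc k) x \<omega> * u (x + V (real (Suc k) * h) \<omega>) \<partial>M) =
        (\<integral>\<^sup>+\<omega>. alive h k x \<omega> * u (x + V (c + h) \<omega>) \<partial>M)"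
    proof (rule nn_integral_cong)
      fix \<omega>
      show "alive h (Suc k) x \<omega> * u (x + V (real (Suc k) * h) \<omega>) = alive h k x \<omega> * u (x + V (c + h) \<omega>)"
        using u0[of "x + V (c + h) \<omega>"] c h
        by (cases "0 < x + V (c + h) \<omega>") (auto simp: alive_def le_Suc_eq Suc_c max_def simp del: of_nat_Suc)
    qed
    also have "\<dots> = (\<integral>\<^sup>+\<omega>. alive h k x \<omega> * PP h u (x + V c \<omega>) \<partial>M)"
      unfolding c_def using h by (intro alive_markov) auto
    also have "\<dots> = (\<integral>\<^sup>+\<omega>. alive h k x \<omega> * u (x + V c \<omega>) +
        alive h k x \<omega> * (\<integral>\<^sup>+s. PP s f (x + V c \<omega>) * indicator {0..h} s \<partial>lborel) \<partial>M)"
      by (intro nn_integral_cong_AE, use step in eventually_elim) (simp add: c distrib_left)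
    also have "\<dots> = (\<integral>\<^sup>+\<omega>. alive h k x \<omega> * u (x + V c \<omega>) \<partial>M) +
        (\<integral>\<^sup>+\<omega>. alive h k x \<omega> * (\<integral>\<^sup>+s. PP s f (x + V c \<omega>) * indicator {0..h} s \<partial>lborel) \<partial>M)"
      by (intro nn_integral_add) measurable
    also have "(\<integral>\<^sup>+\<omega>. alive h k x \<omega> * (\<integral>\<^sup>+s. PP s f (x + V c \<omega>) * indicator {0..h} s \<partial>lborel) \<partial>M) =
        (\<integral>\<^sup>+\<omega>. \<integral>\<^sup>+s. alive h k x \<omega> * (PP s f (x + V c \<omega>) * indicator {0..h} s) \<partial>lborel \<partial>M)"
      by (intro nn_integral_cong nn_integral_cmult[symmetric]) measurable
    also have "\<dots> = (\<integral>\<^sup>+s. \<integral>\<^sup>+\<omega>. alive h k x \<omega> * (PP s f (x + V c \<omega>) * indicator {0..h} s) \<partial>M \<partial>lborel)"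
      by (rule Fubini') measurable
    also have "\<dots> = (\<integral>\<^sup>+s. (\<integral>\<^sup>+\<omega>. alive h k x \<omega> * f (x + V (max 0 (c + s)) \<omega>) \<partial>M) * indicator {0..h} s \<partial>lborel)"
    proof (rule nn_integral_cong)
      fix s
      show "(\<integral>\<^sup>+\<omega>. alive h k x \<omega> * (PP s f (x + V c \<omega>) * indicator {0..h} s) \<partial>M) =
          (\<integral>\<^sup>+\<omega>. alive h k x \<omega> * f (x + V (max 0 (c + s)) \<omega>) \<partial>M) * indicator {0..h} s"
      proof (cases "s \<in> {0..h}")
        case True
        then have "0 \<le> s" by simp
        from alive_markov[OF less_imp_le[OF h] this, of f k x] True c show ?thesis
          by (simp add: c_def)
      qed simp
    qed
    also have "\<dots> = (\<integral>\<^sup>+s. (\<integral>\<^sup>+\<omega>. alive h (nat \<lfloor>(c + s) / h\<rfloor>) x \<omega> * f (x + V (max 0 (c + s)) \<omega>) \<partial>M) *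
        indicator {c..<c + h} (c + s) \<partial>lborel)"
    proof (rule nn_integral_cong_AE, use AE_lborel_singleton[of h] in eventually_elim)
      fix s assume "s \<noteq> h"
      have fl: "nat \<lfloor>(c + s) / h\<rfloor> = k" if "0 \<le> s" "s < h"
      proof -
        have "\<lfloor>(c + s) / h\<rfloor> = int k"
          using that h by (intro floor_unique) (auto simp: c_def field_simps)
        then show ?thesis by simp
      qed
      show "(\<integral>\<^sup>+\<omega>. alive h k x \<omega> * f (x + V (max 0 (c + s)) \<omega>) \<partial>M) * indicator {0..h} s =
          (\<integral>\<^sup>+\<omega>. alive h (nat \<lfloor>(c + s) / h\<rfloor>) x \<omega> * f (x + V (max 0 (c + s)) \<omega>) \<partial>M) * indicator {c..<c + h} (c + s)"
        using \<open>s \<noteq> h\<close> fl by (cases "s \<in> {0..<h}") (auto simp: indicator_def)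
    qed
    also have "\<dots> = (\<integral>\<^sup>+s. (\<integral>\<^sup>+\<omega>. alive h (nat \<lfloor>s / h\<rfloor>) x \<omega> * f (x + V (max 0 s) \<omega>) \<partial>M) *
        indicator {c..<c + h} s \<partial>lborel)"
      using nn_integral_real_affine[of "\<lambda>s. (\<integral>\<^sup>+\<omega>. alive h (nat \<lfloor>s / h\<rfloor>) x \<omega> * f (x + V (max 0 s) \<omega>) \<partial>M) *
        indicator {c..<c + h} s" 1 c] by simp
    finally have "(\<integral>\<^sup>+\<omega>. alive h (Suc k) x \<omega> * u (x + V (real (Suc k) * h) \<omega>) \<partial>M) =
        u x + ((\<integral>\<^sup>+s. (\<integral>\<^sup>+\<omega>. alive h (nat \<lfloor>s / h\<rfloor>) x \<omega> * f (x + V (max 0 s) \<omega>) \<partial>M) *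
        indicator {0..<c} s \<partial>lborel) + (\<integral>\<^sup>+s. (\<integral>\<^sup>+\<omega>. alive h (nat \<lfloor>s / h\<rfloor>) x \<omega> * f (x + V (max 0 s) \<omega>) \<partial>M) *
        indicator {c..<c + h} s \<partial>lborel))"
      using IH by (simp add: c_def[symmetric] add.assoc)
    also have "((\<integral>\<^sup>+s. (\<integral>\<^sup>+\<omega>. alive h (nat \<lfloor>s / h\<rfloor>) x \<omega> * f (x + V (max 0 s) \<omega>) \<partial>M) *
        indicator {0..<c} s \<partial>lborel) + (\<integral>\<^sup>+s. (\<integral>\<^sup>+\<omega>. alive h (nat \<lfloor>s / h\<rfloor>) x \<omega> * f (x + V (max 0 s) \<omega>) \<partial>M) *
        indicator {c..<c + h} s \<partial>lborel)) =
        (\<integral>\<^sup>+s. (\<integral>\<^sup>+\<omega>. alive h (nat \<lfloor>s / h\<rfloor>) x \<omega> * f (x + V (max 0 s) \<omega>) \<partial>M) *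
        indicator {0..<c} s + (\<integral>\<^sup>+\<omega>. alive h (nat \<lfloor>s / h\<rfloor>) x \<omega> * f (x + V (max 0 s) \<omega>) \<partial>M) *
        indicator {c..<c + h} s \<partial>lborel)"
      by (rule nn_integral_add[symmetric]) measurable
    also have "\<dots> = (\<integral>\<^sup>+s. (\<integral>\<^sup>+\<omega>. alive h (nat \<lfloor>s / h\<rfloor>) x \<omega> * f (x + V (max 0 s) \<omega>) \<partial>M) *
        indicator {0..<real (Suc k) * h} s \<partial>lborel)"
      unfolding Suc_c using c h by (intro nn_integral_cong) (auto simp: indicator_def)
    finally show "(\<integral>\<^sup>+\<omega>. alive h (Suc k) x \<omega> * u (x + V (real (Suc k) * h) \<omega>) \<partial>M) =
      u x + (\<integral>\<^sup>+s. (\<integral>\<^sup>+\<omega>. alive h (nat \<lfloor>s / h\<rfloor>) x \<omega> * f (x + V (max 0 s) \<omega>) \<partial>M) *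
        indicator {0..<real (Suc k) * h} s \<partial>lborel)" .
  qed
qed

text \<open>For each path a single starting point is exceptional, so Fubini leaves almost every
  starting point.\<close>

lemma runinf_ne_AE:
  assumes "0 \<le> s"
  shows "AE x in lborel. AE \<omega> in M. x + runinf (\<lambda>r. V r \<omega>) (max 0 s) \<noteq> 0"
proof -
  interpret pair_sigma_finite lborel M ..
  have "AE \<omega> in M. AE x in lborel. x + runinf (\<lambda>r. V r \<omega>) (max 0 s) \<noteq> 0"
  proof (rule AE_I2)
    fix \<omega>
    show "AE x in lborel. x + runinf (\<lambda>r. V r \<omega>) (max 0 s) \<noteq> 0"
      using AE_lborel_singleton[of "- runinf (\<lambda>r. V r \<omega>) (max 0 s)"] by eventually_elim auto
  qed
  then show ?thesis by (subst AE_commute) measurable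
qed

lemma runinf_ne_AE2:
  "AE x in lborel. AE s in lborel. AE \<omega> in M. x + runinf (\<lambda>r. V r \<omega>) (max 0 s) \<noteq> 0"
proof -
  define q where "q x s = (\<integral>\<^sup>+\<omega>. (if x + runinf (\<lambda>r. V r \<omega>) (max 0 s) = 0 then 1 else 0) \<partial>M)" for x s
  have [measurable]: "(\<lambda>p. q (fst p) (snd p)) \<in> borel_measurable (borel \<Otimes>\<^sub>M borel)"
    unfolding q_def by measurable
  have q: "(AE \<omega> in M. x + runinf (\<lambda>r. V r \<omega>) (max 0 s) \<noteq> 0) \<longleftrightarrow> q x s = 0" for x s
    unfolding q_def by (subst nn_integral_0_iff_AE) (auto intro!: AE_cong)
  have "AE s in lborel. AE x in lborel. q x s = 0"
    using runinf_ne_AE[of "max 0 _"] by (simp add: q)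
  then show ?thesis unfolding q by (subst lborel_pair.AE_commute) measurable
qed

text \<open>Optional stopping along dyadic grids, which is where right-continuity of the paths enters.
  It only works for almost every starting point, since the running infimum may hit 0 exactly.\<close>

lemma killed_identity_AE:
  assumes [measurable]: "f \<in> borel_measurable borel" "u \<in> borel_measurable borel"
    and u0: "\<And>z. z \<le> 0 \<Longrightarrow> u z = 0" and f0: "\<And>z. z < 0 \<Longrightarrow> f z = 0" and t: "0 < t"
    and free: "\<And>h. 0 < h \<Longrightarrow> AE z in lborel. PP h u z = u z + (\<integral>\<^sup>+s. PP s f z * indicator {0..h} s \<partial>lborel)"
    and fin: "AE z in lborel. PP t u z < \<infinity>"
  shows "AE x in lborel. KP t u x = u x + (\<integral>\<^sup>+s. KP s f x * indicator {0..t} s \<partial>lborel)"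
proof -
  have V[measurable]: "V t \<in> borel_measurable M" using t by (intro random_variable_V) simp
  have ha: "0 < t / 2 ^ n" for n using t by simp
  have "AE x in lborel. \<forall>n. (\<integral>\<^sup>+\<omega>. alive (t / 2 ^ n) (2 ^ n) x \<omega> * u (x + V (real (2 ^ n) * (t / 2 ^ n)) \<omega>) \<partial>M) =
    u x + (\<integral>\<^sup>+s. (\<integral>\<^sup>+\<omega>. alive (t / 2 ^ n) (nat \<lfloor>s / (t / 2 ^ n)\<rfloor>) x \<omega> * f (x + V (max 0 s) \<omega>) \<partial>M) *
      indicator {0..<real (2 ^ n) * (t / 2 ^ n)} s \<partial>lborel)"
    unfolding AE_all_countable by (intro allI killed_grid assms(1,2) u0 ha free)
  with fin free[OF t] runinf_ne_AE[OF less_imp_le[OF t]] runinf_ne_AE2 show ?thesis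
  proof eventually_elim
    fix x
    assume fin: "PP t u x < \<infinity>"
      and fr: "PP t u x = u x + (\<integral>\<^sup>+s. PP s f x * indicator {0..t} s \<partial>lborel)"
      and ne1: "AE \<omega> in M. x + runinf (\<lambda>r. V r \<omega>) (max 0 t) \<noteq> 0"
      and ne2: "AE s in lborel. AE \<omega> in M. x + runinf (\<lambda>r. V r \<omega>) (max 0 s) \<noteq> 0"
      and eq: "\<forall>n. (\<integral>\<^sup>+\<omega>. alive (t / 2 ^ n) (2 ^ n) x \<omega> * u (x + V (real (2 ^ n) * (t / 2 ^ n)) \<omega>) \<partial>M) =
    u x + (\<integral>\<^sup>+s. (\<integral>\<^sup>+\<omega>. alive (t / 2 ^ n) (nat \<lfloor>s / (t / 2 ^ n)\<rfloor>) x \<omega> * f (x + V (max 0 s) \<omega>) \<partial>M) *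
      indicator {0..<real (2 ^ n) * (t / 2 ^ n)} s \<partial>lborel)"
    have al1: "alive h k y \<omega> * c \<le> c" for h k y \<omega> c by (simp add: alive_def)
    have "(\<lambda>n. \<integral>\<^sup>+\<omega>. alive (t / 2 ^ n) (2 ^ n) x \<omega> * u (x + V t \<omega>) \<partial>M) \<longlonglongrightarrow>
        (\<integral>\<^sup>+\<omega>. kill t x \<omega> * u (x + V t \<omega>) \<partial>M)"
    proof (rule nn_integral_dominated_convergence[where w="\<lambda>\<omega>. u (x + V t \<omega>)"])
      show "(\<integral>\<^sup>+\<omega>. u (x + V t \<omega>) \<partial>M) < \<infinity>" using fin t by (simp add: PP_def max_def)
      show "AE \<omega> in M. (\<lambda>n. alive (t / 2 ^ n) (2 ^ n) x \<omega> * u (x + V t \<omega>)) \<longlonglongrightarrow> kill t x \<omega> * u (x + V t \<omega>)"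
        using ne1 AE_space
      proof eventually_elim
        fix \<omega> assume ne: "x + runinf (\<lambda>r. V r \<omega>) (max 0 t) \<noteq> 0" and \<omega>: "\<omega> \<in> space M"
        have "nat \<lfloor>t / (t / 2 ^ n)\<rfloor> = 2 ^ n" for n
        proof -
          have "t / (t / 2 ^ n) = of_int (2 ^ n)" using t by simp
          then show ?thesis by (simp only: floor_of_int) (simp add: nat_power_eq)
        qed
        then show "(\<lambda>n. alive (t / 2 ^ n) (2 ^ n) x \<omega> * u (x + V t \<omega>)) \<longlonglongrightarrow> kill t x \<omega> * u (x + V t \<omega>)"
          using alive_tendsto[OF \<omega> t _ order_refl, of u x] u0 ne t by (simp add: max_def nat_power_eq)
      qed
      show "(\<lambda>\<omega>. kill t x \<omega> * u (x + V t \<omega>)) \<in> borel_measurable M" by measurable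
    qed (auto simp: al1)
    also have "(\<integral>\<^sup>+\<omega>. kill t x \<omega> * u (x + V t \<omega>) \<partial>M) = KP t u x" using t by (simp add: KP_def max_def)
    finally have L: "(\<lambda>n. \<integral>\<^sup>+\<omega>. alive (t / 2 ^ n) (2 ^ n) x \<omega> * u (x + V t \<omega>) \<partial>M) \<longlonglongrightarrow> KP t u x" .
    define g where "g n s = (\<integral>\<^sup>+\<omega>. alive (t / 2 ^ n) (nat \<lfloor>s / (t / 2 ^ n)\<rfloor>) x \<omega> * f (x + V (max 0 s) \<omega>) \<partial>M)" for n :: nat and s
    have g[measurable]: "g n \<in> borel_measurable borel" for n unfolding g_def by measurable
    have gP: "g n s \<le> PP s f x" for n s unfolding g_def PP_def by (intro nn_integral_mono al1)
    have finI: "(\<integral>\<^sup>+s. PP s f x * indicator {0..t} s \<partial>lborel) < \<infinity>"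
      using fin unfolding fr by (simp add: less_top[symmetric])
    have "AE s in lborel. PP s f x * indicator {0..t} s \<noteq> \<infinity>"
      using finI by (intro nn_integral_PInf_AE) auto
    with ne2 have "AE s in lborel. (\<lambda>n. g n s * indicator {0..<t} s) \<longlonglongrightarrow> KP s f x * indicator {0..<t} s"
    proof eventually_elim
      fix s assume ne: "AE \<omega> in M. x + runinf (\<lambda>r. V r \<omega>) (max 0 s) \<noteq> 0"
        and pf: "PP s f x * indicator {0..t} s \<noteq> \<infinity>"
      show "(\<lambda>n. g n s * indicator {0..<t} s) \<longlonglongrightarrow> KP s f x * indicator {0..<t} s"
      proof (cases "s \<in> {0..<t}")
        case True
        have [measurable]: "V s \<in> borel_measurable M" using True by (intro random_variable_V) simp
        have ms: "max 0 s = s" using True by simp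
        have "(\<lambda>n. g n s) \<longlonglongrightarrow> KP s f x"
          unfolding g_def KP_def ms
        proof (rule nn_integral_dominated_convergence[where w="\<lambda>\<omega>. f (x + V s \<omega>)"])
          show "(\<integral>\<^sup>+\<omega>. f (x + V s \<omega>) \<partial>M) < \<infinity>" using pf True by (simp add: PP_def max_def less_top)
          show "AE \<omega> in M. (\<lambda>n. alive (t / 2 ^ n) (nat \<lfloor>s / (t / 2 ^ n)\<rfloor>) x \<omega> * f (x + V s \<omega>)) \<longlonglongrightarrow> kill s x \<omega> * f (x + V s \<omega>)"
            using ne AE_space
            by eventually_elim (rule alive_tendsto, use True t f0 in auto)
          show "(\<lambda>\<omega>. kill s x \<omega> * f (x + V s \<omega>)) \<in> borel_measurable M" by measurable
        qed (auto simp: al1)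
        then show ?thesis using True by simp
      qed simp
    qed
    then have "(\<lambda>n. \<integral>\<^sup>+s. g n s * indicator {0..<t} s \<partial>lborel) \<longlonglongrightarrow> (\<integral>\<^sup>+s. KP s f x * indicator {0..<t} s \<partial>lborel)"
      using finI gP
      by (intro nn_integral_dominated_convergence[where w="\<lambda>s. PP s f x * indicator {0..t} s"])
        (auto intro!: AE_I2 simp: indicator_def)
    then have "(\<lambda>n. u x + (\<integral>\<^sup>+s. g n s * indicator {0..<t} s \<partial>lborel)) \<longlonglongrightarrow>
        u x + (\<integral>\<^sup>+s. KP s f x * indicator {0..<t} s \<partial>lborel)"
      by (intro tendsto_add tendsto_const)
    moreover have "u x + (\<integral>\<^sup>+s. g n s * indicator {0..<t} s \<partial>lborel) =
        (\<integral>\<^sup>+\<omega>. alive (t / 2 ^ n) (2 ^ n) x \<omega> * u (x + V t \<omega>) \<partial>M)" for n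
      using eq[THEN spec, of n] by (simp add: g_def)
    ultimately have "KP t u x = u x + (\<integral>\<^sup>+s. KP s f x * indicator {0..<t} s \<partial>lborel)"
      using L by (simp add: LIMSEQ_unique)
    also have "(\<integral>\<^sup>+s. KP s f x * indicator {0..<t} s \<partial>lborel) = (\<integral>\<^sup>+s. KP s f x * indicator {0..t} s \<partial>lborel)"
      by (intro nn_integral_cong_AE, use AE_lborel_singleton[of t] in eventually_elim) (auto simp: indicator_def)
    finally show "KP t u x = u x + (\<integral>\<^sup>+s. KP s f x * indicator {0..t} s \<partial>lborel)" .
  qed
qed

end

section \<open>The scale function\<close>

lemma AE_lborel_dense:
  assumes "AE z in lborel. P (z::real)" "a < b"
  obtains z where "a < z" "z < b" "P z"
proof -
  have "\<exists>z. a < z \<and> z < b \<and> P z"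
  proof (rule ccontr)
    assume n: "\<nexists>z. a < z \<and> z < b \<and> P z"
    have "AE z in lborel. z \<notin> {a<..<b}"
      using assms(1) by eventually_elim (use n in auto)
    then have "emeasure lborel {a<..<b} = 0"
      by (subst (asm) AE_iff_measurable[of "{a<..<b}"]) auto
    then show False using assms(2) by simp
  qed
  then show thesis using that by blast
qed

context laplace_levy
begin

lemma PP_exp: "0 \<le> h \<Longrightarrow> 0 \<le> a \<Longrightarrow> 0 \<le> C \<Longrightarrow>
    PP h (\<lambda>z. ennreal (C * exp (a * z))) z = ennreal (C * exp (a * z) * exp (h * \<Psi> a))"
proof -
  assume h: "0 \<le> h" "0 \<le> a" "0 \<le> C"
  then have [measurable]: "V h \<in> borel_measurable M" by (intro random_variable_V)
  have "PP h (\<lambda>z. ennreal (C * exp (a * z))) z = (\<integral>\<^sup>+\<omega>. ennreal (C * exp (a * z)) * ennreal (exp (a * V h \<omega>)) \<partial>M)"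
    unfolding PP_def using h by (intro nn_integral_cong) (simp add: ennreal_mult[symmetric] exp_add distrib_left)
  also have "\<dots> = ennreal (C * exp (a * z)) * ennreal (exp (h * \<Psi> a))"
    using h by (subst nn_integral_cmult) (auto simp: exp_nn_integral)
  finally show ?thesis using h by (simp add: ennreal_mult)
qed

end

locale scale_levy = laplace_levy M V \<Psi> for M :: "'a measure" and V and \<Psi> :: "real \<Rightarrow> real" +
  fixes W :: "real \<Rightarrow> real" and c :: real
  assumes c_nonneg: "0 \<le> c" and Psi_pos: "\<And>l. c < l \<Longrightarrow> 0 < \<Psi> l"
    and W_cont: "continuous_on {0..} W" and W_mono: "mono_on {0..} W"
    and W_nonneg: "\<And>x. 0 \<le> x \<Longrightarrow> 0 \<le> W x" and W_pos: "\<And>x. 0 < x \<Longrightarrow> 0 < W x"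
    and LT_W: "\<And>l. c < l \<Longrightarrow> LT (\<lambda>x. ennreal (if 0 \<le> x then W x else 0)) l = ennreal (1 / \<Psi> l)"
begin

text \<open>Continuation of \<open>W\<close> by 0, in real and extended form. No value of
  \<open>W 0\<close> is established, so a jump at 0 has to be allowed and continuity there is used
  from the right only.\<close>

definition Wr :: "real \<Rightarrow> real" where "Wr x = (if 0 \<le> x then W x else 0)"
definition Wp :: "real \<Rightarrow> ennreal" where "Wp x = ennreal (Wr x)"

lemma Wr_nonneg: "0 \<le> Wr x" by (simp add: Wr_def W_nonneg)

lemma Wr_mono: "mono Wr"
  using W_mono W_nonneg by (intro monoI) (auto simp: Wr_def mono_on_def)

lemma Wr_measurable [measurable]: "Wr \<in> borel_measurable borel"
  by (rule borel_measurable_mono[OF Wr_mono])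

lemma Wp_measurable [measurable]: "Wp \<in> borel_measurable borel"
  unfolding Wp_def by measurable

lemma Wp_mono: "x \<le> y \<Longrightarrow> Wp x \<le> Wp y"
  unfolding Wp_def by (intro ennreal_leI monoD[OF Wr_mono])

lemma LT_Wp: "c < l \<Longrightarrow> LT Wp l = ennreal (1 / \<Psi> l)"
  using LT_W unfolding Wp_def[abs_def] Wr_def[abs_def] by simp

text \<open>By monotonicity the part of the transform to the right of \<open>x\<close> is at least
  \<open>Wr x * exp (- (l * x)) / l\<close>.\<close>

lemma Wr_bound:
  assumes l: "c < l"
  shows "Wr x \<le> l / \<Psi> l * exp (l * x)"
proof -
  have l0: "0 < l" using l c_nonneg by simp
  have "ennreal (Wr x * (exp (- (l * x)) / l)) = ennreal (Wr x) * (\<integral>\<^sup>+y. ennreal (exp (- (l * y))) * indicator {x..} y \<partial>lborel)"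
  proof -
    have "(\<integral>\<^sup>+y. ennreal (exp (- (l * y))) * indicator {x..} y \<partial>lborel) = ennreal (0 - - (exp (- (l * x)) / l))"
    proof (rule nn_integral_FTC_atLeast)
      show "((\<lambda>y. - (exp (- (l * y)) / l)) \<longlongrightarrow> 0) at_top" using l0 by real_asymp
    qed (use l0 in \<open>auto intro!: derivative_eq_intros\<close>)
    then show ?thesis using l0 Wr_nonneg by (simp add: ennreal_mult[symmetric])
  qed
  also have "\<dots> = (\<integral>\<^sup>+y. ennreal (Wr x) * (ennreal (exp (- (l * y))) * indicator {x..} y) \<partial>lborel)"
    by (rule nn_integral_cmult[symmetric]) measurable
  also have "\<dots> \<le> LT Wp l"
    unfolding LT_def
    using Wp_mono[of x] by (intro nn_integral_mono) (auto simp: indicator_def mult.commute Wp_def[symmetric] intro!: mult_right_mono)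
  also have "\<dots> = ennreal (1 / \<Psi> l)" by (rule LT_Wp[OF l])
  finally have "Wr x * (exp (- (l * x)) / l) \<le> 1 / \<Psi> l" using Psi_pos[OF l] by (simp add: ennreal_le_iff)
  then show ?thesis using l0 Psi_pos[OF l] by (simp add: exp_minus field_simps)
qed

text \<open>Positivity of \<open>W\<close> close to 0 bounds the transform
  \<open>1 / \<Psi> l\<close> from below by a multiple of \<open>exp (- (l * e))\<close>. This
  growth bound controls overshoots on grids and, in the analytic part, the size of
  \<open>\<phi>'\<close>.\<close>

lemma Psi_subexp:
  assumes e: "0 < e"
  shows "\<exists>C>0. \<forall>l>c. \<Psi> l \<le> C * exp (e * l)"
proof -
  define A where "A = e / 2 * W (e / 2)"
  have A: "0 < A" using e W_pos[of "e / 2"] by (simp add: A_def)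
  have "\<Psi> l \<le> (1 / A) * exp (e * l)" if l: "c < l" for l
  proof -
    have l0: "0 < l" using l c_nonneg by simp
    have "ennreal (A * exp (- (l * e))) = (\<integral>\<^sup>+y. ennreal (W (e / 2) * exp (- (l * e))) * indicator {e / 2..e} y \<partial>lborel)"
      using e W_pos[of "e / 2"]
      by (subst nn_integral_cmult_indicator) (auto simp: A_def ennreal_mult[symmetric] mult_ac)
    also have "\<dots> \<le> LT Wp l"
      unfolding LT_def
    proof (intro nn_integral_mono)
      fix y
      have "W (e / 2) * exp (- (l * e)) \<le> exp (- (l * y)) * Wr y" if "y \<in> {e / 2..e}"
      proof -
        have "W (e / 2) \<le> Wr y" using that e monoD[OF Wr_mono, of "e / 2" y] by (simp add: Wr_def)
        moreover have "exp (- (l * e)) \<le> exp (- (l * y))" using that l0 by simp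
        ultimately have "W (e / 2) * exp (- (l * e)) \<le> Wr y * exp (- (l * y))"
          using Wr_nonneg by (intro mult_mono) auto
        then show ?thesis by (simp add: mult.commute)
      qed
      then show "ennreal (W (e / 2) * exp (- (l * e))) * indicator {e / 2..e} y \<le> ennreal (exp (- (l * y))) * Wp y"
        by (auto simp: indicator_def Wp_def ennreal_mult'[symmetric] intro!: ennreal_leI)
    qed
    also have "\<dots> = ennreal (1 / \<Psi> l)" by (rule LT_Wp[OF l])
    finally have "A * exp (- (l * e)) \<le> 1 / \<Psi> l" using Psi_pos[OF l] by (simp add: ennreal_le_iff)
    then show ?thesis using A Psi_pos[OF l] by (simp add: exp_minus field_simps)
  qed
  then show ?thesis using A by (intro exI[of _ "1 / A"]) auto
qed

lemma PP_mono: "(\<And>z. f z \<le> g z) \<Longrightarrow> PP h f z \<le> PP h g z"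
  unfolding PP_def by (intro nn_integral_mono) auto

lemma Wp_bound: "\<exists>C>0. \<forall>x. Wp x \<le> ennreal (C * exp ((c + 1) * x))"
proof (intro exI[of _ "(c + 1) / \<Psi> (c + 1)"] conjI allI)
  show "0 < (c + 1) / \<Psi> (c + 1)" using c_nonneg Psi_pos[of "c + 1"] by auto
  show "Wp x \<le> ennreal ((c + 1) / \<Psi> (c + 1) * exp ((c + 1) * x))" for x
    unfolding Wp_def using Wr_bound[of "c + 1" x] by (intro ennreal_leI) auto
qed

lemma PP_Wp_finite: "0 \<le> h \<Longrightarrow> PP h Wp z < \<infinity>"
proof -
  assume h: "0 \<le> h"
  obtain C where C: "0 < C" "\<And>x. Wp x \<le> ennreal (C * exp ((c + 1) * x))" using Wp_bound by blast
  have "PP h Wp z \<le> PP h (\<lambda>z. ennreal (C * exp ((c + 1) * z))) z" by (rule PP_mono[OF C(2)])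
  also have "\<dots> < \<infinity>" using h C c_nonneg by (subst PP_exp) auto
  finally show ?thesis .
qed

lemma Wr_right_cont:
  assumes "zs \<longlonglongrightarrow> z" "\<And>n. z \<le> zs n"
  shows "(\<lambda>n. Wr (zs n)) \<longlonglongrightarrow> Wr z"
proof (cases "0 \<le> z")
  case True
  then have "0 \<le> zs n" for n using assms(2) order_trans by blast
  moreover have "(\<lambda>n. W (zs n)) \<longlonglongrightarrow> W z"
    by (rule continuous_on_tendsto_compose[OF W_cont assms(1)]) (use calculation True in auto)
  ultimately show ?thesis using True by (simp add: Wr_def)
next
  case False
  then have "\<forall>\<^sub>F n in sequentially. zs n < 0" using order_tendstoD(2)[OF assms(1)] by simp
  then have "\<forall>\<^sub>F n in sequentially. Wr (zs n) = 0" by eventually_elim (simp add: Wr_def)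
  then show ?thesis using False by (simp add: Wr_def tendsto_eventually)
qed

text \<open>The generator formally maps \<open>W\<close> to a point mass at 0, positive but not a
  function. Averaging \<open>W\<close> over a window of length \<open>e\<close> replaces the point
  mass by the uniform density \<open>fe\<close>, to which \<open>free_identity\<close> applies;
  monotonicity places the average between \<open>Wp (z - e)\<close> and \<open>Wp z\<close>.\<close>

lemma Wp_subharmonic:
  assumes h: "0 < h"
  shows "Wp z \<le> PP h Wp z"
proof -
  have [measurable]: "V h \<in> borel_measurable M" using h by (intro random_variable_V) simp
  have "AE z in lborel. Wp (z - e) \<le> PP h Wp z" if e: "0 < e" for e
  proof -
    define fe where "fe y = indicator {0..e} y * ennreal (1 / e)" for y :: real
    have [measurable]: "fe \<in> borel_measurable borel" unfolding fe_def by measurable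
    have int: "(\<integral>\<^sup>+y. fe y \<partial>lborel) = 1"
      using e unfolding fe_def by (simp add: nn_integral_multc ennreal_mult[symmetric])
    have "AE z in lborel. PP h (conv Wp fe) z = conv Wp fe z + (\<integral>\<^sup>+s. PP s fe z * indicator {0..h} s \<partial>lborel)"
    proof (rule free_identity[where c=c])
      fix l assume l: "c < l"
      have "LT fe l \<le> (\<integral>\<^sup>+y. fe y \<partial>lborel)"
        unfolding LT_def using l c_nonneg
        by (intro nn_integral_mono) (auto simp: fe_def indicator_def ennreal_mult[symmetric] intro!: ennreal_leI mult_left_le_one_le divide_right_mono)
      then have fin: "LT fe l < \<infinity>" unfolding int using order_le_less_trans by fastforce
      have LTu: "LT (conv Wp fe) l = ennreal (1 / \<Psi> l) * LT fe l"
        by (subst LT_conv) (auto simp: LT_Wp[OF l])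
      show "LT (conv Wp fe) l < \<infinity>" using fin unfolding LTu by (simp add: ennreal_mult_less_top)
      show "LT fe l = ennreal (\<Psi> l) * LT (conv Wp fe) l"
        unfolding LTu mult.assoc[symmetric] using Psi_pos[OF l] by (simp add: ennreal_mult[symmetric])
    qed (use h c_nonneg Psi_pos in auto)
    then show ?thesis
    proof eventually_elim
      fix z
      assume eq: "PP h (conv Wp fe) z = conv Wp fe z + (\<integral>\<^sup>+s. PP s fe z * indicator {0..h} s \<partial>lborel)"
      have "Wp (z - e) = (\<integral>\<^sup>+y. Wp (z - e) * fe y \<partial>lborel)"
        by (subst nn_integral_cmult) (auto simp: int)
      also have "\<dots> \<le> conv Wp fe z"
        unfolding conv_def by (intro nn_integral_mono) (auto simp: fe_def indicator_def intro!: mult_right_mono Wp_mono)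
      also have "\<dots> \<le> PP h (conv Wp fe) z" unfolding eq by simp
      also have "\<dots> \<le> PP h Wp z"
      proof (rule PP_mono)
        fix z
        have "conv Wp fe z \<le> (\<integral>\<^sup>+y. Wp z * fe y \<partial>lborel)"
          unfolding conv_def by (intro nn_integral_mono) (auto simp: fe_def indicator_def intro!: mult_right_mono Wp_mono)
        also have "\<dots> = Wp z" by (subst nn_integral_cmult) (auto simp: int)
        finally show "conv Wp fe z \<le> Wp z" .
      qed
      finally show "Wp (z - e) \<le> PP h Wp z" .
    qed
  qed
  then have "AE z in lborel. Wp (z - 1 / real (Suc n)) \<le> PP h Wp z" for n by simp
  \<comment> \<open>Admissible points approach \<open>z\<close> from the right, but slowly enough
    that \<open>y - 1 / real (Suc n)\<close> stays above \<open>z\<close>. Right-continuity of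
    \<open>W\<close> then carries the inequality to \<open>z\<close> itself.\<close>
  then have "\<exists>y. z + 1 / real (Suc n) < y \<and> y < z + 2 / real (Suc n) \<and> Wp (y - 1 / real (Suc n)) \<le> PP h Wp y" for n
    by (rule AE_lborel_dense[of _ "z + 1 / real (Suc n)" "z + 2 / real (Suc n)"])
      (auto simp: divide_strict_right_mono)
  then obtain y where y: "\<And>n. z + 1 / real (Suc n) < y n" "\<And>n. y n < z + 2 / real (Suc n)"
    "\<And>n. Wp (y n - 1 / real (Suc n)) \<le> PP h Wp (y n)" by metis
  have yz: "z \<le> y n" for n using y(1)[of n] by (smt (verit) divide_nonneg_nonneg of_nat_0_le_iff)
  have "(\<lambda>n. z + 2 / real (Suc n)) \<longlonglongrightarrow> z" by real_asymp
  then have ylim: "y \<longlonglongrightarrow> z"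
    by (rule tendsto_sandwich[OF _ _ tendsto_const, rotated 2]) (use yz y(2) in \<open>auto intro!: always_eventually less_imp_le\<close>)
  have "(\<lambda>n. PP h Wp (y n)) \<longlonglongrightarrow> PP h Wp z"
    unfolding PP_def
  proof (rule nn_integral_dominated_convergence[where w="\<lambda>\<omega>. Wp (z + 2 + V (max 0 h) \<omega>)"])
    show "(\<integral>\<^sup>+\<omega>. Wp (z + 2 + V (max 0 h) \<omega>) \<partial>M) < \<infinity>" using PP_Wp_finite[of h "z + 2"] h by (simp add: PP_def)
    have "y n \<le> z + 2" for n
    proof -
      have "2 / real (Suc n) \<le> 2" by (simp add: field_simps)
      then show ?thesis using y(2)[of n] by simp
    qed
    then show "AE \<omega> in M. Wp (y n + V (max 0 h) \<omega>) \<le> Wp (z + 2 + V (max 0 h) \<omega>)" for n by (intro AE_I2 Wp_mono) simp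
    show "AE \<omega> in M. (\<lambda>n. Wp (y n + V (max 0 h) \<omega>)) \<longlonglongrightarrow> Wp (z + V (max 0 h) \<omega>)"
      unfolding Wp_def by (intro AE_I2 tendsto_ennrealI Wr_right_cont tendsto_add ylim tendsto_const add_right_mono yz)
  qed measurable
  then show ?thesis
  proof (rule LIMSEQ_le_const, intro exI allI impI)
    fix n
    show "Wp z \<le> PP h Wp (y n)" using order_trans[OF Wp_mono y(3)[of n], of z] y(1)[of n] by simp
  qed
qed

end

subsection \<open>First passage upwards\<close>

context levy_process
begin

definition below :: "real \<Rightarrow> real \<Rightarrow> nat \<Rightarrow> 'a \<Rightarrow> ennreal" where
  "below b h k \<omega> = (if \<forall>j. j \<le> k \<longrightarrow> V (max 0 (real j * h)) \<omega> < b then 1 else 0)"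

text \<open>These are the disjoint events that first passage over \<open>b\<close> on the grid
  happens exactly at step \<open>k + 1\<close>; they decompose the stopped process.\<close>

definition upcross :: "real \<Rightarrow> real \<Rightarrow> nat \<Rightarrow> 'a \<Rightarrow> ennreal" where
  "upcross b h k \<omega> = below b h k \<omega> * (if b \<le> V (max 0 (real (Suc k) * h)) \<omega> then 1 else 0)"

lemma below_measurable [measurable]: "below b h k \<in> borel_measurable M"
  unfolding below_def[abs_def] by measurable

lemma upcross_measurable [measurable]: "upcross b h k \<in> borel_measurable M"
  unfolding upcross_def[abs_def] by measurable

lemma below_Suc: "below b h k \<omega> = upcross b h k \<omega> + below b h (Suc k) \<omega>"
  by (auto simp: below_def upcross_def le_Suc_eq not_le)

lemma sum_upcross: "below b h 0 \<omega> = (\<Sum>j<k. upcross b h j \<omega>) + below b h k \<omega>"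
proof (induction k)
  case (Suc k)
  then show ?case using below_Suc[of b h k \<omega>] by (simp add: add.assoc)
qed simp

lemma sum_upcross_le:
  "(\<Sum>j<k. upcross b h j \<omega>) \<le> indicator {\<omega>. \<exists>j\<le>k. b \<le> V (max 0 (real j * h)) \<omega>} \<omega>"
proof (cases "\<exists>j\<le>k. b \<le> V (max 0 (real j * h)) \<omega>")
  case True
  have "(\<Sum>j<k. upcross b h j \<omega>) \<le> below b h 0 \<omega>" unfolding sum_upcross[of b h \<omega> k] by simp
  also have "\<dots> \<le> 1" by (simp add: below_def)
  finally show ?thesis using True by simp
next
  case False
  then have "upcross b h j \<omega> = 0" if "j < k" for j
    using that Suc_leI[OF that] unfolding upcross_def by (auto simp del: of_nat_Suc)
  then show ?thesis by simp
qed

lemma below_markov: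
  assumes h: "0 \<le> h" and F[measurable]: "F \<in> borel_measurable borel"
  shows "(\<integral>\<^sup>+\<omega>. below b h k \<omega> * PP h F (V (max 0 (real k * h)) \<omega>) \<partial>M) =
    (\<integral>\<^sup>+\<omega>. upcross b h k \<omega> * F (V (max 0 (real (Suc k) * h)) \<omega>) \<partial>M) +
    (\<integral>\<^sup>+\<omega>. below b h (Suc k) \<omega> * F (V (max 0 (real (Suc k) * h)) \<omega>) \<partial>M)"
proof -
  have "below b h k = indicator {\<omega>. \<forall>j\<le>k. V (real j * h) \<omega> \<in> {..<b}}"
    using h by (auto simp: fun_eq_iff below_def indicator_def max_def)
  then have "(\<integral>\<^sup>+\<omega>. below b h k \<omega> * PP h F (V (max 0 (real k * h)) \<omega>) \<partial>M) =
      (\<integral>\<^sup>+\<omega>. below b h k \<omega> * F (V (max 0 (real (Suc k) * h)) \<omega>) \<partial>M)"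
    using markov_grid[OF h h, of "\<lambda>_. {..<b}" F k] h
    by (simp add: PP_def max_def distrib_right add.commute)
  also have "\<dots> = (\<integral>\<^sup>+\<omega>. upcross b h k \<omega> * F (V (max 0 (real (Suc k) * h)) \<omega>) +
      below b h (Suc k) \<omega> * F (V (max 0 (real (Suc k) * h)) \<omega>) \<partial>M)"
    by (intro nn_integral_cong) (simp only: below_Suc[of b h k] distrib_right)
  also have "\<dots> = (\<integral>\<^sup>+\<omega>. upcross b h k \<omega> * F (V (max 0 (real (Suc k) * h)) \<omega>) \<partial>M) +
    (\<integral>\<^sup>+\<omega>. below b h (Suc k) \<omega> * F (V (max 0 (real (Suc k) * h)) \<omega>) \<partial>M)"
    by (rule nn_integral_add) measurable
  finally show ?thesis .
qed

lemma below_0: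
  assumes b: "0 < b"
  shows "(\<integral>\<^sup>+\<omega>. below b h 0 \<omega> * F (V (max 0 (real 0 * h)) \<omega>) \<partial>M) = F 0"
proof -
  have "(\<integral>\<^sup>+\<omega>. below b h 0 \<omega> * F (V (max 0 (real 0 * h)) \<omega>) \<partial>M) = (\<integral>\<^sup>+\<omega>. F 0 \<partial>M)"
    by (intro nn_integral_cong_AE, use start_zero in eventually_elim) (use b in \<open>auto simp: below_def\<close>)
  then show ?thesis by (simp add: emeasure_space_1)
qed

text \<open>Optional stopping at the first grid time at or above \<open>b\<close>, unrolled step by
  step. With values in \<open>ennreal\<close> no integrability has to be checked.\<close>

lemma subharmonic_stop:
  assumes b: "0 < b" and h: "0 \<le> h" and F[measurable]: "F \<in> borel_measurable borel"
    and sub: "\<And>z. F z \<le> PP h F z"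
  shows "F 0 \<le> (\<Sum>j<k. \<integral>\<^sup>+\<omega>. upcross b h j \<omega> * F (V (max 0 (real (Suc j) * h)) \<omega>) \<partial>M) +
    (\<integral>\<^sup>+\<omega>. below b h k \<omega> * F (V (max 0 (real k * h)) \<omega>) \<partial>M)"
proof (induction k)
  case 0
  then show ?case using below_0[OF b, of h F] by simp
next
  case (Suc k)
  have "(\<integral>\<^sup>+\<omega>. below b h k \<omega> * F (V (max 0 (real k * h)) \<omega>) \<partial>M) \<le>
      (\<integral>\<^sup>+\<omega>. below b h k \<omega> * PP h F (V (max 0 (real k * h)) \<omega>) \<partial>M)"
    by (intro nn_integral_mono mult_left_mono sub) simp
  from order_trans[OF Suc add_left_mono[OF this]] show ?case
    unfolding below_markov[OF h F] by (simp add: add.assoc)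
qed

lemma superharmonic_stop:
  assumes b: "0 < b" and h: "0 \<le> h" and F[measurable]: "F \<in> borel_measurable borel"
    and sup: "\<And>z. PP h F z \<le> F z"
  shows "(\<Sum>j<k. \<integral>\<^sup>+\<omega>. upcross b h j \<omega> * F (V (max 0 (real (Suc j) * h)) \<omega>) \<partial>M) +
    (\<integral>\<^sup>+\<omega>. below b h k \<omega> * F (V (max 0 (real k * h)) \<omega>) \<partial>M) \<le> F 0"
proof (induction k)
  case 0
  then show ?case using below_0[OF b, of h F] by simp
next
  case (Suc k)
  have "(\<integral>\<^sup>+\<omega>. below b h k \<omega> * PP h F (V (max 0 (real k * h)) \<omega>) \<partial>M) \<le>
      (\<integral>\<^sup>+\<omega>. below b h k \<omega> * F (V (max 0 (real k * h)) \<omega>) \<partial>M)"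
    by (intro nn_integral_mono mult_left_mono sup) simp
  from order_trans[OF add_left_mono[OF this] Suc] show ?case
    unfolding below_markov[OF h F] by (simp add: add.assoc)
qed

end

context laplace_levy
begin

text \<open>If \<open>\<Psi> l \<le> 0\<close>, then \<open>exp (l * V t)\<close> is a
  supermartingale, and at passage it is at least \<open>exp (l * b)\<close>. The resulting bound
  depends neither on the mesh nor on the number of steps.\<close>

lemma passage_bound:
  assumes k: "0 \<le> l" "\<Psi> l \<le> 0" and b: "0 < b" and h: "0 \<le> h"
  shows "emeasure M {\<omega> \<in> space M. \<exists>j\<le>k. b \<le> V (max 0 (real j * h)) \<omega>} \<le> ennreal (exp (- (l * b)))"
proof -
  define F where "F z = ennreal (1 * exp (l * z))" for z
  have [measurable]: "F \<in> borel_measurable borel" unfolding F_def by measurable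
  define E where "E = {\<omega> \<in> space M. \<exists>j\<le>k. b \<le> V (max 0 (real j * h)) \<omega>}"
  have E[measurable]: "E \<in> sets M" unfolding E_def by measurable
  have sup: "PP h F z \<le> F z" for z
    unfolding F_def using PP_exp[OF h k(1), of 1 z] k(2) h
    by (auto intro!: ennreal_leI simp: mult_nonneg_nonpos)
  have first: "(\<integral>\<^sup>+\<omega>. indicator E \<omega> * ennreal (exp (l * b)) \<partial>M) \<le>
      (\<integral>\<^sup>+\<omega>. (\<Sum>j<k. upcross b h j \<omega> * F (V (max 0 (real (Suc j) * h)) \<omega>)) \<partial>M)"
  proof (intro nn_integral_mono_AE, use start_zero in eventually_elim)
    fix \<omega> assume V0: "V 0 \<omega> = 0"
    have up: "upcross b h j \<omega> * ennreal (exp (l * b)) \<le> upcross b h j \<omega> * F (V (max 0 (real (Suc j) * h)) \<omega>)" for j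
      using k(1) by (auto simp: upcross_def below_def F_def intro!: ennreal_leI mult_left_mono)
    have "indicator E \<omega> * ennreal (exp (l * b)) \<le> (\<Sum>j<k. upcross b h j \<omega>) * ennreal (exp (l * b))"
    proof (cases "\<exists>j\<le>k. b \<le> V (max 0 (real j * h)) \<omega>")
      case True
      then have "below b h k \<omega> = 0" by (auto simp: below_def not_less)
      moreover have "below b h 0 \<omega> = 1" using V0 b by (simp add: below_def)
      ultimately have "(\<Sum>j<k. upcross b h j \<omega>) = 1" using sum_upcross[of b h \<omega> k] by simp
      then show ?thesis by (simp add: indicator_def)
    qed (simp add: E_def)
    also have "\<dots> \<le> (\<Sum>j<k. upcross b h j \<omega> * F (V (max 0 (real (Suc j) * h)) \<omega>))"
      unfolding sum_distrib_right by (intro sum_mono up)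
    finally show "indicator E \<omega> * ennreal (exp (l * b)) \<le>
      (\<Sum>j<k. upcross b h j \<omega> * F (V (max 0 (real (Suc j) * h)) \<omega>))" .
  qed
  also have "\<dots> = (\<Sum>j<k. \<integral>\<^sup>+\<omega>. upcross b h j \<omega> * F (V (max 0 (real (Suc j) * h)) \<omega>) \<partial>M)"
    by (rule nn_integral_sum) measurable
  also have "\<dots> \<le> F 0"
    by (rule order_trans[OF _ superharmonic_stop[OF b h _ sup, of k]]) auto
  finally have "emeasure M E * ennreal (exp (l * b)) \<le> 1"
    by (simp add: nn_integral_multc F_def)
  then have "emeasure M E * ennreal (exp (l * b)) * ennreal (exp (- (l * b))) \<le> 1 * ennreal (exp (- (l * b)))"
    by (rule mult_right_mono) simp
  then show ?thesis
    unfolding E_def[symmetric] by (simp add: mult.assoc ennreal_mult[symmetric] exp_add[symmetric])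
qed

end

context scale_levy
begin

text \<open>Subharmonic functions of a process drifting to minus infinity are dominated by their value at the
  level \<open>x + b\<close> times the probability of reaching it. On a grid of mesh \<open>h\<close> the overshoot over the
  level is controlled by the exponential moments of \<open>V h\<close>, since \<open>\<Psi>\<close> grows subexponentially.\<close>

lemma first_passage_grid:
  assumes F[measurable]: "F \<in> borel_measurable borel" and Fmono: "\<And>y z. y \<le> z \<Longrightarrow> F y \<le> F z"
    and Fbound: "\<And>z. F z \<le> ennreal (C * exp (a * z))" and C: "0 \<le> C" and a: "0 < a"
    and sub: "\<And>h z. 0 < h \<Longrightarrow> F z \<le> PP h F z"
    and p: "\<And>h k. 0 < h \<Longrightarrow> emeasure M {\<omega> \<in> space M. \<exists>j\<le>k. b \<le> V (max 0 (real j * h)) \<omega>} \<le> ennreal p"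
    and b: "0 < b" and e: "0 < e" and T: "0 < T" and N: "0 < N" and l: "0 \<le> l"
  shows "F 0 \<le> F (b + e) * ennreal p +
    ennreal (real N * (C * exp (a * b) * exp (- (l * e)) * exp (T / real N * \<Psi> (a + l)))) +
    (\<integral>\<^sup>+\<omega>. F (min (V T \<omega>) b) \<partial>M)"
proof -
  define h where "h = T / real N"
  have h: "0 < h" using T N by (simp add: h_def)
  define t where "t j = real j * h" for j
  have t: "0 \<le> t j" "max 0 (t j) = t j" "t (Suc j) = t j + h" for j using h by (simp_all add: t_def distrib_right)
  have tN: "t N = T" using N by (simp add: t_def h_def)
  have [measurable]: "V (t j) \<in> borel_measurable M" for j using t by (intro random_variable_V)
  have [measurable]: "V T \<in> borel_measurable M" using T by (intro random_variable_V) simp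
  define K where "K = C * exp (a * b)"
  have K: "0 \<le> K" using C by (simp add: K_def)
  define G where "G y = ennreal (K * exp (- (l * e)) * exp ((a + l) * y))" for y
  have [measurable]: "G \<in> borel_measurable borel" unfolding G_def by measurable
  \<comment> \<open>A crossing step of size at most \<open>e\<close> lands below
    \<open>b + e\<close>. A larger step \<open>d\<close> is charged to \<open>G d\<close>, by
    inserting the factor \<open>exp (l * (d - e))\<close>, which is at least 1.\<close>
  have jump: "upcross b h j \<omega> * F (V (t (Suc j)) \<omega>) \<le>
      upcross b h j \<omega> * F (b + e) + G (V (t (Suc j)) \<omega> - V (t j) \<omega>)" for j \<omega>
  proof (cases "upcross b h j \<omega> = 0")
    case False
    then have up: "upcross b h j \<omega> = 1" "V (t j) \<omega> < b"
      using t(2)[of j] by (auto simp: upcross_def below_def t_def[symmetric] split: if_splits)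
    define d where "d = V (t (Suc j)) \<omega> - V (t j) \<omega>"
    show ?thesis
    proof (cases "d \<le> e")
      case True
      then have "F (V (t (Suc j)) \<omega>) \<le> F (b + e)" using up by (intro Fmono) (simp add: d_def)
      then show ?thesis using up by (simp add: add_increasing2)
    next
      case F: False
      have "F (V (t (Suc j)) \<omega>) \<le> F (b + d)" using up by (intro Fmono) (simp add: d_def)
      also have "\<dots> \<le> ennreal (C * exp (a * (b + d)))" by (rule Fbound)
      also have "\<dots> \<le> G d"
        unfolding G_def
      proof (rule ennreal_leI)
        have "C * exp (a * (b + d)) = K * exp (a * d)" by (simp add: K_def distrib_left exp_add)
        also have "\<dots> \<le> K * exp (- (l * e) + (a + l) * d)"
          using K F l mult_left_mono[of e d l] by (intro mult_left_mono) (auto simp: distrib_right)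
        finally show "C * exp (a * (b + d)) \<le> K * exp (- (l * e)) * exp ((a + l) * d)"
          by (simp add: mult.assoc flip: exp_add)
      qed
      finally show ?thesis using up by (simp add: d_def add_increasing)
    qed
  qed simp
  have GV: "(\<integral>\<^sup>+\<omega>. G (V (t (Suc j)) \<omega> - V (t j) \<omega>) \<partial>M) = ennreal (K * exp (- (l * e)) * exp (h * \<Psi> (a + l)))" for j
  proof -
    have "(\<integral>\<^sup>+\<omega>. G (V (t (Suc j)) \<omega> - V (t j) \<omega>) \<partial>M) = PP h G 0"
      unfolding t(3) PP_def using h t(1)[of j] by (subst increment_nn_integral) (auto simp: max_def)
    also have "\<dots> = ennreal (K * exp (- (l * e)) * exp (h * \<Psi> (a + l)))"
      unfolding G_def[abs_def] using PP_exp[of h "a + l" "K * exp (- (l * e))" 0] h a l K by simp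
    finally show ?thesis .
  qed
  have "(\<Sum>j<N. \<integral>\<^sup>+\<omega>. upcross b h j \<omega> * F (V (t (Suc j)) \<omega>) \<partial>M) \<le>
      (\<Sum>j<N. \<integral>\<^sup>+\<omega>. upcross b h j \<omega> * F (b + e) + G (V (t (Suc j)) \<omega> - V (t j) \<omega>) \<partial>M)"
    by (intro sum_mono nn_integral_mono jump)
  also have "\<dots> = (\<Sum>j<N. (\<integral>\<^sup>+\<omega>. upcross b h j \<omega> \<partial>M) * F (b + e) + ennreal (K * exp (- (l * e)) * exp (h * \<Psi> (a + l))))"
    by (intro sum.cong refl) (simp add: nn_integral_add nn_integral_multc GV)
  also have "\<dots> = (\<integral>\<^sup>+\<omega>. (\<Sum>j<N. upcross b h j \<omega>) \<partial>M) * F (b + e) + ennreal (real N * (K * exp (- (l * e)) * exp (h * \<Psi> (a + l))))"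
    using K by (simp add: sum.distrib sum_distrib_right nn_integral_sum ennreal_mult ennreal_of_nat_eq_real_of_nat)
  also have "(\<integral>\<^sup>+\<omega>. (\<Sum>j<N. upcross b h j \<omega>) \<partial>M) \<le> ennreal p"
  proof -
    have "(\<integral>\<^sup>+\<omega>. (\<Sum>j<N. upcross b h j \<omega>) \<partial>M) \<le>
        (\<integral>\<^sup>+\<omega>. indicator {\<omega> \<in> space M. \<exists>j\<le>N. b \<le> V (max 0 (real j * h)) \<omega>} \<omega> \<partial>M)"
      by (intro nn_integral_mono order_trans[OF sum_upcross_le]) (auto simp: indicator_def)
    also have "\<dots> \<le> ennreal p" using p[OF h, of N] by (subst nn_integral_indicator) measurable
    finally show ?thesis .
  qed
  finally have 1: "(\<Sum>j<N. \<integral>\<^sup>+\<omega>. upcross b h j \<omega> * F (V (t (Suc j)) \<omega>) \<partial>M) \<le>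
      ennreal p * F (b + e) + ennreal (real N * (K * exp (- (l * e)) * exp (h * \<Psi> (a + l))))"
    by (simp add: mult_right_mono add_right_mono)
  have 2: "(\<integral>\<^sup>+\<omega>. below b h N \<omega> * F (V (t N) \<omega>) \<partial>M) \<le> (\<integral>\<^sup>+\<omega>. F (min (V T \<omega>) b) \<partial>M)"
  proof (rule nn_integral_mono)
    fix \<omega>
    show "below b h N \<omega> * F (V (t N) \<omega>) \<le> F (min (V T \<omega>) b)"
    proof (cases "below b h N \<omega> = 0")
      case False
      then have "below b h N \<omega> = 1" "V (t N) \<omega> < b"
        using t(2)[of N] by (auto simp: below_def t_def[symmetric] split: if_splits)
      then show ?thesis by (simp add: tN min_def)
    qed simp
  qed
  have "F 0 \<le> (\<Sum>j<N. \<integral>\<^sup>+\<omega>. upcross b h j \<omega> * F (V (t (Suc j)) \<omega>) \<partial>M) +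
      (\<integral>\<^sup>+\<omega>. below b h N \<omega> * F (V (t N) \<omega>) \<partial>M)"
    using subharmonic_stop[OF b less_imp_le[OF h] F sub[OF h], of N]
    unfolding t_def[symmetric] t(2) by simp
  also have "\<dots> \<le> (ennreal p * F (b + e) + ennreal (real N * (K * exp (- (l * e)) * exp (h * \<Psi> (a + l))))) +
      (\<integral>\<^sup>+\<omega>. F (min (V T \<omega>) b) \<partial>M)"
    by (intro add_mono 1 2)
  finally show ?thesis by (simp add: mult.commute K_def h_def mult.assoc)
qed

text \<open>Two limits, in this order. For fixed \<open>T\<close> the number \<open>N\<close> of
  steps grows like \<open>exp (e / 2 * l)\<close>, which keeps
  \<open>exp (T / real N * \<Psi> (a + l))\<close> bounded, while each large step costs
  \<open>exp (- (l * e))\<close>; so the overshoot error vanishes as \<open>l\<close> grows. Then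
  \<open>T\<close> tends to infinity, and the drift removes the part of the paths still below
  \<open>b\<close>.\<close>

lemma first_passage:
  assumes drift: "drifts_to_minus_infinity M V"
    and F[measurable]: "F \<in> borel_measurable borel" and Fmono: "\<And>y z. y \<le> z \<Longrightarrow> F y \<le> F z"
    and Fbound: "\<And>z. F z \<le> ennreal (C * exp (a * z))" and C: "0 < C" and a: "0 < a"
    and sub: "\<And>h z. 0 < h \<Longrightarrow> F z \<le> PP h F z"
    and p: "\<And>h k. 0 < h \<Longrightarrow> emeasure M {\<omega> \<in> space M. \<exists>j\<le>k. b \<le> V (max 0 (real j * h)) \<omega>} \<le> ennreal p"
    and b: "0 < b" and e: "0 < e"
  shows "F 0 \<le> F (b + e) * ennreal p"
proof -
  obtain C' where C': "0 < C'" "\<And>l. c < l \<Longrightarrow> \<Psi> l \<le> C' * exp (e / 2 * l)"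
    using Psi_subexp[of "e / 2"] e by auto
  define R where "R T = (\<integral>\<^sup>+\<omega>. F (min (V T \<omega>) b) \<partial>M)" for T
  have step: "F 0 \<le> F (b + e) * ennreal p + R T" if T: "0 < T" for T
  proof -
    define K where "K = C * exp (a * b) * exp 1"
    define q where "q l = (T * C' * exp (e / 2 * (a + l)) + 1) * (K * exp (- (l * e)))" for l
    have "F 0 \<le> F (b + e) * ennreal p + ennreal (q l) + R T" if l: "c < l" for l
    proof -
      have l0: "0 \<le> l" "c < a + l" using l c_nonneg a by auto
      define N where "N = nat \<lceil>T * C' * exp (e / 2 * (a + l))\<rceil>"
      have pos: "0 < T * C' * exp (e / 2 * (a + l))" using T C' by simp
      have N: "0 < N" "T * C' * exp (e / 2 * (a + l)) \<le> real N" "real N \<le> T * C' * exp (e / 2 * (a + l)) + 1"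
        using pos unfolding N_def by (auto simp: of_nat_nat le_of_int_ceiling)
      have "T / real N * \<Psi> (a + l) \<le> T / real N * (C' * exp (e / 2 * (a + l)))"
        using T l0 by (intro mult_left_mono C') auto
      also have "\<dots> \<le> 1" using N by (simp add: mult.assoc)
      finally have E: "exp (T / real N * \<Psi> (a + l)) \<le> exp 1" by simp
      have "F 0 \<le> F (b + e) * ennreal p +
          ennreal (real N * (C * exp (a * b) * exp (- (l * e)) * exp (T / real N * \<Psi> (a + l)))) + R T"
        unfolding R_def by (rule first_passage_grid[OF F Fmono Fbound _ a sub p b e T N(1) l0(1)]) (use C in auto)
      also have "\<dots> \<le> F (b + e) * ennreal p + ennreal (q l) + R T"
      proof (intro add_mono order_refl ennreal_leI)
        have "real N * (C * exp (a * b) * exp (- (l * e)) * exp (T / real N * \<Psi> (a + l))) \<le>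
            (T * C' * exp (e / 2 * (a + l)) + 1) * (C * exp (a * b) * exp (- (l * e)) * exp 1)"
          using N(3) E C pos by (intro mult_mono) auto
        then show "real N * (C * exp (a * b) * exp (- (l * e)) * exp (T / real N * \<Psi> (a + l))) \<le> q l"
          by (simp add: q_def K_def mult_ac)
      qed
      finally show ?thesis .
    qed
    moreover have "(q \<longlongrightarrow> 0) at_top"
      unfolding q_def K_def using e by real_asymp
    then have "((\<lambda>l. F (b + e) * ennreal p + ennreal (q l) + R T) \<longlongrightarrow> F (b + e) * ennreal p + ennreal 0 + R T) at_top"
      by (intro tendsto_add tendsto_const tendsto_ennrealI)
    ultimately have "F 0 \<le> F (b + e) * ennreal p + ennreal 0 + R T"
      by (intro tendsto_lowerbound[of _ _ at_top]) (auto intro: eventually_mono[OF eventually_gt_at_top[of c]])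
    then show ?thesis by simp
  qed
  have V[measurable]: "V (real n) \<in> borel_measurable M" for n by (intro random_variable_V) simp
  have "(\<lambda>n. R (real n)) \<longlonglongrightarrow> (\<integral>\<^sup>+\<omega>. 0 \<partial>M)"
    unfolding R_def
  proof (rule nn_integral_dominated_convergence[where w="\<lambda>_. F b"])
    show "AE \<omega> in M. F (min (V (real n) \<omega>) b) \<le> F b" for n by (intro AE_I2 Fmono) simp
    have "F b < \<infinity>" using Fbound[of b] order_le_less_trans by fastforce
    then show "(\<integral>\<^sup>+\<omega>. F b \<partial>M) < \<infinity>" by (simp add: emeasure_space_1)
    show "AE \<omega> in M. (\<lambda>n. F (min (V (real n) \<omega>) b)) \<longlonglongrightarrow> 0"
      using drift unfolding drifts_to_minus_infinity_def
    proof eventually_elim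
      fix \<omega> assume lim: "filterlim (\<lambda>t. V t \<omega>) at_bot at_top"
      have l: "filterlim (\<lambda>n. V (real n) \<omega>) at_bot sequentially"
        by (rule filterlim_compose[OF lim filterlim_real_sequentially])
      have "((\<lambda>z. C * exp (a * z)) \<longlongrightarrow> 0) at_bot" using a by real_asymp
      from filterlim_compose[OF this l]
      have up: "(\<lambda>n. ennreal (C * exp (a * V (real n) \<omega>))) \<longlonglongrightarrow> ennreal 0" by (rule tendsto_ennrealI)
      have "F (min (V (real n) \<omega>) b) \<le> ennreal (C * exp (a * V (real n) \<omega>))" for n
        by (rule order_trans[OF Fmono Fbound]) simp
      then show "(\<lambda>n. F (min (V (real n) \<omega>) b)) \<longlonglongrightarrow> 0"
        using up by (intro tendsto_sandwich[OF _ _ tendsto_const up[simplified]]) auto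
    qed
  qed measurable
  then have "(\<lambda>n. F (b + e) * ennreal p + R (real n)) \<longlonglongrightarrow> F (b + e) * ennreal p + 0"
    by (intro tendsto_add tendsto_const) simp
  moreover have "F 0 \<le> F (b + e) * ennreal p + R (real n)" if "1 \<le> n" for n
    using that by (intro step) simp
  ultimately have "F 0 \<le> F (b + e) * ennreal p + 0" by (intro LIMSEQ_le_const) auto
  then show ?thesis by simp
qed

text \<open>Were \<open>\<Psi>\<close> nonnegative, \<open>exp (l * V t)\<close> would be a
  submartingale for every \<open>l > 0\<close>. The paths have finite suprema, so some level
  \<open>b\<close> is reached with probability at most 1/2, and \<open>first_passage\<close> yields
  \<open>1 \<le> exp (l * (b + 1)) / 2\<close>; this fails as \<open>l\<close> tends to 0.\<close>

lemma Psi_negative: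
  assumes drift: "drifts_to_minus_infinity M V"
  shows "\<exists>l>0. \<Psi> l < 0"
proof (rule ccontr)
  assume "\<not> ?thesis"
  then have pos: "0 \<le> \<Psi> l" if "0 < l" for l using that by (meson not_less)
  define E where "E n = {\<omega> \<in> space M. \<exists>u\<in>\<rat>. real n < V (max 0 u) \<omega>}" for n :: nat
  have E[measurable]: "E n \<in> sets M" for n
  proof -
    have "E n = (\<Union>u\<in>\<rat>. {\<omega> \<in> space M. real n < V (max 0 u) \<omega>})" by (auto simp: E_def)
    also have "\<dots> \<in> sets M" by (intro sets.countable_UN'' countable_rat) measurable
    finally show ?thesis .
  qed
  have "(\<lambda>n. measure M (E n)) \<longlonglongrightarrow> measure M (\<Inter>n. E n)"
  proof (rule finite_Lim_measure_decseq)
    show "decseq E"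
      unfolding decseq_def
    proof (intro allI impI subsetI)
      fix m n \<omega> assume "m \<le> n" "\<omega> \<in> E n"
      then obtain u where "\<omega> \<in> space M" "u \<in> \<rat>" "real n < V (max 0 u) \<omega>" by (auto simp: E_def)
      moreover have "real m \<le> real n" using \<open>m \<le> n\<close> by simp
      ultimately show "\<omega> \<in> E m" by (auto simp: E_def intro!: bexI[of _ u])
    qed
  qed (use E in auto)
  also have "measure M (\<Inter>n. E n) = 0"
  proof -
    have "AE \<omega> in M. \<omega> \<notin> (\<Inter>n. E n)"
      using drift[unfolded drifts_to_minus_infinity_def] AE_space
    proof eventually_elim
      fix \<omega> assume lim: "filterlim (\<lambda>t. V t \<omega>) at_bot at_top" and \<omega>: "\<omega> \<in> space M"
      from filterlim_at_bot[THEN iffD1, OF lim, rule_format, of 0]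
      obtain T where T: "\<And>t. T \<le> t \<Longrightarrow> V t \<omega> \<le> 0" by (auto simp: eventually_at_top_linorder)
      obtain B where B: "\<forall>s\<in>{0..T}. \<bar>V s \<omega>\<bar> \<le> B" using cadlag_bounded[OF cadlag_paths[OF \<omega>]] by blast
      obtain n where n: "max 0 B < real n" using reals_Archimedean2 by blast
      have ub: "V (max 0 u) \<omega> \<le> max 0 B" for u
      proof (cases "T \<le> max 0 u")
        case False
        then have "max 0 u \<in> {0..T}" by (auto simp: not_le max_def split: if_splits)
        from B[rule_format, OF this] show ?thesis by linarith
      qed (use T[of "max 0 u"] in simp)
      have "\<omega> \<notin> E n"
      proof
        assume "\<omega> \<in> E n"
        then obtain u where "real n < V (max 0 u) \<omega>" by (auto simp: E_def)
        with ub[of u] n show False by linarith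
      qed
      then show "\<omega> \<notin> (\<Inter>n. E n)" by auto
    qed
    then show ?thesis by (subst measure_eq_AE[of _ "{}"]) auto
  qed
  finally have "\<forall>\<^sub>F n in sequentially. measure M (E n) < 1 / 2" by (rule order_tendstoD) simp
  then obtain n where n: "measure M (E n) < 1 / 2" by (auto simp: eventually_sequentially)
  \<comment> \<open>\<open>E n\<close> looks at rational times only. Next to a time with value at
    least \<open>n + 1\<close>, right-continuity finds a rational time with value above
    \<open>n\<close>.\<close>
  define b where "b = real n + 1"
  have p: "emeasure M {\<omega> \<in> space M. \<exists>j\<le>k. b \<le> V (max 0 (real j * h)) \<omega>} \<le> ennreal (1 / 2)" for h k
  proof -
    have "{\<omega> \<in> space M. \<exists>j\<le>k. b \<le> V (max 0 (real j * h)) \<omega>} \<subseteq> E n"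
    proof safe
      fix \<omega> j assume \<omega>: "\<omega> \<in> space M" and j: "b \<le> V (max 0 (real j * h)) \<omega>"
      define s where "s = max 0 (real j * h)"
      obtain d where d: "s < d" "\<And>y. s \<le> y \<Longrightarrow> y < d \<Longrightarrow> \<bar>V y \<omega> - V s \<omega>\<bar> < 1"
        using cadlag_right_event[OF cadlag_paths[OF \<omega>], of s 1] by (auto simp: s_def)
      obtain u where u: "u \<in> \<rat>" "s < u" "u < d" using Rats_dense_in_real[OF d(1)] by auto
      then have "0 \<le> u" by (simp add: s_def)
      moreover have "real n < V u \<omega>" using d(2)[of u] u j by (simp add: s_def b_def)
      ultimately show "\<omega> \<in> E n" using u \<omega> by (auto simp: E_def intro!: bexI[of _ u])
    qed
    then have "emeasure M {\<omega> \<in> space M. \<exists>j\<le>k. b \<le> V (max 0 (real j * h)) \<omega>} \<le> emeasure M (E n)"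
      by (rule emeasure_mono) measurable
    also have "\<dots> \<le> ennreal (1 / 2)"
      unfolding emeasure_eq_measure by (rule ennreal_leI) (use n in simp)
    finally show ?thesis .
  qed
  have "1 \<le> exp (l * (b + 1)) * (1 / 2)" if l: "0 < l" for l
  proof -
    define F where "F z = ennreal (1 * exp (l * z))" for z
    have "F 0 \<le> F (b + 1) * ennreal (1 / 2)"
    proof (rule first_passage[where C=1 and a=l, OF drift])
      show "F z \<le> PP h F z" if "0 < h" for h z
        unfolding F_def[abs_def] using PP_exp[of h l 1 z] that l pos[OF l]
        by (auto intro!: ennreal_leI)
      show "emeasure M {\<omega> \<in> space M. \<exists>j\<le>k. b \<le> V (max 0 (real j * h)) \<omega>} \<le> ennreal (1 / 2)" for h k
        by (rule p)
    qed (use l in \<open>auto simp: F_def b_def intro!: ennreal_leI\<close>)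
    then have "ennreal 1 \<le> ennreal (exp (l * (b + 1)) * (1 / 2))"
      by (subst ennreal_mult) (auto simp: F_def)
    then show ?thesis by (subst (asm) ennreal_le_iff) auto
  qed
  moreover have "((\<lambda>l. exp (l * (b + 1)) * (1 / 2)) \<longlongrightarrow> exp (0 * (b + 1)) * (1 / 2)) (at_right 0)"
    by (intro tendsto_intros)
  ultimately have "1 \<le> exp (0 * (b + 1)) * (1 / 2)"
    by (intro tendsto_lowerbound[of _ _ "at_right 0"]) (auto simp: eventually_at_right_less eventually_at intro!: exI[of _ 1])
  then show False by simp
qed

text \<open>As \<open>W\<close> is subharmonic, \<open>W x\<close> is at most
  \<open>W (y + e)\<close> times the probability of climbing by \<open>y - x\<close>, and that
  probability is at most \<open>exp (- (k * (y - x)))\<close>. Right-continuity removes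
  \<open>e\<close>.\<close>

lemma Wsharp_mono:
  assumes drift: "drifts_to_minus_infinity M V" and k: "0 \<le> k" "\<Psi> k \<le> 0" and xy: "0 \<le> x" "x \<le> y"
  shows "exp (- (k * x)) * W x \<le> exp (- (k * y)) * W y"
proof (cases "x = y")
  case False
  define b where "b = y - x"
  have b: "0 < b" using False xy by (simp add: b_def)
  obtain C where C: "0 < C" "\<And>x. Wp x \<le> ennreal (C * exp ((c + 1) * x))" using Wp_bound by blast
  have step: "Wp x \<le> Wp (y + e) * ennreal (exp (- (k * b)))" if e: "0 < e" for e
  proof -
    define F where "F z = Wp (x + z)" for z
    have "F 0 \<le> F (b + e) * ennreal (exp (- (k * b)))"
    proof (rule first_passage[where C="C * exp ((c + 1) * x)" and a="c + 1", OF drift])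
      show "F z \<le> ennreal (C * exp ((c + 1) * x) * exp ((c + 1) * z))" for z
        using C(2)[of "x + z"] by (simp add: F_def distrib_left exp_add mult.assoc)
      show "F z \<le> PP h F z" if "0 < h" for h z
        using Wp_subharmonic[OF that, of "x + z"] by (simp add: F_def PP_def add.assoc)
      show "emeasure M {\<omega> \<in> space M. \<exists>j\<le>m. b \<le> V (max 0 (real j * h)) \<omega>} \<le> ennreal (exp (- (k * b)))"
        if "0 < h" for h m
        using that by (intro passage_bound k b) simp
    qed (use C c_nonneg b e in \<open>auto simp: F_def intro!: Wp_mono\<close>)
    then show ?thesis by (simp add: F_def b_def)
  qed
  have "(\<lambda>n. Wr (y + 1 / real (Suc n))) \<longlonglongrightarrow> Wr y"
    by (rule Wr_right_cont) (real_asymp, simp)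
  then have lim: "(\<lambda>n. Wr (y + 1 / real (Suc n)) * exp (- (k * b))) \<longlonglongrightarrow> Wr y * exp (- (k * b))"
    by (intro tendsto_intros)
  have le: "Wr x \<le> Wr (y + 1 / real (Suc n)) * exp (- (k * b))" for n
    using step[of "1 / real (Suc n)"] Wr_nonneg
    by (simp add: Wp_def ennreal_mult[symmetric] ennreal_le_iff)
  have "Wr x \<le> Wr y * exp (- (k * b))" by (rule LIMSEQ_le_const[OF lim]) (use le in blast)
  then have "exp (- (k * x)) * W x \<le> exp (- (k * x)) * (W y * exp (- (k * b)))"
    using xy by (intro mult_left_mono) (auto simp: Wr_def)
  also have "\<dots> = exp (- (k * y)) * W y"
    using xy by (simp add: b_def mult_exp_exp mult.left_commute[of _ "W y"] algebra_simps)
  finally show ?thesis .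
qed simp

end

section \<open>A bounded function for the Feynman-Kac formula\<close>

text \<open>The weighted function \<open>exp (- (k * x)) * W x\<close> has transform
  \<open>1 / \<Psi> (k + l)\<close>, so it is the scale function for the exponent shifted by
  \<open>k\<close>. Its monotonicity and boundedness have different proofs in the two drift regimes
  and are therefore assumptions here; \<open>harmonic\<close> says that the kernels of the
  conditioned process have mass one.\<close>

locale cond_levy = scale_levy M V \<Psi> W k for M :: "'a measure" and V and \<Psi> :: "real \<Rightarrow> real" and W and k :: real +
  assumes Ws_mono: "\<And>x y. 0 \<le> x \<Longrightarrow> x \<le> y \<Longrightarrow> exp (- (k * x)) * W x \<le> exp (- (k * y)) * W y"
    and Ws_bounded: "\<exists>B. \<forall>x\<ge>0. exp (- (k * x)) * W x \<le> B"
    and harmonic: "\<And>x t. 0 < x \<Longrightarrow> 0 \<le> t \<Longrightarrow> KP t Wp x = Wp x"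
    and Psi_at_top: "filterlim \<Psi> at_top at_top"
begin

definition a :: "nat \<Rightarrow> real" where "a n = 1 / (\<Prod>i=1..n. \<Psi> (k + real i))"
definition J :: "real \<Rightarrow> real" where "J q = (\<Sum>n. a n * q ^ n)"

lemma a_0: "a 0 = 1" by (simp add: a_def)

lemma a_Suc: "a (Suc n) = a n / \<Psi> (k + real (Suc n))" by (simp add: a_def)

lemma a_pos: "0 < a n"
  unfolding a_def using Psi_pos by (auto intro!: prod_pos divide_pos_pos)

lemma a_summable: "summable (\<lambda>n. a n * q ^ n)"
proof -
  have "filterlim (\<lambda>n. k + real (Suc n)) at_top sequentially" by real_asymp
  from filterlim_compose[OF Psi_at_top this]
  have "\<forall>\<^sub>F n in sequentially. 2 * \<bar>q\<bar> + 1 \<le> \<Psi> (k + real (Suc n))" by (simp add: filterlim_at_top)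
  then obtain N where N: "\<And>n. N \<le> n \<Longrightarrow> 2 * \<bar>q\<bar> + 1 \<le> \<Psi> (k + real (Suc n))" by (auto simp: eventually_sequentially)
  show ?thesis
  proof (rule summable_ratio_test[of "1 / 2" N])
    fix n assume n: "N \<le> n"
    have P: "0 < \<Psi> (k + real (Suc n))" by (rule Psi_pos) simp
    have "\<bar>q\<bar> / \<Psi> (k + real (Suc n)) \<le> 1 / 2" using N[OF n] P by (simp add: field_simps)
    then have "\<bar>q\<bar> / \<Psi> (k + real (Suc n)) * (a n * \<bar>q\<bar> ^ n) \<le> 1 / 2 * (a n * \<bar>q\<bar> ^ n)"
      using a_pos[of n] by (intro mult_right_mono) auto
    then show "norm (a (Suc n) * q ^ Suc n) \<le> 1 / 2 * norm (a n * q ^ n)"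
      using P a_pos[of n] by (simp add: a_Suc abs_mult power_abs mult_ac)
  qed simp
qed

primrec Wn :: "nat \<Rightarrow> real \<Rightarrow> ennreal" where
  "Wn 0 = Wp"
| "Wn (Suc n) = conv Wp (\<lambda>y. ennreal (exp (- y)) * Wn n y)"

lemma Wn_measurable [measurable]: "Wn n \<in> borel_measurable borel"
  by (induction n) auto

lemma LT_exp: "f \<in> borel_measurable borel \<Longrightarrow> LT (\<lambda>y. ennreal (exp (- y)) * f y) l = LT f (l + 1)"
  unfolding LT_def
  by (intro nn_integral_cong) (simp add: mult.assoc[symmetric] ennreal_mult[symmetric] exp_add[symmetric] distrib_right)

text \<open>Each convolution with \<open>Wp\<close> contributes a factor
  \<open>1 / \<Psi> l\<close>, and each weight \<open>exp (- y)\<close> shifts the argument of the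
  remaining transform by 1. At \<open>l = k + 1\<close> this produces the coefficients of
  \<open>J\<close>.\<close>

lemma LT_Wn: "k < l \<Longrightarrow> LT (Wn n) l = ennreal (\<Prod>i\<le>n. 1 / \<Psi> (l + real i))"
proof (induction n arbitrary: l)
  case 0
  then show ?case by (simp add: LT_Wp)
next
  case (Suc n)
  have "LT (Wn (Suc n)) l = ennreal (1 / \<Psi> l) * LT (Wn n) (l + 1)"
    using Suc.prems by (simp add: LT_conv LT_Wp LT_exp)
  also have "\<dots> = ennreal (1 / \<Psi> l) * ennreal (\<Prod>i\<le>n. 1 / \<Psi> (l + 1 + real i))"
    using Suc.IH[of "l + 1"] Suc.prems by simp
  also have "\<dots> = ennreal (1 / \<Psi> l * (\<Prod>i\<le>n. 1 / \<Psi> (l + 1 + real i)))"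
    using Suc.prems Psi_pos by (intro ennreal_mult[symmetric] prod_nonneg) (auto simp: less_imp_le)
  also have "1 / \<Psi> l * (\<Prod>i\<le>n. 1 / \<Psi> (l + 1 + real i)) = (\<Prod>i\<le>Suc n. 1 / \<Psi> (l + real i))"
    unfolding prod.atMost_Suc_shift by (simp add: add.assoc)
  finally show ?case .
qed

lemma LT_Wn_k: "LT (Wn n) (k + 1) = ennreal (a (Suc n))"
proof -
  have "(\<Prod>i\<le>n. 1 / \<Psi> (k + 1 + real i)) = a (Suc n)"
    unfolding a_def prod.atLeast_Suc_atMost_Suc_shift One_nat_def atMost_atLeast0
    by (simp add: prod_dividef add.assoc)
  then show ?thesis by (simp add: LT_Wn)
qed

lemma Wp_shift:
  assumes "0 \<le> y"
  shows "Wp (x - y) \<le> Wp x * ennreal (exp (- (k * y)))"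
proof (cases "0 \<le> x - y")
  case True
  have "exp (- (k * (x - y))) * W (x - y) \<le> exp (- (k * x)) * W x"
    using True assms by (intro Ws_mono) auto
  then have "exp (k * (x - y)) * (exp (- (k * (x - y))) * W (x - y)) \<le> exp (k * (x - y)) * (exp (- (k * x)) * W x)"
    by (rule mult_left_mono) simp
  moreover have "exp (k * (x - y)) * exp (- (k * (x - y))) = 1" "exp (k * (x - y)) * exp (- (k * x)) = exp (- (k * y))"
    by (simp_all add: mult_exp_exp right_diff_distrib)
  ultimately have "W (x - y) \<le> W x * exp (- (k * y))"
    unfolding mult.assoc[symmetric] by (simp add: mult.commute)
  then show ?thesis using True assms W_nonneg
    by (simp add: Wp_def Wr_def ennreal_mult[symmetric] ennreal_leI)
qed (simp add: Wp_def Wr_def)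

context
  fixes q :: real
  assumes q: "0 < q"
begin

text \<open>\<open>w\<close> solves the renewal equation \<open>w = W + q * u\<close>, where
  \<open>u\<close> is the convolution of \<open>W\<close> with \<open>fw\<close>. Formally the
  generator maps \<open>u\<close> to \<open>fw\<close>, so \<open>w\<close> is harmonic on the
  positive half-line for the process killed at rate \<open>q * exp (- x)\<close>.\<close>

definition w :: "real \<Rightarrow> ennreal" where "w x = (\<Sum>n. ennreal (q ^ n) * Wn n x)"
definition fw :: "real \<Rightarrow> ennreal" where "fw y = ennreal (exp (- y)) * w y"
definition u :: "real \<Rightarrow> ennreal" where "u = conv Wp fw"

lemma w_measurable [measurable]: "w \<in> borel_measurable borel"
  unfolding w_def by measurable

lemma fw_measurable [measurable]: "fw \<in> borel_measurable borel"
  unfolding fw_def by measurable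

lemma u_measurable [measurable]: "u \<in> borel_measurable borel"
  unfolding u_def by measurable

lemma Wn_neg: "x < 0 \<Longrightarrow> Wn n x = 0"
proof (induction n arbitrary: x)
  case (Suc n)
  have "Wp (x - y) * (ennreal (exp (- y)) * Wn n y) = 0" for y
    using Suc by (cases "y < 0") (auto simp: Wp_def Wr_def)
  then have "Wn (Suc n) x = (\<integral>\<^sup>+y. 0 \<partial>(lborel :: real measure))"
    unfolding Wn.simps conv_def by (intro nn_integral_cong)
  then show ?case by simp
qed (simp add: Wp_def Wr_def)

lemma w_neg: "x < 0 \<Longrightarrow> w x = 0"
  by (simp add: w_def Wn_neg)

lemma w_eq: "w x = Wp x + ennreal q * u x"
proof -
  have "(\<lambda>n. ennreal (q ^ Suc n) * Wn (Suc n) x) sums (\<Sum>n. ennreal (q ^ Suc n) * Wn (Suc n) x)"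
    by (intro summable_sums summableI)
  from sums_Suc[OF this[unfolded], of] have "w x = (\<Sum>n. ennreal (q ^ Suc n) * Wn (Suc n) x) + Wp x"
    by (auto simp: w_def sums_iff)
  also have "(\<Sum>n. ennreal (q ^ Suc n) * Wn (Suc n) x) = (\<Sum>n. \<integral>\<^sup>+y. ennreal q * (Wp (x - y) * (ennreal (exp (- y)) * (ennreal (q ^ n) * Wn n y))) \<partial>lborel)"
  proof (rule suminf_cong)
    fix n
    have "ennreal (q ^ Suc n) * Wn (Suc n) x = (\<integral>\<^sup>+y. ennreal (q ^ Suc n) * (Wp (x - y) * (ennreal (exp (- y)) * Wn n y)) \<partial>lborel)"
      by (simp add: conv_def nn_integral_cmult)
    also have "\<dots> = (\<integral>\<^sup>+y. ennreal q * (Wp (x - y) * (ennreal (exp (- y)) * (ennreal (q ^ n) * Wn n y))) \<partial>lborel)"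
      using q by (intro nn_integral_cong) (simp add: ennreal_mult mult_ac)
    finally show "ennreal (q ^ Suc n) * Wn (Suc n) x =
      (\<integral>\<^sup>+y. ennreal q * (Wp (x - y) * (ennreal (exp (- y)) * (ennreal (q ^ n) * Wn n y))) \<partial>lborel)" .
  qed
  also have "\<dots> = (\<integral>\<^sup>+y. (\<Sum>n. ennreal q * (Wp (x - y) * (ennreal (exp (- y)) * (ennreal (q ^ n) * Wn n y)))) \<partial>lborel)"
    by (rule nn_integral_suminf[symmetric]) measurable
  also have "\<dots> = (\<integral>\<^sup>+y. ennreal q * (Wp (x - y) * fw y) \<partial>lborel)"
    by (simp add: fw_def w_def)
  also have "\<dots> = ennreal q * u x" by (simp add: nn_integral_cmult u_def conv_def)
  finally show ?thesis by (simp add: add.commute)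
qed

lemma LT_w: "LT w l = (\<Sum>n. ennreal (q ^ n) * LT (Wn n) l)"
proof -
  have "LT w l = (\<integral>\<^sup>+x. (\<Sum>n. ennreal (q ^ n) * (ennreal (exp (- (l * x))) * Wn n x)) \<partial>lborel)"
    by (simp add: LT_def w_def mult.left_commute[of "ennreal (q ^ _)"])
  also have "\<dots> = (\<Sum>n. ennreal (q ^ n) * LT (Wn n) l)"
    unfolding LT_def by (subst nn_integral_suminf) (auto simp: nn_integral_cmult)
  finally show ?thesis .
qed

lemma J_split: "J q = 1 + q * (\<Sum>n. q ^ n * a (Suc n))" "summable (\<lambda>n. q ^ n * a (Suc n))"
proof -
  have s: "summable (\<lambda>n. a (Suc n) * q ^ Suc n)" using a_summable[of q] by (subst summable_Suc_iff)
  have "(\<lambda>n. a (Suc n) * q ^ Suc n) = (\<lambda>n. q * (q ^ n * a (Suc n)))" by (simp add: fun_eq_iff mult_ac)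
  with s have s': "summable (\<lambda>n. q * (q ^ n * a (Suc n)))" by simp
  then show s'': "summable (\<lambda>n. q ^ n * a (Suc n))" using q by (simp add: summable_mult_D)
  have "J q = a 0 + (\<Sum>n. a (Suc n) * q ^ Suc n)"
    unfolding J_def using suminf_split_head[OF a_summable[of q]] by simp
  also have "(\<Sum>n. a (Suc n) * q ^ Suc n) = q * (\<Sum>n. q ^ n * a (Suc n))"
    by (subst suminf_mult[symmetric, OF s'']) (simp add: mult_ac)
  finally show "J q = 1 + q * (\<Sum>n. q ^ n * a (Suc n))" by (simp add: a_0)
qed

lemma LT_fw: "LT fw k = ennreal ((J q - 1) / q)"
proof -
  have "LT fw k = LT w (k + 1)" unfolding fw_def[abs_def] by (rule LT_exp) measurable
  also have "\<dots> = (\<Sum>n. ennreal (q ^ n * a (Suc n)))"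
    unfolding LT_w LT_Wn_k using q a_pos by (simp add: ennreal_mult less_imp_le)
  also have "\<dots> = ennreal (\<Sum>n. q ^ n * a (Suc n))"
    using q a_pos J_split(2) by (intro suminf_ennreal2) (auto simp: less_imp_le)
  finally show ?thesis using q J_split(1) by simp
qed

lemma J_ge_1: "1 \<le> J q"
proof -
  have "0 \<le> (\<Sum>n. q ^ n * a (Suc n))"
    using J_split(2) q a_pos by (intro suminf_nonneg) (auto simp: less_imp_le)
  then show ?thesis using J_split(1) q by simp
qed

text \<open>Monotonicity of the weighted scale function compares \<open>W (x - y)\<close> with
  \<open>exp (- (k * y)) * W x\<close>; what remains is the transform of \<open>fw\<close> at
  \<open>k\<close>, equal to \<open>(J q - 1) / q\<close>. This is why the quotient of
  \<open>w\<close> and \<open>W\<close> is bounded by \<open>J q\<close>.\<close>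

lemma u_le: "u x \<le> Wp x * ennreal ((J q - 1) / q)"
proof -
  have "u x \<le> (\<integral>\<^sup>+y. Wp x * (ennreal (exp (- (k * y))) * fw y) \<partial>lborel)"
    unfolding u_def conv_def
  proof (rule nn_integral_mono)
    fix y
    show "Wp (x - y) * fw y \<le> Wp x * (ennreal (exp (- (k * y))) * fw y)"
    proof (cases "0 \<le> y")
      case True
      then show ?thesis using mult_right_mono[OF Wp_shift[OF True, of x], of "fw y"] by (simp add: mult.assoc)
    qed (simp add: fw_def w_neg)
  qed
  also have "\<dots> = Wp x * LT fw k" unfolding LT_def by (rule nn_integral_cmult) measurable
  finally show ?thesis by (simp add: LT_fw)
qed

lemma w_le: "w x \<le> Wp x * ennreal (J q)"
proof -
  have "ennreal q * u x \<le> ennreal q * (Wp x * ennreal ((J q - 1) / q))"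
    by (intro mult_left_mono u_le) simp
  also have "\<dots> = Wp x * ennreal (J q - 1)"
    using q J_ge_1 by (simp add: mult.left_commute[of "ennreal q"] ennreal_mult[symmetric])
  finally have "w x \<le> Wp x * 1 + Wp x * ennreal (J q - 1)" unfolding w_eq by (simp add: add_left_mono)
  also have "\<dots> = Wp x * ennreal (J q)"
    using J_ge_1 by (simp add: distrib_left[symmetric] ennreal_plus[symmetric] del: ennreal_plus flip: ennreal_1)
  finally show ?thesis .
qed

lemma Wp_finite: "Wp x < \<infinity>" by (simp add: Wp_def)

lemma u_finite: "u x < \<infinity>"
  using u_le[of x] Wp_finite[of x] by (auto simp: ennreal_mult_less_top intro: order_le_less_trans)

lemma w_finite: "w x < \<infinity>"
  using w_le[of x] Wp_finite[of x] by (auto simp: ennreal_mult_less_top intro: order_le_less_trans)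

lemma fw_le: "fw y \<le> Wp y * ennreal (J q)"
proof (cases "y < 0")
  case False
  then have "fw y \<le> 1 * w y" unfolding fw_def by (intro mult_right_mono) auto
  then show ?thesis using w_le[of y] by (simp add: order_trans)
qed (simp add: fw_def w_neg)

lemma u_nonpos: "x \<le> 0 \<Longrightarrow> u x = 0"
proof -
  assume x: "x \<le> 0"
  have "u x = (\<integral>\<^sup>+y. 0 \<partial>(lborel :: real measure))"
    unfolding u_def conv_def
  proof (intro nn_integral_cong_AE, use AE_lborel_singleton[of 0] in eventually_elim)
    fix y :: real assume "y \<noteq> 0"
    then show "Wp (x - y) * fw y = 0"
      using x by (cases "y < 0") (auto simp: fw_def w_neg Wp_def Wr_def)
  qed
  then show ?thesis by simp
qed

lemma Wr_tendsto:
  assumes lim: "(zs \<longlongrightarrow> z) F" and z: "z \<noteq> 0"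
  shows "((\<lambda>n. Wr (zs n)) \<longlongrightarrow> Wr z) F"
proof (cases "0 < z")
  case True
  have "isCont W z" by (rule continuous_on_interior[OF W_cont]) (use True in simp)
  then have "((\<lambda>n. W (zs n)) \<longlongrightarrow> W z) F" using lim by (rule isCont_tendsto_compose)
  moreover have "\<forall>\<^sub>F n in F. Wr (zs n) = W (zs n)"
    using order_tendstoD(1)[OF lim True] by eventually_elim (simp add: Wr_def)
  ultimately show ?thesis using True by (simp add: Wr_def tendsto_cong)
next
  case False
  then have "z < 0" using z by simp
  from order_tendstoD(2)[OF lim this] have "\<forall>\<^sub>F n in F. Wr (zs n) = 0" by eventually_elim (simp add: Wr_def)
  then show ?thesis using \<open>z < 0\<close> by (simp add: Wr_def tendsto_eventually)
qed

lemma u_tendsto: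
  assumes lim: "zs \<longlonglongrightarrow> z"
  shows "(\<lambda>n. u (zs n)) \<longlonglongrightarrow> u z"
proof -
  obtain N where N: "\<And>n. N \<le> n \<Longrightarrow> zs n < z + 1"
    using order_tendstoD(2)[OF lim, of "z + 1"] by (auto simp: eventually_sequentially)
  have "(\<lambda>n. u (zs (n + N))) \<longlonglongrightarrow> u z"
    unfolding u_def conv_def
  proof (rule nn_integral_dominated_convergence[where w="\<lambda>y. Wp (z + 1 - y) * fw y"])
    show "(\<integral>\<^sup>+y. Wp (z + 1 - y) * fw y \<partial>lborel) < \<infinity>" using u_finite[of "z + 1"] by (simp add: u_def conv_def)
    show "AE y in lborel. Wp (zs (n + N) - y) * fw y \<le> Wp (z + 1 - y) * fw y" for n
      using N[of "n + N"] by (intro AE_I2 mult_right_mono Wp_mono) auto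
    have lim': "(\<lambda>n. zs (n + N)) \<longlonglongrightarrow> z" using lim by (rule LIMSEQ_ignore_initial_segment)
    show "AE y in lborel. (\<lambda>n. Wp (zs (n + N) - y) * fw y) \<longlonglongrightarrow> Wp (z - y) * fw y"
      using AE_lborel_singleton[of z]
    proof eventually_elim
      fix y assume "y \<noteq> z"
      then have "(\<lambda>n. Wr (zs (n + N) - y)) \<longlonglongrightarrow> Wr (z - y)"
        by (intro Wr_tendsto tendsto_diff lim' tendsto_const) simp
      then have "(\<lambda>n. Wp (zs (n + N) - y)) \<longlonglongrightarrow> Wp (z - y)" unfolding Wp_def by (rule tendsto_ennrealI)
      moreover have "fw y < \<infinity>" using fw_le[of y] Wp_finite[of y] by (auto simp: ennreal_mult_less_top intro: order_le_less_trans)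
      ultimately show "(\<lambda>n. Wp (zs (n + N) - y) * fw y) \<longlonglongrightarrow> Wp (z - y) * fw y"
        using ennreal_tendsto_cmult[of "fw y"] by (simp add: mult.commute[of _ "fw y"])
    qed
  qed measurable
  then show ?thesis by (rule LIMSEQ_offset)
qed

lemma w_tendsto:
  assumes "zs \<longlonglongrightarrow> z" "z \<noteq> 0"
  shows "(\<lambda>n. w (zs n)) \<longlonglongrightarrow> w z"
proof -
  have "(\<lambda>n. Wp (zs n) + ennreal q * u (zs n)) \<longlonglongrightarrow> Wp z + ennreal q * u z"
    unfolding Wp_def using assms u_finite[of z]
    by (intro tendsto_add tendsto_ennrealI Wr_tendsto ennreal_tendsto_cmult u_tendsto) auto
  then show ?thesis by (simp add: w_eq)
qed

lemma fw_tendsto: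
  assumes "zs \<longlonglongrightarrow> z" "z \<noteq> 0"
  shows "(\<lambda>n. fw (zs n)) \<longlonglongrightarrow> fw z"
proof -
  define r where "r y = enn2real (w y)" for y
  have r: "w y = ennreal (r y)" "0 \<le> r y" for y
    using w_finite[of y] by (simp_all add: r_def less_top)
  have "(\<lambda>n. r (zs n)) \<longlonglongrightarrow> r z"
    using w_tendsto[OF assms] r(2) unfolding r(1) by (simp add: tendsto_ennreal_iff)
  then have "(\<lambda>n. ennreal (exp (- zs n) * r (zs n))) \<longlonglongrightarrow> ennreal (exp (- z) * r z)"
    using assms by (intro tendsto_ennrealI tendsto_intros)
  then show ?thesis by (simp add: fw_def r ennreal_mult)
qed

lemma u_identity_AE:
  assumes t: "0 < t"
  shows "AE x in lborel. KP t u x = u x + (\<integral>\<^sup>+s. KP s fw x * indicator {0..t} s \<partial>lborel)"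
proof (rule killed_identity_AE[OF _ _ u_nonpos _ t])
  show "AE z in lborel. PP h u z = u z + (\<integral>\<^sup>+s. PP s fw z * indicator {0..h} s \<partial>lborel)" if h: "0 < h" for h
  proof (rule free_identity[where c=k])
    fix l assume l: "k < l"
    have LTu: "LT u l = ennreal (1 / \<Psi> l) * LT fw l"
      unfolding u_def by (subst LT_conv) (auto simp: LT_Wp[OF l])
    have "LT fw l \<le> LT (\<lambda>y. ennreal (J q) * Wp y) l"
      unfolding LT_def by (intro nn_integral_mono mult_left_mono) (auto simp: fw_le mult.commute)
    also have "\<dots> < \<infinity>" by (simp add: LT_cmult LT_Wp[OF l] ennreal_mult_less_top)
    finally show "LT u l < \<infinity>" by (simp add: LTu ennreal_mult_less_top)
    show "LT fw l = ennreal (\<Psi> l) * LT u l"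
      unfolding LTu mult.assoc[symmetric] using Psi_pos[OF l] by (simp add: ennreal_mult[symmetric])
  qed (use h c_nonneg Psi_pos in auto)
  show "AE z in lborel. PP t u z < \<infinity>"
  proof (rule AE_I2)
    fix z
    have "PP t u z \<le> (\<integral>\<^sup>+\<omega>. Wp (z + V (max 0 t) \<omega>) * ennreal ((J q - 1) / q) \<partial>M)"
      unfolding PP_def by (intro nn_integral_mono u_le)
    also have "\<dots> = PP t Wp z * ennreal ((J q - 1) / q)" unfolding PP_def by (rule nn_integral_multc) measurable
    also have "\<dots> < \<infinity>" using PP_Wp_finite[of t z] t by (simp add: ennreal_mult_less_top)
    finally show "PP t u z < \<infinity>" .
  qed
qed (auto simp: fw_def w_neg)

text \<open>Survival is the strict condition \<open>0 < x + m\<close> with \<open>m\<close> the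
  running infimum, hence left-continuous in the starting point \<open>x\<close>. On survival the
  final position is positive, so continuity of \<open>g\<close> away from 0 suffices.\<close>

lemma KP_left_tendsto:
  assumes [measurable]: "g \<in> borel_measurable borel" and t: "0 \<le> t"
    and zs: "zs \<longlonglongrightarrow> z" "\<And>n. zs n \<le> z"
    and cont: "\<And>ys y. ys \<longlonglongrightarrow> y \<Longrightarrow> y \<noteq> 0 \<Longrightarrow> (\<lambda>n. g (ys n)) \<longlonglongrightarrow> g y"
    and bound: "\<And>y. g y \<le> Wp y * ennreal C"
  shows "(\<lambda>n. KP t g (zs n)) \<longlonglongrightarrow> KP t g z"
  unfolding KP_def
proof (rule nn_integral_dominated_convergence[where w="\<lambda>\<omega>. Wp (z + V (max 0 t) \<omega>) * ennreal C"])
  show "(\<integral>\<^sup>+\<omega>. Wp (z + V (max 0 t) \<omega>) * ennreal C \<partial>M) < \<infinity>"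
    using PP_Wp_finite[OF t, of z] by (subst nn_integral_multc) (auto simp: PP_def[symmetric] ennreal_mult_less_top)
  show "AE \<omega> in M. kill t (zs n) \<omega> * g (zs n + V (max 0 t) \<omega>) \<le> Wp (z + V (max 0 t) \<omega>) * ennreal C" for n
  proof (rule AE_I2)
    fix \<omega>
    have "kill t (zs n) \<omega> * g (zs n + V (max 0 t) \<omega>) \<le> 1 * g (zs n + V (max 0 t) \<omega>)"
      by (intro mult_right_mono) (auto simp: kill_def)
    also have "\<dots> \<le> Wp (zs n + V (max 0 t) \<omega>) * ennreal C" using bound by simp
    also have "\<dots> \<le> Wp (z + V (max 0 t) \<omega>) * ennreal C" using zs(2) by (intro mult_right_mono Wp_mono) auto
    finally show "kill t (zs n) \<omega> * g (zs n + V (max 0 t) \<omega>) \<le> Wp (z + V (max 0 t) \<omega>) * ennreal C" .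
  qed
  show "AE \<omega> in M. (\<lambda>n. kill t (zs n) \<omega> * g (zs n + V (max 0 t) \<omega>)) \<longlonglongrightarrow> kill t z \<omega> * g (z + V (max 0 t) \<omega>)"
    using AE_space
  proof eventually_elim
    fix \<omega> assume \<omega>: "\<omega> \<in> space M"
    define m where "m = runinf (\<lambda>r. V r \<omega>) (max 0 t)"
    have mV: "m \<le> V (max 0 t) \<omega>" unfolding m_def by (rule runinf_le[OF cadlag_paths[OF \<omega>]]) auto
    show "(\<lambda>n. kill t (zs n) \<omega> * g (zs n + V (max 0 t) \<omega>)) \<longlonglongrightarrow> kill t z \<omega> * g (z + V (max 0 t) \<omega>)"
    proof (cases "0 < z + m")
      case True
      have lim: "(\<lambda>n. zs n + m) \<longlonglongrightarrow> z + m" by (intro tendsto_intros zs)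
      have "\<forall>\<^sub>F n in sequentially. 0 < zs n + m" by (rule order_tendstoD(1)[OF lim True])
      then have ev: "\<forall>\<^sub>F n in sequentially. g (zs n + V (max 0 t) \<omega>) = kill t (zs n) \<omega> * g (zs n + V (max 0 t) \<omega>)"
        by eventually_elim (simp add: kill_def m_def)
      have "(\<lambda>n. g (zs n + V (max 0 t) \<omega>)) \<longlonglongrightarrow> g (z + V (max 0 t) \<omega>)"
        using True mV by (intro cont tendsto_intros zs) auto
      then show ?thesis using True ev by (simp add: kill_def m_def tendsto_cong[OF ev])
    next
      case False
      have "zs n + m \<le> 0" for n using False zs(2)[of n] by simp
      then have "kill t (zs n) \<omega> = 0" for n by (simp add: kill_def m_def not_less)
      then show ?thesis using False by (simp add: kill_def m_def)
    qed
  qed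
qed measurable

text \<open>The exceptional null set of \<open>u_identity_AE\<close> is avoided by approaching
  \<open>x\<close> from the left through points where the identity holds.\<close>

lemma u_identity:
  assumes x: "0 < x" and t: "0 < t"
  shows "KP t u x = u x + (\<integral>\<^sup>+s. KP s fw x * indicator {0..t} s \<partial>lborel)"
proof -
  have "\<exists>y. x - 1 / real (Suc n) < y \<and> y < x \<and> KP t u y = u y + (\<integral>\<^sup>+s. KP s fw y * indicator {0..t} s \<partial>lborel)" for n
    by (rule AE_lborel_dense[OF u_identity_AE[OF t], of "x - 1 / real (Suc n)" x]) auto
  then obtain y where y: "\<And>n. x - 1 / real (Suc n) < y n" "\<And>n. y n < x"
    "\<And>n. KP t u (y n) = u (y n) + (\<integral>\<^sup>+s. KP s fw (y n) * indicator {0..t} s \<partial>lborel)" by metis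
  have lim0: "(\<lambda>n. x - 1 / real (Suc n)) \<longlonglongrightarrow> x" by real_asymp
  have lim: "y \<longlonglongrightarrow> x"
    by (rule tendsto_sandwich[OF _ _ lim0 tendsto_const]) (use y in \<open>auto intro!: always_eventually less_imp_le\<close>)
  have yx: "y n \<le> x" for n using y(2)[of n] by simp
  have "(\<lambda>n. KP t u (y n)) \<longlonglongrightarrow> KP t u x"
    by (rule KP_left_tendsto[OF _ _ lim yx _ u_le]) (use t u_tendsto in auto)
  moreover have "(\<lambda>n. \<integral>\<^sup>+s. KP s fw (y n) * indicator {0..t} s \<partial>lborel) \<longlonglongrightarrow> (\<integral>\<^sup>+s. KP s fw x * indicator {0..t} s \<partial>lborel)"
  proof (rule nn_integral_dominated_convergence[where w="\<lambda>s. PP s Wp x * ennreal (J q) * indicator {0..t} s"])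
    obtain C where C: "0 < C" "\<And>x. Wp x \<le> ennreal (C * exp ((k + 1) * x))" using Wp_bound by blast
    define B where "B = C * exp ((k + 1) * x) * exp (t * \<Psi> (k + 1))"
    have Pk: "0 < \<Psi> (k + 1)" by (rule Psi_pos) simp
    have PB: "PP s Wp x \<le> ennreal B" if "s \<in> {0..t}" for s
    proof -
      have "PP s Wp x \<le> PP s (\<lambda>z. ennreal (C * exp ((k + 1) * z))) x" by (rule PP_mono[OF C(2)])
      also have "\<dots> = ennreal (C * exp ((k + 1) * x) * exp (s * \<Psi> (k + 1)))"
        using that C c_nonneg by (intro PP_exp) auto
      also have "\<dots> \<le> ennreal B" unfolding B_def using that C Pk by (intro ennreal_leI mult_left_mono) auto
      finally show ?thesis .
    qed
    have "(\<integral>\<^sup>+s. PP s Wp x * ennreal (J q) * indicator {0..t} s \<partial>lborel) \<le> (\<integral>\<^sup>+s. ennreal B * ennreal (J q) * indicator {0..t} s \<partial>lborel)"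
      using PB by (intro nn_integral_mono) (auto simp: indicator_def intro!: mult_right_mono)
    also have "\<dots> < \<infinity>" using t by (simp add: nn_integral_cmult_indicator ennreal_mult_less_top)
    finally show "(\<integral>\<^sup>+s. PP s Wp x * ennreal (J q) * indicator {0..t} s \<partial>lborel) < \<infinity>" .
    show "AE s in lborel. KP s fw (y n) * indicator {0..t} s \<le> PP s Wp x * ennreal (J q) * indicator {0..t} s" for n
    proof (rule AE_I2)
      fix s
      have "KP s fw (y n) \<le> (\<integral>\<^sup>+\<omega>. Wp (x + V (max 0 s) \<omega>) * ennreal (J q) \<partial>M)"
        unfolding KP_def
      proof (rule nn_integral_mono)
        fix \<omega>
        have "kill s (y n) \<omega> * fw (y n + V (max 0 s) \<omega>) \<le> 1 * fw (y n + V (max 0 s) \<omega>)"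
          by (intro mult_right_mono) (auto simp: kill_def)
        also have "\<dots> \<le> Wp (y n + V (max 0 s) \<omega>) * ennreal (J q)" using fw_le by simp
        also have "\<dots> \<le> Wp (x + V (max 0 s) \<omega>) * ennreal (J q)" using yx by (intro mult_right_mono Wp_mono) auto
        finally show "kill s (y n) \<omega> * fw (y n + V (max 0 s) \<omega>) \<le> Wp (x + V (max 0 s) \<omega>) * ennreal (J q)" .
      qed
      also have "\<dots> = PP s Wp x * ennreal (J q)" unfolding PP_def by (rule nn_integral_multc) measurable
      finally show "KP s fw (y n) * indicator {0..t} s \<le> PP s Wp x * ennreal (J q) * indicator {0..t} s"
        by (rule mult_right_mono) simp
    qed
    show "AE s in lborel. (\<lambda>n. KP s fw (y n) * indicator {0..t} s) \<longlonglongrightarrow> KP s fw x * indicator {0..t} s"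
    proof (rule AE_I2)
      fix s
      show "(\<lambda>n. KP s fw (y n) * indicator {0..t} s) \<longlonglongrightarrow> KP s fw x * indicator {0..t} s"
      proof (cases "s \<in> {0..t}")
        case True
        then show ?thesis using KP_left_tendsto[OF fw_measurable _ lim yx fw_tendsto fw_le, of s] by simp
      qed simp
    qed
  qed measurable
  ultimately have "(\<lambda>n. KP t u (y n)) \<longlonglongrightarrow> u x + (\<integral>\<^sup>+s. KP s fw x * indicator {0..t} s \<partial>lborel)"
    unfolding y(3) by (intro tendsto_add u_tendsto lim)
  with \<open>(\<lambda>n. KP t u (y n)) \<longlonglongrightarrow> KP t u x\<close> show ?thesis by (rule LIMSEQ_unique)
qed

text \<open>The quotient of \<open>w\<close> and \<open>W\<close>, continued by 1. By
  \<open>K_near_0\<close> the continuation is continuous at 0, so \<open>K\<close> is bounded and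
  continuous on the whole line, as a test function for convergence in distribution must be.\<close>

definition K :: "real \<Rightarrow> real" where
  "K z = (if z \<le> 0 then 1 else enn2real (w z) / W z)"

lemma w_K: "w z = Wp z * ennreal (K z)"
proof (cases "0 < z")
  case True
  have "w z = ennreal (enn2real (w z))" using w_finite[of z] by (simp add: less_top)
  also have "\<dots> = ennreal (W z * (enn2real (w z) / W z))" using W_pos[OF True] by simp
  also have "\<dots> = Wp z * ennreal (K z)"
    using True W_pos[OF True] by (subst ennreal_mult) (auto simp: K_def Wp_def Wr_def)
  finally show ?thesis .
next
  case False
  then show ?thesis by (cases "z = 0") (auto simp: w_eq u_nonpos K_def w_neg Wp_def Wr_def)
qed

lemma fw_K: "fw z = Wp z * ennreal (exp (- max z 0) * K z)"
proof (cases "z < 0")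
  case False
  then show ?thesis by (simp add: fw_def w_K ennreal_mult' mult.left_commute max_def)
qed (simp add: fw_def w_neg Wp_def Wr_def)

lemma K_ge_1: "1 \<le> K z"
proof (cases "0 < z")
  case True
  have "ennreal (W z) \<le> w z" using True by (simp add: w_eq Wp_def Wr_def)
  then have "W z \<le> enn2real (w z)"
    using w_finite[of z] W_nonneg[of z] True by (metis enn2real_ennreal enn2real_mono infinity_ennreal_def less_imp_le)
  then show ?thesis using True W_pos[OF True] by (simp add: K_def)
qed (simp add: K_def)

lemma K_upper:
  assumes z: "0 < z" and le: "w z \<le> Wp z * ennreal C" and C: "0 \<le> C"
  shows "K z \<le> C"
proof -
  have "enn2real (w z) \<le> W z * C"
    using z W_pos[OF z] le C by (intro enn2real_leI) (auto simp: Wp_def Wr_def ennreal_mult[symmetric])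
  then show ?thesis using z W_pos[OF z] by (simp add: K_def field_simps)
qed

lemma K_le_J: "K z \<le> J q"
  using K_upper[OF _ w_le] J_ge_1 by (cases "0 < z") (auto simp: K_def)

text \<open>The convolution defining \<open>u z\<close> runs over an interval of length
  \<open>z\<close>, and \<open>W (z - y) \<le> W z\<close> there. So \<open>u z\<close> is
  \<open>W z\<close> times a quantity of order \<open>z\<close>, and \<open>W z\<close> cancels in
  the quotient whatever its behaviour at 0.\<close>

lemma K_near_0:
  assumes z: "0 < z" "z \<le> 1"
  shows "K z \<le> 1 + q * (J q * W 1 * z)"
proof (rule K_upper[OF z(1)])
  define C where "C = J q * W 1"
  have C: "0 \<le> C" using J_ge_1 W_nonneg[of 1] by (simp add: C_def)
  have "u z \<le> (\<integral>\<^sup>+y. Wp z * ennreal C * indicator {0..z} y \<partial>lborel)"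
    unfolding u_def conv_def
  proof (rule nn_integral_mono)
    fix y
    show "Wp (z - y) * fw y \<le> Wp z * ennreal C * indicator {0..z} y"
    proof (cases "y \<in> {0..z}")
      case True
      have "fw y \<le> Wp 1 * ennreal (J q)" using True z by (intro order_trans[OF fw_le] mult_right_mono Wp_mono) auto
      also have "\<dots> = ennreal C" using W_nonneg[of 1] J_ge_1 by (simp add: Wp_def Wr_def C_def ennreal_mult[symmetric] mult.commute)
      finally show ?thesis using True by (auto intro!: mult_mono Wp_mono)
    next
      case False
      then show ?thesis by (auto simp: fw_def w_neg Wp_def Wr_def)
    qed
  qed
  also have "\<dots> = Wp z * ennreal (C * z)" using z C by (subst nn_integral_cmult_indicator) (auto simp: ennreal_mult mult.assoc)
  finally have "ennreal q * u z \<le> ennreal q * (Wp z * ennreal (C * z))" by (rule mult_left_mono) simp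
  then have "w z \<le> Wp z * 1 + Wp z * ennreal (q * (C * z))"
    unfolding w_eq using q C z by (simp add: ennreal_mult mult_ac add_left_mono)
  also have "\<dots> = Wp z * ennreal (1 + q * (C * z))"
    using q C z by (simp add: distrib_left[symmetric] ennreal_plus[symmetric] del: ennreal_plus flip: ennreal_1)
  finally show "w z \<le> Wp z * ennreal (1 + q * (J q * W 1 * z))" by (simp add: C_def)
  show "0 \<le> 1 + q * (J q * W 1 * z)" using q C z by (simp add: C_def)
qed

lemma K_continuous: "isCont K z"
proof (rule continuous_at_sequentiallyI)
  fix zs assume lim: "zs \<longlonglongrightarrow> z"
  consider "z < 0" | "z = 0" | "0 < z" by linarith
  then show "(\<lambda>n. K (zs n)) \<longlonglongrightarrow> K z"
  proof cases
    case 1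
    have "\<forall>\<^sub>F n in sequentially. K (zs n) = K z"
      using order_tendstoD(2)[OF lim 1] by eventually_elim (use 1 in \<open>simp add: K_def\<close>)
    then show ?thesis by (rule tendsto_eventually)
  next
    case 2
    have "(\<lambda>n. 1 + q * (J q * W 1 * max 0 (zs n))) \<longlonglongrightarrow> 1 + q * (J q * W 1 * max 0 z)"
      by (intro tendsto_intros lim)
    then have up: "(\<lambda>n. 1 + q * (J q * W 1 * max 0 (zs n))) \<longlonglongrightarrow> 1" using 2 by simp
    have ev: "\<forall>\<^sub>F n in sequentially. K (zs n) \<le> 1 + q * (J q * W 1 * max 0 (zs n))"
      using order_tendstoD(2)[OF lim, of 1, simplified 2, simplified]
    proof eventually_elim
      case (elim n)
      then show ?case using K_near_0[of "zs n"] by (cases "0 < zs n") (auto simp: K_def max_def)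
    qed
    have "(\<lambda>n. K (zs n)) \<longlonglongrightarrow> 1"
      by (rule tendsto_sandwich[OF _ ev tendsto_const up]) (simp add: K_ge_1)
    then show ?thesis using 2 by (simp add: K_def)
  next
    case 3
    have "(\<lambda>n. enn2real (w (zs n)) / Wr (zs n)) \<longlonglongrightarrow> enn2real (w z) / Wr z"
    proof (rule tendsto_divide)
      have "(\<lambda>n. w (zs n)) \<longlonglongrightarrow> ennreal (enn2real (w z))"
        using w_tendsto[OF lim] 3 w_finite[of z] by (simp add: less_top)
      then show "(\<lambda>n. enn2real (w (zs n))) \<longlonglongrightarrow> enn2real (w z)" by (rule tendsto_enn2real) simp
      show "(\<lambda>n. Wr (zs n)) \<longlonglongrightarrow> Wr z" using 3 by (intro Wr_tendsto lim) simp
      show "Wr z \<noteq> 0" using W_pos[OF 3] 3 by (simp add: Wr_def)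
    qed
    moreover have "\<forall>\<^sub>F n in sequentially. enn2real (w (zs n)) / Wr (zs n) = K (zs n)"
      using order_tendstoD(1)[OF lim 3] by eventually_elim (simp add: K_def Wr_def)
    ultimately show ?thesis using 3 by (simp add: tendsto_cong K_def Wr_def)
  qed
qed

lemma K_measurable [measurable]: "K \<in> borel_measurable borel"
  by (rule borel_measurable_continuous_onI) (simp add: continuous_at_imp_continuous_on K_continuous)

lemma Ws_limit: "\<exists>L>0. ((\<lambda>x. exp (- (k * x)) * W x) \<longlongrightarrow> L) at_top"
proof -
  define Ws where "Ws x = exp (- (k * x)) * W x" for x
  obtain B where B: "\<And>x. 0 \<le> x \<Longrightarrow> Ws x \<le> B" using Ws_bounded unfolding Ws_def by blast
  define L where "L = (SUP x\<in>{0..}. Ws x)"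
  have bdd: "bdd_above (Ws ` {0..})" using B by (auto intro!: bdd_aboveI2)
  have L: "Ws x \<le> L" if "0 \<le> x" for x unfolding L_def using that bdd by (intro cSUP_upper) auto
  have "(Ws \<longlongrightarrow> L) at_top"
  proof (rule order_tendstoI)
    fix y assume "y < L"
    then obtain x0 where x0: "0 \<le> x0" "y < Ws x0"
      unfolding L_def using bdd by (subst (asm) less_cSUP_iff) auto
    then show "\<forall>\<^sub>F x in at_top. y < Ws x"
      using Ws_mono[OF x0(1)] by (intro eventually_mono[OF eventually_ge_at_top[of x0]]) (auto simp: Ws_def intro: order_less_le_trans)
  next
    fix y assume "L < y"
    then show "\<forall>\<^sub>F x in at_top. Ws x < y"
      using L by (intro eventually_mono[OF eventually_ge_at_top[of 0]]) (auto intro: order_le_less_trans)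
  qed
  moreover have "0 < Ws 1" using W_pos[of 1] by (simp add: Ws_def)
  ultimately show ?thesis using L[of 1] unfolding Ws_def by (intro exI[of _ L]) auto
qed

text \<open>\<open>(K x - 1) / q\<close> is the integral of \<open>W (x - y) / W x\<close> against
  \<open>fw\<close>. The quotient tends to \<open>exp (- (k * y))\<close>, because the weighted
  scale function has a positive limit, and it is dominated by this limit; so the integral tends to
  \<open>LT fw k\<close>.\<close>

lemma K_at_top: "(K \<longlongrightarrow> J q) at_top"
proof (rule tendsto_at_topI_sequentially)
  fix X :: "nat \<Rightarrow> real" assume X: "filterlim X at_top sequentially"
  obtain L where L: "0 < L" "((\<lambda>x. exp (- (k * x)) * W x) \<longlongrightarrow> L) at_top" using Ws_limit by blast
  define r where "r n y = Wr (X n - y) / Wr (X n)" for n y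
  have Xpos: "\<forall>\<^sub>F n in sequentially. 0 < X n" using X by (simp add: filterlim_at_top_dense)
  obtain N where N: "\<And>n. N \<le> n \<Longrightarrow> 0 < X n" using Xpos by (auto simp: eventually_sequentially)
  have "(\<lambda>n. \<integral>\<^sup>+y. ennreal (r (n + N) y) * fw y \<partial>lborel) \<longlonglongrightarrow> (\<integral>\<^sup>+y. ennreal (exp (- (k * y))) * fw y \<partial>lborel)"
  proof (rule nn_integral_dominated_convergence[where w="\<lambda>y. ennreal (exp (- (k * y))) * fw y"])
    show "(\<integral>\<^sup>+y. ennreal (exp (- (k * y))) * fw y \<partial>lborel) < \<infinity>" using LT_fw by (simp add: LT_def)
    show "AE y in lborel. ennreal (r (n + N) y) * fw y \<le> ennreal (exp (- (k * y))) * fw y" for n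
    proof (rule AE_I2)
      fix y
      show "ennreal (r (n + N) y) * fw y \<le> ennreal (exp (- (k * y))) * fw y"
      proof (cases "y < 0")
        case False
        have X0: "0 < Wr (X (n + N))" using N[of "n + N"] W_pos by (simp add: Wr_def)
        have "ennreal (Wr (X (n + N) - y)) \<le> ennreal (Wr (X (n + N)) * exp (- (k * y)))"
          using Wp_shift[of y "X (n + N)"] False Wr_nonneg by (simp add: Wp_def ennreal_mult)
        then have "Wr (X (n + N) - y) \<le> Wr (X (n + N)) * exp (- (k * y))"
          using X0 by (subst (asm) ennreal_le_iff) auto
        then have "r (n + N) y \<le> exp (- (k * y))" using X0 by (simp add: r_def field_simps)
        then show ?thesis by (intro mult_right_mono ennreal_leI) auto
      qed (simp add: fw_def w_neg)
    qed
    show "AE y in lborel. (\<lambda>n. ennreal (r (n + N) y) * fw y) \<longlonglongrightarrow> ennreal (exp (- (k * y))) * fw y"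
    proof (rule AE_I2)
      fix y
      have X': "filterlim (\<lambda>n. X n - y) at_top sequentially"
        using filterlim_tendsto_add_at_top[OF tendsto_const X, of "- y"] by (simp add: add.commute)
      have "(\<lambda>n. exp (- (k * y)) * ((exp (- (k * (X n - y))) * W (X n - y)) / (exp (- (k * X n)) * W (X n))))
          \<longlonglongrightarrow> exp (- (k * y)) * (L / L)"
        using L(1) by (intro tendsto_mult tendsto_divide tendsto_const filterlim_compose[OF L(2) X'] filterlim_compose[OF L(2) X]) auto
      moreover have "\<forall>\<^sub>F n in sequentially. exp (- (k * y)) * ((exp (- (k * (X n - y))) * W (X n - y)) / (exp (- (k * X n)) * W (X n))) = r n y"
        using Xpos X'[unfolded filterlim_at_top_dense, rule_format, of 0]
      proof eventually_elim
        case (elim n)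
        have "exp (- (k * y)) * exp (- (k * (X n - y))) = exp (- (k * X n))"
          by (subst exp_add[symmetric]) (simp add: right_diff_distrib)
        then have "exp (- (k * y)) * ((exp (- (k * (X n - y))) * W (X n - y)) / (exp (- (k * X n)) * W (X n))) =
            (exp (- (k * X n)) * W (X n - y)) / (exp (- (k * X n)) * W (X n))"
          by (metis mult.assoc times_divide_eq_right)
        then show ?case using elim by (simp add: r_def Wr_def)
      qed
      ultimately have "(\<lambda>n. r n y) \<longlonglongrightarrow> exp (- (k * y))" using L(1) by (simp add: tendsto_cong)
      then have "(\<lambda>n. ennreal (r (n + N) y)) \<longlonglongrightarrow> ennreal (exp (- (k * y)))"
        by (intro tendsto_ennrealI LIMSEQ_ignore_initial_segment)
      moreover have "fw y < \<infinity>" using fw_le[of y] Wp_finite[of y] by (auto simp: ennreal_mult_less_top intro: order_le_less_trans)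
      ultimately show "(\<lambda>n. ennreal (r (n + N) y) * fw y) \<longlonglongrightarrow> ennreal (exp (- (k * y))) * fw y"
        using ennreal_tendsto_cmult[of "fw y"] by (simp add: mult.commute[of _ "fw y"])
    qed
  qed (auto simp: r_def)
  then have lim: "(\<lambda>n. \<integral>\<^sup>+y. ennreal (r (n + N) y) * fw y \<partial>lborel) \<longlonglongrightarrow> ennreal ((J q - 1) / q)"
    using LT_fw by (simp add: LT_def)
  have "(\<integral>\<^sup>+y. ennreal (r (n + N) y) * fw y \<partial>lborel) = ennreal ((K (X (n + N)) - 1) / q)" for n
  proof -
    define z where "z = X (n + N)"
    have z: "0 < z" unfolding z_def by (rule N) simp
    have W: "0 < W z" "Wr z = W z" using W_pos[OF z] z by (simp_all add: Wr_def)
    have "(\<integral>\<^sup>+y. ennreal (r (n + N) y) * fw y \<partial>lborel) = (\<integral>\<^sup>+y. ennreal (1 / W z) * (Wp (z - y) * fw y) \<partial>lborel)"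
      using W Wr_nonneg by (intro nn_integral_cong) (simp add: r_def z_def[symmetric] Wp_def mult.assoc[symmetric] ennreal_mult[symmetric])
    also have "\<dots> = ennreal (1 / W z) * u z" unfolding u_def conv_def by (rule nn_integral_cmult) measurable
    finally have I: "(\<integral>\<^sup>+y. ennreal (r (n + N) y) * fw y \<partial>lborel) = ennreal (1 / W z) * u z" .
    obtain v where v: "u z = ennreal v" "0 \<le> v" using u_finite[of z] by (cases "u z") auto
    have "ennreal (W z * K z) = ennreal (W z + q * v)"
      using w_eq[of z] w_K[of z] K_ge_1[of z] W v q by (simp add: Wp_def ennreal_mult)
    then have "W z * K z = W z + q * v" using W v q K_ge_1[of z] by (subst (asm) ennreal_inj) auto
    then have "(K z - 1) / q = 1 / W z * v" using W q by (simp add: field_simps)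
    then show ?thesis using I v W by (simp add: z_def[symmetric] ennreal_mult[symmetric])
  qed
  with lim have "(\<lambda>n. ennreal ((K (X (n + N)) - 1) / q)) \<longlonglongrightarrow> ennreal ((J q - 1) / q)" by simp
  then have "(\<lambda>n. (K (X (n + N)) - 1) / q) \<longlonglongrightarrow> (J q - 1) / q"
    using q K_ge_1 J_ge_1 by (subst (asm) tendsto_ennreal_iff) auto
  then have "(\<lambda>n. (K (X (n + N)) - 1) / q * q + 1) \<longlonglongrightarrow> (J q - 1) / q * q + 1"
    by (intro tendsto_add tendsto_mult tendsto_const)
  then have "(\<lambda>n. K (X (n + N))) \<longlonglongrightarrow> J q" using q by simp
  then show "(\<lambda>n. K (X n)) \<longlonglongrightarrow> J q" by (rule LIMSEQ_offset)
qed

lemma KP_identity: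
  assumes x: "0 < x" and t: "0 \<le> t"
  shows "KP t (\<lambda>z. Wp z * ennreal (K z)) x = Wp x * ennreal (K x) +
    ennreal q * (\<integral>\<^sup>+s. KP s (\<lambda>z. Wp z * ennreal (exp (- max z 0) * K z)) x * indicator {0..t} s \<partial>lborel)"
  unfolding w_K[symmetric] fw_K[symmetric]
proof (cases "t = 0")
  case True
  have "KP 0 w x = (\<integral>\<^sup>+\<omega>. w x \<partial>M)"
    unfolding KP_def using x by (intro nn_integral_cong_AE, use kill_0[of x] in eventually_elim) auto
  moreover have "(\<integral>\<^sup>+s. KP s fw x * indicator {0..0} s \<partial>lborel) = (\<integral>\<^sup>+s. 0 \<partial>(lborel :: real measure))"
    by (intro nn_integral_cong_AE, use AE_lborel_singleton[of 0] in eventually_elim) auto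
  ultimately show "KP t w x = w x + ennreal q * (\<integral>\<^sup>+s. KP s fw x * indicator {0..t} s \<partial>lborel)"
    using True by (simp add: emeasure_space_1)
next
  case False
  with t have t: "0 < t" by simp
  have "KP t w x = (\<integral>\<^sup>+\<omega>. kill t x \<omega> * Wp (x + V (max 0 t) \<omega>) + ennreal q * (kill t x \<omega> * u (x + V (max 0 t) \<omega>)) \<partial>M)"
    unfolding KP_def w_eq by (simp add: distrib_left mult.left_commute)
  also have "\<dots> = KP t Wp x + ennreal q * KP t u x"
    unfolding KP_def by (subst nn_integral_add) (auto simp: nn_integral_cmult)
  also have "\<dots> = Wp x + ennreal q * (u x + (\<integral>\<^sup>+s. KP s fw x * indicator {0..t} s \<partial>lborel))"
    using harmonic[OF x] u_identity[OF x t] t by simp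
  finally show "KP t w x = w x + ennreal q * (\<integral>\<^sup>+s. KP s fw x * indicator {0..t} s \<partial>lborel)"
    by (simp add: w_eq distrib_left add.assoc)
qed

end

end

section \<open>The conditioned process started from a positive point\<close>

lemma past_subalgebra:
  assumes X: "\<And>t. 0 \<le> t \<Longrightarrow> X t \<in> borel_measurable N"
  shows "subalgebra N (past N X s)"
proof -
  have "(\<lambda>\<omega>. \<lambda>u\<in>{0..s}. X u \<omega>) \<in> N \<rightarrow>\<^sub>M PiM {0..s} (\<lambda>_. borel)"
    using X by (intro measurable_restrict) auto
  then show ?thesis unfolding subalgebra_def past_def
    by (auto simp: sets_image_in_sets)
qed

lemma past_measurable:
  assumes "0 \<le> t" "t \<le> s"
  shows "X t \<in> borel_measurable (past N X s)"
proof -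
  have "(\<lambda>\<omega>. \<lambda>u\<in>{0..s}. X u \<omega>) \<in> past N X s \<rightarrow>\<^sub>M PiM {0..s} (\<lambda>_. borel)"
    unfolding past_def by (rule measurable_vimage_algebra1) (auto simp: space_PiM)
  from measurable_compose[OF this measurable_component_singleton[of t]]
  show ?thesis using assms by simp
qed

context levy_process
begin

lemma kill_eq:
  assumes "\<omega> \<in> space M" "0 \<le> t"
  shows "kill t x \<omega> = indicator {\<omega> \<in> space M. 0 < (INF s\<in>{0..t}. x + V s \<omega>)} \<omega>"
  using assms runinf_add[OF cadlag_paths[OF assms(1)] assms(2), of x]
  by (simp add: kill_def max_def indicator_def)

lemma kill_pos:
  assumes "\<omega> \<in> space M" "0 \<le> t" "kill t x \<omega> \<noteq> 0"
  shows "0 < x + V t \<omega>"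
  using assms runinf_le[OF cadlag_paths[OF assms(1)], of t t]
  by (auto simp: kill_def max_def split: if_splits)

lemma kernel_nn_integral:
  assumes W[measurable]: "(\<lambda>y. if 0 < y then ennreal (W y / W x) else 0) \<in> borel_measurable borel"
    and t: "0 \<le> t" and f[measurable]: "f \<in> borel_measurable borel"
  shows "(\<integral>\<^sup>+z. f z \<partial>positive_kernel M V W t x) =
    (\<integral>\<^sup>+\<omega>. kill t x \<omega> * (ennreal (W (x + V t \<omega>) / W x) * f (x + V t \<omega>)) \<partial>M)"
proof -
  define S where "S = {\<omega> \<in> space M. 0 < (INF s\<in>{0..t}. x + V s \<omega>)}"
  have V[measurable]: "V t \<in> borel_measurable M" using t by (rule random_variable_V)
  have kill: "kill t x \<omega> = indicator S \<omega>" if "\<omega> \<in> space M" for \<omega>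
    unfolding S_def using that t by (rule kill_eq)
  have "(\<lambda>\<omega>. kill t x \<omega>) \<in> borel_measurable M" by measurable
  then have S0: "(indicator S :: _ \<Rightarrow> ennreal) \<in> borel_measurable M"
    by (subst measurable_cong[of M _ "kill t x"]) (simp_all add: kill)
  then have S[measurable]: "S \<in> sets M"
    by (simp add: borel_measurable_indicator_iff S_def Int_absorb2 subset_eq)
  have "(\<integral>\<^sup>+z. f z \<partial>positive_kernel M V W t x) =
      (\<integral>\<^sup>+z. (if 0 < z then ennreal (W z / W x) else 0) * f z \<partial>distr (density M (indicator S)) borel (\<lambda>\<omega>. x + V t \<omega>))"
    unfolding positive_kernel_def S_def[symmetric] by (subst nn_integral_density) auto
  also have "\<dots> = (\<integral>\<^sup>+\<omega>. (if 0 < x + V t \<omega> then ennreal (W (x + V t \<omega>) / W x) else 0) * f (x + V t \<omega>) \<partial>density M (indicator S))"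
    by (subst nn_integral_distr) auto
  also have "\<dots> = (\<integral>\<^sup>+\<omega>. indicator S \<omega> * ((if 0 < x + V t \<omega> then ennreal (W (x + V t \<omega>) / W x) else 0) * f (x + V t \<omega>)) \<partial>M)"
  proof (subst nn_integral_density)
    show "(\<lambda>\<omega>. (if 0 < x + V t \<omega> then ennreal (W (x + V t \<omega>) / W x) else 0) * f (x + V t \<omega>)) \<in> borel_measurable M"
      using measurable_compose[of "\<lambda>\<omega>. x + V t \<omega>" M borel, OF _ W] by measurable
  qed auto
  also have "\<dots> = (\<integral>\<^sup>+\<omega>. kill t x \<omega> * (ennreal (W (x + V t \<omega>) / W x) * f (x + V t \<omega>)) \<partial>M)"
  proof (rule nn_integral_cong)
    fix \<omega> assume \<omega>: "\<omega> \<in> space M"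
    show "indicator S \<omega> * ((if 0 < x + V t \<omega> then ennreal (W (x + V t \<omega>) / W x) else 0) * f (x + V t \<omega>)) =
        kill t x \<omega> * (ennreal (W (x + V t \<omega>) / W x) * f (x + V t \<omega>))"
      using kill_pos[OF \<omega> t, of x] by (auto simp: kill[OF \<omega>])
  qed
  finally show ?thesis .
qed

text \<open>The Markov property from time 0 for the full set: the left side is the conditional
  expectation of the constant 1. Total mass one of the kernel at \<open>x\<close> amounts to
  invariance of \<open>W\<close> under the killed semigroup, and this is where that invariance comes
  from.\<close>

lemma kernel_mass:
  assumes mp: "markov_process (positive_kernel M V W) x N Y" and t: "0 \<le> t"
  shows "measure (positive_kernel M V W t x) UNIV = 1"
proof -
  interpret N: prob_space N using mp by (simp add: markov_process_def)
  have Y: "Y t \<in> borel_measurable N" if "0 \<le> t" for t using mp that by (simp add: markov_process_def)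
  interpret finite_measure_subalgebra N "past N Y 0"
    by unfold_locales (rule past_subalgebra[OF Y])
  have "AE \<omega> in N. real_cond_exp N (past N Y 0) (\<lambda>\<omega>. 1) \<omega> = 1"
    by (rule real_cond_exp_F_meas) auto
  moreover have "\<forall>s\<ge>0. \<forall>t\<ge>0. \<forall>A\<in>sets borel. AE \<omega> in N.
      real_cond_exp N (past N Y s) (\<lambda>\<omega>'. indicator A (Y (s + t) \<omega>')) \<omega> =
      measure (positive_kernel M V W t (Y s \<omega>)) A"
    using mp unfolding markov_process_def by (elim conjE)
  from this[rule_format, OF order_refl t, of UNIV]
  have "AE \<omega> in N. real_cond_exp N (past N Y 0) (\<lambda>\<omega>'. 1) \<omega> =
      measure (positive_kernel M V W t (Y 0 \<omega>)) UNIV"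
    by simp
  moreover have "AE \<omega> in N. Y 0 \<omega> = x" using mp by (simp add: markov_process_def)
  ultimately have "AE \<omega> in N. measure (positive_kernel M V W t x) UNIV = 1"
    by eventually_elim simp
  then show ?thesis by simp
qed

end

context scale_levy
begin

text \<open>Doob transform of the killed semigroup by \<open>W\<close>. At positive points it is
  integration against \<open>positive_kernel\<close>; in this form joint measurability in time and
  starting point is available.\<close>

definition RR :: "real \<Rightarrow> (real \<Rightarrow> ennreal) \<Rightarrow> real \<Rightarrow> ennreal" where
  "RR t h y = ennreal (1 / Wr y) * KP t (\<lambda>z. Wp z * h z) y"

lemma RR_raw [measurable (raw)]:
  assumes [measurable]: "f \<in> borel_measurable L" "e \<in> borel_measurable L" "h \<in> borel_measurable borel"
  shows "(\<lambda>y. RR (f y) h (e y)) \<in> borel_measurable L"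
  unfolding RR_def by measurable

lemma W_ratio_measurable:
  "(\<lambda>y. if 0 < y then ennreal (W y / W x) else 0) \<in> borel_measurable borel"
proof -
  have "(\<lambda>y. if 0 < y then ennreal (Wr y / W x) else 0) \<in> borel_measurable borel" by measurable
  then show ?thesis by (rule measurable_cong[THEN iffD1, rotated]) (simp add: Wr_def)
qed

lemma kernel_RR:
  assumes y: "0 < y" and t: "0 \<le> t" and [measurable]: "h \<in> borel_measurable borel"
  shows "(\<integral>\<^sup>+z. h z \<partial>positive_kernel M V W t y) = RR t h y"
proof -
  have [measurable]: "V t \<in> borel_measurable M" using t by (rule random_variable_V)
  have "(\<integral>\<^sup>+z. h z \<partial>positive_kernel M V W t y) =
      (\<integral>\<^sup>+\<omega>. kill t y \<omega> * (ennreal (W (y + V t \<omega>) / W y) * h (y + V t \<omega>)) \<partial>M)"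
    by (rule kernel_nn_integral[OF W_ratio_measurable t]) measurable
  also have "\<dots> = (\<integral>\<^sup>+\<omega>. ennreal (1 / Wr y) * (kill t y \<omega> * (Wp (y + V t \<omega>) * h (y + V t \<omega>))) \<partial>M)"
  proof (rule nn_integral_cong)
    fix \<omega> assume \<omega>: "\<omega> \<in> space M"
    show "kill t y \<omega> * (ennreal (W (y + V t \<omega>) / W y) * h (y + V t \<omega>)) =
        ennreal (1 / Wr y) * (kill t y \<omega> * (Wp (y + V t \<omega>) * h (y + V t \<omega>)))"
    proof (cases "kill t y \<omega> = 0")
      case False
      from kill_pos[OF \<omega> t this] have "0 < y + V t \<omega>" .
      then have "ennreal (W (y + V t \<omega>) / W y) = ennreal (1 / Wr y) * Wp (y + V t \<omega>)"
        using y W_nonneg[of y] W_nonneg[of "y + V t \<omega>"] by (simp add: Wr_def Wp_def ennreal_mult[symmetric])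
      then show ?thesis by (simp add: mult_ac)
    qed simp
  qed
  also have "\<dots> = RR t h y" using t unfolding RR_def KP_def by (simp add: nn_integral_cmult max_def)
  finally show ?thesis .
qed

end

context cond_levy
begin

lemma kernel_prob:
  assumes y: "0 < y" and t: "0 \<le> t"
  shows "prob_space (positive_kernel M V W t y)"
proof (rule prob_spaceI)
  have "emeasure (positive_kernel M V W t y) (space (positive_kernel M V W t y)) =
      (\<integral>\<^sup>+z. 1 \<partial>positive_kernel M V W t y)" by simp
  also have "\<dots> = RR t (\<lambda>_. 1) y" by (rule kernel_RR[OF y t]) simp
  also have "\<dots> = ennreal (1 / Wr y) * Wp y" using harmonic[OF y t] by (simp add: RR_def)
  also have "\<dots> = 1" using W_pos[OF y] y by (simp add: Wp_def Wr_def ennreal_mult[symmetric])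
  finally show "emeasure (positive_kernel M V W t y) (space (positive_kernel M V W t y)) = 1" .
qed

text \<open>Integrated Markov property with a weight \<open>G\<close> depending on the past. The
  hypothesis gives it for indicators of Borel sets, and induction over Borel functions extends it. A
  weight between 0 and 1 makes the indicator case integrable.\<close>

lemma markov_RR:
  fixes Y :: "real \<Rightarrow> 'b \<Rightarrow> real"
  assumes mp: "markov_process (positive_kernel M V W) x N Y"
    and pos0: "\<forall>t\<ge>0. \<forall>\<omega>\<in>space N. 0 < Y t \<omega>"
    and s: "0 \<le> s" and t: "0 \<le> t"
    and G: "G \<in> borel_measurable (past N Y s)" "\<And>\<omega>. 0 \<le> G \<omega>" "\<And>\<omega>. G \<omega> \<le> (1::real)"
    and h: "h \<in> borel_measurable borel"
  shows "(\<integral>\<^sup>+\<omega>. ennreal (G \<omega>) * h (Y (s + t) \<omega>) \<partial>N) = (\<integral>\<^sup>+\<omega>. ennreal (G \<omega>) * RR t h (Y s \<omega>) \<partial>N)"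
proof -
  note pos = pos0[rule_format]
  interpret N: prob_space N using mp by (simp add: markov_process_def)
  have Y[measurable]: "Y t \<in> borel_measurable N" if "0 \<le> t" for t using mp that by (simp add: markov_process_def)
  have [measurable]: "Y (s + t) \<in> borel_measurable N" "Y s \<in> borel_measurable N" using s t by auto
  interpret F: finite_measure_subalgebra N "past N Y s"
    by unfold_locales (rule past_subalgebra[OF Y])
  have GN[measurable]: "G \<in> borel_measurable N" using F.subalg G(1) by (rule measurable_from_subalg)
  let ?p = "positive_kernel M V W t"
  show ?thesis using h
  proof (induction rule: borel_measurable_induct)
    case (cong f g)
    have "RR t f y = RR t g y" for y using cong(3) by (simp add: RR_def)
    with cong show ?case by simp
  next
    case (set A)
    have A[measurable]: "A \<in> sets borel" using set by simp
    have RA: "RR t (indicator A) (Y s \<omega>) = ennreal (measure (?p (Y s \<omega>)) A)" if "\<omega> \<in> space N" for \<omega>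
    proof -
      interpret K: prob_space "?p (Y s \<omega>)" using pos[OF s that] t by (rule kernel_prob)
      have "sets (?p (Y s \<omega>)) = sets borel" by (simp add: positive_kernel_def)
      then have "RR t (indicator A) (Y s \<omega>) = emeasure (?p (Y s \<omega>)) A"
        by (subst kernel_RR[OF pos[OF s that] t, symmetric]) auto
      then show ?thesis by (simp add: K.emeasure_eq_measure)
    qed
    have mA[measurable]: "(\<lambda>\<omega>. measure (?p (Y s \<omega>)) A) \<in> borel_measurable N"
    proof -
      have "(\<lambda>\<omega>. enn2real (RR t (indicator A) (Y s \<omega>))) \<in> borel_measurable N" by measurable
      then show ?thesis by (rule measurable_cong[THEN iffD1, rotated]) (simp add: RA)
    qed
    have int: "integrable N (\<lambda>\<omega>. G \<omega> * indicator A (Y (s + t) \<omega>))"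
      using G by (intro N.integrable_const_bound[where B=1]) (auto simp: indicator_def)
    have m1: "measure (?p (Y s \<omega>)) A \<le> 1" if "\<omega> \<in> space N" for \<omega>
      using prob_space.prob_le_1[OF kernel_prob[OF pos[OF s that] t]] .
    have int2: "integrable N (\<lambda>\<omega>. G \<omega> * measure (?p (Y s \<omega>)) A)"
      using G m1 by (intro N.integrable_const_bound[where B=1]) (auto simp: abs_mult intro!: mult_le_one)
    have "(\<integral>\<^sup>+\<omega>. ennreal (G \<omega>) * indicator A (Y (s + t) \<omega>) \<partial>N) = (\<integral>\<^sup>+\<omega>. ennreal (G \<omega> * indicator A (Y (s + t) \<omega>)) \<partial>N)"
      using G by (intro nn_integral_cong) (auto simp: indicator_def)
    also have "\<dots> = ennreal (\<integral>\<omega>. G \<omega> * indicator A (Y (s + t) \<omega>) \<partial>N)"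
      using int G by (intro nn_integral_eq_integral) auto
    also have "(\<integral>\<omega>. G \<omega> * indicator A (Y (s + t) \<omega>) \<partial>N) =
        (\<integral>\<omega>. G \<omega> * real_cond_exp N (past N Y s) (\<lambda>\<omega>'. indicator A (Y (s + t) \<omega>')) \<omega> \<partial>N)"
      by (rule F.real_cond_exp_intg(2)[symmetric, OF int G(1)]) measurable
    also have "\<dots> = (\<integral>\<omega>. G \<omega> * measure (?p (Y s \<omega>)) A \<partial>N)"
    proof (rule integral_cong_AE)
      have "AE \<omega> in N. real_cond_exp N (past N Y s) (\<lambda>\<omega>'. indicator A (Y (s + t) \<omega>')) \<omega> = measure (?p (Y s \<omega>)) A"
        using mp s t A by (simp add: markov_process_def)
      then show "AE \<omega> in N. G \<omega> * real_cond_exp N (past N Y s) (\<lambda>\<omega>'. indicator A (Y (s + t) \<omega>')) \<omega> =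
          G \<omega> * measure (?p (Y s \<omega>)) A" by eventually_elim simp
    qed measurable
    also have "ennreal (\<integral>\<omega>. G \<omega> * measure (?p (Y s \<omega>)) A \<partial>N) = (\<integral>\<^sup>+\<omega>. ennreal (G \<omega> * measure (?p (Y s \<omega>)) A) \<partial>N)"
      using int2 G by (intro nn_integral_eq_integral[symmetric]) auto
    also have "\<dots> = (\<integral>\<^sup>+\<omega>. ennreal (G \<omega>) * RR t (indicator A) (Y s \<omega>) \<partial>N)"
      using G by (intro nn_integral_cong) (simp add: RA ennreal_mult)
    finally show ?case .
  next
    case (mult f c)
    have f[measurable]: "f \<in> borel_measurable borel" using mult by simp
    have "RR t (\<lambda>z. c * f z) y = c * RR t f y" for y
      unfolding RR_def KP_def by (subst nn_integral_cmult[symmetric], measurable) (simp add: nn_integral_cmult[symmetric] mult_ac)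
    then show ?case
      using mult.IH by (simp add: nn_integral_cmult mult.left_commute[of _ c])
  next
    case (add f g)
    have [measurable]: "f \<in> borel_measurable borel" "g \<in> borel_measurable borel" using add by simp_all
    have "RR t (\<lambda>z. g z + f z) y = RR t g y + RR t f y" for y
      unfolding RR_def KP_def by (simp add: distrib_left nn_integral_add)
    then show ?case using add.IH by (simp add: distrib_left nn_integral_add)
  next
    case (seq U)
    have [measurable]: "U i \<in> borel_measurable borel" for i using seq(1) by simp
    have U: "incseq (\<lambda>i. U i z)" for z using seq by (auto simp: incseq_def le_fun_def)
    have sup: "(SUP i. U i) = (\<lambda>z. SUP i. U i z)" by (rule ext) (rule SUP_apply)
    have R: "RR t (\<lambda>z. SUP i. U i z) y = (SUP i. RR t (U i) y)" for y
    proof -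
      have "KP t (\<lambda>z. Wp z * (SUP i. U i z)) y =
          (\<integral>\<^sup>+\<omega>. (SUP i. kill t y \<omega> * (Wp (y + V (max 0 t) \<omega>) * U i (y + V (max 0 t) \<omega>))) \<partial>M)"
        unfolding KP_def by (simp add: SUP_mult_left_ennreal)
      also have "\<dots> = (SUP i. KP t (\<lambda>z. Wp z * U i z) y)"
        unfolding KP_def using U
        by (intro nn_integral_monotone_convergence_SUP) (auto simp: incseq_def le_fun_def intro!: mult_left_mono)
      finally show ?thesis by (simp add: RR_def SUP_mult_left_ennreal)
    qed
    have RI: "RR t (U i) y \<le> RR t (U j) y" if "i \<le> j" for i j y
      unfolding RR_def KP_def using U that by (intro mult_left_mono nn_integral_mono) (auto simp: incseq_def)
    have "(\<integral>\<^sup>+\<omega>. ennreal (G \<omega>) * (SUP i. U i (Y (s + t) \<omega>)) \<partial>N) = (SUP i. \<integral>\<^sup>+\<omega>. ennreal (G \<omega>) * U i (Y (s + t) \<omega>) \<partial>N)"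
      unfolding SUP_mult_left_ennreal using U
      by (intro nn_integral_monotone_convergence_SUP) (auto simp: incseq_def le_fun_def intro!: mult_left_mono)
    also have "\<dots> = (SUP i. \<integral>\<^sup>+\<omega>. ennreal (G \<omega>) * RR t (U i) (Y s \<omega>) \<partial>N)" using seq by simp
    also have "\<dots> = (\<integral>\<^sup>+\<omega>. ennreal (G \<omega>) * (SUP i. RR t (U i) (Y s \<omega>)) \<partial>N)"
      unfolding SUP_mult_left_ennreal using RI
      by (intro nn_integral_monotone_convergence_SUP[symmetric]) (auto simp: incseq_def le_fun_def intro!: mult_left_mono)
    finally show ?case unfolding sup R .
  qed
qed

context
  fixes q :: real
  assumes q: "0 < q"
begin

lemma RR_identity:
  assumes x: "0 < x" and t: "0 \<le> t"
  shows "RR t (\<lambda>z. ennreal (K q z)) x = ennreal (K q x) +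
    ennreal q * (\<integral>\<^sup>+s. RR s (\<lambda>z. ennreal (exp (- max z 0) * K q z)) x * indicator {0..t} s \<partial>lborel)"
proof -
  note [measurable] = K_measurable[OF q]
  have W: "ennreal (1 / Wr x) * Wp x = 1" using W_pos[OF x] x by (simp add: Wp_def Wr_def ennreal_mult[symmetric])
  have "RR t (\<lambda>z. ennreal (K q z)) x = (ennreal (1 / Wr x) * Wp x) * ennreal (K q x) +
      ennreal q * (ennreal (1 / Wr x) * (\<integral>\<^sup>+s. KP s (\<lambda>z. Wp z * ennreal (exp (- max z 0) * K q z)) x * indicator {0..t} s \<partial>lborel))"
    unfolding RR_def KP_identity[OF q x t] by (simp add: distrib_left mult_ac)
  also have "ennreal (1 / Wr x) * (\<integral>\<^sup>+s. KP s (\<lambda>z. Wp z * ennreal (exp (- max z 0) * K q z)) x * indicator {0..t} s \<partial>lborel) =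
      (\<integral>\<^sup>+s. RR s (\<lambda>z. ennreal (exp (- max z 0) * K q z)) x * indicator {0..t} s \<partial>lborel)"
    unfolding RR_def by (subst nn_integral_cmult[symmetric]) (auto simp: mult.assoc)
  finally show ?thesis by (simp add: W)
qed

text \<open>\<open>RR_identity\<close> at the random point \<open>Y s\<close>, integrated with the
  weight \<open>G\<close>. The paths of \<open>Y\<close> carry no regularity, so the time integral
  is formed with \<open>RR\<close>, which is measurable in time by the third claim; the second claim
  returns to the values of \<open>Y\<close> at each fixed time.\<close>

lemma Y_identity:
  fixes Y :: "real \<Rightarrow> 'b \<Rightarrow> real"
  assumes mp: "markov_process (positive_kernel M V W) x N Y"
    and pos0: "\<forall>t\<ge>0. \<forall>\<omega>\<in>space N. 0 < Y t \<omega>"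
    and s: "0 \<le> s" and t: "0 \<le> t"
    and G: "G \<in> borel_measurable (past N Y s)" "\<And>\<omega>. 0 \<le> G \<omega>" "\<And>\<omega>. G \<omega> \<le> (1::real)"
  shows "(\<integral>\<^sup>+\<omega>. ennreal (G \<omega>) * ennreal (K q (Y (s + t) \<omega>)) \<partial>N) = (\<integral>\<^sup>+\<omega>. ennreal (G \<omega>) * ennreal (K q (Y s \<omega>)) \<partial>N) +
    ennreal q * (\<integral>\<^sup>+r. (\<integral>\<^sup>+\<omega>. ennreal (G \<omega>) * RR r (\<lambda>z. ennreal (exp (- max z 0) * K q z)) (Y s \<omega>) \<partial>N) * indicator {0..t} r \<partial>lborel)"
    and "0 \<le> r \<Longrightarrow> (\<integral>\<^sup>+\<omega>. ennreal (G \<omega>) * ennreal (exp (- max (Y (s + r) \<omega>) 0) * K q (Y (s + r) \<omega>)) \<partial>N) =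
      (\<integral>\<^sup>+\<omega>. ennreal (G \<omega>) * RR r (\<lambda>z. ennreal (exp (- max z 0) * K q z)) (Y s \<omega>) \<partial>N)"
    and "(\<lambda>r. \<integral>\<^sup>+\<omega>. ennreal (G \<omega>) * RR r (\<lambda>z. ennreal (exp (- max z 0) * K q z)) (Y s \<omega>) \<partial>N) \<in> borel_measurable borel"
proof -
  note pos = pos0[rule_format]
  note [measurable] = K_measurable[OF q]
  interpret N: prob_space N using mp by (simp add: markov_process_def)
  have Y[measurable]: "Y t \<in> borel_measurable N" if "0 \<le> t" for t using mp that by (simp add: markov_process_def)
  have [measurable]: "Y (s + t) \<in> borel_measurable N" "Y s \<in> borel_measurable N" using s t by auto
  have GN[measurable]: "G \<in> borel_measurable N"
    using past_subalgebra[OF Y] G(1) by (rule measurable_from_subalg)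
  interpret pair_sigma_finite lborel N ..
  show "(\<lambda>r. \<integral>\<^sup>+\<omega>. ennreal (G \<omega>) * RR r (\<lambda>z. ennreal (exp (- max z 0) * K q z)) (Y s \<omega>) \<partial>N) \<in> borel_measurable borel"
    by measurable
  show "(\<integral>\<^sup>+\<omega>. ennreal (G \<omega>) * ennreal (exp (- max (Y (s + r) \<omega>) 0) * K q (Y (s + r) \<omega>)) \<partial>N) =
      (\<integral>\<^sup>+\<omega>. ennreal (G \<omega>) * RR r (\<lambda>z. ennreal (exp (- max z 0) * K q z)) (Y s \<omega>) \<partial>N)" if "0 \<le> r"
    by (rule markov_RR[OF mp pos0 s that G]) measurable
  have "(\<integral>\<^sup>+\<omega>. ennreal (G \<omega>) * ennreal (K q (Y (s + t) \<omega>)) \<partial>N) =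
      (\<integral>\<^sup>+\<omega>. ennreal (G \<omega>) * RR t (\<lambda>z. ennreal (K q z)) (Y s \<omega>) \<partial>N)"
    by (rule markov_RR[OF mp pos0 s t G]) measurable
  also have "\<dots> = (\<integral>\<^sup>+\<omega>. ennreal (G \<omega>) * ennreal (K q (Y s \<omega>)) +
      ennreal q * (ennreal (G \<omega>) * (\<integral>\<^sup>+r. RR r (\<lambda>z. ennreal (exp (- max z 0) * K q z)) (Y s \<omega>) * indicator {0..t} r \<partial>lborel)) \<partial>N)"
    using pos[OF s] by (intro nn_integral_cong) (simp add: RR_identity t distrib_left mult.left_commute)
  also have "\<dots> = (\<integral>\<^sup>+\<omega>. ennreal (G \<omega>) * ennreal (K q (Y s \<omega>)) \<partial>N) +
      ennreal q * (\<integral>\<^sup>+\<omega>. ennreal (G \<omega>) * (\<integral>\<^sup>+r. RR r (\<lambda>z. ennreal (exp (- max z 0) * K q z)) (Y s \<omega>) * indicator {0..t} r \<partial>lborel) \<partial>N)"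
    by (simp add: nn_integral_add nn_integral_cmult)
  also have "(\<integral>\<^sup>+\<omega>. ennreal (G \<omega>) * (\<integral>\<^sup>+r. RR r (\<lambda>z. ennreal (exp (- max z 0) * K q z)) (Y s \<omega>) * indicator {0..t} r \<partial>lborel) \<partial>N) =
      (\<integral>\<^sup>+\<omega>. \<integral>\<^sup>+r. ennreal (G \<omega>) * RR r (\<lambda>z. ennreal (exp (- max z 0) * K q z)) (Y s \<omega>) * indicator {0..t} r \<partial>lborel \<partial>N)"
    by (intro nn_integral_cong) (simp add: nn_integral_cmult[symmetric] mult.assoc)
  also have "\<dots> = (\<integral>\<^sup>+r. \<integral>\<^sup>+\<omega>. ennreal (G \<omega>) * RR r (\<lambda>z. ennreal (exp (- max z 0) * K q z)) (Y s \<omega>) * indicator {0..t} r \<partial>N \<partial>lborel)"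
    by (rule Fubini') measurable
  also have "\<dots> = (\<integral>\<^sup>+r. (\<integral>\<^sup>+\<omega>. ennreal (G \<omega>) * RR r (\<lambda>z. ennreal (exp (- max z 0) * K q z)) (Y s \<omega>) \<partial>N) * indicator {0..t} r \<partial>lborel)"
    by (intro nn_integral_cong nn_integral_multc) measurable
  finally show "(\<integral>\<^sup>+\<omega>. ennreal (G \<omega>) * ennreal (K q (Y (s + t) \<omega>)) \<partial>N) = (\<integral>\<^sup>+\<omega>. ennreal (G \<omega>) * ennreal (K q (Y s \<omega>)) \<partial>N) +
    ennreal q * (\<integral>\<^sup>+r. (\<integral>\<^sup>+\<omega>. ennreal (G \<omega>) * RR r (\<lambda>z. ennreal (exp (- max z 0) * K q z)) (Y s \<omega>) \<partial>N) * indicator {0..t} r \<partial>lborel)" .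
qed

end

end

section \<open>The process started from zero and its exponential functional\<close>

text \<open>Agrees with \<open>exp (- v)\<close> where the processes live, and is bounded and
  continuous on the whole line, as the convergence of marginals requires.\<close>

definition ee :: "real \<Rightarrow> real" where "ee v = exp (- max v 0)"

lemma ee_bounds: "0 < ee v" "ee v \<le> 1" "0 \<le> ee v" by (simp_all add: ee_def)

lemma ee_isCont [continuous_intros]: "isCont ee v"
  unfolding ee_def by (intro continuous_intros)

lemma ee_measurable [measurable]: "ee \<in> borel_measurable borel"
  unfolding ee_def by measurable

text \<open>The grid point strictly to the right of \<open>r\<close>, so that right-continuity of
  paths gives convergence as the mesh tends to 0.\<close>

definition nxt :: "real \<Rightarrow> real \<Rightarrow> real" where
  "nxt h r = (real_of_int \<lfloor>r / h\<rfloor> + 1) * h"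

lemma nxt_bounds: "0 < h \<Longrightarrow> r < nxt h r" "0 < h \<Longrightarrow> nxt h r \<le> r + h"
proof -
  assume h: "0 < h"
  have "r / h < real_of_int \<lfloor>r / h\<rfloor> + 1" "real_of_int \<lfloor>r / h\<rfloor> \<le> r / h" by linarith+
  then have "r < (real_of_int \<lfloor>r / h\<rfloor> + 1) * h" "real_of_int \<lfloor>r / h\<rfloor> * h \<le> r"
    using h by (simp_all only: pos_divide_less_eq pos_le_divide_eq)
  then show "r < nxt h r" "nxt h r \<le> r + h" by (simp_all add: nxt_def distrib_right)
qed

lemma nxt_eq:
  assumes "0 < h" "real i * h \<le> r" "r < real (Suc i) * h"
  shows "nxt h r = real (Suc i) * h"
proof -
  have "\<lfloor>r / h\<rfloor> = int i" using assms by (intro floor_unique) (auto simp: field_simps)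
  then show ?thesis by (simp add: nxt_def)
qed

lemma nxt_measurable [measurable]: "nxt h \<in> borel_measurable borel"
  unfolding nxt_def[abs_def] by measurable

lemma exp_remainder:
  fixes y :: real
  assumes "0 \<le> y"
  shows "0 \<le> y - (1 - exp (- y))" "y - (1 - exp (- y)) \<le> y\<^sup>2"
proof -
  show "0 \<le> y - (1 - exp (- y))" using exp_ge_add_one_self[of "- y"] by simp
  have "exp (- y) \<le> 1 / (1 + y)"
    using exp_ge_add_one_self[of y] assms by (simp add: exp_minus inverse_eq_divide frac_le)
  also have "\<dots> \<le> 1 - y + y\<^sup>2"
    using assms by (simp add: field_simps power2_eq_square)
  finally show "y - (1 - exp (- y)) \<le> y\<^sup>2" by simp
qed

locale limit_levy = cond_levy M V \<Psi> W k
  for M :: "'a measure" and V and \<Psi> :: "real \<Rightarrow> real" and W and k :: real +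
  fixes N :: "real \<Rightarrow> 'b measure" and Y :: "real \<Rightarrow> real \<Rightarrow> 'b \<Rightarrow> real"
    and P :: "'c measure" and X :: "real \<Rightarrow> 'c \<Rightarrow> real"
  assumes cpz: "conditioned_positive_from_zero M V W N Y P X"
begin

lemma P_prob: "prob_space P"
  using cpz by (simp add: conditioned_positive_from_zero_def)

interpretation P: prob_space P by (rule P_prob)

lemma X_rv: "0 \<le> t \<Longrightarrow> X t \<in> borel_measurable P"
  using cpz by (simp add: conditioned_positive_from_zero_def)

lemma X_cadlag: "\<omega> \<in> space P \<Longrightarrow> cadlag (\<lambda>t. X t \<omega>)"
  using cpz by (simp add: conditioned_positive_from_zero_def)

lemma X_0: "AE \<omega> in P. X 0 \<omega> = 0"
  using cpz by (simp add: conditioned_positive_from_zero_def)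

lemma X_raw [measurable (raw)]:
  assumes "f \<in> borel_measurable L" "g \<in> L \<rightarrow>\<^sub>M P"
  shows "(\<lambda>x. X (max 0 (f x)) (g x)) \<in> borel_measurable L"
proof -
  have "(\<lambda>x. (f x, g x)) \<in> L \<rightarrow>\<^sub>M borel \<Otimes>\<^sub>M P" using assms by measurable
  from measurable_compose[OF this right_continuous_jointly_measurable[OF X_rv X_cadlag]]
  show ?thesis by simp
qed

lemma Y_markov: "0 < x \<Longrightarrow> markov_process (positive_kernel M V W) x (N x) (Y x)"
  using cpz by (simp add: conditioned_positive_from_zero_def conditioned_positive_from_def)

lemma Y_pos: "0 < x \<Longrightarrow> 0 \<le> t \<Longrightarrow> \<omega> \<in> space (N x) \<Longrightarrow> 0 < Y x t \<omega>"
  using cpz by (simp add: conditioned_positive_from_zero_def conditioned_positive_from_def)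

lemma Y_pos': "0 < x \<Longrightarrow> \<forall>t\<ge>0. \<forall>\<omega>\<in>space (N x). 0 < Y x t \<omega>"
  by (simp add: Y_pos)

lemma fdd_limit:
  fixes f :: "real \<Rightarrow> real" and \<tau> :: "nat \<Rightarrow> real"
  assumes I: "finite I" "\<And>i. i \<in> I \<Longrightarrow> 0 \<le> \<tau> i" and t: "0 \<le> t" and c: "0 \<le> c"
    and f: "\<And>z. isCont f z" "\<And>z. \<bar>f z\<bar> \<le> B"
  shows "((\<lambda>x. \<integral>\<omega>. exp (- (c * (\<Sum>i\<in>I. ee (Y x (\<tau> i) \<omega>)))) * f (Y x t \<omega>) \<partial>N x) \<longlongrightarrow>
    (\<integral>\<omega>. exp (- (c * (\<Sum>i\<in>I. ee (X (\<tau> i) \<omega>)))) * f (X t \<omega>) \<partial>P)) (at_right 0)"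
proof -
  define F where "F v = exp (- (c * (\<Sum>i\<in>I. ee (v (\<tau> i))))) * f (v t)" for v :: "real \<Rightarrow> real"
  define H where "H = insert t (\<tau> ` I)"
  have co: "continuous_on UNIV (\<lambda>v :: real \<Rightarrow> real. v s)" for s
    by (rule continuous_on_product_coordinates)
  have ce: "continuous_on UNIV (\<lambda>v :: real \<Rightarrow> real. ee (v s))" for s
    using continuous_on_compose2[of UNIV ee UNIV "\<lambda>v :: real \<Rightarrow> real. v s"] co
    by (simp add: continuous_at_imp_continuous_on ee_isCont)
  have cf: "continuous_on UNIV (\<lambda>v :: real \<Rightarrow> real. f (v s))" for s
    using continuous_on_compose2[of UNIV f UNIV "\<lambda>v :: real \<Rightarrow> real. v s"] co f(1)
    by (simp add: continuous_at_imp_continuous_on)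
  have "continuous_on UNIV F"
    unfolding F_def by (intro continuous_intros ce cf)
  moreover have "bounded (range F)"
  proof (rule boundedI[of _ B])
    fix y assume "y \<in> range F"
    then obtain v where y: "y = F v" by auto
    have "0 \<le> c * (\<Sum>i\<in>I. ee (v (\<tau> i)))" using c by (intro mult_nonneg_nonneg sum_nonneg ee_bounds)
    then have "\<bar>F v\<bar> \<le> 1 * B" unfolding F_def abs_mult using f(2) by (intro mult_mono) auto
    then show "norm y \<le> B" by (simp add: y)
  qed
  ultimately have "((\<lambda>x. \<integral>\<omega>. F (\<lambda>t\<in>H. Y x t \<omega>) \<partial>N x) \<longlongrightarrow> (\<integral>\<omega>. F (\<lambda>t\<in>H. X t \<omega>) \<partial>P)) (at_right 0)"
  proof -
    have "fdd_limit_at_zero N Y P X" using cpz unfolding conditioned_positive_from_zero_def by (elim conjE)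
    moreover assume "continuous_on UNIV F" "bounded (range F)"
    moreover have "finite H" "H \<subseteq> {0..}" using I t by (auto simp: H_def)
    ultimately show ?thesis unfolding fdd_limit_at_zero_def by simp
  qed
  then show ?thesis by (simp add: F_def H_def)
qed

text \<open>The negative part truncated at 1 is a bounded continuous test function, and it vanishes
  along each \<open>Y x\<close>.\<close>

lemma X_nonneg: "0 \<le> t \<Longrightarrow> AE \<omega> in P. 0 \<le> X t \<omega>"
proof -
  assume t: "0 \<le> t"
  define f where "f z = min 1 (max (- z) 0)" for z :: real
  have [measurable]: "X t \<in> borel_measurable P" using t by (rule X_rv)
  have fm[measurable]: "f \<in> borel_measurable borel" unfolding f_def by measurable
  have "((\<lambda>x. \<integral>\<omega>. exp (- (0 * (\<Sum>i\<in>({}::nat set). ee (Y x (0::real) \<omega>)))) * f (Y x t \<omega>) \<partial>N x) \<longlongrightarrow>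
    (\<integral>\<omega>. exp (- (0 * (\<Sum>i\<in>({}::nat set). ee (X (0::real) \<omega>)))) * f (X t \<omega>) \<partial>P)) (at_right 0)"
  proof (rule fdd_limit[where \<tau>="\<lambda>_. 0" and B=1])
    show "isCont f z" for z unfolding f_def by (intro continuous_intros)
  qed (use t in \<open>auto simp: f_def\<close>)
  then have lim: "((\<lambda>x. \<integral>\<omega>. f (Y x t \<omega>) \<partial>N x) \<longlongrightarrow> (\<integral>\<omega>. f (X t \<omega>) \<partial>P)) (at_right 0)" by simp
  have "\<forall>\<^sub>F x in at_right 0. (\<integral>\<omega>. f (Y x t \<omega>) \<partial>N x) = 0"
    using eventually_at_right_less[of "0::real"]
  proof eventually_elim
    fix x :: real assume x: "0 < x"
    have "(\<integral>\<omega>. f (Y x t \<omega>) \<partial>N x) = (\<integral>\<omega>. 0 \<partial>N x)"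
      using Y_pos[OF x t] by (intro Bochner_Integration.integral_cong) (auto simp: f_def)
    then show "(\<integral>\<omega>. f (Y x t \<omega>) \<partial>N x) = 0" by simp
  qed
  then have "((\<lambda>x. \<integral>\<omega>. f (Y x t \<omega>) \<partial>N x) \<longlongrightarrow> 0) (at_right 0)" by (rule tendsto_eventually)
  then have "(\<integral>\<omega>. f (X t \<omega>) \<partial>P) = 0"
    by (rule tendsto_unique[OF trivial_limit_at_right_real lim])
  moreover have "integrable P (\<lambda>\<omega>. f (X t \<omega>))"
    by (rule P.integrable_const_bound[where B=1]) (auto simp: f_def)
  ultimately have "AE \<omega> in P. f (X t \<omega>) = 0"
    by (subst (asm) integral_nonneg_eq_0_iff_AE) (auto simp: f_def)
  then show ?thesis by eventually_elim (auto simp: f_def min_def max_def split: if_splits)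
qed

context
  fixes q :: real
  assumes q: "0 < q"
begin

definition eK :: "real \<Rightarrow> real" where "eK z = ee z * K q z"

lemma eK_isCont: "isCont eK z"
  unfolding eK_def by (intro continuous_intros K_continuous[OF q] ee_isCont)

lemma K_meas [measurable]: "K q \<in> borel_measurable borel" by (rule K_measurable[OF q])

lemma eK_meas [measurable]: "eK \<in> borel_measurable borel"
  unfolding eK_def by measurable

lemma K_bounds: "1 \<le> K q z" "0 \<le> K q z" "K q z \<le> J q" "\<bar>K q z\<bar> \<le> J q"
  using K_ge_1[OF q, of z] K_le_J[OF q, of z] by auto

lemma J_pos: "0 < J q" "1 \<le> J q" using J_ge_1[OF q] by auto

lemma eK_bounds: "0 \<le> eK z" "eK z \<le> J q" "\<bar>eK z\<bar> \<le> J q"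
proof -
  show "0 \<le> eK z" using ee_bounds[of z] K_bounds[of z] by (simp add: eK_def)
  moreover have "eK z \<le> 1 * J q" unfolding eK_def using ee_bounds[of z] K_bounds[of z] by (intro mult_mono) auto
  ultimately show "eK z \<le> J q" "\<bar>eK z\<bar> \<le> J q" by auto
qed

definition GG :: "real \<Rightarrow> nat set \<Rightarrow> (nat \<Rightarrow> real) \<Rightarrow> 'c \<Rightarrow> real" where
  "GG c I \<tau> \<omega> = exp (- (c * (\<Sum>i\<in>I. ee (X (max 0 (\<tau> i)) \<omega>))))"

lemma GG_meas [measurable]: "GG c I \<tau> \<in> borel_measurable P"
  unfolding GG_def[abs_def] by measurable

lemma GG_bounds:
  assumes "0 \<le> c" shows "0 \<le> GG c I \<tau> \<omega>" "GG c I \<tau> \<omega> \<le> 1"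
proof -
  have "0 \<le> c * (\<Sum>i\<in>I. ee (X (max 0 (\<tau> i)) \<omega>))" using assms by (intro mult_nonneg_nonneg sum_nonneg ee_bounds)
  then show "0 \<le> GG c I \<tau> \<omega>" "GG c I \<tau> \<omega> \<le> 1" by (simp_all add: GG_def)
qed

lemma GG_integrable:
  assumes c: "0 \<le> c" and f[measurable]: "f \<in> borel_measurable P" and B: "\<And>\<omega>. \<bar>f \<omega>\<bar> \<le> B"
  shows "integrable P (\<lambda>\<omega>. GG c I \<tau> \<omega> * f \<omega>)"
proof (rule P.integrable_const_bound[where B=B])
  show "AE \<omega> in P. norm (GG c I \<tau> \<omega> * f \<omega>) \<le> B"
  proof (rule AE_I2)
    fix \<omega>
    have "\<bar>GG c I \<tau> \<omega>\<bar> * \<bar>f \<omega>\<bar> \<le> 1 * B"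
      using GG_bounds[OF c, of I \<tau> \<omega>] B by (intro mult_mono) auto
    then show "norm (GG c I \<tau> \<omega> * f \<omega>) \<le> B" by (simp add: abs_mult)
  qed
qed measurable

lemma GG_eK_bound:
  assumes c: "0 \<le> c" shows "\<bar>\<integral>\<omega>. GG c I \<tau> \<omega> * eK (X (max 0 r) \<omega>) \<partial>P\<bar> \<le> J q"
proof -
  have "\<bar>\<integral>\<omega>. GG c I \<tau> \<omega> * eK (X (max 0 r) \<omega>) \<partial>P\<bar> \<le> (\<integral>\<omega>. J q \<partial>P)"
  proof (rule integral_abs_bound[THEN order_trans], rule integral_mono)
    show "integrable P (\<lambda>\<omega>. \<bar>GG c I \<tau> \<omega> * eK (X (max 0 r) \<omega>)\<bar>)"
      by (intro integrable_abs GG_integrable[OF c _ eK_bounds(3)]) measurable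
    fix \<omega>
    have "\<bar>GG c I \<tau> \<omega>\<bar> * \<bar>eK (X (max 0 r) \<omega>)\<bar> \<le> 1 * J q"
      using GG_bounds[OF c, of I \<tau> \<omega>] eK_bounds by (intro mult_mono) auto
    then show "\<bar>GG c I \<tau> \<omega> * eK (X (max 0 r) \<omega>)\<bar> \<le> J q" by (simp add: abs_mult)
  qed simp
  then show ?thesis by (simp add: P.prob_space)
qed

text \<open>Limit of \<open>Y_identity\<close> as the starting point tends to 0. Each expectation
  involves a bounded continuous function of finitely many values, so convergence of marginals is
  enough; dominated convergence with the bound \<open>J q\<close> handles the time integral. For
  \<open>X\<close> this takes the place of a Markov property.\<close>

lemma X_identity_nn:
  assumes I: "finite I" "\<And>i. i \<in> I \<Longrightarrow> 0 \<le> \<tau> i \<and> \<tau> i \<le> s" and s: "0 \<le> s" and t: "0 \<le> t" and c: "0 \<le> c"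
  shows "ennreal (\<integral>\<omega>. GG c I \<tau> \<omega> * K q (X (s + t) \<omega>) \<partial>P) = ennreal (\<integral>\<omega>. GG c I \<tau> \<omega> * K q (X s \<omega>) \<partial>P) +
    ennreal q * (\<integral>\<^sup>+r. ennreal (\<integral>\<omega>. GG c I \<tau> \<omega> * eK (X (max 0 (s + r)) \<omega>) \<partial>P) * indicator {0..t} r \<partial>lborel)"
proof -
  have \<tau>0: "0 \<le> \<tau> i" if "i \<in> I" for i using I(2) that by auto
  have \<tau>m: "max 0 (\<tau> i) = \<tau> i" if "i \<in> I" for i using \<tau>0 that by (simp add: max_def)
  define x where "x n = 1 / real (Suc n)" for n
  have x: "0 < x n" for n by (simp add: x_def)
  have xlim: "filterlim x (at_right 0) sequentially"
    unfolding filterlim_at using x by (auto simp: x_def[abs_def] intro!: always_eventually) real_asymp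
  define G where "G n \<omega> = exp (- (c * (\<Sum>i\<in>I. ee (Y (x n) (\<tau> i) \<omega>))))" for n \<omega>
  define E where "E n f t = (\<integral>\<omega>. G n \<omega> * f (Y (x n) t \<omega>) \<partial>N (x n))" for n and f :: "real \<Rightarrow> real" and t
  have Elim: "(\<lambda>n. E n f r) \<longlonglongrightarrow> (\<integral>\<omega>. GG c I \<tau> \<omega> * f (X r \<omega>) \<partial>P)"
    if "\<And>z. isCont f z" "\<And>z. \<bar>f z\<bar> \<le> J q" "0 \<le> r" for f r
    using filterlim_compose[OF fdd_limit[OF I(1) \<tau>0 that(3) c that(1,2)] xlim]
    by (simp add: E_def G_def GG_def \<tau>m cong: sum.cong)
  have Gb: "0 \<le> G n \<omega>" "G n \<omega> \<le> 1" for n \<omega>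
    using mult_nonneg_nonneg[OF c sum_nonneg[of I "\<lambda>i. ee (Y (x n) (\<tau> i) \<omega>)"]] ee_bounds by (auto simp: G_def)
  define g where "g n r = (\<integral>\<^sup>+\<omega>. ennreal (G n \<omega>) * RR r (\<lambda>z. ennreal (exp (- max z 0) * K q z)) (Y (x n) s \<omega>) \<partial>N (x n))" for n r
  have nnE: "(\<integral>\<^sup>+\<omega>. ennreal (G n \<omega>) * ennreal (f (Y (x n) r \<omega>)) \<partial>N (x n)) = ennreal (E n f r)"
    and Gm: "G n \<in> borel_measurable (past (N (x n)) (Y (x n)) s)"
    if f[measurable]: "f \<in> borel_measurable borel" and fb: "\<And>z. 0 \<le> f z" "\<And>z. \<bar>f z\<bar> \<le> J q" and r: "0 \<le> r" for n f r
  proof -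
    interpret Nn: prob_space "N (x n)" using Y_markov[OF x] by (simp add: markov_process_def)
    have Y: "Y (x n) t \<in> borel_measurable (N (x n))" if "0 \<le> t" for t
      using Y_markov[OF x[of n]] that by (simp add: markov_process_def)
    show Gm: "G n \<in> borel_measurable (past (N (x n)) (Y (x n)) s)"
    proof -
      have [measurable]: "Y (x n) (\<tau> i) \<in> borel_measurable (past (N (x n)) (Y (x n)) s)" if "i \<in> I" for i
        using I(2)[OF that] by (intro past_measurable) auto
      show ?thesis unfolding G_def[abs_def] by measurable
    qed
    have [measurable]: "Y (x n) r \<in> borel_measurable (N (x n))" "G n \<in> borel_measurable (N (x n))"
      using Y[OF r] measurable_from_subalg[OF past_subalgebra[OF Y] Gm] by auto
    have "integrable (N (x n)) (\<lambda>\<omega>. G n \<omega> * f (Y (x n) r \<omega>))"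
    proof (rule Nn.integrable_const_bound[where B="J q"])
      show "AE \<omega> in N (x n). norm (G n \<omega> * f (Y (x n) r \<omega>)) \<le> J q"
        using Gb[of n] fb mult_mono[of "\<bar>G n _\<bar>" 1 "\<bar>f _\<bar>" "J q"] by (intro AE_I2) (simp add: abs_mult)
    qed measurable
    then have "(\<integral>\<^sup>+\<omega>. ennreal (G n \<omega> * f (Y (x n) r \<omega>)) \<partial>N (x n)) = ennreal (E n f r)"
      unfolding E_def using Gb fb by (intro nn_integral_eq_integral) auto
    then show "(\<integral>\<^sup>+\<omega>. ennreal (G n \<omega>) * ennreal (f (Y (x n) r \<omega>)) \<partial>N (x n)) = ennreal (E n f r)"
      using Gb fb by (simp add: ennreal_mult)
  qed
  have Gm': "G n \<in> borel_measurable (past (N (x n)) (Y (x n)) s)" for n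
    using Gm[of "\<lambda>_. 0" s n] s J_pos by simp
  note Yid = Y_identity[OF q Y_markov[OF x] Y_pos'[OF x] s _ Gm' Gb]
  have id: "ennreal (E n (K q) (s + t)) = ennreal (E n (K q) s) + ennreal q * (\<integral>\<^sup>+r. g n r * indicator {0..t} r \<partial>lborel)" for n
    using Yid(1)[OF t, of n] nnE[OF K_meas K_bounds(2,4)] s t by (simp add: g_def)
  have g: "g n r = ennreal (E n eK (s + r))" if "0 \<le> r" for n r
    using Yid(2)[OF t that, of n] nnE[OF eK_meas eK_bounds(1,3), of "s + r" n] s that
    by (simp add: g_def eK_def[abs_def] ee_def)
  have gm[measurable]: "g n \<in> borel_measurable borel" for n
    unfolding g_def[abs_def] by (rule Yid(3)[OF t])
  define a where "a r = (\<integral>\<omega>. GG c I \<tau> \<omega> * eK (X (max 0 (s + r)) \<omega>) \<partial>P)" for r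
  have am[measurable]: "a \<in> borel_measurable borel"
    unfolding a_def by measurable
  have EJ: "E n eK r \<le> J q" if "0 \<le> r" for n r
  proof -
    interpret Nn: prob_space "N (x n)" using Y_markov[OF x] by (simp add: markov_process_def)
    have "E n eK r \<le> (\<integral>\<omega>. J q \<partial>N (x n))"
      unfolding E_def
    proof (rule integral_mono')
      fix \<omega>
      have "G n \<omega> * eK (Y (x n) r \<omega>) \<le> 1 * J q" using Gb eK_bounds by (intro mult_mono) auto
      then show "G n \<omega> * eK (Y (x n) r \<omega>) \<le> J q" by simp
    qed (use J_pos in auto)
    then show ?thesis by (simp add: Nn.prob_space)
  qed
  have "(\<lambda>n. \<integral>\<^sup>+r. g n r * indicator {0..t} r \<partial>lborel) \<longlonglongrightarrow> (\<integral>\<^sup>+r. ennreal (a r) * indicator {0..t} r \<partial>lborel)"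
  proof (rule nn_integral_dominated_convergence[where w="\<lambda>r. ennreal (J q) * indicator {0..t} r"])
    show "(\<integral>\<^sup>+r. ennreal (J q) * indicator {0..t} r \<partial>lborel) < \<infinity>"
      using t by (simp add: nn_integral_cmult_indicator ennreal_mult_less_top)
    show "AE r in lborel. g n r * indicator {0..t} r \<le> ennreal (J q) * indicator {0..t} r" for n
      using EJ s by (intro AE_I2) (auto simp: indicator_def g intro!: ennreal_leI)
    show "AE r in lborel. (\<lambda>n. g n r * indicator {0..t} r) \<longlonglongrightarrow> ennreal (a r) * indicator {0..t} r"
    proof (rule AE_I2)
      fix r
      show "(\<lambda>n. g n r * indicator {0..t} r) \<longlonglongrightarrow> ennreal (a r) * indicator {0..t} r"
      proof (cases "r \<in> {0..t}")
        case True
        have "(\<lambda>n. E n eK (s + r)) \<longlonglongrightarrow> a r"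
          using Elim[OF eK_isCont eK_bounds(3), of "s + r"] True s by (simp add: a_def max_def)
        then show ?thesis using True by (simp add: g tendsto_ennrealI)
      qed simp
    qed
  qed measurable
  then have "(\<lambda>n. ennreal (E n (K q) s) + ennreal q * (\<integral>\<^sup>+r. g n r * indicator {0..t} r \<partial>lborel)) \<longlonglongrightarrow>
      ennreal (\<integral>\<omega>. GG c I \<tau> \<omega> * K q (X s \<omega>) \<partial>P) + ennreal q * (\<integral>\<^sup>+r. ennreal (a r) * indicator {0..t} r \<partial>lborel)"
    using s by (intro tendsto_add tendsto_ennrealI ennreal_tendsto_cmult Elim K_continuous[OF q] K_bounds) auto
  moreover have "(\<lambda>n. ennreal (E n (K q) (s + t))) \<longlonglongrightarrow> ennreal (\<integral>\<omega>. GG c I \<tau> \<omega> * K q (X (s + t) \<omega>) \<partial>P)"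
    using s t by (intro tendsto_ennrealI Elim K_continuous[OF q] K_bounds) auto
  ultimately show ?thesis unfolding id a_def by (simp add: LIMSEQ_unique)
qed

lemma X_identity:
  assumes I: "finite I" "\<And>i. i \<in> I \<Longrightarrow> 0 \<le> \<tau> i \<and> \<tau> i \<le> s" and s: "0 \<le> s" "s \<le> s'" and c: "0 \<le> c"
  shows "(\<integral>\<omega>. GG c I \<tau> \<omega> * K q (X s' \<omega>) \<partial>P) = (\<integral>\<omega>. GG c I \<tau> \<omega> * K q (X s \<omega>) \<partial>P) +
    q * (\<integral>r. indicator {s..<s'} r * (\<integral>\<omega>. GG c I \<tau> \<omega> * eK (X (max 0 r) \<omega>) \<partial>P) \<partial>lborel)"
proof -
  define a where "a r = (\<integral>\<omega>. GG c I \<tau> \<omega> * eK (X (max 0 r) \<omega>) \<partial>P)" for r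
  have am[measurable]: "a \<in> borel_measurable borel" unfolding a_def by measurable
  have a0: "0 \<le> a r" for r unfolding a_def using GG_bounds[OF c] eK_bounds by (intro Bochner_Integration.integral_nonneg) auto
  have aJ: "\<bar>a r\<bar> \<le> J q" for r unfolding a_def by (rule GG_eK_bound[OF c])
  have int: "integrable lborel (\<lambda>r. indicator {s..<s'} r * a r)"
  proof (rule Bochner_Integration.integrable_bound[where f="\<lambda>r. J q * indicator {s..<s'} r"])
    show "integrable lborel (\<lambda>r. J q * indicator {s..<s'} r :: real)" using s by (intro integrable_mult_right integrable_real_indicator) auto
  qed (use aJ J_pos in \<open>auto simp: indicator_def\<close>)
  have "(\<integral>\<^sup>+r. ennreal (a (s + r)) * indicator {0..s' - s} r \<partial>lborel) = (\<integral>\<^sup>+r. ennreal (indicator {s..<s'} r * a r) \<partial>lborel)"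
  proof -
    have "(\<integral>\<^sup>+r. ennreal (indicator {s..<s'} r * a r) \<partial>lborel) = (\<integral>\<^sup>+r. ennreal (indicator {s..<s'} (s + 1 * r) * a (s + 1 * r)) \<partial>lborel)"
      using nn_integral_real_affine[of "\<lambda>r. ennreal (indicator {s..<s'} r * a r)" 1 s] by simp
    also have "\<dots> = (\<integral>\<^sup>+r. ennreal (a (s + r)) * indicator {0..s' - s} r \<partial>lborel)"
      by (intro nn_integral_cong_AE, use AE_lborel_singleton[of "s' - s"] in eventually_elim) (auto simp: indicator_def)
    finally show ?thesis by simp
  qed
  also have "\<dots> = ennreal (\<integral>r. indicator {s..<s'} r * a r \<partial>lborel)"
    using int a0 by (intro nn_integral_eq_integral) auto
  finally have I': "(\<integral>\<^sup>+r. ennreal (a (s + r)) * indicator {0..s' - s} r \<partial>lborel) = ennreal (\<integral>r. indicator {s..<s'} r * a r \<partial>lborel)" .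
  have i0: "0 \<le> (\<integral>r. indicator {s..<s'} r * a r \<partial>lborel)" using a0 by (intro Bochner_Integration.integral_nonneg) auto
  have K0: "0 \<le> (\<integral>\<omega>. GG c I \<tau> \<omega> * K q (X r \<omega>) \<partial>P)" for r
    using GG_bounds[OF c] K_bounds(2) by (intro Bochner_Integration.integral_nonneg) auto
  have "ennreal (\<integral>\<omega>. GG c I \<tau> \<omega> * K q (X s' \<omega>) \<partial>P) =
      ennreal ((\<integral>\<omega>. GG c I \<tau> \<omega> * K q (X s \<omega>) \<partial>P) + q * (\<integral>r. indicator {s..<s'} r * a r \<partial>lborel))"
    using X_identity_nn[OF I s(1) _ c, where t="s' - s"] s I' i0 K0[of s] q by (simp add: a_def ennreal_mult ennreal_plus)
  then show ?thesis
    unfolding a_def using K0[of s'] K0[of s] i0 q by (subst (asm) ennreal_inj) (auto simp: a_def intro!: add_nonneg_nonneg)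
qed

text \<open>Feynman-Kac expectation with a right Riemann sum in the exponent, hence no term for time
  0. For a fine mesh it is nearly constant in \<open>i\<close>.\<close>

definition DD :: "real \<Rightarrow> nat \<Rightarrow> real" where
  "DD h i = (\<integral>\<omega>. GG (q * h) {1..i} (\<lambda>j. real j * h) \<omega> * K q (X (max 0 (real i * h)) \<omega>) \<partial>P)"

definition zz :: "real \<Rightarrow> real \<Rightarrow> real" where
  "zz h r = (\<integral>\<omega>. \<bar>eK (X (max 0 r) \<omega>) - eK (X (max 0 (nxt h r)) \<omega>)\<bar> \<partial>P)"

lemma zz_meas [measurable]: "zz h \<in> borel_measurable borel"
  unfolding zz_def[abs_def] by measurable

lemma eK_diff: "\<bar>eK y - eK z\<bar> \<le> J q"
  using eK_bounds[of y] eK_bounds[of z] by linarith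

lemma zz_bounds: "0 \<le> zz h r" "zz h r \<le> J q"
proof -
  show "0 \<le> zz h r" unfolding zz_def by simp
  have "zz h r \<le> (\<integral>\<omega>. J q \<partial>P)"
    unfolding zz_def using J_pos eK_diff by (intro integral_mono') auto
  then show "zz h r \<le> J q" by (simp add: P.prob_space)
qed

lemma integrable_bounded_on:
  fixes f :: "real \<Rightarrow> real"
  assumes [measurable]: "f \<in> borel_measurable borel" and B: "\<And>r. \<bar>f r\<bar> \<le> B"
  shows "integrable lborel (\<lambda>r. indicator {x..<y} r * f r)"
proof (cases "x \<le> y")
  case True
  show ?thesis
  proof (rule Bochner_Integration.integrable_bound[where f="\<lambda>r. B * indicator {x..<y} r"])
    show "integrable lborel (\<lambda>r. B * indicator {x..<y} r :: real)"
      using True by (intro integrable_mult_right integrable_real_indicator) auto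
  qed (use B abs_ge_self[of B] in \<open>auto simp: indicator_def intro: order_trans\<close>)
qed simp

text \<open>Over one step the weighted expectation of \<open>K\<close> gains \<open>q\<close> times
  the integral of \<open>eK\<close>, by \<open>X_identity\<close>, while the new factor
  \<open>exp (- y)\<close> costs \<open>q * h\<close> times the expectation of \<open>eK\<close> at
  the right end. These cancel up to the oscillation \<open>zz\<close> of \<open>eK\<close> within
  the step and the second-order remainder \<open>R\<close>.\<close>

lemma DD_step:
  assumes h: "0 < h"
  shows "\<bar>DD h (Suc i) - DD h i\<bar> \<le>
    q * (\<integral>r. indicator {real i * h..<real (Suc i) * h} r * zz h r \<partial>lborel) + (q * h)\<^sup>2 * J q"
proof -
  define G where "G = GG (q * h) {1..i} (\<lambda>j. real j * h)"
  define s where "s = real i * h"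
  define s' where "s' = real (Suc i) * h"
  have s: "0 \<le> s" "s \<le> s'" "s' = s + h" using h by (auto simp: s_def s'_def distrib_right)
  have ms: "max 0 s = s" "max 0 s' = s'" using s by auto
  have c: "0 \<le> q * h" using q h by simp
  have Xm[measurable]: "X s \<in> borel_measurable P" "X s' \<in> borel_measurable P" using s by (auto intro!: X_rv)
  have Gm[measurable]: "G \<in> borel_measurable P" unfolding G_def by measurable
  have G: "0 \<le> G \<omega>" "G \<omega> \<le> 1" for \<omega> unfolding G_def using GG_bounds[OF c] by auto
  have Gint: "integrable P (\<lambda>\<omega>. G \<omega> * f \<omega>)" if "f \<in> borel_measurable P" "\<And>\<omega>. \<bar>f \<omega>\<bar> \<le> B" for f B
    unfolding G_def using c that by (rule GG_integrable)
  define y where "y \<omega> = q * h * ee (X s' \<omega>)" for \<omega>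
  have y0: "0 \<le> y \<omega>" "y \<omega> \<le> q * h" for \<omega>
    using c ee_bounds[of "X s' \<omega>"] mult_left_mono[of "ee (X s' \<omega>)" 1 "q * h"] by (auto simp: y_def)
  have ym[measurable]: "y \<in> borel_measurable P" unfolding y_def[abs_def] by measurable
  define a where "a r = (\<integral>\<omega>. G \<omega> * eK (X (max 0 r) \<omega>) \<partial>P)" for r
  have am[measurable]: "a \<in> borel_measurable borel" unfolding a_def by measurable
  have aJ: "\<bar>a r\<bar> \<le> J q" for r unfolding a_def G_def by (rule GG_eK_bound[OF c])
  define b where "b = (\<integral>\<omega>. G \<omega> * eK (X s' \<omega>) \<partial>P)"
  have DS: "DD h (Suc i) = (\<integral>\<omega>. G \<omega> * (exp (- y \<omega>) * K q (X s' \<omega>)) \<partial>P)"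
  proof -
    have "GG (q * h) {1..Suc i} (\<lambda>j. real j * h) \<omega> = G \<omega> * exp (- y \<omega>)" for \<omega>
      unfolding G_def GG_def y_def using ms
      by (simp add: exp_add[symmetric] distrib_left s'_def algebra_simps)
    then show ?thesis unfolding DD_def s'_def[symmetric] by (simp add: ms mult.assoc)
  qed
  have DI: "(\<integral>\<omega>. G \<omega> * K q (X s' \<omega>) \<partial>P) = DD h i + q * (\<integral>r. indicator {s..<s'} r * a r \<partial>lborel)"
    using X_identity[of "{1..i}" "\<lambda>j. real j * h" s s' "q * h"] s c h
    unfolding DD_def G_def[symmetric] a_def s_def[symmetric] ms
    by (auto simp: s_def intro!: mult_right_mono)
  define R where "R = (\<integral>\<omega>. G \<omega> * ((y \<omega> - (1 - exp (- y \<omega>))) * K q (X s' \<omega>)) \<partial>P)"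
  have exb: "\<bar>exp (- y \<omega>) * K q (X s' \<omega>)\<bar> \<le> J q" for \<omega>
    using y0[of \<omega>] K_bounds[of "X s' \<omega>"] mult_mono[of "exp (- y \<omega>)" 1 "K q (X s' \<omega>)" "J q"] by (simp add: abs_mult)
  have yb: "\<bar>y \<omega> * K q (X s' \<omega>)\<bar> \<le> q * h * J q" for \<omega>
    using y0[of \<omega>] K_bounds[of "X s' \<omega>"] c mult_mono[of "y \<omega>" "q * h" "K q (X s' \<omega>)" "J q"] by (simp add: abs_mult)
  have R_eq: "R = q * h * b - (\<integral>\<omega>. G \<omega> * K q (X s' \<omega>) \<partial>P) + DD h (Suc i)"
  proof -
    have i1: "integrable P (\<lambda>\<omega>. G \<omega> * (y \<omega> * K q (X s' \<omega>)))"
      by (rule Gint[OF _ yb]) measurable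
    have i2: "integrable P (\<lambda>\<omega>. G \<omega> * K q (X s' \<omega>))"
      by (rule Gint[OF _ K_bounds(4)]) measurable
    have i3: "integrable P (\<lambda>\<omega>. G \<omega> * (exp (- y \<omega>) * K q (X s' \<omega>)))"
      by (rule Gint[OF _ exb]) measurable
    have "R = (\<integral>\<omega>. G \<omega> * (y \<omega> * K q (X s' \<omega>)) - G \<omega> * K q (X s' \<omega>) + G \<omega> * (exp (- y \<omega>) * K q (X s' \<omega>)) \<partial>P)"
      unfolding R_def by (intro Bochner_Integration.integral_cong) (auto simp: algebra_simps)
    also have "\<dots> = (\<integral>\<omega>. G \<omega> * (y \<omega> * K q (X s' \<omega>)) \<partial>P) - (\<integral>\<omega>. G \<omega> * K q (X s' \<omega>) \<partial>P) + DD h (Suc i)"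
      using i1 i2 i3 by (simp add: DS)
    also have "(\<integral>\<omega>. G \<omega> * (y \<omega> * K q (X s' \<omega>)) \<partial>P) = q * h * b"
      unfolding b_def y_def eK_def by (subst integral_mult_right_zero[symmetric]) (simp add: mult_ac)
    finally show ?thesis .
  qed
  have R_bound: "\<bar>R\<bar> \<le> (q * h)\<^sup>2 * J q"
  proof -
    have b: "0 \<le> G \<omega> * ((y \<omega> - (1 - exp (- y \<omega>))) * K q (X s' \<omega>))"
      "G \<omega> * ((y \<omega> - (1 - exp (- y \<omega>))) * K q (X s' \<omega>)) \<le> (q * h)\<^sup>2 * J q" for \<omega>
    proof -
      note r = exp_remainder[OF y0(1)[of \<omega>]]
      have "(y \<omega>)\<^sup>2 \<le> (q * h)\<^sup>2" using y0 by (intro power_mono) auto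
      then have "y \<omega> - (1 - exp (- y \<omega>)) \<le> (q * h)\<^sup>2" using r by linarith
      then have "(y \<omega> - (1 - exp (- y \<omega>))) * K q (X s' \<omega>) \<le> (q * h)\<^sup>2 * J q"
        using r K_bounds by (intro mult_mono) auto
      moreover have "0 \<le> (y \<omega> - (1 - exp (- y \<omega>))) * K q (X s' \<omega>)" using r K_bounds by (intro mult_nonneg_nonneg)
      ultimately show "0 \<le> G \<omega> * ((y \<omega> - (1 - exp (- y \<omega>))) * K q (X s' \<omega>))"
        "G \<omega> * ((y \<omega> - (1 - exp (- y \<omega>))) * K q (X s' \<omega>)) \<le> (q * h)\<^sup>2 * J q"
        using G[of \<omega>] mult_mono[of "G \<omega>" 1 "(y \<omega> - (1 - exp (- y \<omega>))) * K q (X s' \<omega>)" "(q * h)\<^sup>2 * J q"] by auto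
    qed
    have "R \<le> (\<integral>\<omega>. (q * h)\<^sup>2 * J q \<partial>P)" unfolding R_def using b J_pos by (intro integral_mono') auto
    moreover have "0 \<le> R" unfolding R_def using b by (intro Bochner_Integration.integral_nonneg) auto
    ultimately show ?thesis by (simp add: P.prob_space)
  qed
  have hb: "(\<integral>r. indicator {s..<s'} r * b \<partial>lborel) = h * b"
    using s h by simp
  have "\<bar>(\<integral>r. indicator {s..<s'} r * a r \<partial>lborel) - h * b\<bar> \<le> (\<integral>r. indicator {s..<s'} r * zz h r \<partial>lborel)"
  proof -
    have ia: "integrable lborel (\<lambda>r. indicator {s..<s'} r * a r)" by (rule integrable_bounded_on[OF am aJ])
    have ib: "integrable lborel (\<lambda>r. indicator {s..<s'} r * b)" by (rule integrable_bounded_on[of _ "\<bar>b\<bar>"]) auto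
    have iz: "integrable lborel (\<lambda>r. indicator {s..<s'} r * zz h r)"
      by (rule integrable_bounded_on[of _ "J q"]) (use zz_bounds[of h] in auto)
    have "(\<integral>r. indicator {s..<s'} r * a r \<partial>lborel) - h * b =
        (\<integral>r. indicator {s..<s'} r * a r - indicator {s..<s'} r * b \<partial>lborel)"
      using ia ib by (simp add: hb[symmetric])
    also have "\<bar>\<dots>\<bar> \<le> (\<integral>r. indicator {s..<s'} r * zz h r \<partial>lborel)"
    proof (rule integral_abs_bound[THEN order_trans], rule integral_mono)
      show "integrable lborel (\<lambda>r. \<bar>indicator {s..<s'} r * a r - indicator {s..<s'} r * b\<bar>)"
        using ia ib by (intro integrable_abs Bochner_Integration.integrable_diff)
      fix r
      have "\<bar>a r - b\<bar> \<le> zz h r" if r: "r \<in> {s..<s'}"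
      proof -
        have n: "nxt h r = s'" unfolding s'_def using r h by (intro nxt_eq) (auto simp: s_def s'_def)
        have i1: "integrable P (\<lambda>\<omega>. G \<omega> * eK (X (max 0 r) \<omega>))" by (rule Gint[OF _ eK_bounds(3)]) measurable
        have i2: "integrable P (\<lambda>\<omega>. G \<omega> * eK (X s' \<omega>))" by (rule Gint[OF _ eK_bounds(3)]) measurable
        have "a r - b = (\<integral>\<omega>. G \<omega> * eK (X (max 0 r) \<omega>) - G \<omega> * eK (X s' \<omega>) \<partial>P)"
          unfolding a_def b_def using i1 i2 by simp
        also have "\<bar>\<dots>\<bar> \<le> zz h r"
          unfolding zz_def n ms
        proof (rule integral_abs_bound[THEN order_trans], rule integral_mono)
          show "integrable P (\<lambda>\<omega>. \<bar>G \<omega> * eK (X (max 0 r) \<omega>) - G \<omega> * eK (X s' \<omega>)\<bar>)"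
            using i1 i2 by (intro integrable_abs Bochner_Integration.integrable_diff)
          show "integrable P (\<lambda>\<omega>. \<bar>eK (X (max 0 r) \<omega>) - eK (X s' \<omega>)\<bar>)"
            by (rule P.integrable_const_bound[where B="J q"]) (auto simp: eK_diff)
          fix \<omega>
          have "\<bar>G \<omega>\<bar> * \<bar>eK (X (max 0 r) \<omega>) - eK (X s' \<omega>)\<bar> \<le> 1 * \<bar>eK (X (max 0 r) \<omega>) - eK (X s' \<omega>)\<bar>"
            using G[of \<omega>] by (intro mult_right_mono) auto
          then show "\<bar>G \<omega> * eK (X (max 0 r) \<omega>) - G \<omega> * eK (X s' \<omega>)\<bar> \<le> \<bar>eK (X (max 0 r) \<omega>) - eK (X s' \<omega>)\<bar>"
            by (simp add: abs_mult[symmetric] right_diff_distrib)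
        qed
        finally show ?thesis .
      qed
      then show "\<bar>indicator {s..<s'} r * a r - indicator {s..<s'} r * b\<bar> \<le> indicator {s..<s'} r * zz h r"
        by (auto simp: indicator_def)
    qed (rule iz)
    finally show ?thesis .
  qed
  then have "\<bar>q * ((\<integral>r. indicator {s..<s'} r * a r \<partial>lborel) - h * b)\<bar> \<le> q * (\<integral>r. indicator {s..<s'} r * zz h r \<partial>lborel)"
    using q by (simp add: abs_mult)
  moreover have "DD h (Suc i) - DD h i = q * ((\<integral>r. indicator {s..<s'} r * a r \<partial>lborel) - h * b) + R"
    unfolding R_eq DI by (simp add: right_diff_distrib mult.assoc)
  ultimately show ?thesis using R_bound unfolding s_def s'_def by linarith
qed

lemma indicator_integral_append:
  fixes f :: "real \<Rightarrow> real"
  assumes f: "f \<in> borel_measurable borel" "\<And>r. \<bar>f r\<bar> \<le> B" and xy: "x \<le> y" "y \<le> z"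
  shows "(\<integral>r. indicator {x..<z} r * f r \<partial>lborel) =
    (\<integral>r. indicator {x..<y} r * f r \<partial>lborel) + (\<integral>r. indicator {y..<z} r * f r \<partial>lborel)"
proof -
  have "(\<integral>r. indicator {x..<z} r * f r \<partial>lborel) = (\<integral>r. indicator {x..<y} r * f r + indicator {y..<z} r * f r \<partial>lborel)"
    using xy by (intro Bochner_Integration.integral_cong) (auto simp: indicator_def)
  then show ?thesis using integrable_bounded_on[OF f] by simp
qed

lemma DD_total:
  assumes h: "0 < h"
  shows "\<bar>DD h n - DD h 0\<bar> \<le>
    q * (\<integral>r. indicator {0..<real n * h} r * zz h r \<partial>lborel) + real n * ((q * h)\<^sup>2 * J q)"
proof (induction n)
  case (Suc n)
  have zb: "\<bar>zz h r\<bar> \<le> J q" for r using zz_bounds[of h r] by simp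
  have "(\<integral>r. indicator {0..<real (Suc n) * h} r * zz h r \<partial>lborel) = (\<integral>r. indicator {0..<real n * h} r * zz h r \<partial>lborel) +
      (\<integral>r. indicator {real n * h..<real (Suc n) * h} r * zz h r \<partial>lborel)"
    using h by (intro indicator_integral_append[OF zz_meas zb]) (auto simp: distrib_right)
  then show ?case using Suc DD_step[OF h, of n] by (simp add: distrib_left distrib_right)
qed simp

lemma DD_0: "DD h 0 = 1"
proof -
  have "DD h 0 = (\<integral>\<omega>. 1 \<partial>P)"
    unfolding DD_def
  proof (rule integral_cong_AE)
    show "AE \<omega> in P. GG (q * h) {1..0} (\<lambda>j. real j * h) \<omega> * K q (X (max 0 (real 0 * h)) \<omega>) = 1"
      using X_0 by eventually_elim (simp add: GG_def K_def[OF q])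
  qed measurable
  then show ?thesis by (simp add: P.prob_space)
qed

lemma X_nxt_tendsto:
  assumes \<omega>: "\<omega> \<in> space P" and r: "0 \<le> r" and T: "0 < T"
  shows "(\<lambda>n. X (max 0 (nxt (T / real (Suc n)) r)) \<omega>) \<longlonglongrightarrow> X (max 0 r) \<omega>"
proof -
  define x where "x n = nxt (T / real (Suc n)) r" for n
  have x: "r < x n" "x n \<le> r + T / real (Suc n)" for n
    unfolding x_def using T by (auto intro!: nxt_bounds)
  have up: "(\<lambda>n. r + T / real (Suc n)) \<longlonglongrightarrow> r" by real_asymp
  have "x \<longlonglongrightarrow> r"
    by (rule tendsto_sandwich[OF _ _ tendsto_const up]) (use x in \<open>auto intro!: always_eventually less_imp_le\<close>)
  then have "filterlim x (at_right r) sequentially"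
    using x by (auto simp: filterlim_at intro!: always_eventually)
  moreover have "((\<lambda>t. X t \<omega>) \<longlongrightarrow> X r \<omega>) (at_right r)"
    using X_cadlag[OF \<omega>] r by (simp add: cadlag_def continuous_within)
  ultimately have "(\<lambda>n. X (x n) \<omega>) \<longlonglongrightarrow> X r \<omega>" by (rule filterlim_compose[rotated])
  moreover have "max 0 (x n) = x n" for n using x(1)[of n] r by simp
  ultimately show ?thesis using r by (simp add: x_def)
qed

lemma zz_tendsto:
  assumes T: "0 < T"
  shows "(\<lambda>n. \<integral>r. indicator {0..<T} r * zz (T / real (Suc n)) r \<partial>lborel) \<longlonglongrightarrow> 0"
proof -
  have "(\<lambda>n. \<integral>r. indicator {0..<T} r * zz (T / real (Suc n)) r \<partial>lborel) \<longlonglongrightarrow> (\<integral>r. (0::real) \<partial>(lborel :: real measure))"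
  proof (rule integral_dominated_convergence[where w="\<lambda>r. indicator {0..<T} r * J q"])
    show "integrable lborel (\<lambda>r. indicator {0..<T} r * J q)"
      using J_pos by (intro integrable_bounded_on[of _ "J q"]) auto
    show "AE r in lborel. norm (indicator {0..<T} r * zz (T / real (Suc n)) r) \<le> indicator {0..<T} r * J q" for n
      using zz_bounds by (intro AE_I2) (auto simp: indicator_def)
    show "AE r in lborel. (\<lambda>n. indicator {0..<T} r * zz (T / real (Suc n)) r) \<longlonglongrightarrow> 0"
    proof (rule AE_I2)
      fix r
      show "(\<lambda>n. indicator {0..<T} r * zz (T / real (Suc n)) r) \<longlonglongrightarrow> 0"
      proof (cases "r \<in> {0..<T}")
        case True
        have "(\<lambda>n. zz (T / real (Suc n)) r) \<longlonglongrightarrow> (\<integral>\<omega>. 0 \<partial>P)"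
          unfolding zz_def
        proof (rule integral_dominated_convergence[where w="\<lambda>_. J q"])
          show "AE \<omega> in P. (\<lambda>n. \<bar>eK (X (max 0 r) \<omega>) - eK (X (max 0 (nxt (T / real (Suc n)) r)) \<omega>)\<bar>) \<longlonglongrightarrow> 0"
          proof (rule AE_I2)
            fix \<omega> assume \<omega>: "\<omega> \<in> space P"
            have "(\<lambda>n. eK (X (max 0 (nxt (T / real (Suc n)) r)) \<omega>)) \<longlonglongrightarrow> eK (X (max 0 r) \<omega>)"
              using True by (intro isCont_tendsto_compose[OF eK_isCont] X_nxt_tendsto[OF \<omega> _ T]) auto
            then have "(\<lambda>n. \<bar>eK (X (max 0 r) \<omega>) - eK (X (max 0 (nxt (T / real (Suc n)) r)) \<omega>)\<bar>) \<longlonglongrightarrow> \<bar>eK (X (max 0 r) \<omega>) - eK (X (max 0 r) \<omega>)\<bar>"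
              by (intro tendsto_intros)
            then show "(\<lambda>n. \<bar>eK (X (max 0 r) \<omega>) - eK (X (max 0 (nxt (T / real (Suc n)) r)) \<omega>)\<bar>) \<longlonglongrightarrow> 0" by simp
          qed
        qed (auto simp: eK_diff)
        then show ?thesis using True by simp
      qed simp
    qed
  qed auto
  then show ?thesis by simp
qed

end

section \<open>The additive functional of the limit process and its Laplace transform\<close>

definition AA :: "real \<Rightarrow> 'c \<Rightarrow> real" where
  "AA T \<omega> = (\<integral>r. indicator {0..<T} r * ee (X (max 0 r) \<omega>) \<partial>lborel)"

lemma AA_meas [measurable]: "AA T \<in> borel_measurable P"
  unfolding AA_def[abs_def] by measurable

lemma ee_abs: "\<bar>ee z\<bar> \<le> 1" using ee_bounds[of z] by simp

lemma X_path_meas [measurable]: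
  "\<omega> \<in> space P \<Longrightarrow> (\<lambda>r. X (max 0 r) \<omega>) \<in> borel_measurable borel"
  using X_raw[of "\<lambda>r. r" borel "\<lambda>_. \<omega>"] by simp

lemma riemann_sum:
  assumes h: "0 < h" and \<omega>: "\<omega> \<in> space P"
  shows "h * (\<Sum>j\<in>{1..i}. ee (X (max 0 (real j * h)) \<omega>)) =
    (\<integral>r. indicator {0..<real i * h} r * ee (X (max 0 (nxt h r)) \<omega>) \<partial>lborel)"
proof (induction i)
  case (Suc i)
  have m: "(\<lambda>r. ee (X (max 0 (nxt h r)) \<omega>)) \<in> borel_measurable borel"
    by (rule measurable_compose[OF measurable_compose[OF nxt_measurable X_path_meas[OF \<omega>]] ee_measurable])
  have "(\<integral>r. indicator {0..<real (Suc i) * h} r * ee (X (max 0 (nxt h r)) \<omega>) \<partial>lborel) =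
      (\<integral>r. indicator {0..<real i * h} r * ee (X (max 0 (nxt h r)) \<omega>) \<partial>lborel) +
      (\<integral>r. indicator {real i * h..<real (Suc i) * h} r * ee (X (max 0 (nxt h r)) \<omega>) \<partial>lborel)"
    using h by (intro indicator_integral_append[OF zero_less_one m ee_abs]) (auto simp: distrib_right)
  also have "(\<integral>r. indicator {real i * h..<real (Suc i) * h} r * ee (X (max 0 (nxt h r)) \<omega>) \<partial>lborel) =
      (\<integral>r. indicator {real i * h..<real (Suc i) * h} r * ee (X (max 0 (real (Suc i) * h)) \<omega>) \<partial>lborel)"
    using nxt_eq[OF h, of i] by (intro Bochner_Integration.integral_cong) (auto simp: indicator_def)
  also have "\<dots> = h * ee (X (max 0 (real (Suc i) * h)) \<omega>)"
    using h by (simp add: distrib_right)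
  finally show ?case using Suc by (simp add: distrib_left)
qed simp

lemma AA_nxt_tendsto:
  assumes T: "0 < T" and \<omega>: "\<omega> \<in> space P"
  shows "(\<lambda>n. \<integral>r. indicator {0..<T} r * ee (X (max 0 (nxt (T / real (Suc n)) r)) \<omega>) \<partial>lborel) \<longlonglongrightarrow> AA T \<omega>"
  unfolding AA_def
proof (rule integral_dominated_convergence[where w="\<lambda>r. indicator {0..<T} r * 1"])
  have [measurable]: "(\<lambda>r. ee (X (max 0 r) \<omega>)) \<in> borel_measurable borel"
    by (rule measurable_compose[OF X_path_meas[OF \<omega>] ee_measurable])
  have [measurable]: "(\<lambda>r. ee (X (max 0 (nxt h r)) \<omega>)) \<in> borel_measurable borel" for h
    by (rule measurable_compose[OF measurable_compose[OF nxt_measurable X_path_meas[OF \<omega>]] ee_measurable])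
  show "(\<lambda>r. indicator {0..<T} r * ee (X (max 0 r) \<omega>)) \<in> borel_measurable lborel" by measurable
  show "(\<lambda>r. indicator {0..<T} r * ee (X (max 0 (nxt (T / real (Suc n)) r)) \<omega>)) \<in> borel_measurable lborel" for n by measurable
  show "integrable lborel (\<lambda>r. indicator {0..<T} r * (1::real))" using T by simp
  show "AE r in lborel. (\<lambda>n. indicator {0..<T} r * ee (X (max 0 (nxt (T / real (Suc n)) r)) \<omega>)) \<longlonglongrightarrow> indicator {0..<T} r * ee (X (max 0 r) \<omega>)"
  proof (rule AE_I2)
    fix r
    show "(\<lambda>n. indicator {0..<T} r * ee (X (max 0 (nxt (T / real (Suc n)) r)) \<omega>)) \<longlonglongrightarrow> indicator {0..<T} r * ee (X (max 0 r) \<omega>)"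
    proof (cases "r \<in> {0..<T}")
      case True
      then show ?thesis
        by (intro tendsto_mult tendsto_const isCont_tendsto_compose[OF ee_isCont] X_nxt_tendsto[OF zero_less_one \<omega> _ T]) auto
    qed simp
  qed
  show "AE r in lborel. norm (indicator {0..<T} r * ee (X (max 0 (nxt (T / real (Suc n)) r)) \<omega>)) \<le> indicator {0..<T} r * 1" for n
    by (intro AE_I2) (auto simp: indicator_def ee_abs)
qed

lemma AA_nonneg: "0 \<le> AA T \<omega>"
  unfolding AA_def using ee_bounds by (intro Bochner_Integration.integral_nonneg) (auto simp: less_imp_le)

text \<open>With \<open>n + 1\<close> steps of length \<open>T / real (Suc n)\<close> the
  second-order remainders add up to order \<open>1 / n\<close>, and the accumulated oscillation
  tends to 0 by right-continuity of the paths.\<close>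

lemma feynman_kac:
  assumes q: "0 < q" and T: "0 < T"
  shows "(\<integral>\<omega>. exp (- (q * AA T \<omega>)) * K q (X T \<omega>) \<partial>P) = 1"
proof -
  note [measurable] = K_measurable[OF q]
  define h where "h n = T / real (Suc n)" for n
  have h: "0 < h n" for n using T by (simp add: h_def)
  have nh: "real (Suc n) * h n = T" for n by (simp add: h_def)
  have XT[measurable]: "X T \<in> borel_measurable P" using T by (intro X_rv) simp
  have mT: "max 0 T = T" using T by simp
  define bd where "bd n = q * (\<integral>r. indicator {0..<T} r * zz q (h n) r \<partial>lborel) + real (Suc n) * ((q * h n)\<^sup>2 * J q)" for n
  have "(\<lambda>n. real (Suc n) * ((q * h n)\<^sup>2 * J q)) \<longlonglongrightarrow> 0"
  proof -
    have "m * ((q * (T / m))\<^sup>2 * J q) = (q * T)\<^sup>2 * J q / m" if "m \<noteq> 0" for m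
      using that by (simp add: power2_eq_square)
    from this[of "real (Suc _)"]
    have "real (Suc n) * ((q * h n)\<^sup>2 * J q) = (q * T)\<^sup>2 * J q / real (Suc n)" for n
      by (simp add: h_def del: of_nat_Suc)
    then show ?thesis using LIMSEQ_Suc[OF lim_const_over_n[of "(q * T)\<^sup>2 * J q"]] by simp
  qed
  then have bd: "bd \<longlonglongrightarrow> q * 0 + 0"
    unfolding bd_def h_def by (intro tendsto_add tendsto_mult tendsto_const zz_tendsto[OF q T]) (simp_all only: h_def)
  have le: "\<bar>DD q (h n) (Suc n) - 1\<bar> \<le> bd n" for n
    using DD_total[OF q h, of n "Suc n"] unfolding DD_0[OF q] nh bd_def .
  have "bd \<longlonglongrightarrow> 0" using bd by simp
  then have "(\<lambda>n. DD q (h n) (Suc n) - 1) \<longlonglongrightarrow> 0"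
    by (rule Lim_null_comparison[rotated]) (simp add: le)
  then have L1: "(\<lambda>n. DD q (h n) (Suc n)) \<longlonglongrightarrow> 1" by (simp add: LIM_zero_iff)
  have "(\<lambda>n. DD q (h n) (Suc n)) \<longlonglongrightarrow> (\<integral>\<omega>. exp (- (q * AA T \<omega>)) * K q (X T \<omega>) \<partial>P)"
    unfolding DD_def[OF q] nh mT
  proof (rule integral_dominated_convergence[where w="\<lambda>_. J q"])
    show "AE \<omega> in P. (\<lambda>n. GG (q * h n) {1..Suc n} (\<lambda>j. real j * h n) \<omega> * K q (X T \<omega>)) \<longlonglongrightarrow> exp (- (q * AA T \<omega>)) * K q (X T \<omega>)"
    proof (rule AE_I2)
      fix \<omega> assume \<omega>: "\<omega> \<in> space P"
      have "GG (q * h n) {1..Suc n} (\<lambda>j. real j * h n) \<omega> =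
          exp (- (q * (\<integral>r. indicator {0..<T} r * ee (X (max 0 (nxt (h n) r)) \<omega>) \<partial>lborel)))" for n
        using riemann_sum[OF h \<omega>, of n "Suc n"] unfolding GG_def[OF q] nh by (simp add: mult.assoc)
      moreover have "(\<lambda>n. exp (- (q * (\<integral>r. indicator {0..<T} r * ee (X (max 0 (nxt (h n) r)) \<omega>) \<partial>lborel)))) \<longlonglongrightarrow> exp (- (q * AA T \<omega>))"
        unfolding h_def by (intro tendsto_intros AA_nxt_tendsto[OF T \<omega>])
      ultimately show "(\<lambda>n. GG (q * h n) {1..Suc n} (\<lambda>j. real j * h n) \<omega> * K q (X T \<omega>)) \<longlonglongrightarrow> exp (- (q * AA T \<omega>)) * K q (X T \<omega>)"
        by (intro tendsto_mult tendsto_const) simp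
    qed
    show "AE \<omega> in P. norm (GG (q * h n) {1..Suc n} (\<lambda>j. real j * h n) \<omega> * K q (X T \<omega>)) \<le> J q" for n
    proof (rule AE_I2)
      fix \<omega>
      have "0 \<le> q * h n" using q h[of n] by simp
      from GG_bounds[OF q this, of "{1..Suc n}" "\<lambda>j. real j * h n" \<omega>]
      have "\<bar>GG (q * h n) {1..Suc n} (\<lambda>j. real j * h n) \<omega>\<bar> * \<bar>K q (X T \<omega>)\<bar> \<le> 1 * J q"
        using K_bounds[OF q] by (intro mult_mono) auto
      then show "norm (GG (q * h n) {1..Suc n} (\<lambda>j. real j * h n) \<omega> * K q (X T \<omega>)) \<le> J q" by (simp add: abs_mult)
    qed
    show "(\<lambda>\<omega>. GG (q * h n) {1..Suc n} (\<lambda>j. real j * h n) \<omega> * K q (X T \<omega>)) \<in> borel_measurable P" for n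
      using GG_meas[OF q] by measurable
  qed auto
  with L1 show ?thesis by (metis LIMSEQ_unique)
qed

definition mE :: "real \<Rightarrow> real" where
  "mE r = (\<integral>\<omega>. ee (X (max 0 r) \<omega>) \<partial>P)"

lemma mE_meas [measurable]: "mE \<in> borel_measurable borel"
  unfolding mE_def[abs_def] by measurable

lemma ee_integrable: "integrable P (\<lambda>\<omega>. ee (X (max 0 r) \<omega>))"
  by (rule P.integrable_const_bound[where B=1]) (auto simp: ee_abs)

lemma mE_bounds: "0 \<le> mE r" "mE r \<le> 1"
proof -
  show "0 \<le> mE r" unfolding mE_def using ee_bounds by (intro Bochner_Integration.integral_nonneg) auto
  have "mE r \<le> (\<integral>\<omega>. 1 \<partial>P)" unfolding mE_def using ee_bounds by (intro integral_mono') auto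
  then show "mE r \<le> 1" by (simp add: P.prob_space)
qed

text \<open>\<open>X_identity\<close> without weights: the expectation of \<open>K (X T)\<close>
  starts from 1, stays below \<open>J q\<close>, and grows by \<open>q\<close> times the integral of
  the mean of \<open>eK\<close>, which dominates \<open>ee\<close>. The bound is uniform in
  \<open>T\<close>.\<close>

lemma mE_integral:
  assumes q: "0 < q" and T: "0 \<le> T"
  shows "(\<integral>r. indicator {0..<T} r * mE r \<partial>lborel) \<le> (J q - 1) / q"
proof -
  note [measurable] = K_measurable[OF q] eK_meas[OF q]
  define a where "a r = (\<integral>\<omega>. eK q (X (max 0 r) \<omega>) \<partial>P)" for r
  have [measurable]: "a \<in> borel_measurable borel" unfolding a_def by measurable
  have ieK: "integrable P (\<lambda>\<omega>. eK q (X (max 0 r) \<omega>))" for r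
    by (rule P.integrable_const_bound[where B="J q"]) (auto simp: eK_bounds[OF q])
  have aJ: "\<bar>a r\<bar> \<le> J q" for r
  proof -
    have "a r \<le> (\<integral>\<omega>. J q \<partial>P)"
      unfolding a_def using eK_bounds[OF q] J_pos[OF q] by (intro integral_mono') auto
    moreover have "0 \<le> a r" unfolding a_def using eK_bounds[OF q] by (intro Bochner_Integration.integral_nonneg) auto
    ultimately show ?thesis by (simp add: P.prob_space)
  qed
  have [measurable]: "X T \<in> borel_measurable P" using T by (rule X_rv)
  have K0: "(\<integral>\<omega>. K q (X 0 \<omega>) \<partial>P) = 1"
    using DD_0[OF q, of 1] by (simp add: DD_def[OF q] GG_def[OF q])
  have KT: "(\<integral>\<omega>. K q (X T \<omega>) \<partial>P) \<le> J q"
  proof -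
    have "(\<integral>\<omega>. K q (X T \<omega>) \<partial>P) \<le> (\<integral>\<omega>. J q \<partial>P)"
      using K_bounds[OF q] J_pos[OF q] by (intro integral_mono') auto
    then show ?thesis by (simp add: P.prob_space)
  qed
  have id: "(\<integral>\<omega>. K q (X T \<omega>) \<partial>P) = 1 + q * (\<integral>r. indicator {0..<T} r * a r \<partial>lborel)"
    using X_identity[OF q, of "{}" "\<lambda>_. 0" 0 T 0] T K0 by (simp add: GG_def[OF q] a_def)
  have "(\<integral>r. indicator {0..<T} r * mE r \<partial>lborel) \<le> (\<integral>r. indicator {0..<T} r * a r \<partial>lborel)"
  proof (rule integral_mono)
    show "integrable lborel (\<lambda>r. indicator {0..<T} r * mE r)"
      by (rule integrable_bounded_on[OF zero_less_one mE_meas, of 1]) (use mE_bounds in auto)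
    show "integrable lborel (\<lambda>r. indicator {0..<T} r * a r)"
      by (rule integrable_bounded_on[OF zero_less_one _ aJ]) measurable
    have "mE r \<le> a r" for r
      unfolding mE_def a_def
    proof (rule integral_mono[OF ee_integrable ieK])
      fix \<omega>
      show "ee (X (max 0 r) \<omega>) \<le> eK q (X (max 0 r) \<omega>)"
        using mult_left_mono[OF K_bounds(1)[OF q] ee_bounds(3)] by (simp add: eK_def[OF q])
    qed
    then show "indicator {0..<T} r * mE r \<le> indicator {0..<T} r * a r" for r
      by (intro mult_left_mono) auto
  qed
  also have "\<dots> \<le> (J q - 1) / q" using id KT q by (simp add: field_simps)
  finally show ?thesis .
qed

text \<open>A uniformly bounded integral of the means forces them to be small at some late times.
  This stands in for the convergence of \<open>X\<close> to infinity.\<close>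

lemma mE_small:
  assumes e: "0 < e"
  shows "\<exists>T\<ge>T0. 0 < T \<and> mE T < e"
proof (rule ccontr)
  assume "\<not> ?thesis"
  then have ge: "e \<le> mE r" if "T0 \<le> r" "0 < r" for r using that by (auto simp: not_less)
  define B where "B = (J 1 - 1) / 1"
  define S where "S = max T0 1"
  define T where "T = S + (\<bar>B\<bar> + 1) / e"
  have T: "S \<le> T" "0 \<le> T" using e by (auto simp: T_def S_def intro!: add_nonneg_nonneg)
  have "(\<integral>r. indicator {S..<T} r * e \<partial>lborel) \<le> (\<integral>r. indicator {0..<T} r * mE r \<partial>lborel)"
  proof (rule integral_mono)
    show "integrable lborel (\<lambda>r. indicator {0..<T} r * mE r)"
      by (rule integrable_bounded_on[OF zero_less_one mE_meas, of 1]) (use mE_bounds in auto)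
    show "integrable lborel (\<lambda>r. indicator {S..<T} r * e)" using T by simp
    show "indicator {S..<T} r * e \<le> indicator {0..<T} r * mE r" for r
      using ge[of r] mE_bounds[of r] by (auto simp: indicator_def S_def)
  qed
  also have "\<dots> \<le> B" unfolding B_def using T by (intro mE_integral) auto
  finally have "(T - S) * e \<le> B" using T by simp
  then show False using e by (simp add: T_def)
qed

definition II :: "'c \<Rightarrow> ennreal" where
  "II \<omega> = (\<integral>\<^sup>+r. ennreal (ee (X (max 0 r) \<omega>)) * indicator {0..} r \<partial>lborel)"

lemma II_meas [measurable]: "II \<in> borel_measurable P"
  unfolding II_def[abs_def] by measurable

text \<open>Nonnegativity is known at each fixed time almost surely; Fubini gives it almost surely
  at almost every time, which is enough under the integral.\<close>

lemma exponential_functional_II: "AE \<omega> in P. exponential_functional X \<omega> = II \<omega>"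
proof -
  interpret PP: pair_sigma_finite lborel P ..
  have "AE r in lborel. AE \<omega> in P. 0 \<le> X (max 0 r) \<omega>"
    by (intro AE_I2 X_nonneg) simp
  then have "AE \<omega> in P. AE r in lborel. 0 \<le> X (max 0 r) \<omega>"
    by (subst (asm) PP.AE_commute) measurable
  then show ?thesis
  proof eventually_elim
    fix \<omega> assume pos: "AE r in lborel. 0 \<le> X (max 0 r) \<omega>"
    show "exponential_functional X \<omega> = II \<omega>"
      unfolding exponential_functional_def II_def
      by (intro nn_integral_cong_AE, use pos in eventually_elim) (auto simp: indicator_def ee_def max_def)
  qed
qed

lemma AA_II:
  assumes \<omega>: "\<omega> \<in> space P"
  shows "ennreal (AA T \<omega>) = (\<integral>\<^sup>+r. ennreal (ee (X (max 0 r) \<omega>)) * indicator {0..<T} r \<partial>lborel)"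
    and "ennreal (AA T \<omega>) \<le> II \<omega>"
    and "(\<lambda>n. ennreal (AA (real n) \<omega>)) \<longlonglongrightarrow> II \<omega>"
proof -
  have [measurable]: "(\<lambda>r. ee (X (max 0 r) \<omega>)) \<in> borel_measurable borel"
    by (rule measurable_compose[OF X_path_meas[OF \<omega>] ee_measurable])
  show eq: "ennreal (AA T \<omega>) = (\<integral>\<^sup>+r. ennreal (ee (X (max 0 r) \<omega>)) * indicator {0..<T} r \<partial>lborel)" for T
  proof -
    have "integrable lborel (\<lambda>r. indicator {0..<T} r * ee (X (max 0 r) \<omega>))"
      by (rule integrable_bounded_on[OF zero_less_one _ ee_abs]) measurable
    then have "ennreal (AA T \<omega>) = (\<integral>\<^sup>+r. ennreal (indicator {0..<T} r * ee (X (max 0 r) \<omega>)) \<partial>lborel)"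
      unfolding AA_def using ee_bounds by (intro nn_integral_eq_integral[symmetric]) auto
    also have "\<dots> = (\<integral>\<^sup>+r. ennreal (ee (X (max 0 r) \<omega>)) * indicator {0..<T} r \<partial>lborel)"
      by (intro nn_integral_cong) (auto simp: indicator_def)
    finally show ?thesis .
  qed
  show "ennreal (AA T \<omega>) \<le> II \<omega>"
    unfolding eq II_def by (intro nn_integral_mono) (auto simp: indicator_def)
  show "(\<lambda>n. ennreal (AA (real n) \<omega>)) \<longlonglongrightarrow> II \<omega>"
    unfolding eq II_def
  proof (rule nn_integral_LIMSEQ)
    show "incseq (\<lambda>n r. ennreal (ee (X (max 0 r) \<omega>)) * indicator {0..<real n} r)"
      by (auto simp: incseq_def le_fun_def indicator_def)
    fix r
    obtain m where m: "r < real m" using reals_Archimedean2 by blast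
    have "\<forall>\<^sub>F n in sequentially. ennreal (ee (X (max 0 r) \<omega>)) * indicator {0..<real n} r = ennreal (ee (X (max 0 r) \<omega>)) * indicator {0..} r"
      using eventually_ge_at_top[of m] by eventually_elim (use m in \<open>auto simp: indicator_def\<close>)
    then show "(\<lambda>n. ennreal (ee (X (max 0 r) \<omega>)) * indicator {0..<real n} r) \<longlonglongrightarrow> ennreal (ee (X (max 0 r) \<omega>)) * indicator {0..} r"
      by (rule tendsto_eventually)
  qed measurable
qed

lemma II_finite: "AE \<omega> in P. II \<omega> \<noteq> \<infinity>"
proof (rule nn_integral_PInf_AE)
  interpret PP: pair_sigma_finite lborel P ..
  have "(\<integral>\<^sup>+\<omega>. ennreal (AA (real n) \<omega>) \<partial>P) \<le> ennreal (J 1 - 1)" for n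
  proof -
    have "(\<integral>\<^sup>+\<omega>. ennreal (AA (real n) \<omega>) \<partial>P) =
        (\<integral>\<^sup>+\<omega>. \<integral>\<^sup>+r. ennreal (ee (X (max 0 r) \<omega>)) * indicator {0..<real n} r \<partial>lborel \<partial>P)"
      by (intro nn_integral_cong) (simp add: AA_II)
    also have "\<dots> = (\<integral>\<^sup>+r. \<integral>\<^sup>+\<omega>. ennreal (ee (X (max 0 r) \<omega>)) * indicator {0..<real n} r \<partial>P \<partial>lborel)"
      by (rule PP.Fubini') measurable
    also have "\<dots> = (\<integral>\<^sup>+r. ennreal (indicator {0..<real n} r * mE r) \<partial>lborel)"
    proof (rule nn_integral_cong)
      fix r
      have "(\<integral>\<^sup>+\<omega>. ennreal (ee (X (max 0 r) \<omega>)) \<partial>P) = ennreal (mE r)"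
        unfolding mE_def using ee_bounds by (intro nn_integral_eq_integral ee_integrable) auto
      then show "(\<integral>\<^sup>+\<omega>. ennreal (ee (X (max 0 r) \<omega>)) * indicator {0..<real n} r \<partial>P) = ennreal (indicator {0..<real n} r * mE r)"
        by (auto simp: indicator_def)
    qed
    also have "\<dots> = ennreal (\<integral>r. indicator {0..<real n} r * mE r \<partial>lborel)"
      using mE_bounds by (intro nn_integral_eq_integral integrable_bounded_on[OF zero_less_one mE_meas, of 1]) auto
    also have "\<dots> \<le> ennreal (J 1 - 1)" using mE_integral[of 1 "real n"] by (intro ennreal_leI) simp
    finally show ?thesis .
  qed
  moreover have "(\<lambda>n. \<integral>\<^sup>+\<omega>. ennreal (AA (real n) \<omega>) * indicator (space P) \<omega> \<partial>P) \<longlonglongrightarrow> (\<integral>\<^sup>+\<omega>. II \<omega> * indicator (space P) \<omega> \<partial>P)"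
  proof (rule nn_integral_LIMSEQ)
    show "incseq (\<lambda>n \<omega>. ennreal (AA (real n) \<omega>) * indicator (space P) \<omega>)"
      unfolding incseq_def le_fun_def
    proof (intro allI impI)
      fix m n \<omega> assume mn: "(m::nat) \<le> n"
      show "ennreal (AA (real m) \<omega>) * indicator (space P) \<omega> \<le> ennreal (AA (real n) \<omega>) * indicator (space P) \<omega>"
        using mn by (cases "\<omega> \<in> space P") (auto simp: AA_II(1) indicator_def intro!: nn_integral_mono)
    qed
    fix \<omega>
    show "(\<lambda>n. ennreal (AA (real n) \<omega>) * indicator (space P) \<omega>) \<longlonglongrightarrow> II \<omega> * indicator (space P) \<omega>"
      using AA_II(3)[of \<omega>] by (cases "\<omega> \<in> space P") auto
  qed measurable
  then have "(\<lambda>n. \<integral>\<^sup>+\<omega>. ennreal (AA (real n) \<omega>) \<partial>P) \<longlonglongrightarrow> (\<integral>\<^sup>+\<omega>. II \<omega> \<partial>P)"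
    by (simp cong: nn_integral_cong)
  ultimately have "(\<integral>\<^sup>+\<omega>. II \<omega> \<partial>P) \<le> ennreal (J 1 - 1)" by (intro LIMSEQ_le_const2) auto
  then show "(\<integral>\<^sup>+\<omega>. II \<omega> \<partial>P) \<noteq> \<infinity>" by (auto simp: top_unique)
qed measurable

definition ZZ :: "'c \<Rightarrow> real" where "ZZ \<omega> = enn2real (II \<omega>)"

lemma ZZ_meas [measurable]: "ZZ \<in> borel_measurable P"
  unfolding ZZ_def[abs_def] by measurable

lemma ZZ_nonneg: "0 \<le> ZZ \<omega>" by (simp add: ZZ_def)

lemma exponential_functional_ZZ: "AE \<omega> in P. exponential_functional X \<omega> = ennreal (ZZ \<omega>)"
  using exponential_functional_II II_finite by eventually_elim (simp add: ZZ_def less_top)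

text \<open>From \<open>feynman_kac\<close> and \<open>K \<le> J q\<close>, the transform is at
  least \<open>1 / J q\<close>. For the other inequality \<open>J q\<close> exceeds
  \<open>K v\<close> by at most \<open>e / 2 + c * ee v\<close>, because \<open>K\<close> tends to
  \<open>J q\<close> at infinity, and \<open>mE_small\<close> provides a time at which the
  expectation of \<open>ee\<close> is negligible.\<close>

lemma laplace_ZZ:
  assumes q: "0 < q"
  shows "(\<integral>\<omega>. exp (- (q * ZZ \<omega>)) \<partial>P) = 1 / J q"
proof -
  note [measurable] = K_measurable[OF q]
  define L where "L = (\<integral>\<omega>. exp (- (q * ZZ \<omega>)) \<partial>P)"
  define f where "f T = (\<integral>\<omega>. exp (- (q * AA T \<omega>)) \<partial>P)" for T
  have ebd: "norm (exp (- (q * AA T \<omega>))) \<le> 1" for T \<omega> using AA_nonneg[of T \<omega>] q by simp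
  have if': "integrable P (\<lambda>\<omega>. exp (- (q * AA T \<omega>)))" for T
    by (rule P.integrable_const_bound[where B=1]) (use ebd in auto)
  have iL: "integrable P (\<lambda>\<omega>. exp (- (q * ZZ \<omega>)))"
    by (rule P.integrable_const_bound[where B=1]) (use ZZ_nonneg q in auto)
  have XT: "X T \<in> borel_measurable P" if "0 < T" for T using that by (intro X_rv) simp
  have iK: "integrable P (\<lambda>\<omega>. exp (- (q * AA T \<omega>)) * K q (X T \<omega>))" if T: "0 < T" for T
  proof (rule P.integrable_const_bound[where B="J q"])
    note [measurable] = XT[OF T]
    show "(\<lambda>\<omega>. exp (- (q * AA T \<omega>)) * K q (X T \<omega>)) \<in> borel_measurable P" by measurable
    show "AE \<omega> in P. norm (exp (- (q * AA T \<omega>)) * K q (X T \<omega>)) \<le> J q"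
      using mult_mono[OF ebd K_bounds(4)[OF q]] by (intro AE_I2) (simp add: abs_mult)
  qed
  have lower: "1 \<le> J q * f T" if T: "0 < T" for T
  proof -
    have "(\<integral>\<omega>. exp (- (q * AA T \<omega>)) * K q (X T \<omega>) \<partial>P) \<le> (\<integral>\<omega>. exp (- (q * AA T \<omega>)) * J q \<partial>P)"
      using iK[OF T] if' K_bounds[OF q] by (intro integral_mono) (auto intro: mult_left_mono)
    then show ?thesis using feynman_kac[OF q T] by (simp add: f_def mult.commute)
  qed
  have AZ: "AE \<omega> in P. AA T \<omega> \<le> ZZ \<omega>" for T
    using II_finite AE_space
  proof eventually_elim
    fix \<omega> assume "II \<omega> \<noteq> \<infinity>" "\<omega> \<in> space P"
    then show "AA T \<omega> \<le> ZZ \<omega>"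
      using enn2real_mono[OF AA_II(2)[of \<omega> T]] AA_nonneg[of T \<omega>] by (simp add: ZZ_def less_top)
  qed
  have "(\<lambda>n. f (real n)) \<longlonglongrightarrow> L"
    unfolding f_def L_def
  proof (rule integral_dominated_convergence[where w="\<lambda>_. 1"])
    show "AE \<omega> in P. (\<lambda>n. exp (- (q * AA (real n) \<omega>))) \<longlonglongrightarrow> exp (- (q * ZZ \<omega>))"
      using II_finite AE_space
    proof eventually_elim
      fix \<omega> assume fin: "II \<omega> \<noteq> \<infinity>" and \<omega>: "\<omega> \<in> space P"
      have "II \<omega> = ennreal (ZZ \<omega>)" using fin by (simp add: ZZ_def less_top)
      with AA_II(3)[OF \<omega>] have "(\<lambda>n. AA (real n) \<omega>) \<longlonglongrightarrow> ZZ \<omega>"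
        using AA_nonneg ZZ_nonneg by (simp add: tendsto_ennreal_iff)
      then show "(\<lambda>n. exp (- (q * AA (real n) \<omega>))) \<longlonglongrightarrow> exp (- (q * ZZ \<omega>))" by (intro tendsto_intros)
    qed
  qed (use ebd in auto)
  then have "(\<lambda>n. J q * f (real n)) \<longlonglongrightarrow> J q * L" by (intro tendsto_intros)
  then have JL1: "1 \<le> J q * L"
    by (rule LIMSEQ_le_const) (use lower in \<open>auto intro!: exI[of _ 1]\<close>)
  have "J q * L \<le> 1 + e" if e: "0 < e" for e
  proof -
    have "\<forall>\<^sub>F v in at_top. J q - e / 2 < K q v"
      using order_tendstoD(1)[OF K_at_top[OF q], of "J q - e / 2"] e by simp
    then obtain v0 where v0: "\<And>v. v0 \<le> v \<Longrightarrow> J q - e / 2 < K q v" by (auto simp: eventually_at_top_linorder)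
    \<comment> \<open>With this factor \<open>c * ee v\<close> is at least \<open>J q\<close> for
      every \<open>v\<close> below \<open>v0\<close>, where \<open>K\<close> need not be close to
      \<open>J q\<close>.\<close>
    define c where "c = J q * exp (max v0 0)"
    have c: "0 < c" using J_pos[OF q] by (simp add: c_def)
    obtain T where T: "0 < T" "mE T < e / 2 / c" using mE_small[of "e / 2 / c" 0] e c by auto
    have [measurable]: "X T \<in> borel_measurable P" by (rule XT[OF T(1)])
    have mT: "max 0 T = T" using T by simp
    have pt: "J q \<le> K q v + (e / 2 + c * ee v)" for v
    proof (cases "v0 \<le> v")
      case True
      then show ?thesis using v0[OF True] c ee_bounds[of v] by (smt (verit) mult_nonneg_nonneg)
    next
      case False
      have "1 \<le> exp (max v0 0) * ee v" using False unfolding ee_def by (simp add: exp_add[symmetric] flip: exp_diff) 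
      then have "J q * 1 \<le> J q * (exp (max v0 0) * ee v)" using J_pos[OF q] by (intro mult_left_mono) auto
      then have "J q \<le> c * ee v" unfolding c_def mult.assoc by (simp only: mult_1_right)
      then show ?thesis using K_bounds(1)[OF q, of v] e by linarith
    qed
    have "J q * L \<le> J q * f T"
      unfolding L_def f_def using J_pos[OF q] AZ[of T] q
      by (intro mult_left_mono integral_mono_AE iL if') (auto elim!: eventually_mono)
    also have "\<dots> = (\<integral>\<omega>. J q * exp (- (q * AA T \<omega>)) \<partial>P)" by (simp add: f_def)
    also have "\<dots> \<le> (\<integral>\<omega>. exp (- (q * AA T \<omega>)) * K q (X T \<omega>) + (e / 2 + c * ee (X (max 0 T) \<omega>)) \<partial>P)"
    proof (rule integral_mono)
      show "integrable P (\<lambda>\<omega>. J q * exp (- (q * AA T \<omega>)))" using if' by simp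
      show "integrable P (\<lambda>\<omega>. exp (- (q * AA T \<omega>)) * K q (X T \<omega>) + (e / 2 + c * ee (X (max 0 T) \<omega>)))"
        using iK[OF T(1)] ee_integrable by (intro Bochner_Integration.integrable_add integrable_mult_right) auto
      fix \<omega>
      define E where "E = exp (- (q * AA T \<omega>))"
      have E: "0 \<le> E" "E \<le> 1" using ebd[of T \<omega>] by (auto simp: E_def)
      have r: "0 \<le> e / 2 + c * ee (X T \<omega>)" using e c ee_bounds[of "X T \<omega>"] by (intro add_nonneg_nonneg mult_nonneg_nonneg) auto
      have "J q * E \<le> (K q (X T \<omega>) + (e / 2 + c * ee (X T \<omega>))) * E"
        by (rule mult_right_mono[OF pt E(1)])
      also have "\<dots> \<le> E * K q (X T \<omega>) + (e / 2 + c * ee (X T \<omega>))"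
        using mult_left_le[OF E(2) r] unfolding distrib_right by (simp add: mult.commute[of E])
      finally show "J q * exp (- (q * AA T \<omega>)) \<le> exp (- (q * AA T \<omega>)) * K q (X T \<omega>) + (e / 2 + c * ee (X (max 0 T) \<omega>))"
        by (simp add: E_def mT)
    qed
    also have "\<dots> = 1 + (e / 2 + c * mE T)"
      using iK[OF T(1)] ee_integrable feynman_kac[OF q T(1)] by (simp add: mE_def P.prob_space)
    also have "\<dots> \<le> 1 + e" using T(2) c by (simp add: field_simps)
    finally show ?thesis .
  qed
  then have "J q * L \<le> 1" by (rule field_le_epsilon)
  with JL1 have "J q * L = 1" by simp
  then show ?thesis using J_pos[OF q] by (simp add: L_def field_simps)
qed

end

section \<open>The function \<open>\<phi>\<close>\<close>

locale psi_sharp =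
  fixes S :: "real \<Rightarrow> real" and g0 :: real
  assumes S_convex: "convex_on {0..} S" and S_0: "S 0 = 0"
    and S_diff: "\<And>l. 0 < l \<Longrightarrow> \<exists>D. (S has_real_derivative D) (at l)"
    and g0_pos: "0 < g0" and g_lim: "((\<lambda>l. S l / l) \<longlongrightarrow> g0) (at_right 0)"
    and g_top: "filterlim (\<lambda>l. S l / l) at_top at_top"
    and subexp: "\<And>e. 0 < e \<Longrightarrow> \<exists>C>0. \<forall>l>0. S l \<le> C * exp (e * l)"
begin

definition g :: "real \<Rightarrow> real" where "g l = S l / l"
text \<open>\<open>- m l\<close> is the value at 0 of the tangent to \<open>S\<close> at
  \<open>l\<close>, so convexity makes \<open>m\<close> monotone. As \<open>m l / l\<^sup>2\<close>
  is the derivative of \<open>g\<close>, it also determines \<open>\<phi>'\<close>.\<close>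

definition m :: "real \<Rightarrow> real" where "m l = l * deriv S l - S l"
definition ph :: "real \<Rightarrow> real" where
  "ph x = Inf {l. 0 \<le> l \<and> x < (if l = 0 then g0 else S l / l)}"

lemma S_deriv: "0 < l \<Longrightarrow> (S has_real_derivative deriv S l) (at l)"
  using S_diff DERIV_imp_deriv by blast

lemma tangent:
  assumes "0 < l" "0 \<le> y"
  shows "S l + deriv S l * (y - l) \<le> S y"
proof -
  have "deriv S l * (y - l) \<le> S y - S l"
    using assms S_deriv[OF assms(1)]
    by (intro convex_on_imp_above_tangent[OF S_convex]) (auto intro: has_field_derivative_at_within)
  then show ?thesis by simp
qed

lemma m_nonneg: "0 < l \<Longrightarrow> 0 \<le> m l"
  using tangent[of l 0] S_0 by (simp add: m_def algebra_simps)

text \<open>The tangent inequality at \<open>l\<close>, taken at \<open>L\<close> and divided by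
  \<open>L\<close>. In the variable \<open>- 1 / l\<close> it says that \<open>g\<close> is convex
  with slope \<open>m l\<close>.\<close>

lemma g_diff_lower:
  assumes "0 < l" "0 < L"
  shows "m l * (1 / l - 1 / L) \<le> g L - g l"
proof -
  have "(S l + deriv S l * (L - l)) / L \<le> S L / L"
    using tangent[of l L] assms by (intro divide_right_mono) auto
  moreover have "(S l + deriv S l * (L - l)) / L - S l / l = m l * (1 / l - 1 / L)"
    using assms by (simp add: m_def field_simps)
  ultimately show ?thesis by (simp add: g_def)
qed

lemma g_diff_upper: "0 < l \<Longrightarrow> 0 < L \<Longrightarrow> g L - g l \<le> m L * (1 / l - 1 / L)"
  using g_diff_lower[of L l] by (simp add: algebra_simps)

lemma g_mono:
  assumes "0 < l" "l \<le> L"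
  shows "g l \<le> g L"
proof -
  have "1 / L \<le> 1 / l" using assms by (intro frac_le) auto
  then have "0 \<le> m l * (1 / l - 1 / L)" using m_nonneg[of l] assms by simp
  then show ?thesis using g_diff_lower[of l L] assms by linarith
qed

lemma g_ge: "0 < l \<Longrightarrow> g0 \<le> g l"
proof -
  assume l: "0 < l"
  have "\<forall>\<^sub>F y in at_right 0. S y / y \<le> g l"
    using eventually_at_right_real[OF l] by eventually_elim (use g_mono in \<open>auto simp: g_def\<close>)
  then show ?thesis by (rule tendsto_upperbound[OF g_lim]) simp
qed

lemma g_pos: "0 < l \<Longrightarrow> 0 < g l" using g_ge[of l] g0_pos by linarith

lemma S_pos: "0 < l \<Longrightarrow> 0 < S l" using g_pos[of l] by (simp add: g_def zero_less_divide_iff)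

lemma m_mono:
  assumes "0 < l" "l \<le> L"
  shows "m l \<le> m L"
proof (cases "l = L")
  case False
  then have "0 < 1 / l - 1 / L" using assms by (simp add: frac_less2)
  moreover have "m l * (1 / l - 1 / L) \<le> m L * (1 / l - 1 / L)"
    using g_diff_lower[of l L] g_diff_upper[of l L] assms by linarith
  ultimately show ?thesis by simp
qed simp

text \<open>If \<open>m l\<close> vanished, \<open>g_diff_upper\<close> would make
  \<open>g l\<close> a minimum of \<open>g\<close>, hence equal to \<open>g0\<close>. An initial
  interval on which \<open>g\<close> equals \<open>g0\<close> is possible; beyond it
  \<open>ph\<close> is a genuine inverse.\<close>

lemma m_pos: "0 < l \<Longrightarrow> g0 < g l \<Longrightarrow> 0 < m l"
proof (rule ccontr)
  assume l: "0 < l" "g0 < g l" and "\<not> 0 < m l"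
  then have "m l = 0" using m_nonneg[OF l(1)] by simp
  then have "g l \<le> g y" if "0 < y" for y using g_diff_upper[OF that l(1)] by simp
  then have "\<forall>\<^sub>F y in at_right 0. g l \<le> S y / y"
    using eventually_at_right_less[of "0::real"] by (auto simp: g_def elim: eventually_mono)
  then have "g l \<le> g0" by (rule tendsto_lowerbound[OF g_lim]) simp
  with l show False by simp
qed

lemma g_strict:
  assumes "0 < l" "l < L" "g0 < g L"
  shows "g l < g L"
proof (rule ccontr)
  assume "\<not> g l < g L"
  then have eq: "g l = g L" using g_mono[of l L] assms by simp
  then have "0 < m l" using assms by (intro m_pos) auto
  moreover have "0 < 1 / l - 1 / L" using assms by (simp add: frac_less2)
  ultimately have "0 < m l * (1 / l - 1 / L)" by simp
  with g_diff_lower[of l L] eq assms show False by simp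
qed

lemma g_DERIV: "0 < l \<Longrightarrow> (g has_real_derivative m l / l\<^sup>2) (at l)"
  unfolding g_def[abs_def] by (auto intro!: derivative_eq_intros S_deriv simp: m_def power2_eq_square mult.commute)

lemma g_isCont: "0 < l \<Longrightarrow> isCont g l"
  using g_DERIV DERIV_isCont by blast

lemma g_at_top: "filterlim g at_top at_top"
  using g_top by (simp add: g_def[abs_def])

lemma ph_g:
  assumes l: "0 < l" "g0 < g l"
  shows "ph (g l) = l"
proof -
  have "{y. 0 \<le> y \<and> g l < (if y = 0 then g0 else S y / y)} = {l<..}"
  proof (intro set_eqI iffI)
    fix y assume "y \<in> {y. 0 \<le> y \<and> g l < (if y = 0 then g0 else S y / y)}"
    then have y: "0 < y" "g l < g y" using l by (auto simp: g_def split: if_splits)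
    then show "y \<in> {l<..}" using g_mono[of y l] by (auto simp: not_less[symmetric])
  next
    fix y assume "y \<in> {l<..}"
    then have y: "l < y" by simp
    then have "g0 < g y" using g_mono[of l y] l by simp
    with y show "y \<in> {y. 0 \<le> y \<and> g l < (if y = 0 then g0 else S y / y)}"
      using g_strict[OF l(1) y] l by (auto simp: g_def)
  qed
  then show ?thesis unfolding ph_def by (simp add: cInf_greaterThan)
qed

lemma g_surj:
  assumes r: "g0 < r"
  shows "\<exists>l>0. g l = r"
proof -
  have "\<forall>\<^sub>F y in at_right 0. S y / y < r" by (rule order_tendstoD(2)[OF g_lim r])
  then have "\<forall>\<^sub>F y in at_right 0. S y / y < r \<and> 0 < y"
    using eventually_at_right_less[of "0::real"] by eventually_elim auto
  then obtain y where y: "0 < y" "g y < r"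
    using eventually_happens'[of "at_right (0::real)"] by (auto simp: g_def)
  have "\<forall>\<^sub>F z in at_top. r \<le> g z" using g_at_top by (simp add: filterlim_at_top)
  then have "\<forall>\<^sub>F z in at_top. r \<le> g z \<and> y \<le> z" by (intro eventually_conj eventually_ge_at_top)
  then obtain z where z: "r \<le> g z" "y \<le> z" using eventually_happens'[of "at_top :: real filter"] by auto
  have "\<exists>x. y \<le> x \<and> x \<le> z \<and> g x = r"
    using y z by (intro IVT) (auto intro!: g_isCont)
  then obtain x where "y \<le> x" "g x = r" by blast
  then show ?thesis using y by (intro exI[of _ x]) auto
qed

lemma ph_pos: "g0 < r \<Longrightarrow> 0 < ph r" and g_ph: "g0 < r \<Longrightarrow> g (ph r) = r"
  using g_surj[of r] ph_g by auto

lemma le_ph: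
  assumes l: "0 < l" and r: "g0 < r"
  shows "l \<le> ph r \<longleftrightarrow> g l \<le> r"
proof
  assume "l \<le> ph r"
  then show "g l \<le> r" using g_mono[OF l, of "ph r"] g_ph[OF r] by simp
next
  assume le: "g l \<le> r"
  show "l \<le> ph r"
  proof (rule ccontr)
    assume "\<not> l \<le> ph r"
    then have "g (ph r) < g l"
      using g_strict[OF ph_pos[OF r], of l] g_mono[OF ph_pos[OF r], of l] g_ph[OF r] r by simp
    with le g_ph[OF r] show False by simp
  qed
qed

lemma ph_mono: "g0 < r \<Longrightarrow> r \<le> r' \<Longrightarrow> ph r \<le> ph r'"
  using le_ph[of "ph r" r'] ph_pos[of r] g_ph[of r] by simp

lemma ph_at_top: "filterlim ph at_top at_top"
  unfolding filterlim_at_top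
proof
  fix Z :: real
  define l where "l = max Z 1"
  have l: "0 < l" "Z \<le> l" by (auto simp: l_def)
  show "\<forall>\<^sub>F r in at_top. Z \<le> ph r"
    using eventually_gt_at_top[of "g l"]
  proof eventually_elim
    fix r assume r: "g l < r"
    then have "l \<le> ph r" using g_ge[OF l(1)] l by (subst le_ph) auto
    then show "Z \<le> ph r" using l by simp
  qed
qed

lemma ph_deriv:
  assumes r: "g0 < r"
  shows "deriv ph r = (ph r)\<^sup>2 / m (ph r)"
proof -
  define L where "L = ph r"
  have L: "0 < L" "g L = r" using ph_pos[OF r] g_ph[OF r] by (simp_all add: L_def)
  have mL: "0 < m L" using m_pos L r by simp
  have "isCont g L" using L by (intro g_isCont)
  then have "\<forall>\<^sub>F z in nhds L. g0 < g z"
    using L r by (auto simp: continuous_at tendsto_at_iff_tendsto_nhds intro: order_tendstoD(1))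
  moreover have "\<forall>\<^sub>F z in nhds L. 0 < z" using L eventually_nhds_in_open[of "{0<..}" L] by simp
  ultimately have "\<forall>\<^sub>F z in nhds L. g0 < g z \<and> 0 < z" by eventually_elim auto
  then obtain d where d: "0 < d" "\<And>z. dist z L < d \<Longrightarrow> g0 < g z \<and> 0 < z" by (auto simp: eventually_nhds_metric)
  have "isCont ph (g L)"
  proof (rule isCont_inverse_function[where f=g and g=ph and x=L and d="d / 2"])
    show "0 < d / 2" using d by simp
    fix z assume "\<bar>z - L\<bar> \<le> d / 2"
    then have "g0 < g z \<and> 0 < z" using d(1) by (intro d(2)) (auto simp: dist_real_def)
    then show "ph (g z) = z" "isCont g z" by (auto intro: ph_g g_isCont)
  qed
  then have ic: "isCont ph r" by (simp add: L)
  have "DERIV ph r :> inverse (m L / L\<^sup>2)"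
  proof (rule DERIV_inverse_function[where f=g and g=ph and x=r and a=g0 and b="r + 1"])
    show "DERIV g (ph r) :> m L / L\<^sup>2" using g_DERIV[OF L(1)] by (simp add: L_def)
    show "m L / L\<^sup>2 \<noteq> 0" using mL L by simp
  qed (use r ic g_ph in auto)
  then show ?thesis by (simp add: DERIV_imp_deriv L_def inverse_eq_divide)
qed

lemma m_le: "0 < l \<Longrightarrow> m l \<le> l * S (l + 1)"
proof -
  assume l: "0 < l"
  have "deriv S l \<le> S (l + 1)" using tangent[of l "l + 1"] l S_pos[OF l] by simp
  then have "l * deriv S l \<le> l * S (l + 1)" using l by (intro mult_left_mono) auto
  then show ?thesis using S_pos[OF l] by (simp add: m_def)
qed

text \<open>The tangent inequality gives \<open>m l \<le> l * S (l + 1)\<close>, so \<open>m\<close>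
  inherits the subexponential growth of \<open>S\<close>; the factor \<open>l\<close> is paid for by
  halving the exponent.\<close>

lemma m_subexp:
  assumes e: "0 < e" and K: "0 < K"
  shows "\<forall>\<^sub>F l in at_top. m l \<le> K * exp (e * l)"
proof -
  obtain C where C: "0 < C" "\<And>l. 0 < l \<Longrightarrow> S l \<le> C * exp (e / 2 * l)" using subexp[of "e / 2"] e by auto
  have "\<forall>\<^sub>F l in at_top. l * (C * exp (e / 2 * (l + 1))) \<le> K * exp (e * l)"
    using e K C(1) by real_asymp
  with eventually_gt_at_top[of 0] show ?thesis
  proof eventually_elim
    fix l :: real assume l: "0 < l" and le: "l * (C * exp (e / 2 * (l + 1))) \<le> K * exp (e * l)"
    have "l * S (l + 1) \<le> l * (C * exp (e / 2 * (l + 1)))" using l C(2)[of "l + 1"] by (intro mult_left_mono) auto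
    with m_le[OF l] le show "m l \<le> K * exp (e * l)" by linarith
  qed
qed

lemma m_g: "\<forall>\<^sub>F l in at_top. K * g l \<le> m l"
proof -
  \<comment> \<open>From \<open>l0\<close> on, \<open>g l - g l0 \<le> m l / l0\<close> by
    \<open>g_diff_upper\<close>. For large \<open>l\<close> the left side exceeds half of
    \<open>g l\<close>, so \<open>m l\<close> is at least \<open>l0 / 2\<close> times
    \<open>g l\<close>, and \<open>l0 / 2\<close> exceeds \<open>K\<close>.\<close>
  define l0 where "l0 = 2 * (\<bar>K\<bar> + 1)"
  have l0: "0 < l0" by (simp add: l0_def)
  have "\<forall>\<^sub>F l in at_top. 2 * g l0 + 2 \<le> g l" using g_at_top by (simp add: filterlim_at_top)
  with eventually_gt_at_top[of "2 * l0"] show ?thesis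
  proof eventually_elim
    fix l assume l: "2 * l0 < l" and gl: "2 * g l0 + 2 \<le> g l"
    have l1: "0 < l" "l0 < l" using l l0 by auto
    have "g l - g l0 \<le> m l * (1 / l0 - 1 / l)" using l0 l1 by (intro g_diff_upper)
    also have "\<dots> \<le> m l * (1 / l0)" using l1 m_nonneg[OF l1(1)] by (intro mult_left_mono) auto
    finally have "l0 * (g l - g l0) \<le> m l" using l0 by (simp add: field_simps)
    moreover have "K * g l \<le> (\<bar>K\<bar> + 1) * g l" using g_pos[OF l1(1)] by (intro mult_right_mono) auto
    moreover have "(\<bar>K\<bar> + 1) * g l \<le> l0 * (g l - g l0)"
    proof -
      have "(\<bar>K\<bar> + 1) * g l \<le> (\<bar>K\<bar> + 1) * (2 * (g l - g l0))" using gl by (intro mult_left_mono) auto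
      also have "\<dots> = l0 * (g l - g l0)" unfolding l0_def by (simp only: ac_simps)
      finally show ?thesis .
    qed
    ultimately show "K * g l \<le> m l" by linarith
  qed
qed

definition ph0 :: "real \<Rightarrow> real" where "ph0 r = (if r \<le> g0 then 0 else ph r)"

lemma ph0_mono: "mono ph0"
  using ph_mono ph_pos by (intro monoI) (auto simp: ph0_def intro: less_imp_le)

definition I :: "real \<Rightarrow> real" where "I b = integral {g0..b} (\<lambda>r. ph r / r)"

lemma ph_integrable:
  assumes a: "g0 \<le> a"
  shows "(\<lambda>r. ph r / r) integrable_on {a..b}"
proof -
  have [measurable]: "ph0 \<in> borel_measurable borel" by (rule borel_measurable_mono[OF ph0_mono])
  have b: "\<bar>ph0 r / r\<bar> \<le> ph0 b / a" if "r \<in> {a..b}" for r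
  proof -
    have "0 \<le> ph0 r" using ph_pos[of r] by (auto simp: ph0_def)
    moreover have "ph0 r \<le> ph0 b" using that monoD[OF ph0_mono] by simp
    ultimately show ?thesis using that a g0_pos by (auto intro!: frac_le)
  qed
  have "integrable lborel (\<lambda>r. indicator {a..b} r *\<^sub>R (ph0 r / r))"
  proof (cases "a \<le> b")
    case True
    show ?thesis
    proof (rule Bochner_Integration.integrable_bound[where f="\<lambda>r. indicator {a..b} r * (ph0 b / a)"])
      show "integrable lborel (\<lambda>r. indicator {a..b} r * (ph0 b / a) :: real)"
        using True by (intro integrable_mult_left integrable_real_indicator) auto
      show "AE r in lborel. norm (indicator {a..b} r *\<^sub>R (ph0 r / r)) \<le> norm (indicator {a..b} r * (ph0 b / a))"
      proof (rule AE_I2)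
        fix r show "norm (indicator {a..b} r *\<^sub>R (ph0 r / r)) \<le> norm (indicator {a..b} r * (ph0 b / a))"
          using b[of r] by (cases "r \<in> {a..b}") (auto simp del: abs_divide)
      qed
    qed measurable
  qed simp
  then have "set_integrable lborel {a..b} (\<lambda>r. ph0 r / r)" by (simp add: set_integrable_def)
  then have "(\<lambda>r. ph0 r / r) integrable_on {a..b}" by (rule set_borel_integral_eq_integral(1))
  then show ?thesis
    by (rule integrable_spike_finite[of "{g0}", rotated 2]) (use a in \<open>auto simp: ph0_def\<close>)
qed

lemma I_diff:
  assumes "g0 \<le> a" "a \<le> b"
  shows "I b - I a = integral {a..b} (\<lambda>r. ph r / r)"
  using Henstock_Kurzweil_Integration.integral_combine[of g0 a b "\<lambda>r. ph r / r"] assms ph_integrable[of g0 b]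
  by (simp add: I_def)

lemma inverse_has_integral:
  fixes x y :: real
  assumes "0 < x" "x \<le> y"
  shows "((\<lambda>r. 1 / r) has_integral ln (y / x)) {x..y}"
proof -
  have "((\<lambda>r. 1 / r) has_integral (ln y - ln x)) {x..y}"
  proof (rule fundamental_theorem_of_calculus[OF assms(2)])
    fix r assume "r \<in> {x..y}"
    then have "(ln has_real_derivative 1 / r) (at r within {x..y})"
      using assms by (intro has_field_derivative_at_within[OF DERIV_ln_divide]) auto
    then show "(ln has_vector_derivative 1 / r) (at r within {x..y})"
      by (simp add: has_real_derivative_iff_has_vector_derivative)
  qed
  then show ?thesis using assms by (simp add: ln_div)
qed

text \<open>\<open>ln (b / g k)\<close> is the integral of \<open>1 / r\<close> from
  \<open>g k\<close> to \<open>b\<close>. Summed over \<open>k\<close>, the integrand becomes the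
  number of \<open>k\<close> with \<open>g k \<le> r\<close>, essentially the integer part of
  \<open>\<phi> r\<close>, divided by \<open>r\<close>.\<close>

definition hh :: "real \<Rightarrow> real \<Rightarrow> real" where "hh c r = (if c \<le> r then 1 / r else 0)"

lemma hh_integral:
  assumes "g0 \<le> c" "c \<le> b"
  shows "(hh c has_integral ln (b / c)) {g0..b}"
proof -
  have "((\<lambda>r. if r \<in> {c..b} then 1 / r else 0) has_integral ln (b / c)) {g0..b}"
    using assms g0_pos by (subst has_integral_restrict) (auto intro!: inverse_has_integral)
  then show ?thesis by (rule has_integral_eq[rotated]) (auto simp: hh_def)
qed

lemma hh_sum:
  "(\<Sum>k\<in>{1..n}. hh (g (real k)) r) = real (card {k\<in>{1..n}. g (real k) \<le> r}) / r"
  unfolding hh_def by (subst sum.If_cases) (auto simp: Int_def)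

lemma card_le_ph:
  assumes r: "g0 < r"
  shows "real (card {k\<in>{1..n}. g (real k) \<le> r}) \<le> ph r"
proof -
  have "{k\<in>{1..n}. g (real k) \<le> r} \<subseteq> {1..nat \<lfloor>ph r\<rfloor>}"
    using r by (auto simp: le_ph[symmetric] le_nat_floor)
  then have "card {k\<in>{1..n}. g (real k) \<le> r} \<le> nat \<lfloor>ph r\<rfloor>"
    by (metis card_atLeastAtMost card_mono diff_Suc_1 finite_atLeastAtMost)
  then show ?thesis using ph_pos[OF r] by (simp add: le_nat_iff le_floor_iff)
qed

lemma sum_ln_le_I:
  assumes b: "g0 < b"
  shows "(\<Sum>k\<in>{1..n}. ln (b / g (real k))) \<le> I b"
proof -
  define A where "A = {k\<in>{1..n}. g (real k) \<le> b}"
  have "(\<Sum>k\<in>{1..n}. ln (b / g (real k))) \<le> (\<Sum>k\<in>{1..n}. if g (real k) \<le> b then ln (b / g (real k)) else 0)"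
  proof (rule sum_mono)
    fix k assume k: "k \<in> {1..n}"
    then have "0 < g (real k)" by (intro g_pos) simp
    then show "ln (b / g (real k)) \<le> (if g (real k) \<le> b then ln (b / g (real k)) else 0)"
      using b g0_pos by auto
  qed
  also have "\<dots> = (\<Sum>k\<in>A. ln (b / g (real k)))"
    by (simp add: A_def sum.If_cases Int_def)
  also have "\<dots> \<le> I b"
  proof (rule has_integral_le)
    show "((\<lambda>r. \<Sum>k\<in>A. hh (g (real k)) r) has_integral (\<Sum>k\<in>A. ln (b / g (real k)))) {g0..b}"
      unfolding A_def by (intro has_integral_sum hh_integral g_ge) auto
    have "((\<lambda>r. ph r / r) has_integral I b) {g0..b}"
      unfolding I_def by (intro integrable_integral ph_integrable) simp
    \<comment> \<open>The counting bound needs \<open>r > g0\<close>, so the integrand is changed at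
      the single point \<open>g0\<close>.\<close>
    then show "((\<lambda>r. if r = g0 then real n / g0 else ph r / r) has_integral I b) {g0..b}"
      by (rule has_integral_spike_finite[of "{g0}", rotated 2]) auto
    fix r assume r: "r \<in> {g0..b}"
    have "(\<Sum>k\<in>A. hh (g (real k)) r) \<le> (\<Sum>k\<in>{1..n}. hh (g (real k)) r)"
      using r g0_pos by (intro sum_mono2) (auto simp: A_def hh_def)
    also have "\<dots> \<le> (if r = g0 then real n / g0 else ph r / r)"
    proof (cases "r = g0")
      case True
      have "card {k\<in>{1..n}. g (real k) \<le> r} \<le> card {1..n}" by (intro card_mono) auto
      then show ?thesis using True g0_pos unfolding hh_sum by (simp add: divide_right_mono)
    next
      case False
      then show ?thesis unfolding hh_sum using card_le_ph[of r n] r g0_pos by (simp add: divide_right_mono)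
    qed
    finally show "(\<Sum>k\<in>A. hh (g (real k)) r) \<le> (if r = g0 then real n / g0 else ph r / r)" .
  qed
  finally show ?thesis .
qed

text \<open>\<open>\<phi> r\<close> exceeds its integer part by at most 1, and this excess
  integrates to \<open>ln (b / g0)\<close>. It reappears as the polynomial factor
  \<open>b / g0\<close> in the upper tail bound.\<close>

lemma I_le_sum_ln:
  assumes b: "g0 < b"
  shows "I b \<le> (\<Sum>k\<in>{1..nat \<lfloor>ph b\<rfloor>}. ln (b / g (real k))) + ln (b / g0)"
proof -
  define n where "n = nat \<lfloor>ph b\<rfloor>"
  have kb: "g (real k) \<le> b" if "k \<in> {1..n}" for k
  proof -
    have "real k \<le> ph b" using that ph_pos[OF b] by (simp add: n_def le_nat_iff le_floor_iff)
    then show ?thesis using that b by (subst (asm) le_ph) auto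
  qed
  show ?thesis
    unfolding n_def[symmetric]
  proof (rule has_integral_le)
    have "((\<lambda>r. ph r / r) has_integral I b) {g0..b}"
      unfolding I_def by (intro integrable_integral ph_integrable) simp
    then show "((\<lambda>r. if r = g0 then 0 else ph r / r) has_integral I b) {g0..b}"
      by (rule has_integral_spike_finite[of "{g0}", rotated 2]) auto
    show "((\<lambda>r. (\<Sum>k\<in>{1..n}. hh (g (real k)) r) + hh g0 r) has_integral (\<Sum>k\<in>{1..n}. ln (b / g (real k))) + ln (b / g0)) {g0..b}"
      using b kb by (intro has_integral_add has_integral_sum hh_integral g_ge) auto
    fix r assume r: "r \<in> {g0..b}"
    show "(if r = g0 then 0 else ph r / r) \<le> (\<Sum>k\<in>{1..n}. hh (g (real k)) r) + hh g0 r"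
    proof (cases "r = g0")
      case False
      then have r0: "g0 < r" using r by simp
      have "{1..nat \<lfloor>ph r\<rfloor>} \<subseteq> {k\<in>{1..n}. g (real k) \<le> r}"
      proof
        fix k assume k: "k \<in> {1..nat \<lfloor>ph r\<rfloor>}"
        then have "real k \<le> ph r" using ph_pos[OF r0] by (simp add: le_nat_iff le_floor_iff)
        moreover have "ph r \<le> ph b" using r r0 by (intro ph_mono) auto
        ultimately show "k \<in> {k\<in>{1..n}. g (real k) \<le> r}"
          using k r0 by (auto simp: le_ph[symmetric] n_def le_nat_floor)
      qed
      then have "nat \<lfloor>ph r\<rfloor> \<le> card {k\<in>{1..n}. g (real k) \<le> r}"
        by (metis card_atLeastAtMost card_mono diff_Suc_1 finite_Collect_conjI finite_atLeastAtMost Collect_mem_eq)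
      moreover have "ph r \<le> real (nat \<lfloor>ph r\<rfloor>) + 1" using ph_pos[OF r0] by linarith
      ultimately have "ph r \<le> real (card {k\<in>{1..n}. g (real k) \<le> r}) + 1" by linarith
      then have "ph r / r \<le> (real (card {k\<in>{1..n}. g (real k) \<le> r}) + 1) / r"
        using r0 g0_pos by (intro divide_right_mono) auto
      then show ?thesis using False r0 unfolding hh_sum by (simp add: hh_def add_divide_distrib)
    qed (use g0_pos in \<open>auto simp: hh_def intro!: add_nonneg_nonneg sum_nonneg\<close>)
  qed
qed

lemma I_diff_linear:
  assumes a: "g0 < a" and b: "a \<le> b"
  shows "ph a * ln (b / a) \<le> I b - I a"
proof -
  have a0: "0 < a" using a g0_pos by simp
  have "((\<lambda>r. ph a * (1 / r)) has_integral ph a * ln (b / a)) {a..b}"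
    using a0 b by (intro has_integral_mult_right inverse_has_integral)
  moreover have "((\<lambda>r. ph r / r) has_integral I b - I a) {a..b}"
    unfolding I_diff[OF less_imp_le[OF a] b] using a by (intro integrable_integral ph_integrable) simp
  ultimately show ?thesis
  proof (rule has_integral_le)
    fix r assume r: "r \<in> {a..b}"
    then show "ph a * (1 / r) \<le> ph r / r"
      using ph_mono[OF a, of r] a0 by (auto intro!: divide_right_mono)
  qed
qed

text \<open>Between \<open>a\<close> and \<open>b\<close>, \<open>g_diff_lower\<close> and
  monotonicity of \<open>m\<close> give \<open>1 / \<phi> r \<le> 1 / L + (b - r) / M\<close>. The
  reciprocal of the right side has a logarithm as its integral.\<close>

lemma I_diff_log:
  assumes a: "g0 < a" and b: "a \<le> b"
  shows "m (ph a) / b * ln (1 + (b - a) * ph b / m (ph a)) \<le> I b - I a"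
proof -
  define M where "M = m (ph a)"
  define L where "L = ph b"
  have a0: "0 < a" "0 < b" "g0 < b" using a b g0_pos by auto
  have M: "0 < M" unfolding M_def using a ph_pos g_ph by (intro m_pos) auto
  have L: "0 < L" unfolding L_def using a0 by (intro ph_pos)
  define H where "H r = 1 / L + (b - r) / M" for r
  have H: "0 < H r" if "r \<le> b" for r using that M L by (simp add: H_def add_pos_nonneg)
  define F where "F r = - (M / b) * ln (H r)" for r
  have F: "((\<lambda>r. 1 / b * (1 / H r)) has_integral F b - F a) {a..b}"
  proof (rule fundamental_theorem_of_calculus[OF b])
    fix r assume r: "r \<in> {a..b}"
    have "(H has_real_derivative - (1 / M)) (at r within {a..b})"
      unfolding H_def[abs_def] using M by (auto intro!: derivative_eq_intros)
    then have "(F has_real_derivative - (M / b) * (1 / H r * - (1 / M))) (at r within {a..b})"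
      unfolding F_def[abs_def] using H[of r] r by (intro DERIV_cmult DERIV_chain2[OF DERIV_ln_divide]) auto
    then show "(F has_vector_derivative 1 / b * (1 / H r)) (at r within {a..b})"
      using M by (simp add: has_real_derivative_iff_has_vector_derivative[symmetric])
  qed
  have Feq: "F b - F a = M / b * ln (1 + (b - a) * L / M)"
  proof -
    have "H a / H b = 1 + (b - a) * L / M" using L M by (simp add: H_def field_simps)
    then have "ln (1 + (b - a) * L / M) = ln (H a) - ln (H b)" using H[of a] H[of b] b ln_div[of "H a" "H b"] by simp
    then show ?thesis by (simp add: F_def right_diff_distrib)
  qed
  moreover have "((\<lambda>r. ph r / r) has_integral I b - I a) {a..b}"
    unfolding I_diff[OF less_imp_le[OF a] b] using a by (intro integrable_integral ph_integrable) simp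
  moreover have "1 / b * (1 / H r) \<le> ph r / r" if r: "r \<in> {a..b}" for r
  proof -
    define l where "l = ph r"
    have r0: "g0 < r" using r a by simp
    have l: "0 < l" "g l = r" "ph a \<le> l" using ph_pos[OF r0] g_ph[OF r0] ph_mono[OF a] r by (simp_all add: l_def)
    have lL: "l \<le> L" unfolding l_def L_def using r r0 by (intro ph_mono) auto
    have "M * (1 / l - 1 / L) \<le> m l * (1 / l - 1 / L)"
      using m_mono[of "ph a" l] ph_pos[OF a] l lL by (intro mult_right_mono) (auto simp: M_def frac_le)
    also have "\<dots> \<le> g L - g l" using l L by (intro g_diff_lower)
    also have "\<dots> = b - r" using g_ph[of b] a0 l by (simp add: L_def)
    finally have "1 / l - 1 / L \<le> (b - r) / M" using M by (simp add: field_simps)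
    then have "1 / l \<le> H r" by (simp add: H_def)
    then have "1 / H r \<le> l" using l H[of r] r by (simp add: field_simps)
    then have "1 / b * (1 / H r) \<le> 1 / r * l"
      using r r0 g0_pos H[of r] by (intro mult_mono frac_le) auto
    then show ?thesis by (simp add: l_def)
  qed
  ultimately have "F b - F a \<le> I b - I a" by (intro has_integral_le[OF F])
  then show ?thesis using Feq by (simp add: M_def L_def)
qed

text \<open>Passing from \<open>a\<close> to \<open>\<rho> a\<close> gains any polynomial factor in \<open>ph (\<rho> a)\<close>: the linear bound above
  suffices unless \<open>ph (\<rho> a)\<close> is exponentially large in \<open>ph a\<close>, and then the logarithmic one does, as
  \<open>m / g\<close> tends to infinity.\<close>

lemma I_gain:
  assumes C: "0 < C" and \<rho>: "1 < \<rho>"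
  shows "\<forall>\<^sub>F a in at_top. C * ph (\<rho> * a) \<le> exp (I (\<rho> * a) - I a)"
proof -
  define c where "c = ln \<rho>"
  have c: "0 < c" using \<rho> by (simp add: c_def)
  \<comment> \<open>If \<open>ln Z \<le> c / 2 * l\<close>, the linear gain \<open>c * l\<close>
    covers \<open>ln C + ln Z\<close>. Otherwise the subexponential bound on \<open>m\<close> makes
    the logarithm in \<open>I_diff_log\<close> at least \<open>ln Z / 2\<close>, and the bound by
    \<open>4 * \<rho> * g l\<close> makes its prefactor at least 4, so the gain is at least
    \<open>2 * ln Z\<close>.\<close>
  have "\<forall>\<^sub>F l in at_top. 4 * \<rho> * g l \<le> m l \<and> m l \<le> (\<rho> - 1) * g0 * exp (c / 4 * l) \<and> max 1 C \<le> l \<and> ln C \<le> c / 2 * l"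
  proof (intro eventually_conj m_g m_subexp eventually_ge_at_top)
    show "\<forall>\<^sub>F l in at_top. ln C \<le> c / 2 * l" using c by real_asymp
  qed (use c \<rho> g0_pos in auto)
  from eventually_compose_filterlim[OF this ph_at_top] eventually_gt_at_top[of g0]
  show ?thesis
  proof eventually_elim
    fix a
    assume H: "4 * \<rho> * g (ph a) \<le> m (ph a) \<and> m (ph a) \<le> (\<rho> - 1) * g0 * exp (c / 4 * ph a) \<and> max 1 C \<le> ph a \<and> ln C \<le> c / 2 * ph a"
      and a: "g0 < a"
    define l where "l = ph a"
    define Z where "Z = ph (\<rho> * a)"
    define b where "b = \<rho> * a"
    have a0: "0 < a" using a g0_pos by simp
    have ab: "a \<le> b" using a0 \<rho> by (simp add: b_def)
    have lZ: "l \<le> Z" unfolding l_def Z_def b_def[symmetric] by (rule ph_mono[OF a ab])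
    have Z: "1 \<le> Z" "C \<le> Z" using H lZ by (auto simp: l_def)
    have "ln (C * Z) \<le> I b - I a"
    proof (cases "ln Z \<le> c / 2 * l")
      case True
      have "ln (C * Z) = ln C + ln Z" using C Z by (simp add: ln_mult)
      also have "\<dots> \<le> c * l" using H True by (simp add: l_def)
      also have "c * l = ph a * ln (b / a)" using a0 by (simp add: l_def c_def b_def)
      also have "\<dots> \<le> I b - I a" by (rule I_diff_linear[OF a ab])
      finally show ?thesis .
    next
      case False
      define M where "M = m (ph a)"
      have M: "0 < M" unfolding M_def using a ph_pos g_ph by (intro m_pos) auto
      have Mb: "4 \<le> M / b" using H g_ph[OF a] a0 \<rho> by (simp add: M_def b_def field_simps)
      have "exp (c / 4 * l) \<le> sqrt Z"
      proof (rule real_le_rsqrt)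
        have "(exp (c / 4 * l))\<^sup>2 = exp (c / 2 * l)" by (simp add: power2_eq_square exp_add[symmetric])
        also have "\<dots> \<le> exp (ln Z)" using False by simp
        finally show "(exp (c / 4 * l))\<^sup>2 \<le> Z" using Z by simp
      qed
      then have "(\<rho> - 1) * g0 * exp (c / 4 * l) \<le> (\<rho> - 1) * a * sqrt Z"
        using a \<rho> g0_pos by (intro mult_mono) auto
      then have "M \<le> (\<rho> - 1) * a * sqrt Z" using H by (simp add: M_def l_def)
      then have "M * sqrt Z \<le> (b - a) * Z"
        using mult_right_mono[of M "(\<rho> - 1) * a * sqrt Z" "sqrt Z"] Z
        by (simp add: b_def algebra_simps flip: power2_eq_square)
      then have "sqrt Z \<le> (b - a) * Z / M" using M by (simp add: field_simps)
      then have "ln (sqrt Z) \<le> ln (1 + (b - a) * Z / M)" using Z by (intro ln_mono) auto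
      moreover have "ln (sqrt Z) = ln Z / 2" using Z by (simp add: ln_sqrt)
      ultimately have h: "ln Z / 2 \<le> ln (1 + (b - a) * Z / M)" by simp
      have "ln (C * Z) = ln C + ln Z" using C Z by (simp add: ln_mult)
      also have "\<dots> \<le> ln Z + ln Z" using C Z by simp
      also have "\<dots> = 4 * (ln Z / 2)" by simp
      also have "\<dots> \<le> M / b * ln (1 + (b - a) * Z / M)" using Mb h Z by (intro mult_mono) auto
      also have "\<dots> \<le> I b - I a" using I_diff_log[OF a ab] by (simp add: M_def Z_def b_def)
      finally show ?thesis .
    qed
    then have "exp (ln (C * Z)) \<le> exp (I b - I a)" by simp
    moreover have "exp (ln (C * Z)) = C * Z" using C Z by simp
    ultimately show "C * ph (\<rho> * a) \<le> exp (I (\<rho> * a) - I a)" by (simp only: Z_def b_def)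
  qed
qed

end

section \<open>Tail bounds from the Laplace transform\<close>

text \<open>A crude Stirling bound; the induction step is
  \<open>(n / (n + 1)) ^ (n + 1) \<le> exp (- 1)\<close>. Only a polynomial factor is lost.\<close>

lemma fact_exp_le:
  assumes "1 \<le> n"
  shows "fact n * exp (real n) \<le> exp 1 * real n ^ (n + 1)"
  using assms
proof (induction n rule: dec_induct)
  case (step n)
  define z where "z = real n / (real n + 1)"
  have z: "0 \<le> z" "z * (real n + 1) = real n" by (simp_all add: z_def)
  have "1 + - 1 / (real n + 1) = z" by (simp add: z_def field_simps)
  then have "z \<le> exp (- 1 / (real n + 1))" using exp_ge_add_one_self[of "- 1 / (real n + 1)"] by linarith
  then have "z ^ (n + 1) \<le> exp (- 1 / (real n + 1)) ^ (n + 1)" using z by (intro power_mono)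
  also have "\<dots> = exp (- 1)" by (simp add: exp_of_nat_mult[symmetric] del: power_Suc)
  finally have "z ^ (n + 1) * (real n + 1) ^ (n + 1) \<le> exp (- 1) * (real n + 1) ^ (n + 1)"
    by (intro mult_right_mono) auto
  then have "real n ^ (n + 1) \<le> exp (- 1) * (real n + 1) ^ (n + 1)"
    unfolding power_mult_distrib[symmetric] z(2) .
  then have "exp 1 * real n ^ (n + 1) \<le> exp 1 * (exp (- 1) * (real n + 1) ^ (n + 1))"
    by (intro mult_left_mono) auto
  also have "\<dots> = (real n + 1) ^ (n + 1)" by (simp add: exp_minus)
  finally have le: "exp 1 * real n ^ (n + 1) \<le> (real n + 1) ^ (n + 1)" .
  have "fact (Suc n) * exp (real (Suc n)) = (real n + 1) * exp 1 * (fact n * exp (real n))"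
    by (simp add: exp_add algebra_simps)
  also have "\<dots> \<le> (real n + 1) * exp 1 * (exp 1 * real n ^ (n + 1))"
    using step by (intro mult_left_mono) auto
  also have "\<dots> \<le> (real n + 1) * exp 1 * (real n + 1) ^ (n + 1)"
    using le by (intro mult_left_mono) auto
  finally show ?case by (simp add: algebra_simps)
qed simp

locale psi_tail = psi_sharp S g0 + prob_space P
  for S g0 and P :: "'c measure" +
  fixes co :: "nat \<Rightarrow> real" and J :: "real \<Rightarrow> real" and Z :: "'c \<Rightarrow> real"
  assumes co_def: "\<And>n. co n = 1 / (\<Prod>i=1..n. S (real i))"
    and J_def: "\<And>q. J q = (\<Sum>n. co n * q ^ n)"
    and co_summable: "\<And>q. summable (\<lambda>n. co n * q ^ n)"
    and Z_meas[measurable]: "Z \<in> borel_measurable P"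
    and Z_nonneg: "\<And>\<omega>. 0 \<le> Z \<omega>"
    and laplace_Z: "\<And>q. 0 < q \<Longrightarrow> (\<integral>\<omega>. exp (- (q * Z \<omega>)) \<partial>P) = 1 / J q"
begin

definition cdf where "cdf x = measure P {\<omega> \<in> space P. Z \<omega> \<le> x}"

lemma co_pos: "0 < co n"
  by (auto simp: co_def intro!: prod_pos S_pos)

lemma co_Suc: "co (Suc n) = co n / S (real (Suc n))"
  by (simp add: co_def prod.nat_ivl_Suc')

lemma co_eq: "co n = 1 / (fact n * (\<Prod>i=1..n. g (real i)))"
proof -
  have "(\<Prod>i=1..n. S (real i)) = (\<Prod>i=1..n. real i * g (real i))"
    by (intro prod.cong) (auto simp: g_def)
  then show ?thesis by (simp add: co_def prod.distrib fact_prod)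
qed

lemma J_ge_partial: "0 \<le> q \<Longrightarrow> finite A \<Longrightarrow> (\<Sum>n\<in>A. co n * q ^ n) \<le> J q"
  unfolding J_def using co_pos by (intro sum_le_suminf co_summable) (auto simp: less_imp_le)

lemma J_ge: "0 \<le> q \<Longrightarrow> co n * q ^ n \<le> J q"
  using J_ge_partial[of q "{n}"] by simp

lemma J_ge_1: "0 \<le> q \<Longrightarrow> 1 \<le> J q"
  using J_ge[of q 0] by (simp add: co_def)

lemma int_exp[simp]: "0 \<le> q \<Longrightarrow> integrable P (\<lambda>\<omega>. exp (- (q * Z \<omega>)))"
  using Z_nonneg by (intro integrable_const_bound[where B=1]) auto

lemma prod_g_scale:
  assumes "0 < b"
  shows "(\<Prod>k=1..n. g (real k) / b) = exp (- (\<Sum>k=1..n. ln (b / g (real k))))"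
proof -
  have "(\<Prod>k=1..n. g (real k) / b) = (\<Prod>k=1..n. exp (- ln (b / g (real k))))"
    using assms by (intro prod.cong) (auto simp: exp_minus g_pos inverse_eq_divide)
  then show ?thesis by (simp add: exp_sum[symmetric] sum_negf)
qed

lemma cdf_chernoff:
  assumes q: "0 < q"
  shows "cdf x \<le> exp (q * x) / J q"
proof -
  have "cdf x = (\<integral>\<omega>. indicator {\<omega> \<in> space P. Z \<omega> \<le> x} \<omega> \<partial>P)" by (simp add: cdf_def)
  also have "\<dots> \<le> (\<integral>\<omega>. exp (q * x) * exp (- (q * Z \<omega>)) \<partial>P)"
    using q by (intro integral_mono integrable_mult_right int_exp integrable_real_indicator)
      (auto simp: emeasure_eq_measure indicator_def exp_add[symmetric])
  also have "\<dots> = exp (q * x) / J q" using laplace_Z[OF q] by simp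
  finally show ?thesis .
qed

text \<open>Of the series \<open>J\<close> only the term with index \<open>n\<close> is kept. The
  Stirling bound evaluates it up to a factor of order \<open>n\<close>, and replacing
  \<open>1 / b\<close> by \<open>x = 1 / (\<delta> * b)\<close> supplies the exponentially small
  \<open>\<delta> powr (- ph b)\<close>.\<close>

lemma cdf_upper:
  assumes \<delta>: "1 < \<delta>" and b: "g0 < b" "1 \<le> ph b"
  shows "cdf (1 / (\<delta> * b)) \<le> exp 1 * ph b * \<delta> * (b / g0) * \<delta> powr (- ph b) * exp (- I b)"
proof -
  define n where "n = nat \<lfloor>ph b\<rfloor>"
  define x where "x = 1 / (\<delta> * b)"
  have b0: "0 < b" using b g0_pos by simp
  have x: "0 < x" using \<delta> b0 by (simp add: x_def)
  have n: "1 \<le> n" "real n \<le> ph b" "ph b \<le> real n + 1" using b by (auto simp: n_def le_nat_floor; linarith)+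
  define q where "q = real n / x"
  have q: "0 < q" using n x by (simp add: q_def)
  have pp: "0 < (\<Prod>i=1..n. g (real i))" by (intro prod_pos) (simp add: g_pos)
  have "cdf x \<le> exp (q * x) / J q" by (rule cdf_chernoff[OF q])
  also have "\<dots> \<le> exp (q * x) / (co n * q ^ n)"
    using q co_pos J_ge[of q n] J_ge_1[of q] by (intro divide_left_mono mult_pos_pos) auto
  also have "\<dots> = fact n * exp (real n) / real n ^ n * (x ^ n * (\<Prod>i=1..n. g (real i)))"
    using n x by (simp add: q_def co_eq power_divide)
  also have "\<dots> \<le> exp 1 * real n * (x ^ n * (\<Prod>i=1..n. g (real i)))"
    using fact_exp_le[OF n(1)] n x pp by (intro mult_right_mono) (auto simp: field_simps)
  also have "x ^ n * (\<Prod>i=1..n. g (real i)) = (1 / \<delta>) ^ n * (\<Prod>k=1..n. g (real k) / b)"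
    using b0 by (simp add: x_def prod_dividef power_divide power_mult_distrib)
  also have "\<dots> = (1 / \<delta>) ^ n * exp (- (\<Sum>k=1..n. ln (b / g (real k))))" by (simp only: prod_g_scale[OF b0])
  also have "\<dots> \<le> \<delta> * \<delta> powr (- ph b) * (b / g0 * exp (- I b))"
  proof (intro mult_mono)
    have "(1 / \<delta>) ^ n = \<delta> powr (- real n)" using \<delta> by (simp add: powr_minus powr_realpow power_one_over inverse_eq_divide)
    also have "\<dots> \<le> \<delta> powr (1 - ph b)" using \<delta> n by (intro powr_mono) auto
    also have "\<dots> = \<delta> * \<delta> powr (- ph b)" using \<delta> by (simp add: powr_diff powr_minus divide_inverse)
    finally show "(1 / \<delta>) ^ n \<le> \<delta> * \<delta> powr (- ph b)" .
    have "- (\<Sum>k=1..n. ln (b / g (real k))) \<le> ln (b / g0) - I b"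
      using I_le_sum_ln[OF b(1)] by (simp add: n_def)
    then have "exp (- (\<Sum>k=1..n. ln (b / g (real k)))) \<le> exp (ln (b / g0) - I b)" by simp
    also have "\<dots> = b / g0 * exp (- I b)" using b0 g0_pos by (simp add: exp_diff exp_minus divide_inverse)
    finally show "exp (- (\<Sum>k=1..n. ln (b / g (real k)))) \<le> b / g0 * exp (- I b)" .
  qed (use \<delta> in auto)
  finally have "cdf x \<le> exp 1 * real n * (\<delta> * \<delta> powr (- ph b) * (b / g0 * exp (- I b)))" by (simp add: mult_left_mono)
  also have "\<dots> \<le> exp 1 * ph b * (\<delta> * \<delta> powr (- ph b) * (b / g0 * exp (- I b)))"
    using n \<delta> b0 g0_pos by (intro mult_right_mono mult_left_mono) auto
  finally show ?thesis by (simp add: x_def mult_ac)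
qed

text \<open>The factor \<open>\<delta> powr (- l)\<close> with \<open>l = ph b\<close> beats
  \<open>1 / sqrt (m l)\<close>, since \<open>m\<close> is subexponential, and together with the
  factor \<open>l\<close> this produces \<open>l / sqrt (m l)\<close>, the square root of
  \<open>\<phi>'\<close>.\<close>

lemma tail_upper:
  assumes \<delta>: "1 < \<delta>"
  shows "\<forall>\<^sub>F b in at_top. cdf (1 / (\<delta> * b)) \<le> \<delta> * b / (\<delta> - 1) * sqrt (deriv ph b) * exp (- I b)"
proof -
  define c where "c = ln \<delta>"
  \<comment> \<open>Chosen so that \<open>exp 1 * \<delta> * (b / g0) * k\<close> equals
    \<open>\<delta> * b / (\<delta> - 1)\<close>.\<close>
  define k where "k = g0 / (exp 1 * (\<delta> - 1))"
  have c: "0 < c" and k: "0 < k" using \<delta> g0_pos by (simp_all add: c_def k_def)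
  have "\<forall>\<^sub>F l in at_top. m l \<le> k\<^sup>2 * exp (2 * c * l)" using c k by (intro m_subexp) auto
  then have "\<forall>\<^sub>F l in at_top. m l \<le> k\<^sup>2 * exp (2 * c * l) \<and> 1 \<le> l"
    by (intro eventually_conj eventually_ge_at_top)
  from eventually_compose_filterlim[OF this ph_at_top] eventually_gt_at_top[of g0]
  show ?thesis
  proof eventually_elim
    fix b assume H: "m (ph b) \<le> k\<^sup>2 * exp (2 * c * ph b) \<and> 1 \<le> ph b" and b: "g0 < b"
    define l where "l = ph b"
    have b0: "0 < b" using b g0_pos by simp
    have l: "1 \<le> l" "m l \<le> k\<^sup>2 * exp (2 * c * l)" using H by (simp_all add: l_def)
    have m: "0 < m l" unfolding l_def using b ph_pos g_ph by (intro m_pos) auto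
    have "sqrt (m l) \<le> sqrt ((k * exp (c * l))\<^sup>2)"
      using l by (simp add: power_mult_distrib exp_double[symmetric] mult.assoc)
    also have "\<dots> = k * exp (c * l)" using k by simp
    finally have "exp (- (c * l)) * sqrt (m l) \<le> exp (- (c * l)) * (k * exp (c * l))" by (intro mult_left_mono) auto
    also have "\<dots> = k" by (simp add: exp_minus)
    finally have "exp (- (c * l)) \<le> k / sqrt (m l)" using m by (simp add: field_simps)
    moreover have "\<delta> powr (- l) = exp (- (c * l))" using \<delta> by (simp add: powr_def c_def mult.commute)
    ultimately have p: "\<delta> powr (- l) \<le> k / sqrt (m l)" by simp
    have "cdf (1 / (\<delta> * b)) \<le> exp 1 * l * \<delta> * (b / g0) * \<delta> powr (- l) * exp (- I b)"
      unfolding l_def using H by (intro cdf_upper \<delta> b) auto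
    also have "\<dots> \<le> exp 1 * l * \<delta> * (b / g0) * (k / sqrt (m l)) * exp (- I b)"
      using p l \<delta> b0 g0_pos by (intro mult_right_mono mult_left_mono) auto
    also have "\<dots> = \<delta> * b / (\<delta> - 1) * (l / sqrt (m l)) * exp (- I b)"
      using g0_pos by (simp add: k_def)
    also have "l / sqrt (m l) = sqrt (deriv ph b)"
      using ph_deriv[OF b] l by (simp add: real_sqrt_divide l_def)
    finally show "cdf (1 / (\<delta> * b)) \<le> \<delta> * b / (\<delta> - 1) * sqrt (deriv ph b) * exp (- I b)" .
  qed
qed

section \<open>The mean index of the series and the lower tail bound\<close>

definition Jd where "Jd q = (\<Sum>n. diffs co n * q ^ n)"
text \<open>The logarithmic derivative of \<open>J\<close>. Under the weights
  \<open>co n * q ^ n / J q\<close> on indices, \<open>q * y q\<close> is the mean index and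
  \<open>y q\<close> the mean of \<open>1 / g (real (Suc n))\<close>.\<close>

definition y where "y q = Jd q / J q"

lemma Jd_summable: "summable (\<lambda>n. diffs co n * q ^ n)"
  by (rule termdiff_converges_all) (rule co_summable)

lemma diffs_co: "diffs co n = co n / g (real (Suc n))"
  by (simp add: diffs_def co_Suc g_def)

lemma Jd_sums: "(\<lambda>n. real n * (co n * q ^ n)) sums (q * Jd q)"
proof -
  have "(\<lambda>n. q * (diffs co n * q ^ n)) sums (q * Jd q)"
    unfolding Jd_def by (intro sums_mult summable_sums Jd_summable)
  also have "(\<lambda>n. q * (diffs co n * q ^ n)) = (\<lambda>n. real (Suc n) * (co (Suc n) * q ^ Suc n))"
    by (simp add: diffs_def fun_eq_iff mult_ac)
  finally show ?thesis by (subst (asm) sums_Suc_iff) simp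
qed

lemma Jd_pos: "0 \<le> q \<Longrightarrow> 0 < Jd q"
  unfolding Jd_def using co_pos g_pos
  by (intro suminf_pos2[OF Jd_summable, of _ 0]) (auto simp: diffs_co less_imp_le)

lemma y_isCont: "0 \<le> q \<Longrightarrow> isCont y q"
proof -
  assume q: "0 \<le> q"
  have "isCont J q" "isCont Jd q"
    unfolding J_def[abs_def] Jd_def[abs_def]
    by (intro isCont_powser_converges_everywhere co_summable Jd_summable)+
  then show "isCont y q" unfolding y_def[abs_def] using J_ge_1[OF q] by (intro continuous_intros) auto
qed

text \<open>The first \<open>d\<close> terms together are at most a constant over \<open>q\<close>
  times the single term of index \<open>d\<close>.\<close>

lemma head_small:
  obtains C where "0 \<le> C" "\<And>q. 1 \<le> q \<Longrightarrow> (\<Sum>n<d. co n * q ^ n) \<le> C / q * J q"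
proof
  define C where "C = (\<Sum>n<d. co n) / co d"
  show "0 \<le> C" using co_pos by (simp add: C_def sum_nonneg less_imp_le)
  fix q :: real assume q: "1 \<le> q"
  have "q * (\<Sum>n<d. co n * q ^ n) = (\<Sum>n<d. co n * q ^ Suc n)" by (simp add: sum_distrib_left mult_ac)
  also have "\<dots> \<le> (\<Sum>n<d. co n * q ^ d)"
    using q co_pos by (intro sum_mono mult_left_mono power_increasing) (auto simp: less_imp_le)
  also have "\<dots> = C * (co d * q ^ d)" using co_pos[of d] by (simp add: C_def flip: sum_distrib_right)
  also have "\<dots> \<le> C * J q" using q \<open>0 \<le> C\<close> by (intro mult_left_mono J_ge) auto
  finally show "(\<Sum>n<d. co n * q ^ n) \<le> C / q * J q" using q by (simp add: field_simps)
qed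

lemma tail_sums:
  "(\<lambda>n. if n < d then 0 else co n * q ^ n) sums (J q - (\<Sum>n<d. co n * q ^ n))"
proof -
  have "(\<lambda>n. if n < d then co n * q ^ n else 0) sums (\<Sum>n<d. co n * q ^ n)"
    using sums_If_finite_set[of "{..<d}" "\<lambda>n. co n * q ^ n"] by simp
  from sums_diff[OF summable_sums[OF co_summable] this]
  show ?thesis unfolding J_def by (rule sums_cong[THEN iffD1, rotated]) auto
qed

text \<open>Once the terms below index \<open>m\<close> carry at most half of \<open>J q\<close>,
  the mean index is at least \<open>m / 2\<close>.\<close>

lemma qy_at_top: "filterlim (\<lambda>q. q * y q) at_top at_top"
  unfolding filterlim_at_top
proof
  fix A :: real
  define m where "m = nat \<lceil>2 * max A 0\<rceil>"
  have m: "2 * A \<le> real m" by (simp add: m_def) linarith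
  obtain C where C: "0 \<le> C" "\<And>q. 1 \<le> q \<Longrightarrow> (\<Sum>n<m. co n * q ^ n) \<le> C / q * J q" using head_small[of m] by blast
  show "\<forall>\<^sub>F q in at_top. A \<le> q * y q"
    using eventually_ge_at_top[of "max 1 (2 * C)"]
  proof eventually_elim
    fix q assume "max 1 (2 * C) \<le> q"
    then have q: "1 \<le> q" "C / q \<le> 1 / 2" by (auto simp: field_simps)
    have J: "0 < J q" using J_ge_1[of q] q by simp
    have "real m * (J q - (\<Sum>n<m. co n * q ^ n)) \<le> q * Jd q"
    proof (rule sums_le[OF _ sums_mult[OF tail_sums] Jd_sums])
      fix n show "real m * (if n < m then 0 else co n * q ^ n) \<le> real n * (co n * q ^ n)"
        using q co_pos[of n] by (auto intro!: mult_right_mono)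
    qed
    moreover have "(\<Sum>n<m. co n * q ^ n) \<le> 1 / 2 * J q"
      by (rule order_trans[OF C(2)[OF q(1)] mult_right_mono[OF q(2)]]) (use J in simp)
    then have "real m * (J q / 2) \<le> real m * (J q - (\<Sum>n<m. co n * q ^ n))"
      by (intro mult_left_mono) auto
    moreover have "A * J q \<le> real m * (J q / 2)" using m J mult_right_mono[OF m, of "J q"] by simp
    ultimately have "A * J q \<le> q * Jd q" by linarith
    then show "A \<le> q * y q" using J by (simp add: y_def field_simps)
  qed
qed

text \<open>As a mean of \<open>1 / g (real (Suc n))\<close>, \<open>y q\<close> becomes small
  because \<open>g\<close> tends to infinity and the weight of any fixed set of initial indices
  tends to 0.\<close>

lemma y_small:
  assumes e: "0 < e"
  shows "\<forall>\<^sub>F q in at_top. y q \<le> e"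
proof -
  obtain l0 where l0: "\<And>l. l0 \<le> l \<Longrightarrow> 2 / e \<le> g l"
    using g_at_top by (auto simp: filterlim_at_top eventually_at_top_linorder)
  define m where "m = nat \<lceil>l0\<rceil>"
  have m: "2 / e \<le> g (real (Suc n))" if "m \<le> n" for n
  proof (rule l0)
    have "l0 \<le> real m" unfolding m_def by linarith
    then show "l0 \<le> real (Suc n)" using that by simp
  qed
  obtain C where C: "0 \<le> C" "\<And>q. 1 \<le> q \<Longrightarrow> (\<Sum>n<m. co n * q ^ n) \<le> C / q * J q" using head_small[of m] by blast
  show ?thesis
    using eventually_ge_at_top[of "max 1 (2 * C / (g0 * e))"]
  proof eventually_elim
    fix q assume Q: "max 1 (2 * C / (g0 * e)) \<le> q"
    then have q: "1 \<le> q" "C / q / g0 \<le> e / 2" using g0_pos e by (auto simp: field_simps)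
    have J: "0 < J q" using J_ge_1[of q] q by simp
    define H where "H = (\<Sum>n<m. co n * q ^ n)"
    have H0: "0 \<le> H" unfolding H_def using q co_pos by (intro sum_nonneg) (auto simp: less_imp_le)
    have "(\<lambda>n. if n < m then co n * q ^ n else 0) sums H"
      unfolding H_def using sums_If_finite_set[of "{..<m}" "\<lambda>n. co n * q ^ n"] by simp
    then have "(\<lambda>n. 1 / g0 * (if n < m then co n * q ^ n else 0) + e / 2 * (if n < m then 0 else co n * q ^ n))
      sums (1 / g0 * H + e / 2 * (J q - H))"
      unfolding H_def by (intro sums_add sums_mult tail_sums)
    note up = this
    have lo: "(\<lambda>n. diffs co n * q ^ n) sums Jd q" unfolding Jd_def by (intro summable_sums Jd_summable)
    have "Jd q \<le> 1 / g0 * H + e / 2 * (J q - H)"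
    proof (rule sums_le[OF _ lo up])
      fix n
      have z: "0 \<le> co n * q ^ n" using q co_pos[of n] by simp
      have "1 / g (real (Suc n)) \<le> (if n < m then 1 / g0 else e / 2)"
      proof (cases "n < m")
        case True
        then show ?thesis using g_ge[of "real (Suc n)"] g0_pos by (simp add: frac_le)
      next
        case False
        then have "1 / g (real (Suc n)) \<le> 1 / (2 / e)" using m[of n] e by (intro frac_le) auto
        then show ?thesis using False by simp
      qed
      from mult_right_mono[OF this z]
      show "diffs co n * q ^ n \<le> 1 / g0 * (if n < m then co n * q ^ n else 0) + e / 2 * (if n < m then 0 else co n * q ^ n)"
        by (auto simp: diffs_co split: if_splits)
    qed
    also have "\<dots> \<le> 1 / g0 * H + e / 2 * J q" using H0 e by simp
    also have "\<dots> \<le> 1 / g0 * (C / q * J q) + e / 2 * J q"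
      using C(2)[OF q(1)] g0_pos by (intro add_right_mono mult_left_mono) (auto simp: H_def)
    also have "\<dots> = (C / q / g0) * J q + e / 2 * J q" by simp
    also have "\<dots> \<le> e / 2 * J q + e / 2 * J q" using q J by (intro add_right_mono mult_right_mono) auto
    finally show "y q \<le> e" using J by (simp add: y_def field_simps)
  qed
qed

text \<open>Jensen's inequality for the weights \<open>co n * q ^ n / J q\<close>: the mean of
  \<open>c ^ n\<close> is at least \<open>c\<close> to the power of the mean index. It is carried
  out termwise with the tangent of \<open>exp\<close> at the mean.\<close>

lemma J_scale:
  assumes q: "0 \<le> q" and c: "0 < c"
  shows "exp (q * y q * ln c) * J q \<le> J (c * q)"
proof -
  define N where "N = q * y q"
  define L where "L = ln c"
  have J: "0 < J q" using J_ge_1[OF q] by simp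
  have NJ: "q * Jd q = N * J q" using J by (simp add: N_def y_def)
  have "(\<lambda>n. exp (N * L) * (co n * q ^ n + L * (real n * (co n * q ^ n) - N * (co n * q ^ n))))
      sums (exp (N * L) * (J q + L * (q * Jd q - N * J q)))"
    unfolding J_def by (intro sums_mult sums_add sums_diff Jd_sums summable_sums[OF co_summable])
  then have "(\<lambda>n. exp (N * L) * (co n * q ^ n + L * (real n * (co n * q ^ n) - N * (co n * q ^ n)))) sums (exp (N * L) * J q)"
    by (simp add: NJ)
  moreover have "(\<lambda>n. co n * (c * q) ^ n) sums J (c * q)"
    unfolding J_def by (intro summable_sums[OF co_summable])
  ultimately have "exp (N * L) * J q \<le> J (c * q)"
  proof (rule sums_le[rotated 1])
    fix n
    have "1 + L * (real n - N) \<le> exp (L * (real n - N))" by (rule exp_ge_add_one_self)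
    then have "exp (N * L) * (1 + L * (real n - N)) \<le> exp (N * L) * exp (L * (real n - N))" by (intro mult_left_mono) auto
    also have "\<dots> = c ^ n" using c by (simp add: exp_add[symmetric] algebra_simps L_def exp_of_nat_mult)
    finally have "exp (N * L) * (1 + L * (real n - N)) * (co n * q ^ n) \<le> c ^ n * (co n * q ^ n)"
      using q co_pos[of n] by (intro mult_right_mono) auto
    then show "exp (N * L) * (co n * q ^ n + L * (real n * (co n * q ^ n) - N * (co n * q ^ n))) \<le> co n * (c * q) ^ n"
      by (simp add: algebra_simps power_mult_distrib)
  qed
  then show ?thesis by (simp add: N_def L_def)
qed

text \<open>Rescaling by \<open>b\<close> writes the term of index \<open>n\<close> as
  \<open>(q / b) ^ n / fact n\<close> times the exponential of the sum bounded in
  \<open>sum_ln_le_I\<close>. That bound is uniform in \<open>n\<close>, so the exponential series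
  remains.\<close>

lemma J_upper:
  assumes b: "g0 < b" and q: "0 \<le> q"
  shows "J q \<le> exp (q / b + I b)"
proof -
  have b0: "0 < b" using b g0_pos by simp
  have "(\<lambda>n. (q / b) ^ n / fact n * exp (I b)) sums (exp (q / b) * exp (I b))"
    using exp_converges[of "q / b"] by (intro sums_mult2) (simp add: divide_inverse mult.commute)
  note up = this
  have lo: "(\<lambda>n. co n * q ^ n) sums J q" unfolding J_def by (intro summable_sums co_summable)
  have "J q \<le> exp (q / b) * exp (I b)"
  proof (rule sums_le[OF _ lo up])
    fix n
    have "co n * q ^ n = (q / b) ^ n / fact n / (\<Prod>k=1..n. g (real k) / b)"
      using b0 by (simp add: co_eq power_divide prod_dividef)
    also have "\<dots> = (q / b) ^ n / fact n * exp (\<Sum>k=1..n. ln (b / g (real k)))"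
      unfolding prod_g_scale[OF b0] by (simp add: exp_minus field_simps)
    also have "\<dots> \<le> (q / b) ^ n / fact n * exp (I b)"
      using sum_ln_le_I[OF b, of n] q b0 by (intro mult_left_mono) auto
    finally show "co n * q ^ n \<le> (q / b) ^ n / fact n * exp (I b)" .
  qed
  then show ?thesis by (simp add: exp_add)
qed

text \<open>Under the law with density proportional to \<open>exp (- (q * Z))\<close>, \<open>Z\<close> concentrates around its
  mean \<open>y q\<close>; the two deviations are controlled by an exponential moment of the tilted law.\<close>

lemma cdf_lower_tilt:
  assumes \<eta>: "0 < \<eta>" "\<eta> < 1" and q: "0 < q" and N: "8 * ln 4 / \<eta>\<^sup>2 \<le> q * y q"
  shows "exp ((1 - \<eta>) * (q * y q)) / (2 * J q) \<le> cdf ((1 + \<eta>) * y q)"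
proof -
  define N where "N = q * y q"
  define x where "x = (1 + \<eta>) * y q"
  \<comment> \<open>This value turns \<open>2 * e\<^sup>2 - e * \<eta>\<close> into
    \<open>- (\<eta>\<^sup>2 / 8)\<close>. By the premise on \<open>q * y q\<close>, each deviation
    then has tilted probability at most 1/4, leaving 1/2 for the event itself.\<close>
  define e where "e = \<eta> / 4"
  have e: "0 < e" "e \<le> 1 / 4" using \<eta> by (simp_all add: e_def)
  have J: "0 < J q" using J_ge_1[of q] q by simp
  have qx: "q * x = (1 + \<eta>) * N" by (simp add: x_def N_def)
  have N0: "ln 4 \<le> N * (\<eta>\<^sup>2 / 8)" using N \<eta> by (simp add: N_def field_simps)
  have N_nonneg: "0 \<le> N" using N_def y_def Jd_pos[of q] J q by simp
  define B where "B = {\<omega> \<in> space P. Z \<omega> \<le> x}"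
  have [measurable]: "B \<in> sets P" unfolding B_def by measurable
  \<comment> \<open>The second and third terms are exponential Markov bounds for the deviations
    above \<open>x\<close> and below \<open>(1 - \<eta>) * y q\<close>; taking expectations turns
    them into values of \<open>1 / J\<close> at nearby arguments.\<close>
  have pt: "exp (- (q * Z \<omega>)) \<le> exp (- ((1 - \<eta>) * N)) * indicator B \<omega>
      + exp (- (e * (q * x))) * exp (- ((1 - e) * q * Z \<omega>))
      + exp (e * ((1 - \<eta>) * N)) * exp (- ((1 + e) * q * Z \<omega>))" (is "_ \<le> ?A + ?B + ?C") if "\<omega> \<in> space P" for \<omega>
  proof -
    have nn: "0 \<le> ?A" "0 \<le> ?B" "0 \<le> ?C" by auto
    consider "x < Z \<omega>" | "q * Z \<omega> < (1 - \<eta>) * N" | "Z \<omega> \<le> x" "(1 - \<eta>) * N \<le> q * Z \<omega>" by linarith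
    then show ?thesis
    proof cases
      case 1
      then have "e * (q * x) \<le> e * (q * Z \<omega>)" using e q by (intro mult_left_mono) auto
      then have "exp (- (q * Z \<omega>)) \<le> ?B" by (simp add: exp_add[symmetric] algebra_simps)
      then show ?thesis using nn by linarith
    next
      case 2
      then have "e * (q * Z \<omega>) \<le> e * ((1 - \<eta>) * N)" using e by (intro mult_left_mono) auto
      then have "exp (- (q * Z \<omega>)) \<le> ?C" by (simp add: exp_add[symmetric] algebra_simps)
      then show ?thesis using nn by linarith
    next
      case 3
      then have "exp (- (q * Z \<omega>)) \<le> ?A" using that by (simp add: B_def)
      then show ?thesis using nn by linarith
    qed
  qed
  have q1: "0 < (1 - e) * q" "0 < (1 + e) * q" using e q by simp_all
  have "1 / J q = (\<integral>\<omega>. exp (- (q * Z \<omega>)) \<partial>P)" using laplace_Z[OF q] by simp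
  also have "\<dots> \<le> (\<integral>\<omega>. exp (- ((1 - \<eta>) * N)) * indicator B \<omega>
      + exp (- (e * (q * x))) * exp (- ((1 - e) * q * Z \<omega>))
      + exp (e * ((1 - \<eta>) * N)) * exp (- ((1 + e) * q * Z \<omega>)) \<partial>P)"
    using q q1 by (intro integral_mono Bochner_Integration.integrable_add integrable_mult_right int_exp pt)
      (auto intro!: integrable_real_indicator simp: emeasure_eq_measure)
  also have "\<dots> = exp (- ((1 - \<eta>) * N)) * cdf x
      + exp (- (e * (q * x))) * (1 / J ((1 - e) * q)) + exp (e * ((1 - \<eta>) * N)) * (1 / J ((1 + e) * q))"
    using q1 laplace_Z[OF q1(1)] laplace_Z[OF q1(2)]
    by (subst Bochner_Integration.integral_add Bochner_Integration.integral_mult_right_zero;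
        (intro Bochner_Integration.integrable_add integrable_mult_right int_exp integrable_real_indicator)?)+
      (auto simp: emeasure_eq_measure cdf_def B_def)
  finally have le: "1 / J q \<le> exp (- ((1 - \<eta>) * N)) * cdf x
      + exp (- (e * (q * x))) * (1 / J ((1 - e) * q)) + exp (e * ((1 - \<eta>) * N)) * (1 / J ((1 + e) * q))" .
  have inv: "1 / J (c * q) \<le> exp (- (N * ln c)) / J q" if c: "0 < c" for c
  proof -
    have "1 / J (c * q) \<le> 1 / (exp (N * ln c) * J q)"
      using J_scale[of q c] c q J by (intro divide_left_mono) (auto simp: N_def intro!: mult_pos_pos less_le_trans[OF _ J_ge_1])
    then show ?thesis by (simp add: exp_minus field_simps)
  qed
  have quarter: "exp s * (exp (- (N * ln c)) / J q) \<le> 1 / (4 * J q)" if "s - N * ln c \<le> - (N * (\<eta>\<^sup>2 / 8))" for s c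
  proof -
    have "exp (s - N * ln c) \<le> exp (- ln 4)" using that N0 by simp
    also have "\<dots> = 1 / 4" by (simp add: exp_minus)
    finally show ?thesis using J by (simp add: exp_diff exp_minus field_simps)
  qed
  have "exp (- (e * (q * x))) * (1 / J ((1 - e) * q)) \<le> exp (- (e * (q * x))) * (exp (- (N * ln (1 - e))) / J q)"
    using e by (intro mult_left_mono inv) auto
  also have "\<dots> \<le> 1 / (4 * J q)"
  proof (rule quarter)
    have "N * (- e - 2 * e\<^sup>2) \<le> N * ln (1 - e)"
      using N_nonneg e by (intro mult_left_mono ln_one_minus_pos_lower_bound) auto
    then have "- (e * (q * x)) - N * ln (1 - e) \<le> - (e * (q * x)) - N * (- e - 2 * e\<^sup>2)" by simp
    also have "\<dots> = N * (2 * e\<^sup>2 - e * \<eta>)" by (simp add: qx algebra_simps)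
    also have "\<dots> = - (N * (\<eta>\<^sup>2 / 8))" by (simp add: e_def power2_eq_square field_simps)
    finally show "- (e * (q * x)) - N * ln (1 - e) \<le> - (N * (\<eta>\<^sup>2 / 8))" .
  qed
  finally have t1: "exp (- (e * (q * x))) * (1 / J ((1 - e) * q)) \<le> 1 / (4 * J q)" .
  have "exp (e * ((1 - \<eta>) * N)) * (1 / J ((1 + e) * q)) \<le> exp (e * ((1 - \<eta>) * N)) * (exp (- (N * ln (1 + e))) / J q)"
    using e by (intro mult_left_mono inv) auto
  also have "\<dots> \<le> 1 / (4 * J q)"
  proof (rule quarter)
    have "N * (e - e\<^sup>2) \<le> N * ln (1 + e)"
      using N_nonneg e by (intro mult_left_mono ln_one_plus_pos_lower_bound) auto
    then have "e * ((1 - \<eta>) * N) - N * ln (1 + e) \<le> e * ((1 - \<eta>) * N) - N * (e - e\<^sup>2)" by simp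
    also have "\<dots> = N * (e\<^sup>2 - e * \<eta>)" by (simp add: algebra_simps)
    also have "\<dots> \<le> N * (2 * e\<^sup>2 - e * \<eta>)" using N_nonneg by (intro mult_left_mono) auto
    also have "\<dots> = - (N * (\<eta>\<^sup>2 / 8))" by (simp add: e_def power2_eq_square field_simps)
    finally show "e * ((1 - \<eta>) * N) - N * ln (1 + e) \<le> - (N * (\<eta>\<^sup>2 / 8))" .
  qed
  finally have "exp (e * ((1 - \<eta>) * N)) * (1 / J ((1 + e) * q)) \<le> 1 / (4 * J q)" .
  moreover have "1 / (4 * J q) = 1 / J q / 4" "1 / (2 * J q) = 1 / J q / 2" by simp_all
  ultimately have "1 / (2 * J q) \<le> exp (- ((1 - \<eta>) * N)) * cdf x" using le t1 by linarith
  then have "exp ((1 - \<eta>) * N) * (1 / (2 * J q)) \<le> exp ((1 - \<eta>) * N) * (exp (- ((1 - \<eta>) * N)) * cdf x)"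
    by (intro mult_left_mono) auto
  also have "\<dots> = cdf x" by (simp add: exp_minus)
  finally show ?thesis by (simp add: N_def x_def)
qed

text \<open>Here \<open>\<eta>\<close> solves \<open>(1 + \<eta>) / (1 - \<eta>) = \<rho>\<close>,
  and \<open>q\<close> is chosen by the intermediate value theorem with
  \<open>(1 + \<eta>) * y q = x\<close>. Then \<open>(1 - \<eta>) * (q * y q)\<close> equals
  \<open>q / b\<close> for \<open>b = \<rho> / x\<close>, and the exponential gained in
  \<open>cdf_lower_tilt\<close> cancels the one in \<open>J_upper\<close> exactly.\<close>

lemma tail_lower:
  assumes \<rho>: "1 < \<rho>"
  shows "\<exists>x0>0. \<forall>x. 0 < x \<and> x < x0 \<longrightarrow> exp (- I (\<rho> / x)) / 2 \<le> cdf x"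
proof -
  define \<eta> where "\<eta> = (\<rho> - 1) / (\<rho> + 1)"
  have \<eta>: "0 < \<eta>" "\<eta> < 1" using \<rho> by (simp_all add: \<eta>_def)
  have r: "(1 + \<eta>) = \<rho> * (1 - \<eta>)" using \<rho> by (simp add: \<eta>_def field_simps)
  have "\<forall>\<^sub>F q in at_top. 8 * ln 4 / \<eta>\<^sup>2 \<le> q * y q" using qy_at_top by (simp add: filterlim_at_top)
  then obtain Q' where Q': "\<And>q. Q' \<le> q \<Longrightarrow> 8 * ln 4 / \<eta>\<^sup>2 \<le> q * y q" by (auto simp: eventually_at_top_linorder)
  define Q where "Q = max Q' 1"
  have Q: "0 < Q" "\<And>q. Q \<le> q \<Longrightarrow> 8 * ln 4 / \<eta>\<^sup>2 \<le> q * y q" using Q' by (auto simp: Q_def)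
  have ypos: "0 < y q" if "0 \<le> q" for q using Jd_pos[OF that] J_ge_1[OF that] by (simp add: y_def)
  define x0 where "x0 = min ((1 + \<eta>) * y Q) (\<rho> / g0)"
  show ?thesis
  proof (intro exI conjI allI impI)
    show "0 < x0" using ypos[of Q] Q \<eta> \<rho> g0_pos by (simp add: x0_def)
    fix x assume "0 < x \<and> x < x0"
    then have x: "0 < x" "x / (1 + \<eta>) \<le> y Q" "g0 < \<rho> / x" using \<eta> g0_pos by (auto simp: x0_def field_simps)
    have "\<forall>\<^sub>F q in at_top. y q \<le> x / (1 + \<eta>)" using x \<eta> by (intro y_small) auto
    then have "\<forall>\<^sub>F q in at_top. y q \<le> x / (1 + \<eta>) \<and> Q \<le> q" by (intro eventually_conj eventually_ge_at_top)
    then obtain q1 where "y q1 \<le> x / (1 + \<eta>)" "Q \<le> q1"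
      using eventually_happens'[of "at_top :: real filter"] by auto
    then have "\<exists>q. Q \<le> q \<and> q \<le> q1 \<and> y q = x / (1 + \<eta>)"
      using x Q by (intro IVT2) (auto intro!: y_isCont)
    then obtain q where q: "Q \<le> q" "y q = x / (1 + \<eta>)" by blast
    have q0: "0 < q" using q Q by simp
    have xy: "(1 + \<eta>) * y q = x" using q \<eta> by simp
    define b where "b = \<rho> / x"
    have "x = \<rho> * ((1 - \<eta>) * y q)" using xy r by (simp add: mult.assoc)
    then have "(1 - \<eta>) * y q = x / \<rho>" using \<rho> by simp
    then have qb: "(1 - \<eta>) * (q * y q) = q / b" by (simp add: b_def mult.left_commute)
    have J: "0 < J q" using J_ge_1[of q] q0 by simp
    have "J q \<le> exp (q / b + I b)" using x q0 by (intro J_upper) (auto simp: b_def)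
    then have "exp (- I b) * J q \<le> exp (- I b) * exp (q / b + I b)" by (intro mult_left_mono) auto
    also have "\<dots> = exp (q / b)" by (simp add: exp_add[symmetric])
    finally have "exp (- I b) / 2 \<le> exp (q / b) / (2 * J q)" using J by (simp add: field_simps)
    also have "\<dots> \<le> cdf x" using cdf_lower_tilt[OF \<eta> q0 Q(2)[OF q(1)]] by (simp add: qb xy)
    finally show "exp (- I (\<rho> / x)) / 2 \<le> cdf x" by (simp add: b_def)
  qed
qed

text \<open>For the lower bound \<open>\<delta>\<close> is split as \<open>\<rho> * \<rho>\<close>.
  One factor is spent in \<open>tail_lower\<close>; the other, through \<open>I_gain\<close>, pays
  for the 1/2, for \<open>\<delta> - 1\<close> and for the square root of \<open>\<phi>'\<close>,
  which is at most \<open>ph (\<delta> / x)\<close> because \<open>m\<close> is eventually at least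
  1.\<close>

lemma tail_bounds:
  assumes \<delta>: "1 < \<delta>"
  shows "\<exists>x0>0. \<forall>x. 0 < x \<and> x < x0 \<longrightarrow>
     (\<delta> - 1) * sqrt (deriv ph (\<delta> / x)) * exp (- I (\<delta> / x)) \<le> cdf x
   \<and> cdf x \<le> 1 / ((\<delta> - 1) * x) * sqrt (deriv ph (1 / (\<delta> * x))) * exp (- I (1 / (\<delta> * x)))"
proof -
  define \<rho> where "\<rho> = sqrt \<delta>"
  have \<rho>: "1 < \<rho>" "\<rho> * \<rho> = \<delta>" using \<delta> by (simp_all add: \<rho>_def)
  obtain x1 where x1: "0 < x1" "\<And>x. 0 < x \<Longrightarrow> x < x1 \<Longrightarrow> exp (- I (\<rho> / x)) / 2 \<le> cdf x"
    using tail_lower[OF \<rho>(1)] by blast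
  have "\<forall>\<^sub>F b in at_top. 2 * (\<delta> - 1) * ph (\<rho> * b) \<le> exp (I (\<rho> * b) - I b)"
    using \<delta> \<rho> by (intro I_gain) auto
  moreover have "\<forall>\<^sub>F l in at_top. 1 / g0 * g l \<le> m l" by (rule m_g)
  from eventually_compose_filterlim[OF this ph_at_top]
  have "\<forall>\<^sub>F b in at_top. 1 / g0 * g (ph b) \<le> m (ph b)" .
  moreover note tail_upper[OF \<delta>] eventually_gt_at_top[of g0]
  ultimately have "\<forall>\<^sub>F b in at_top. 2 * (\<delta> - 1) * ph (\<rho> * b) \<le> exp (I (\<rho> * b) - I b) \<and> 1 / g0 * g (ph b) \<le> m (ph b)
    \<and> cdf (1 / (\<delta> * b)) \<le> \<delta> * b / (\<delta> - 1) * sqrt (deriv ph b) * exp (- I b) \<and> g0 < b"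
    by eventually_elim auto
  then obtain B' where B': "\<And>b. B' \<le> b \<Longrightarrow> 2 * (\<delta> - 1) * ph (\<rho> * b) \<le> exp (I (\<rho> * b) - I b) \<and> 1 / g0 * g (ph b) \<le> m (ph b)
    \<and> cdf (1 / (\<delta> * b)) \<le> \<delta> * b / (\<delta> - 1) * sqrt (deriv ph b) * exp (- I b) \<and> g0 < b"
    unfolding eventually_at_top_linorder by blast
  define B where "B = max B' 1"
  have B0: "0 < B" by (simp add: B_def)
  show ?thesis
  proof (intro exI[of _ "min x1 (1 / (\<delta> * B))"] conjI allI impI)
    show "0 < min x1 (1 / (\<delta> * B))" using x1 \<delta> B0 by simp
    fix x assume "0 < x \<and> x < min x1 (1 / (\<delta> * B))"
    then have x: "0 < x" "x < x1" "B \<le> 1 / (\<delta> * x)" using \<delta> B0 by (auto simp: field_simps)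
    have "1 / \<delta> \<le> \<rho>" using \<delta> \<rho>(1) by (intro order_trans[of "1 / \<delta>" 1 \<rho>]) auto
    then have "1 / \<delta> / x \<le> \<rho> / x" using x by (intro divide_right_mono) auto
    then have "1 / (\<delta> * x) \<le> \<rho> / x" by (simp only: divide_divide_eq_left)
    then have B1: "B' \<le> 1 / (\<delta> * x)" "B' \<le> \<rho> / x" using x by (auto simp: B_def)
    have "\<rho> \<le> \<delta>" using \<rho> mult_left_mono[of 1 \<rho> \<rho>] by linarith
    then have "\<rho> / x \<le> \<delta> / x" using x by (intro divide_right_mono) auto
    then have B2: "B' \<le> \<delta> / x" using B1 by simp
    have rr: "\<rho> * (\<rho> / x) = \<delta> / x" using \<rho> by simp
    define l where "l = ph (\<delta> / x)"
    have gd: "g0 < \<delta> / x" using B'[OF B2] by simp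
    have l: "0 < l" unfolding l_def by (rule ph_pos[OF gd])
    have m1: "1 \<le> m l"
    proof -
      have "1 \<le> 1 / g0 * g l" using g_ge[OF l] g0_pos by simp
      then show ?thesis using B'[OF B2] by (simp add: l_def)
    qed
    have "deriv ph (\<delta> / x) = l\<^sup>2 / m l" unfolding l_def by (rule ph_deriv[OF gd])
    also have "\<dots> \<le> l\<^sup>2" using m1 by (simp add: divide_le_eq mult_le_cancel_left1)
    finally have s: "sqrt (deriv ph (\<delta> / x)) \<le> l" using l by (simp add: real_sqrt_le_iff real_le_lsqrt)
    have "2 * (\<delta> - 1) * l \<le> exp (I (\<delta> / x) - I (\<rho> / x))"
      using B'[OF B1(2)] unfolding rr l_def by blast
    then have gain: "(\<delta> - 1) * l \<le> exp (I (\<delta> / x) - I (\<rho> / x)) / 2" by linarith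
    have "(\<delta> - 1) * sqrt (deriv ph (\<delta> / x)) * exp (- I (\<delta> / x)) \<le> (\<delta> - 1) * l * exp (- I (\<delta> / x))"
      using s \<delta> by (intro mult_right_mono mult_left_mono) auto
    also have "\<dots> \<le> exp (I (\<delta> / x) - I (\<rho> / x)) / 2 * exp (- I (\<delta> / x))"
      by (intro mult_right_mono gain) simp
    also have "\<dots> = exp (- I (\<rho> / x)) / 2" by (simp add: exp_add[symmetric])
    also have "\<dots> \<le> cdf x" by (rule x1(2)) (use x in auto)
    finally show "(\<delta> - 1) * sqrt (deriv ph (\<delta> / x)) * exp (- I (\<delta> / x)) \<le> cdf x" .
    have e: "1 / (\<delta> * (1 / (\<delta> * x))) = x" "\<delta> * (1 / (\<delta> * x)) / (\<delta> - 1) = 1 / ((\<delta> - 1) * x)"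
      using \<delta> x by (simp_all add: field_simps)
    show "cdf x \<le> 1 / ((\<delta> - 1) * x) * sqrt (deriv ph (1 / (\<delta> * x))) * exp (- I (1 / (\<delta> * x)))"
      using B'[OF B1(1)] unfolding e by blast
  qed
qed

end

section \<open>The two drift regimes\<close>

lemma convex_slope_mono:
  fixes S :: "real \<Rightarrow> real"
  assumes conv: "convex_on {0..} S" and S0: "S 0 = 0" and l: "0 < l" "l \<le> L"
  shows "S l / l \<le> S L / L"
proof -
  have "S ((1 - l / L) *\<^sub>R 0 + (l / L) *\<^sub>R L) \<le> (1 - l / L) * S 0 + (l / L) * S L"
    using l by (intro convex_onD[OF conv]) auto
  then have "S l \<le> l / L * S L" using l S0 by simp
  then show ?thesis using l by (simp add: field_simps)
qed

lemma convex_slope_limit: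
  fixes S :: "real \<Rightarrow> real"
  assumes conv: "convex_on {0..} S" and S0: "S 0 = 0" and \<gamma>: "\<And>l. 0 < l \<Longrightarrow> \<gamma> * l \<le> S l"
  shows "\<exists>g0\<ge>\<gamma>. ((\<lambda>l. S l / l) \<longlongrightarrow> g0) (at_right 0)"
proof -
  define g where "g l = S l / l" for l
  define g0 where "g0 = (INF l\<in>{0<..}. g l)"
  have mono: "g l \<le> g L" if "0 < l" "l \<le> L" for l L
    unfolding g_def by (rule convex_slope_mono[OF conv S0 that])
  have \<gamma>': "\<gamma> \<le> g l" if "0 < l" for l using \<gamma>[OF that] that by (simp add: g_def field_simps)
  have bdd: "bdd_below (g ` {0<..})" using \<gamma>' by (intro bdd_belowI2[of _ \<gamma>]) auto
  have "\<gamma> \<le> g0" unfolding g0_def using \<gamma>' by (intro cINF_greatest) (auto intro: exI[of _ 1])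
  moreover have "(g \<longlongrightarrow> g0) (at_right 0)"
  proof (rule decreasing_tendsto)
    show "\<forall>\<^sub>F l in at_right 0. g0 \<le> g l"
      using eventually_at_right_less[of "0::real"]
      by eventually_elim (auto simp: g0_def intro!: cINF_lower bdd)
    fix y assume "g0 < y"
    then obtain l where l: "0 < l" "g l < y"
      unfolding g0_def by (subst (asm) cINF_less_iff[OF _ bdd]) auto
    show "\<forall>\<^sub>F z in at_right 0. g z < y"
      using eventually_at_right_real[OF l(1)]
    proof eventually_elim
      fix z assume "z \<in> {0<..<l}"
      then show "g z < y" using mono[of z l] l(2) by simp
    qed
  qed
  ultimately show ?thesis by (auto simp: g_def[abs_def])
qed

context scale_levy
begin

lemma harmonic_if_kernel_mass:
  assumes x: "0 < x" and t: "0 \<le> t" and mass: "measure (positive_kernel M V W t x) UNIV = 1"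
  shows "KP t Wp x = Wp x"
proof -
  define p where "p = positive_kernel M V W t x"
  have sp: "space p = UNIV" by (simp add: p_def positive_kernel_def)
  have "emeasure p UNIV = (\<integral>\<^sup>+z. 1 \<partial>p)" by (simp add: sp)
  also have "\<dots> = RR t (\<lambda>_. 1) x" unfolding p_def by (rule kernel_RR[OF x t]) simp
  also have "\<dots> = ennreal (1 / W x) * KP t Wp x" using x by (simp add: RR_def Wr_def)
  finally have e: "emeasure p UNIV = ennreal (1 / W x) * KP t Wp x" .
  have "enn2real (emeasure p UNIV) = 1" using mass by (simp add: p_def measure_def)
  then have "emeasure p UNIV = 1" by (cases "emeasure p UNIV") auto
  then have "ennreal (W x) * (ennreal (1 / W x) * KP t Wp x) = ennreal (W x)" by (simp add: e[symmetric])
  moreover have "ennreal (W x) * ennreal (1 / W x) = 1" using W_pos[OF x] by (simp add: ennreal_mult[symmetric])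
  ultimately have "KP t Wp x = ennreal (W x)" by (simp add: mult.assoc[symmetric])
  then show ?thesis using x by (simp add: Wp_def Wr_def)
qed

text \<open>For some \<open>n\<close> the path started from \<open>n + 1\<close> stays positive
  forever with probability \<open>p > 0\<close>; integer times suffice to express this. On that
  event the path tends to infinity, so invariance of \<open>W\<close> and Fatou's lemma give
  \<open>W y * p \<le> W (n + 1)\<close> for every \<open>y \<ge> 0\<close>.\<close>

lemma W_bounded_drift_plus:
  assumes drift: "drifts_to_plus_infinity M V"
    and harm: "\<And>x t. 0 < x \<Longrightarrow> 0 \<le> t \<Longrightarrow> KP t Wp x = Wp x"
  shows "\<exists>B. \<forall>x\<ge>0. W x \<le> B"
proof -
  define B where "B n = {\<omega> \<in> space M. \<forall>j::nat. kill (real j) (real (Suc n)) \<omega> = 1}" for n :: nat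
  have B[measurable]: "B n \<in> sets M" for n unfolding B_def by measurable
  have up: "AE \<omega> in M. filterlim (\<lambda>t. V t \<omega>) at_top at_top"
    using drift by (simp add: drifts_to_plus_infinity_def)
  have "AE \<omega> in M. \<exists>n. \<omega> \<in> B n"
    using up AE_space
  proof eventually_elim
    fix \<omega> assume lim: "filterlim (\<lambda>t. V t \<omega>) at_top at_top" and \<omega>: "\<omega> \<in> space M"
    have c: "cadlag (\<lambda>t. V t \<omega>)" by (rule cadlag_paths[OF \<omega>])
    obtain T where T: "\<And>t. T \<le> t \<Longrightarrow> 0 \<le> V t \<omega>"
      using lim by (auto simp: filterlim_at_top eventually_at_top_linorder)
    obtain b where b: "\<forall>s\<in>{0..T}. \<bar>V s \<omega>\<bar> \<le> b" using cadlag_bounded[OF c] by blast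
    obtain n :: nat where n: "max b 0 \<le> real n" using real_arch_simple by blast
    have low: "- real n \<le> V s \<omega>" if "0 \<le> s" for s
      using b T[of s] n that by (cases "s \<le> T") (auto simp: abs_le_iff dest!: bspec[of _ _ s])
    have "kill (real j) (real (Suc n)) \<omega> = 1" for j :: nat
    proof -
      have "- real n \<le> runinf (\<lambda>r. V r \<omega>) (real j)"
        unfolding runinf_def using low by (intro cINF_greatest) auto
      then show ?thesis by (simp add: kill_def)
    qed
    then show "\<exists>n. \<omega> \<in> B n" using \<omega> by (auto simp: B_def)
  qed
  then have "\<exists>n. emeasure M (B n) \<noteq> 0"
  proof (rule contrapos_pp)
    assume "\<not> (\<exists>n. emeasure M (B n) \<noteq> 0)"
    then have "AE \<omega> in M. \<omega> \<notin> B n" for n by (intro AE_not_in) auto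
    then have "AE \<omega> in M. \<forall>n. \<omega> \<notin> B n" by (simp add: AE_all_countable)
    show "\<not> (AE \<omega> in M. \<exists>n. \<omega> \<in> B n)"
    proof
      assume "AE \<omega> in M. \<exists>n. \<omega> \<in> B n"
      with \<open>AE \<omega> in M. \<forall>n. \<omega> \<notin> B n\<close> have "AE \<omega> in M. False" by eventually_elim auto
      then show False by simp
    qed
  qed
  then obtain n where n: "0 < measure M (B n)" by (auto simp: emeasure_eq_measure zero_less_measure_iff)
  define p where "p = measure M (B n)"
  have bound: "Wr y * p \<le> Wr (real (Suc n))" for y
  proof -
    have "Wp y * emeasure M (B n) = (\<integral>\<^sup>+\<omega>. Wp y * indicator (B n) \<omega> \<partial>M)"
      by (simp only: nn_integral_cmult_indicator[OF B])
    also have "\<dots> \<le> (\<integral>\<^sup>+\<omega>. liminf (\<lambda>j. kill (real j) (real (Suc n)) \<omega> * Wp (real (Suc n) + V (max 0 (real j)) \<omega>)) \<partial>M)"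
    proof (rule nn_integral_mono_AE, use up in eventually_elim)
      fix \<omega> assume lim: "filterlim (\<lambda>t. V t \<omega>) at_top at_top"
      show "Wp y * indicator (B n) \<omega> \<le> liminf (\<lambda>j. kill (real j) (real (Suc n)) \<omega> * Wp (real (Suc n) + V (max 0 (real j)) \<omega>))"
      proof (cases "\<omega> \<in> B n")
        case True
        have "filterlim (\<lambda>j. V (real j) \<omega>) at_top sequentially"
          by (rule filterlim_compose[OF lim filterlim_real_sequentially])
        then have "\<forall>\<^sub>F j in sequentially. y \<le> V (real j) \<omega>" by (simp add: filterlim_at_top)
        then have "\<forall>\<^sub>F j in sequentially. Wp y \<le> kill (real j) (real (Suc n)) \<omega> * Wp (real (Suc n) + V (max 0 (real j)) \<omega>)"
          by eventually_elim (use True in \<open>auto simp: B_def intro!: Wp_mono\<close>)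
        then show ?thesis using True by (simp add: Liminf_bounded)
      qed simp
    qed
    also have "\<dots> \<le> liminf (\<lambda>j. \<integral>\<^sup>+\<omega>. kill (real j) (real (Suc n)) \<omega> * Wp (real (Suc n) + V (max 0 (real j)) \<omega>) \<partial>M)"
      by (rule nn_integral_liminf) measurable
    also have "\<dots> = liminf (\<lambda>j. Wp (real (Suc n)))"
      using harm[of "real (Suc n)"] by (simp add: KP_def)
    finally have "Wp y * emeasure M (B n) \<le> Wp (real (Suc n))" by (simp add: Liminf_const)
    then show ?thesis
      by (simp add: Wp_def emeasure_eq_measure p_def ennreal_mult[symmetric] Wr_nonneg ennreal_le_iff)
  qed
  have "W x \<le> Wr (real (Suc n)) / p" if "0 \<le> x" for x
    using bound[of x] that n by (simp add: Wr_def p_def pos_le_divide_eq)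
  then show ?thesis by blast
qed

lemma slope_lower:
  assumes B: "\<And>x. 0 \<le> x \<Longrightarrow> W x \<le> B" and l: "c < l"
  shows "l \<le> B * \<Psi> l"
proof -
  have l0: "0 < l" using l c_nonneg by simp
  have B0: "0 < B" using B[of 1] W_pos[of 1] by simp
  have "ennreal (1 / \<Psi> l) = LT Wp l" by (rule LT_Wp[OF l, symmetric])
  also have "\<dots> \<le> (\<integral>\<^sup>+y. ennreal (B * exp (- (l * y))) * indicator {0..} y \<partial>lborel)"
    unfolding LT_def using B B0 W_nonneg
    by (intro nn_integral_mono)
      (auto simp: Wp_def Wr_def indicator_def ennreal_mult[symmetric] mult.commute intro!: ennreal_leI mult_right_mono)
  also have "\<dots> = ennreal (0 - - (B * exp (- (l * 0)) / l))"
  proof (rule nn_integral_FTC_atLeast)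
    show "((\<lambda>y. - (B * exp (- (l * y)) / l)) \<longlongrightarrow> 0) at_top" using l0 by real_asymp
  qed (use l0 B0 in \<open>auto intro!: derivative_eq_intros\<close>)
  finally have "1 / \<Psi> l \<le> B / l" using l0 B0 by (simp add: ennreal_le_iff)
  then show ?thesis using l0 Psi_pos[OF l] by (simp add: field_simps)
qed

text \<open>By monotonicity the tail of the transform beyond \<open>x\<close> is at least
  \<open>w * exp (- (l * x)) / l\<close>, whereas the whole transform is at most
  \<open>1 / (\<gamma> * l)\<close>. The factor \<open>l\<close> cancels, and \<open>l\<close> tends
  to 0.\<close>

lemma Ws_upper:
  assumes mono: "\<And>x y. 0 \<le> x \<Longrightarrow> x \<le> y \<Longrightarrow> exp (- (c * x)) * W x \<le> exp (- (c * y)) * W y"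
    and \<gamma>: "0 < \<gamma>" "\<And>l. 0 < l \<Longrightarrow> \<gamma> * l \<le> \<Psi> (c + l)" and x: "0 \<le> x"
  shows "exp (- (c * x)) * W x \<le> 1 / \<gamma>"
proof -
  define w where "w = exp (- (c * x)) * W x"
  have w: "0 \<le> w" using W_nonneg[OF x] by (simp add: w_def)
  have le: "w \<le> exp (l * x) / \<gamma>" if l: "0 < l" for l
  proof -
    have cl: "c < c + l" using l by simp
    have "ennreal (w * (exp (- (l * x)) / l)) = ennreal (0 - - (w * exp (- (l * x)) / l))" by simp
    also have "\<dots> = (\<integral>\<^sup>+y. ennreal (w * exp (- (l * y))) * indicator {x..} y \<partial>lborel)"
    proof (rule nn_integral_FTC_atLeast[symmetric])
      show "((\<lambda>y. - (w * exp (- (l * y)) / l)) \<longlongrightarrow> 0) at_top" using l by real_asymp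
    qed (use l w in \<open>auto intro!: derivative_eq_intros\<close>)
    also have "\<dots> \<le> LT Wp (c + l)"
      unfolding LT_def
    proof (intro nn_integral_mono)
      fix y
      show "ennreal (w * exp (- (l * y))) * indicator {x..} y \<le> ennreal (exp (- ((c + l) * y))) * Wp y"
      proof (cases "x \<le> y")
        case True
        have "w * exp (- (l * y)) \<le> exp (- (c * y)) * W y * exp (- (l * y))"
          unfolding w_def using mono[OF x True] by (intro mult_right_mono) auto
        also have "\<dots> = exp (- (c * y) + - (l * y)) * W y" unfolding exp_add by (simp only: mult_ac)
        also have "- (c * y) + - (l * y) = - ((c + l) * y)" by (simp add: algebra_simps)
        finally show ?thesis using True x W_nonneg[of y]
          by (simp add: Wp_def Wr_def ennreal_mult[symmetric] ennreal_leI)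
      qed simp
    qed
    also have "\<dots> = ennreal (1 / \<Psi> (c + l))" by (rule LT_Wp[OF cl])
    finally have "w * (exp (- (l * x)) / l) \<le> 1 / \<Psi> (c + l)" using Psi_pos[OF cl] by (simp add: ennreal_le_iff)
    also have "\<dots> \<le> 1 / (\<gamma> * l)" using \<gamma> l by (intro frac_le) auto
    finally show ?thesis using l \<gamma>(1) by (simp add: exp_minus field_simps)
  qed
  have "((\<lambda>l. exp (l * x) / \<gamma>) \<longlongrightarrow> exp (0 * x) / \<gamma>) (at_right 0)" using \<gamma> by (intro tendsto_intros) auto
  moreover have "\<forall>\<^sub>F l in at_right 0. w \<le> exp (l * x) / \<gamma>"
    using eventually_at_right_less[of "0::real"] by eventually_elim (rule le)
  ultimately have "w \<le> exp (0 * x) / \<gamma>" by (rule tendsto_lowerbound) simp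
  then show ?thesis by (simp add: w_def)
qed

end

context limit_levy
begin

lemma exponential_functional_tail:
  assumes Psi_k: "\<Psi> k = 0" and \<gamma>: "0 < \<gamma>" "\<And>l. 0 < l \<Longrightarrow> \<gamma> * l \<le> \<Psi> (k + l)"
    and sup: "\<And>d. \<exists>l>k. d * l \<le> \<Psi> l" and \<delta>: "1 < \<delta>"
  shows "\<exists>x0>0. \<forall>x. 0 < x \<and> x < x0 \<longrightarrow>
      (\<delta> - 1) * sqrt (deriv (phi \<Psi> k) (\<delta> / x))
          * exp (- integral {deriv_nonneg \<Psi> k..\<delta> / x} (\<lambda>r. phi \<Psi> k r / r))
        \<le> measure P {\<omega> \<in> space P. exponential_functional X \<omega> \<le> ennreal x}
    \<and> measure P {\<omega> \<in> space P. exponential_functional X \<omega> \<le> ennreal x}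
        \<le> 1 / ((\<delta> - 1) * x) * sqrt (deriv (phi \<Psi> k) (1 / (\<delta> * x)))
          * exp (- integral {deriv_nonneg \<Psi> k..1 / (\<delta> * x)} (\<lambda>r. phi \<Psi> k r / r))"
proof -
  define S where "S l = \<Psi> (k + l)" for l
  have k: "0 \<le> k" by (rule c_nonneg)
  have S0: "S 0 = 0" by (simp add: S_def Psi_k)
  have conv: "convex_on {0..} S"
  proof (rule convex_onI)
    fix u a b :: real assume u: "0 < u" "u < 1" and ab: "a \<in> {0..}" "b \<in> {0..}"
    have "\<Psi> ((1 - u) *\<^sub>R (k + a) + u *\<^sub>R (k + b)) \<le> (1 - u) * \<Psi> (k + a) + u * \<Psi> (k + b)"
      using u ab k by (intro convex_onD[OF Psi_convex]) auto
    moreover have "(1 - u) *\<^sub>R (k + a) + u *\<^sub>R (k + b) = k + ((1 - u) *\<^sub>R a + u *\<^sub>R b)" by (simp add: algebra_simps)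
    ultimately show "S ((1 - u) *\<^sub>R a + u *\<^sub>R b) \<le> (1 - u) * S a + u * S b" by (simp add: S_def)
  qed simp
  have \<gamma>S: "\<gamma> * l \<le> S l" if "0 < l" for l using \<gamma>(2)[OF that] by (simp add: S_def)
  obtain g0 where g0: "\<gamma> \<le> g0" "((\<lambda>l. S l / l) \<longlongrightarrow> g0) (at_right 0)"
    using convex_slope_limit[OF conv S0 \<gamma>S] by blast
  note mono = convex_slope_mono[OF conv S0]
  have top: "filterlim (\<lambda>l. S l / l) at_top at_top"
    unfolding filterlim_at_top
  proof
    fix Z :: real
    obtain l where l: "k < l" "max Z 0 * l \<le> \<Psi> l" using sup by blast
    have "Z * (l - k) \<le> max Z 0 * (l - k)" using l by (intro mult_right_mono) auto
    also have "\<dots> \<le> max Z 0 * l" using k by (intro mult_left_mono) auto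
    also have "\<dots> \<le> S (l - k)" using l by (simp add: S_def)
    finally have "Z \<le> S (l - k) / (l - k)" using l by (simp add: field_simps)
    then have "Z \<le> S L / L" if "l - k \<le> L" for L using mono[of "l - k" L] l that by simp
    then show "\<forall>\<^sub>F L in at_top. Z \<le> S L / L" by (auto simp: eventually_at_top_linorder)
  qed
  interpret T: psi_tail S g0 P a J ZZ
  proof (intro psi_tail.intro psi_sharp.intro psi_tail_axioms.intro P_prob conv S0 g0(2) top ZZ_meas ZZ_nonneg laplace_ZZ a_summable J_def)
    show "0 < g0" using g0 \<gamma> by simp
    show "\<exists>D. (S has_real_derivative D) (at l)" if l: "0 < l" for l
    proof -
      obtain D where "(\<Psi> has_real_derivative D) (at (k + l))" using Psi_differentiable[of "k + l"] k l by auto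
      then have "(S has_real_derivative D * 1) (at l)"
        unfolding S_def[abs_def] by (intro DERIV_chain2) (auto intro!: derivative_eq_intros)
      then show ?thesis by blast
    qed
    show "\<exists>C>0. \<forall>l>0. S l \<le> C * exp (e * l)" if e: "0 < e" for e
    proof -
      obtain C where C: "0 < C" "\<forall>l>k. \<Psi> l \<le> C * exp (e * l)" using Psi_subexp[OF e] by blast
      have "S l \<le> C * exp (e * k) * exp (e * l)" if "0 < l" for l
        using C(2)[rule_format, of "k + l"] that by (simp add: S_def distrib_left exp_add)
      then show ?thesis using C(1) by (intro exI[of _ "C * exp (e * k)"]) auto
    qed
    show "a n = 1 / (\<Prod>i=1..n. S (real i))" for n by (simp add: a_def S_def)
  qed auto
  \<comment> \<open>\<open>deriv_nonneg\<close> takes the derivative within the nonnegative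
    half-line, whereas \<open>g0\<close> is a right slope. They agree trivially if
    \<open>k = 0\<close>, and by two-sided differentiability if \<open>k > 0\<close>.\<close>
  have der: "deriv_nonneg \<Psi> k = g0"
  proof -
    have "((\<lambda>l. (\<Psi> l - \<Psi> k) / (l - k)) \<longlongrightarrow> g0) (at_right k)"
    proof -
      have "((\<lambda>l. S (l - k) / (l - k)) \<longlongrightarrow> g0) (at_right k)"
        using g0(2) filterlim_at_right_to_0[of "\<lambda>l. S (l - k) / (l - k)" "nhds g0" k] by simp
      then show ?thesis by (simp add: S_def Psi_k)
    qed
    then have right: "(\<Psi> has_real_derivative g0) (at k within {k..})"
      by (simp add: has_field_derivative_iff at_within_Ici_at_right)
    have "(\<Psi> has_vector_derivative g0) (at k within {0..})"
    proof (cases "k = 0")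
      case True
      then show ?thesis using right by (simp add: has_real_derivative_iff_has_vector_derivative)
    next
      case False
      then obtain D where D: "(\<Psi> has_real_derivative D) (at k)" using Psi_differentiable[of k] k by auto
      then have "(\<Psi> has_real_derivative D) (at k within {k..})" by (rule has_field_derivative_at_within)
      with right have "D = g0"
        by (intro vector_derivative_unique_within[of k "{k..}" \<Psi>])
          (auto simp: has_real_derivative_iff_has_vector_derivative at_within_Ici_at_right)
      with D show ?thesis
        by (simp add: has_real_derivative_iff_has_vector_derivative[symmetric] has_field_derivative_at_within)
    qed
    moreover have "at k within {k..} \<le> at k within {0..}" using k by (intro at_le) auto
    then have "at k within {0..} \<noteq> bot" by (auto simp: at_within_Ici_at_right bot_unique trivial_limit_at_right_real)
    ultimately show ?thesis unfolding deriv_nonneg_def by (rule vector_derivative_within[rotated])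
  qed
  have phi: "phi \<Psi> k = T.ph"
    unfolding phi_def T.ph_def der by (simp add: fun_eq_iff S_def add.commute)
  have cdf: "measure P {\<omega> \<in> space P. exponential_functional X \<omega> \<le> ennreal x} = T.cdf x" if x: "0 < x" for x
    unfolding T.cdf_def
  proof (rule measure_eq_AE)
    show "AE \<omega> in P. (\<omega> \<in> {\<omega> \<in> space P. exponential_functional X \<omega> \<le> ennreal x}) = (\<omega> \<in> {\<omega> \<in> space P. ZZ \<omega> \<le> x})"
      using exponential_functional_ZZ by eventually_elim (use x in \<open>simp add: ennreal_le_iff\<close>)
    have "(\<lambda>\<omega>. exponential_functional X \<omega>) = (\<lambda>\<omega>. \<integral>\<^sup>+t. ennreal (exp (- X (max 0 t) \<omega>)) * indicator {0..} t \<partial>lborel)"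
      unfolding exponential_functional_def
      by (intro ext nn_integral_cong) (auto simp: indicator_def max_def)
    moreover have "(\<lambda>\<omega>. \<integral>\<^sup>+t. ennreal (exp (- X (max 0 t) \<omega>)) * indicator {0..} t \<partial>lborel) \<in> borel_measurable P" by measurable
    ultimately have [measurable]: "exponential_functional X \<in> borel_measurable P" by simp
    show "{\<omega> \<in> space P. exponential_functional X \<omega> \<le> ennreal x} \<in> sets P" by measurable
  qed simp
  from T.tail_bounds[OF \<delta>] show ?thesis
    by (auto simp: cdf phi der T.I_def)
qed

end

text \<open>Positivity of \<open>W\<close> comes from the kernel at time 0: if
  \<open>W x = 0\<close>, the density \<open>W y / W x\<close> would be 0 by the convention on
  division, contradicting mass one. Positivity of \<open>\<Psi>\<close> follows, as
  \<open>1 / \<Psi> l\<close> is the integral of a function bounded below on an interval.\<close>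

lemma (in laplace_levy) scale_levyI:
  assumes sf: "scale_function \<Psi> \<kappa> W" and cpz: "conditioned_positive_from_zero M V W N Y P X"
  shows "scale_levy M V \<Psi> W (max \<kappa> 0)"
proof -
  have W: "continuous_on {0..} W" "mono_on {0..} W" "\<And>x. 0 \<le> x \<Longrightarrow> 0 \<le> W x"
    using sf by (simp_all add: scale_function_def)
  have int: "((\<lambda>x. exp (- l * x) * W x) has_integral 1 / \<Psi> l) {0..}" if "max \<kappa> 0 < l" for l
    using sf that by (simp add: scale_function_def)
  have pos: "0 < W x" if x: "0 < x" for x
  proof (rule ccontr)
    assume "\<not> 0 < W x"
    then have "W x = 0" using W(3)[of x] x by simp
    then have "positive_kernel M V W 0 x = density (distr (density M (indicator {\<omega> \<in> space M. 0 < (INF s\<in>{0..0}. x + V s \<omega>)}))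
          borel (\<lambda>\<omega>. x + V 0 \<omega>)) (\<lambda>_. 0)"
      unfolding positive_kernel_def by (intro arg_cong2[where f=density] refl ext) simp
    then have "measure (positive_kernel M V W 0 x) UNIV = 0" by (simp add: measure_def emeasure_density)
    moreover have "measure (positive_kernel M V W 0 x) UNIV = 1"
      using cpz x by (intro kernel_mass[of W x "N x" "Y x"]) (auto simp: conditioned_positive_from_zero_def conditioned_positive_from_def)
    ultimately show False by simp
  qed
  have Psi: "0 < \<Psi> l" if l: "max \<kappa> 0 < l" for l
  proof -
    define e where "e = exp (- l * 2) * W 1"
    have e: "0 < e" using pos[of 1] by (simp add: e_def)
    have "((\<lambda>x::real. e) has_integral (2 - 1) *\<^sub>R e) {1..2::real}" using has_integral_const_real[of e 1 2] by simp
    then have "((\<lambda>x::real. if x \<in> {1..2} then e else 0) has_integral (2 - 1) *\<^sub>R e) {0..}"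
      by (subst has_integral_restrict) auto
    then have "(2 - 1) *\<^sub>R e \<le> 1 / \<Psi> l"
    proof (rule has_integral_le[OF _ int[OF l]])
      fix x :: real assume x: "x \<in> {0..}"
      show "(if x \<in> {1..2} then e else 0) \<le> exp (- l * x) * W x"
      proof (cases "x \<in> {1..2}")
        case True
        then have "e \<le> exp (- l * x) * W x"
          unfolding e_def using l W(2) pos[of 1] by (intro mult_mono) (auto simp: mono_on_def)
        then show ?thesis using True by simp
      qed (use W(3)[of x] x in auto)
    qed
    then have "e \<le> 1 / \<Psi> l" by simp
    with e have "0 < 1 / \<Psi> l" by (rule less_le_trans)
    then show ?thesis by simp
  qed
  show ?thesis
  proof unfold_locales
    fix l assume l: "max \<kappa> 0 < l"
    have "LT (\<lambda>x. ennreal (if 0 \<le> x then W x else 0)) l = (\<integral>\<^sup>+x. ennreal (exp (- l * x) * W x) * indicator {0..} x \<partial>lborel)"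
      unfolding LT_def by (intro nn_integral_cong) (auto simp: indicator_def ennreal_mult'[symmetric])
    also have "\<dots> = ennreal (1 / \<Psi> l)"
      using W(3) by (intro nn_integral_has_integral_lebesgue' int l) auto
    finally show "LT (\<lambda>x. ennreal (if 0 \<le> x then W x else 0)) l = ennreal (1 / \<Psi> l)" .
  qed (use W pos Psi in auto)
qed

text \<open>\<open>\<Psi>\<close> is negative somewhere and, by superlinear growth, positive
  somewhere. Convexity and \<open>\<Psi> 0 = 0\<close> leave exactly one positive root, so the
  infimum defining \<open>kappa\<close> is attained there.\<close>

lemma (in laplace_levy) kappa_root:
  assumes drift: "drifts_to_minus_infinity M V" and uv: "unbounded_variation M V"
    and neg: "\<exists>l>0. \<Psi> l < 0"
  shows "\<Psi> (kappa M V \<Psi>) = 0 \<and> (\<exists>l. 0 < l \<and> l < kappa M V \<Psi> \<and> \<Psi> l < 0)"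
proof -
  have conv: "\<Psi> z \<le> (1 - z / L) * \<Psi> 0 + z / L * \<Psi> L" if "0 \<le> z" "z \<le> L" "0 < L" for z L
    using convex_onD[OF Psi_convex, of "z / L" 0 L] that by simp
  obtain l1 where l1: "0 < l1" "\<Psi> l1 < 0" using neg by blast
  obtain l2 where l2: "0 \<le> l2" "0 < \<Psi> l2" using Psi_superlinear[OF uv, of 0 0] by auto
  have neg_below: "\<Psi> z < 0" if z: "0 < z" "z \<le> L" "\<Psi> L < 0" for z L
    using conv[of z L] z Psi_0 mult_pos_neg[of "z / L" "\<Psi> L"] by simp
  have l12: "l1 < l2"
  proof (rule ccontr)
    assume "\<not> l1 < l2"
    then show False using neg_below[of l2 l1] l1 l2 Psi_0 by (cases "l2 = 0") auto
  qed
  have "\<exists>z. l1 \<le> z \<and> z \<le> l2 \<and> \<Psi> z = 0"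
  proof (rule IVT)
    show "\<forall>x. l1 \<le> x \<and> x \<le> l2 \<longrightarrow> isCont \<Psi> x"
      using Psi_differentiable l1 DERIV_isCont by (meson less_le_trans)
  qed (use l1 l2 l12 in auto)
  then obtain z where z: "l1 \<le> z" "\<Psi> z = 0" by blast
  have lt: "l1 < z'" if "0 < z'" "\<Psi> z' = 0" for z'
    by (rule ccontr) (use neg_below[of z' l1] l1 that in auto)
  have no: "\<not> z1 < z2" if "0 < z1" "\<Psi> z1 = 0" "0 < z2" "\<Psi> z2 = 0" for z1 z2
  proof
    assume z12: "z1 < z2"
    define u where "u = (z1 - l1) / (z2 - l1)"
    have u: "0 < u" "u < 1" using lt[OF that(1,2)] z12 by (simp_all add: u_def)
    have "u * (z2 - l1) = z1 - l1" using lt[OF that(1,2)] z12 by (simp add: u_def)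
    then have "(1 - u) *\<^sub>R l1 + u *\<^sub>R z2 = z1" by (simp add: algebra_simps)
    then have "\<Psi> z1 \<le> (1 - u) * \<Psi> l1 + u * \<Psi> z2"
      using convex_onD[OF Psi_convex, of u l1 z2] u l1 that by simp
    then show False using that mult_pos_neg[of "1 - u" "\<Psi> l1"] u l1 by simp
  qed
  have "{l. 0 < l \<and> \<Psi> l = 0} = {z}" using no z l1 by (auto intro: antisym simp: not_less)
  then have "kappa M V \<Psi> = z" using drift by (simp add: kappa_def)
  then show ?thesis using z lt[of z] l1 by auto
qed

theorem proposition1p11:
  fixes M :: "'a measure" and V :: "real \<Rightarrow> 'a \<Rightarrow> real"
    and \<Psi> W :: "real \<Rightarrow> real" and \<kappa> :: real and \<phi> :: "real \<Rightarrow> real"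
    and N :: "real \<Rightarrow> 'b measure" and Y :: "real \<Rightarrow> real \<Rightarrow> 'b \<Rightarrow> real"
    and P :: "'c measure" and X :: "real \<Rightarrow> 'c \<Rightarrow> real"
  assumes "spectrally_negative_levy_process M V"
    and "\<not> subordinator M (\<lambda>t \<omega>. - V t \<omega>)"
    and "laplace_exponent M V \<Psi>"
    and "\<kappa> = kappa M V \<Psi>"
    and "\<phi> = phi \<Psi> \<kappa>"
    and "scale_function \<Psi> \<kappa> W"
    and "conditioned_positive_from_zero M V W N Y P X"
    and "unbounded_variation M V"
    and "drifts_to_plus_infinity M V \<or> drifts_to_minus_infinity M V"
  shows "\<exists>K1>0. \<exists>K2>0. \<forall>\<delta>>1. \<exists>x0>0. \<forall>x. 0 < x \<and> x < x0 \<longrightarrow>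
      K1 * (\<delta> - 1) * sqrt (deriv \<phi> (\<delta> / x))
          * exp (- integral {deriv_nonneg \<Psi> \<kappa>..\<delta> / x} (\<lambda>r. \<phi> r / r))
        \<le> measure P {\<omega> \<in> space P. exponential_functional X \<omega> \<le> ennreal x}
    \<and> measure P {\<omega> \<in> space P. exponential_functional X \<omega> \<le> ennreal x}
        \<le> K2 / ((\<delta> - 1) * x) * sqrt (deriv \<phi> (1 / (\<delta> * x)))
          * exp (- integral {deriv_nonneg \<Psi> \<kappa>..1 / (\<delta> * x)} (\<lambda>r. \<phi> r / r))"
proof -
  interpret laplace_levy M V \<Psi>
    using assms(1,3) by (intro laplace_levy.intro laplace_levy_axioms.intro)
      (simp_all add: spectrally_negative_levy_process_def)
  note cpz = assms(7)
  \<comment> \<open>The sign of \<open>\<kappa>\<close> is not yet available: under drift to minus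
    infinity it is obtained from a negative value of \<open>\<Psi>\<close>, whose existence is
    proved with the scale function. Hence \<open>max \<kappa> 0\<close> for the moment.\<close>
  interpret sc: scale_levy M V \<Psi> W "max \<kappa> 0" by (rule scale_levyI[OF assms(6) cpz])
  have harm: "KP t sc.Wp x = sc.Wp x" if "0 < x" "0 \<le> t" for t x
  proof (rule sc.harmonic_if_kernel_mass[OF that], rule kernel_mass[OF _ that(2)])
    show "markov_process (positive_kernel M V W) x (N x) (Y x)"
      using cpz that by (simp add: conditioned_positive_from_zero_def conditioned_positive_from_def)
  qed
  \<comment> \<open>The slope \<open>\<gamma>\<close> bounds the derivative of \<open>\<Psi>\<close>
    at \<open>\<kappa>\<close> away from 0; this is where the absence of oscillation is
    used.\<close>
  have "\<exists>\<gamma>>0. limit_levy M V \<Psi> W \<kappa> N Y P X \<and> \<Psi> \<kappa> = 0 \<and> (\<forall>l>0. \<gamma> * l \<le> \<Psi> (\<kappa> + l))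
      \<and> (\<forall>d. \<exists>l>\<kappa>. d * l \<le> \<Psi> l)"
  proof -
    have "\<exists>\<gamma>>0. 0 \<le> \<kappa> \<and> \<Psi> \<kappa> = 0 \<and> (\<forall>l>0. \<gamma> * l \<le> \<Psi> (\<kappa> + l)) \<and> (\<forall>l. 0 \<le> l \<longrightarrow> l \<le> \<kappa> \<longrightarrow> \<Psi> l \<le> 0)
      \<and> (\<exists>B. \<forall>x\<ge>0. exp (- (\<kappa> * x)) * W x \<le> B)
      \<and> (\<forall>x y. 0 \<le> x \<longrightarrow> x \<le> y \<longrightarrow> exp (- (\<kappa> * x)) * W x \<le> exp (- (\<kappa> * y)) * W y)"
    proof (cases "drifts_to_minus_infinity M V")
      case True
      obtain l1 where l1: "\<Psi> \<kappa> = 0" "0 < l1" "l1 < \<kappa>" "\<Psi> l1 < 0"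
        using kappa_root[OF True assms(8) sc.Psi_negative[OF True]] assms(4) by blast
      \<comment> \<open>Slope of the chord of \<open>\<Psi>\<close> from \<open>l1\<close> to its
        root \<open>\<kappa>\<close>. By convexity chords starting at \<open>\<kappa>\<close> are at
        least as steep.\<close>
      define \<gamma> where "\<gamma> = - \<Psi> l1 / (\<kappa> - l1)"
      have \<gamma>: "0 < \<gamma>" using l1 by (simp add: \<gamma>_def divide_neg_pos)
      have mk: "max \<kappa> 0 = \<kappa>" using l1 by simp
      have slope: "\<gamma> * l \<le> \<Psi> (\<kappa> + l)" if l: "0 < l" for l
      proof -
        define u where "u = (\<kappa> - l1) / (\<kappa> + l - l1)"
        have u: "0 < u" "u < 1" using l l1 by (simp_all add: u_def)
        have "u * (\<kappa> + l - l1) = \<kappa> - l1" using l l1 by (simp add: u_def)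
        then have e: "(1 - u) *\<^sub>R l1 + u *\<^sub>R (\<kappa> + l) = \<kappa>" by (simp add: algebra_simps)
        have "\<Psi> \<kappa> \<le> (1 - u) * \<Psi> l1 + u * \<Psi> (\<kappa> + l)"
          using convex_onD[OF Psi_convex, of u l1 "\<kappa> + l"] u l l1 unfolding e by simp
        then have "(1 - u) / u * (- \<Psi> l1) \<le> \<Psi> (\<kappa> + l)" using u l1(1) by (simp add: field_simps)
        moreover have "1 - u = l / (\<kappa> + l - l1)" using l l1 by (simp add: u_def diff_divide_eq_iff)
        then have "(1 - u) / u = l / (\<kappa> - l1)" using l l1 by (simp add: u_def)
        ultimately show ?thesis by (simp add: \<gamma>_def mult.commute)
      qed
      have below: "\<Psi> l \<le> 0" if "0 \<le> l" "l \<le> \<kappa>" for l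
        using convex_onD[OF Psi_convex, of "l / \<kappa>" 0 \<kappa>] that l1 Psi_0 by simp
      have mono: "exp (- (\<kappa> * x)) * W x \<le> exp (- (\<kappa> * y)) * W y" if "0 \<le> x" "x \<le> y" for x y
        using sc.Wsharp_mono[OF True _ _ that, of \<kappa>] l1 by simp
      have "exp (- (\<kappa> * x)) * W x \<le> 1 / \<gamma>" if "0 \<le> x" for x
        using sc.Ws_upper[unfolded mk, OF mono \<gamma> slope that] .
      then show ?thesis using \<gamma> l1 slope below mono by (intro exI[of _ \<gamma>]) auto
    next
      case False
      then have k: "\<kappa> = 0" and plus: "drifts_to_plus_infinity M V" using assms(4,9) by (auto simp: kappa_def)
      obtain B where B: "\<And>x. 0 \<le> x \<Longrightarrow> W x \<le> B" using sc.W_bounded_drift_plus[OF plus harm] by blast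
      have B0: "0 < B" using B[of 1] sc.W_pos[of 1] by simp
      have "1 / B * l \<le> \<Psi> l" if "0 < l" for l
        using sc.slope_lower[OF B, of l] that B0 by (simp add: k field_simps)
      then show ?thesis using B B0 sc.W_mono Psi_0
        by (intro exI[of _ "1 / B"]) (auto simp: k mono_on_def)
    qed
    then obtain \<gamma> where \<gamma>: "0 < \<gamma>" and k: "0 \<le> \<kappa>" "\<Psi> \<kappa> = 0" and slope: "\<forall>l>0. \<gamma> * l \<le> \<Psi> (\<kappa> + l)"
      and below: "\<forall>l. 0 \<le> l \<longrightarrow> l \<le> \<kappa> \<longrightarrow> \<Psi> l \<le> 0" and bdd: "\<exists>B. \<forall>x\<ge>0. exp (- (\<kappa> * x)) * W x \<le> B"
      and mono: "\<forall>x y. 0 \<le> x \<longrightarrow> x \<le> y \<longrightarrow> exp (- (\<kappa> * x)) * W x \<le> exp (- (\<kappa> * y)) * W y" by blast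
    have mk: "max \<kappa> 0 = \<kappa>" using k by simp
    interpret sk: scale_levy M V \<Psi> W \<kappa> using sc.scale_levy_axioms unfolding mk .
    have "filterlim \<Psi> at_top at_top"
    proof (rule filterlim_at_top_mono)
      show "filterlim (\<lambda>l. \<gamma> * (l - \<kappa>)) at_top at_top" using \<gamma> by real_asymp
      show "\<forall>\<^sub>F l in at_top. \<gamma> * (l - \<kappa>) \<le> \<Psi> l"
        using eventually_gt_at_top[of \<kappa>]
      proof eventually_elim
        fix l assume "\<kappa> < l" then show "\<gamma> * (l - \<kappa>) \<le> \<Psi> l" using slope[rule_format, of "l - \<kappa>"] by simp
      qed
    qed
    moreover have "KP t sk.Wp x = sk.Wp x" if "0 < x" "0 \<le> t" for t x
      using harm[OF that] by (simp only: mk)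
    ultimately have "limit_levy M V \<Psi> W \<kappa> N Y P X"
      using mono bdd cpz by unfold_locales auto
    moreover have "\<exists>l>\<kappa>. d * l \<le> \<Psi> l" for d
    proof -
      \<comment> \<open>A point with \<open>\<Psi> l > 0\<close> lies beyond
        \<open>\<kappa>\<close>, since \<open>\<Psi>\<close> is at most 0 up to there; taking
        \<open>max d 0\<close> ensures positivity.\<close>
      obtain l where l: "0 \<le> l" "max d 0 * l + 0 < \<Psi> l" using Psi_superlinear[OF assms(8)] by blast
      have "0 < \<Psi> l" using l mult_nonneg_nonneg[of "max d 0" l] by linarith
      then have "\<kappa> < l" using below l by (meson not_less)
      moreover have "d * l \<le> max d 0 * l" using l by (intro mult_right_mono) auto
      ultimately show ?thesis using l by (intro exI[of _ l]) auto
    qed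
    ultimately show ?thesis using \<gamma> k slope by blast
  qed
  then obtain \<gamma> where \<gamma>: "0 < \<gamma>" "limit_levy M V \<Psi> W \<kappa> N Y P X" "\<Psi> \<kappa> = 0" "\<And>l. 0 < l \<Longrightarrow> \<gamma> * l \<le> \<Psi> (\<kappa> + l)"
    "\<And>d. \<exists>l>\<kappa>. d * l \<le> \<Psi> l" by blast
  note bounds = limit_levy.exponential_functional_tail[OF \<gamma>(2,3,1,4,5), folded assms(5)]
  \<comment> \<open>Both constants are 1: for \<open>x\<close> small depending on
    \<open>\<delta>\<close>, moving \<open>x\<close> by the factor \<open>\<delta>\<close> outweighs
    every constant.\<close>
  show ?thesis
    by (rule exI[of _ 1], rule conjI[OF zero_less_one], rule exI[of _ 1], rule conjI[OF zero_less_one])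
      (use bounds in \<open>unfold mult_1, blast\<close>)
qed

end
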